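(* Let $\mu$ be admissible and let $B:X^0\to X^{-1}$ be a mapping. For $K>0$ define $B_K(u)=e^{-Kt}B(\bar u_K)$ with $\bar u_K(x,t)=e^{Kt}u(x,t)$. Assume there exist constants $K_*>0$, $C_*>0$ such that $$\|B_K(u_1)-B_K(u_2)\|_{X^{-1}}\le C_*\|u_1-u_2\|_{X^0}\qquad\forall u_1,u_2\in X^0,\ K>K_*.$$ Then for every $\varphi\in X^{-1}$ there exists a unique solution $u\in Y^1$ of the problem $\partial u/\partial t=\mathcal A u+B(u)+\varphi$ for $t\in(0,T)$, $u(x,0)=0$, $u|_{x\in\partial D}=0$.
   Context: Let $n\ge1$ and let $D\subseteq\mathbb{R}^n$ be an open domain such that either $D=\mathbb{R}^n$ or $D$ is bounded with $C^2$-smooth boundary. Let $T>0$, $Q=D\times(0,T)$. $H^0=L_2(D)$; $H^1$ is the closure in the $W_2^1(D)$-norm of smooth functions vanishing on $\partial D$; $H^{-1}$ is its dual, with norm $\|u\|_{H^{-1}}=\sup\{(u,w)_{H^0}:\|w\|_{H^1}\le1\}$. $X^k=L^2([0,T];H^k)$ for $k=-1,0,1$; $Y^1=X^1\cap C([0,T];H^0)$. Admissible $\mu=(T,n,D,\delta,b,f,\lambda)$: measurable $b$ (symmetric $n\times n$), $f$ ($\mathbb{R}^n$-valued), $\lambda$ (real) on $\mathbb{R}^n\times[0,T]$ with $\xi^\top b(x,t)\xi\ge\delta|\xi|^2$ ($\delta>0$) for all $\xi$, $(x,t)\in Q$, and $\operatorname{ess\,sup}_Q[|b|+|b^{-1}|+|f|+|\lambda|]<\infty$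 (Frobenius norms). $\mathcal A y=\sum_{i}\frac{\partial}{\partial x_i}\sum_j\big(b_{ij}\frac{\partial y}{\partial x_j}\big)+\sum_i f_i\frac{\partial y}{\partial x_i}+\lambda y$. *)

theory Defs
  imports "HOL-Analysis.Analysis"
begin

definition pd :: "('a::real_normed_vector \<Rightarrow> real) \<Rightarrow> 'a \<Rightarrow> 'a \<Rightarrow> real" where
  "pd f v x = frechet_derivative f (at x) v"

coinductive smooth_fun :: "('a::euclidean_space \<Rightarrow> real) \<Rightarrow> bool" where
  "(\<forall>x. f differentiable (at x)) \<Longrightarrow> (\<forall>i\<in>Basis. smooth_fun (pd f i)) \<Longrightarrow> smooth_fun f"

definition C2_fun :: "('a::euclidean_space \<Rightarrow> real) \<Rightarrow> bool" where
  "C2_fun f \<longleftrightarrow> (\<forall>x. f differentiable (at x)) \<and>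
     (\<forall>i\<in>Basis. \<forall>x. pd f i differentiable (at x)) \<and>
     (\<forall>i\<in>Basis. \<forall>j\<in>Basis. continuous_on UNIV (pd (pd f i) j))"

definition C2_boundary :: "'a::euclidean_space set \<Rightarrow> bool" where
  "C2_boundary D \<longleftrightarrow> (\<exists>\<rho>. C2_fun \<rho> \<and> D = {x. \<rho> x < 0} \<and>
      (\<forall>x\<in>frontier D. frechet_derivative \<rho> (at x) \<noteq> (\<lambda>v. 0)))"

definition domain_ok :: "(real^'n) set \<Rightarrow> bool" where
  "domain_ok D \<longleftrightarrow> open D \<and> connected D \<and> D \<noteq> {} \<and>
     (D = UNIV \<or> (bounded D \<and> C2_boundary D))"

definition L2 :: "(real^'n) set \<Rightarrow> (real^'n \<Rightarrow> real) \<Rightarrow> bool" where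
  "L2 D v \<longleftrightarrow> v \<in> borel_measurable (lebesgue_on D) \<and> integrable (lebesgue_on D) (\<lambda>x. (v x)\<^sup>2)"

definition grad :: "(real^'n \<Rightarrow> real) \<Rightarrow> real^'n \<Rightarrow> real^'n" where
  "grad \<psi> x = (\<chi> i. pd \<psi> (axis i 1) x)"

definition smooth_vanishing :: "(real^'n) set \<Rightarrow> (real^'n \<Rightarrow> real) \<Rightarrow> bool" where
  "smooth_vanishing D \<psi> \<longleftrightarrow> smooth_fun \<psi> \<and> (\<forall>x\<in>frontier D. \<psi> x = 0) \<and> L2 D \<psi> \<and>
     (\<forall>i. L2 D (pd \<psi> (axis i 1)))"

text \<open>H1 D v g: v belongs to H^1 (closure of smooth functions vanishing on the boundary
  in the W^1_2(D) norm), and g is its gradient (the limit of the gradients).\<close>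
definition H1 :: "(real^'n) set \<Rightarrow> (real^'n \<Rightarrow> real) \<Rightarrow> (real^'n \<Rightarrow> real^'n) \<Rightarrow> bool" where
  "H1 D v g \<longleftrightarrow> L2 D v \<and> g \<in> borel_measurable (lebesgue_on D) \<and>
     integrable (lebesgue_on D) (\<lambda>x. (norm (g x))\<^sup>2) \<and>
     (\<exists>\<psi>s. (\<forall>k. smooth_vanishing D (\<psi>s k)) \<and>
        (\<lambda>k. integral\<^sup>L (lebesgue_on D) (\<lambda>x. (\<psi>s k x - v x)\<^sup>2)) \<longlonglongrightarrow> 0 \<and>
        (\<lambda>k. integral\<^sup>L (lebesgue_on D) (\<lambda>x. (norm (grad (\<psi>s k) x - g x))\<^sup>2)) \<longlonglongrightarrow> 0)"

definition cyl :: "(real^'n) set \<Rightarrow> real \<Rightarrow> ((real^'n) \<times> real) set" where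
  "cyl D T = D \<times> {0<..<T}"

definition X0 :: "(real^'n) set \<Rightarrow> real \<Rightarrow> (real^'n \<Rightarrow> real \<Rightarrow> real) \<Rightarrow> bool" where
  "X0 D T u \<longleftrightarrow> (\<lambda>p. u (fst p) (snd p)) \<in> borel_measurable (lebesgue_on (cyl D T)) \<and>
     integrable (lebesgue_on (cyl D T)) (\<lambda>p. (u (fst p) (snd p))\<^sup>2)"

definition X0norm :: "(real^'n) set \<Rightarrow> real \<Rightarrow> (real^'n \<Rightarrow> real \<Rightarrow> real) \<Rightarrow> real" where
  "X0norm D T u = sqrt (integral\<^sup>L (lebesgue_on (cyl D T)) (\<lambda>p. (u (fst p) (snd p))\<^sup>2))"

definition X1 :: "(real^'n) set \<Rightarrow> real \<Rightarrow> (real^'n \<Rightarrow> real \<Rightarrow> real) \<Rightarrow> (real^'n \<Rightarrow> real \<Rightarrow> real^'n) \<Rightarrow> bool" where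
  "X1 D T u G \<longleftrightarrow> X0 D T u \<and>
     (\<lambda>p. G (fst p) (snd p)) \<in> borel_measurable (lebesgue_on (cyl D T)) \<and>
     integrable (lebesgue_on (cyl D T)) (\<lambda>p. (norm (G (fst p) (snd p)))\<^sup>2) \<and>
     (AE t in lebesgue_on {0<..<T}. H1 D (\<lambda>x. u x t) (\<lambda>x. G x t))"

definition X1sq :: "(real^'n) set \<Rightarrow> real \<Rightarrow> (real^'n \<Rightarrow> real \<Rightarrow> real) \<Rightarrow> (real^'n \<Rightarrow> real \<Rightarrow> real^'n) \<Rightarrow> real" where
  "X1sq D T u G = integral\<^sup>L (lebesgue_on (cyl D T))
      (\<lambda>p. (u (fst p) (snd p))\<^sup>2 + (norm (G (fst p) (snd p)))\<^sup>2)"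

text \<open>Elements of X^{-1} = L2(0,T;H^{-1}), realised as bounded linear functionals on X^1.\<close>
definition Xm1 :: "(real^'n) set \<Rightarrow> real \<Rightarrow> ((real^'n \<Rightarrow> real \<Rightarrow> real) \<Rightarrow> real) \<Rightarrow> bool" where
  "Xm1 D T F \<longleftrightarrow>
     (\<forall>w1 G1 w2 G2 a c. X1 D T w1 G1 \<longrightarrow> X1 D T w2 G2 \<longrightarrow>
        F (\<lambda>x t. a * w1 x t + c * w2 x t) = a * F w1 + c * F w2) \<and>
     (\<exists>C. \<forall>w G. X1 D T w G \<longrightarrow> \<bar>F w\<bar> \<le> C * sqrt (X1sq D T w G))"

definition Xm1norm :: "(real^'n) set \<Rightarrow> real \<Rightarrow> ((real^'n \<Rightarrow> real \<Rightarrow> real) \<Rightarrow> real) \<Rightarrow> real" where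
  "Xm1norm D T F = Sup {F w | w G. X1 D T w G \<and> X1sq D T w G \<le> 1}"

definition Y1 :: "(real^'n) set \<Rightarrow> real \<Rightarrow> (real^'n \<Rightarrow> real \<Rightarrow> real) \<Rightarrow> (real^'n \<Rightarrow> real \<Rightarrow> real^'n) \<Rightarrow> bool" where
  "Y1 D T u G \<longleftrightarrow> X1 D T u G \<and> (\<forall>t\<in>{0..T}. L2 D (\<lambda>x. u x t)) \<and>
     (\<forall>t0\<in>{0..T}. ((\<lambda>t. integral\<^sup>L (lebesgue_on D) (\<lambda>x. (u x t - u x t0)\<^sup>2)) \<longlongrightarrow> 0)
        (at t0 within {0..T}))"

definition admissible :: "real \<Rightarrow> (real^'n) set \<Rightarrow> real \<Rightarrow> (real^'n \<Rightarrow> real \<Rightarrow> real^'n^'n) \<Rightarrow>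
     (real^'n \<Rightarrow> real \<Rightarrow> real^'n) \<Rightarrow> (real^'n \<Rightarrow> real \<Rightarrow> real) \<Rightarrow> bool" where
  "admissible T D \<delta> b f lam \<longleftrightarrow> T > 0 \<and> domain_ok D \<and> \<delta> > 0 \<and>
     (\<lambda>p. b (fst p) (snd p)) \<in> borel_measurable (lebesgue_on (UNIV \<times> {0..T})) \<and>
     (\<lambda>p. f (fst p) (snd p)) \<in> borel_measurable (lebesgue_on (UNIV \<times> {0..T})) \<and>
     (\<lambda>p. lam (fst p) (snd p)) \<in> borel_measurable (lebesgue_on (UNIV \<times> {0..T})) \<and>
     (\<forall>x. \<forall>t\<in>{0..T}. transpose (b x t) = b x t) \<and>
     (\<forall>x\<in>D. \<forall>t\<in>{0<..<T}. \<forall>\<xi>. \<xi> \<bullet> (b x t *v \<xi>) \<ge> \<delta> * (norm \<xi>)\<^sup>2) \<and>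
     (\<exists>M. AE p in lebesgue_on (cyl D T).
        norm (b (fst p) (snd p)) + norm (matrix_inv (b (fst p) (snd p)))
        + norm (f (fst p) (snd p)) + \<bar>lam (fst p) (snd p)\<bar> \<le> M)"

definition uncur :: "('a \<Rightarrow> 'b \<Rightarrow> 'c) \<Rightarrow> 'a \<times> 'b \<Rightarrow> 'c" where
  "uncur u p = u (fst p) (snd p)"

definition testQ :: "(real^'n) set \<Rightarrow> real \<Rightarrow> (real^'n \<Rightarrow> real \<Rightarrow> real) \<Rightarrow> bool" where
  "testQ D T \<psi> \<longleftrightarrow> smooth_fun (uncur \<psi>) \<and>
     compact (closure {p. uncur \<psi> p \<noteq> 0}) \<and> closure {p. uncur \<psi> p \<noteq> 0} \<subseteq> cyl D T"

definition sgrad :: "(real^'n \<Rightarrow> real \<Rightarrow> real) \<Rightarrow> real^'n \<Rightarrow> real \<Rightarrow> real^'n" where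
  "sgrad \<psi> x t = (\<chi> i. pd (uncur \<psi>) (axis i 1, 0) (x, t))"

definition tderiv :: "(real^'n \<Rightarrow> real \<Rightarrow> real) \<Rightarrow> real^'n \<Rightarrow> real \<Rightarrow> real" where
  "tderiv \<psi> x t = pd (uncur \<psi>) (0, 1) (x, t)"

text \<open>The functional w \<mapsto> \<langle>A u, w\<rangle> for u with spatial gradient G.\<close>
definition Aform :: "real \<Rightarrow> (real^'n) set \<Rightarrow> (real^'n \<Rightarrow> real \<Rightarrow> real^'n^'n) \<Rightarrow>
     (real^'n \<Rightarrow> real \<Rightarrow> real^'n) \<Rightarrow> (real^'n \<Rightarrow> real \<Rightarrow> real) \<Rightarrow>
     (real^'n \<Rightarrow> real \<Rightarrow> real) \<Rightarrow> (real^'n \<Rightarrow> real \<Rightarrow> real^'n) \<Rightarrow>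
     (real^'n \<Rightarrow> real \<Rightarrow> real) \<Rightarrow> (real^'n \<Rightarrow> real \<Rightarrow> real^'n) \<Rightarrow> real" where
  "Aform T D b f lam u G w Gw = integral\<^sup>L (lebesgue_on (cyl D T)) (\<lambda>p.
      - (Gw (fst p) (snd p) \<bullet> (b (fst p) (snd p) *v G (fst p) (snd p)))
      + (f (fst p) (snd p) \<bullet> G (fst p) (snd p)) * w (fst p) (snd p)
      + lam (fst p) (snd p) * u (fst p) (snd p) * w (fst p) (snd p))"

text \<open>u in Y^1 solves du/dt = A u + B(u) + phi in X^{-1}, u(.,0) = 0, u = 0 on the boundary
  (boundary condition encoded in H^1).\<close>
definition is_solution :: "real \<Rightarrow> (real^'n) set \<Rightarrow> (real^'n \<Rightarrow> real \<Rightarrow> real^'n^'n) \<Rightarrow>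
     (real^'n \<Rightarrow> real \<Rightarrow> real^'n) \<Rightarrow> (real^'n \<Rightarrow> real \<Rightarrow> real) \<Rightarrow>
     ((real^'n \<Rightarrow> real \<Rightarrow> real) \<Rightarrow> ((real^'n \<Rightarrow> real \<Rightarrow> real) \<Rightarrow> real)) \<Rightarrow>
     ((real^'n \<Rightarrow> real \<Rightarrow> real) \<Rightarrow> real) \<Rightarrow> (real^'n \<Rightarrow> real \<Rightarrow> real) \<Rightarrow> bool" where
  "is_solution T D b f lam B \<phi> u \<longleftrightarrow> (\<exists>G. Y1 D T u G \<and>
     (AE x in lebesgue_on D. u x 0 = 0) \<and>
     (\<forall>\<psi>. testQ D T \<psi> \<longrightarrow>
        - integral\<^sup>L (lebesgue_on (cyl D T)) (\<lambda>p. u (fst p) (snd p) * tderiv \<psi> (fst p) (snd p))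
        = Aform T D b f lam u G \<psi> (sgrad \<psi>) + B u \<psi> + \<phi> \<psi>))"

text \<open>B_K(u) = e^{-Kt} B(e^{Kt} u), as a functional.\<close>
definition BK :: "((real^'n \<Rightarrow> real \<Rightarrow> real) \<Rightarrow> ((real^'n \<Rightarrow> real \<Rightarrow> real) \<Rightarrow> real)) \<Rightarrow> real \<Rightarrow>
     (real^'n \<Rightarrow> real \<Rightarrow> real) \<Rightarrow> ((real^'n \<Rightarrow> real \<Rightarrow> real) \<Rightarrow> real)" where
  "BK B K u = (\<lambda>w. B (\<lambda>x t. exp (K * t) * u x t) (\<lambda>x t. exp (- K * t) * w x t))"

end

theory Submission
  imports Defs
begin

text \<open>
  Substituting \<open>u = e\<^bsup>Kt\<^esup> v\<close> replaces \<open>A\<close> by \<open>A - K\<close> and \<open>B\<close> by \<open>B\<^sub>K\<close>, whose Lipschitz constant does not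
  depend on \<open>K\<close>. For large \<open>K\<close> the form of \<open>K - A\<close> dominates \<open>c |v|\<^sup>2 + \<kappa> |v|\<^sup>2\<close>, the first norm being that of
  \<open>X\<^sup>1\<close>, the second that of \<open>X\<^sup>0\<close>, with \<open>c\<close> fixed and \<open>\<kappa>\<close> as large as desired. The linear equation with zero
  initial value is solved by a Hilbert space argument in the style of Lions, and the energy inequality shows
  that \<open>v \<mapsto>\<close> (solution with right-hand side \<open>B\<^sub>K(v) + e\<^bsup>-Kt\<^esup>\<phi>\<close>) contracts \<open>X\<^sup>0\<close> by the factor 1/2.

  Time derivatives are avoided by stating \<open>v' = g\<close>, \<open>v(0) = 0\<close> as \<open>(v, \<omega>) = \<langle>g, J \<omega>\<rangle>\<close> for all \<open>\<omega> \<in> X\<^sup>1\<close>, where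
  \<open>(J \<omega>)(t)\<close> is the integral of \<open>\<omega>\<close> over \<open>(t, T)\<close>. The equivalence with the formulation by space-time test
  functions rests on the density of compactly supported smooth functions in \<open>H\<^sup>1\<close> and on continuity at
  time zero.
\<close>

section \<open>Representation of bounded functionals\<close>

text \<open>The statement names a function and its gradient separately, so an element of H^1 is kept
  as the pair (v, grad v) in L_2(R^n; R x R^n), where H^1 is a closed subspace. Functions of time
  are elements of L_2 over the real line with values in such an L_2; the type constructor
  \<open>l2\<close> accepts an \<open>l2\<close> as value type and serves both levels, and an
  isometry with L_2 of space-time leads back to functions u x t. \<open>V\<close> consists of the
  functions of time in H^1, and \<open>P\<close> forgets the gradient. Two obstacles shape the rest.
  A solution has no time derivative in L_2 and cannot test its own equation; (u - u(. + h))/h is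
  inserted instead, whose J is an average of u, and contractivity of translations replaces the
  energy identity. And H^1 is generated by smooth functions that merely vanish on the boundary,
  whereas the test functions have compact support; truncating small values bridges this gap. Half of
  the ellipticity absorbs the drift, hence c = \<delta>/2; the factor 1/2 of the contraction asks
  for C^2 \<le> c \<kappa>, which decides how large K is taken.\<close>

lemma riesz_on_subspace:
  fixes S :: "'a::{real_inner,complete_space} set" and l :: "'a \<Rightarrow> real"
  assumes S: "subspace S"
    and add: "\<And>x y. x \<in> S \<Longrightarrow> y \<in> S \<Longrightarrow> l (x + y) = l x + l y"
    and scale: "\<And>c x. x \<in> S \<Longrightarrow> l (c *\<^sub>R x) = c * l x"
    and bound: "\<And>x. x \<in> S \<Longrightarrow> \<bar>l x\<bar> \<le> C * norm x"
  shows "\<exists>u\<in>closure S. \<forall>x\<in>S. u \<bullet> x = l x"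
proof -
  \<comment> \<open>If u represents l, this is |x - u|^2 - |u|^2, so minimising \<open>q\<close>
    over S means approaching u.\<close>
  define q where "q x = (norm x)\<^sup>2 - 2 * l x" for x
  define m where "m = Inf (q ` S)"
  have S0: "0 \<in> S" using S by (simp add: subspace_0)
  have lower: "q x \<ge> - C\<^sup>2" if "x \<in> S" for x
  proof -
    have "2 * l x \<le> 2 * C * norm x" using bound[OF that] by linarith
    also have "\<dots> \<le> C\<^sup>2 + (norm x)\<^sup>2"
      using sum_squares_bound[of C "norm x"] by (simp add: algebra_simps)
    finally show ?thesis by (simp add: q_def)
  qed
  have bdd: "bdd_below (q ` S)" using lower by (auto intro!: bdd_belowI)
  have mle: "m \<le> q x" if "x \<in> S" for x
    unfolding m_def using that bdd by (intro cInf_lower) auto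
  have "\<exists>x\<in>S. q x < m + 1 / real (Suc n)" for n
  proof -
    have "Inf (q ` S) < m + 1 / real (Suc n)" by (simp add: m_def)
    then show ?thesis using cInf_lessD[of "q ` S"] S0 by (metis empty_iff imageE image_is_empty)
  qed
  then obtain x where xS: "x n \<in> S" and xq: "q (x n) < m + 1 / real (Suc n)" for n by metis
  \<comment> \<open>Parallelogram law: the midpoint of y and z lies in S, where \<open>q\<close> is
    at least m. Two near-minimisers are therefore close to each other.\<close>
  have par: "(norm (y - z))\<^sup>2 \<le> 2 * (q y - m) + 2 * (q z - m)" if "y \<in> S" "z \<in> S" for y z
  proof -
    let ?w = "(1/2) *\<^sub>R (y + z)"
    have w: "?w \<in> S" using S that by (simp add: subspace_scale subspace_add)
    have lw: "l ?w = (l y + l z) / 2"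
      using scale[of "y + z" "1/2"] add[of y z] S that by (simp add: subspace_add)
    have "(norm (y - z))\<^sup>2 + 4 * (norm ?w)\<^sup>2 = 2 * (norm y)\<^sup>2 + 2 * (norm z)\<^sup>2"
      unfolding power2_norm_eq_inner by (simp add: inner_simps inner_commute algebra_simps)
    moreover have "m \<le> (norm ?w)\<^sup>2 - (l y + l z)" using mle[OF w] unfolding q_def lw by argo
    ultimately show ?thesis by (simp add: q_def)
  qed
  have "Cauchy x"
  proof (rule metric_CauchyI)
    fix e :: real assume e: "e > 0"
    obtain N :: nat where N: "4 / e\<^sup>2 < real N" using reals_Archimedean2 by blast
    have N0: "real N > 0" using N e by (smt (verit) divide_pos_pos zero_less_power)
    have "dist (x i) (x j) < e" if "i \<ge> N" "j \<ge> N" for i j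
    proof -
      have i: "q (x i) - m < 1 / real N"
      proof -
        have "1 / real (Suc i) \<le> 1 / real N" using that N0 by (intro divide_left_mono) auto
        then show ?thesis using xq[of i] by linarith
      qed
      have j: "q (x j) - m < 1 / real N"
      proof -
        have "1 / real (Suc j) \<le> 1 / real N" using that N0 by (intro divide_left_mono) auto
        then show ?thesis using xq[of j] by linarith
      qed
      have "(norm (x i - x j))\<^sup>2 < 4 / real N" using par[OF xS xS, of i j] i j by simp
      also have "\<dots> < e\<^sup>2" using N N0 e by (simp add: field_simps)
      finally show ?thesis using e by (simp add: dist_norm power_less_imp_less_base)
    qed
    then show "\<exists>M. \<forall>i\<ge>M. \<forall>j\<ge>M. dist (x i) (x j) < e" by blast
  qed
  then obtain u where u: "x \<longlonglongrightarrow> u" using Cauchy_convergent_iff convergent_def by blast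
  have uS: "u \<in> closure S" using u xS closure_sequential by blast
  have "u \<bullet> y = l y" if y: "y \<in> S" for y
  proof -
    \<comment> \<open>First variation: moving from x_n by c y inside S lowers \<open>q\<close> by
      less than 1/(n+1); then n tends to infinity.\<close>
    have ineq: "2 * c * (l y - u \<bullet> y) \<le> c\<^sup>2 * (norm y)\<^sup>2" for c
    proof -
      have st: "2 * c * (l y - x n \<bullet> y) \<le> c\<^sup>2 * (norm y)\<^sup>2 + 1 / real (Suc n)" for n
      proof -
        have "x n + c *\<^sub>R y \<in> S" using xS y S by (simp add: subspace_add subspace_scale)
        then have "m \<le> q (x n + c *\<^sub>R y)" by (rule mle)
        also have "\<dots> = q (x n) + 2 * c * (x n \<bullet> y) + c\<^sup>2 * (norm y)\<^sup>2 - 2 * c * l y"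
          using add[of "x n" "c *\<^sub>R y"] scale[of y c] xS[of n] y S
          unfolding q_def power2_norm_eq_inner
          by (simp add: inner_simps subspace_scale inner_commute power2_eq_square algebra_simps)
        finally show ?thesis using xq[of n] by (simp add: algebra_simps)
      qed
      have "(\<lambda>n. 2 * c * (l y - x n \<bullet> y)) \<longlonglongrightarrow> 2 * c * (l y - u \<bullet> y)"
        by (intro tendsto_intros u)
      moreover have "(\<lambda>n. c\<^sup>2 * (norm y)\<^sup>2 + 1 / real (Suc n)) \<longlonglongrightarrow> c\<^sup>2 * (norm y)\<^sup>2 + 0"
        by (intro tendsto_intros LIMSEQ_Suc lim_1_over_n)
      ultimately show ?thesis using st by (metis (no_types, lifting) LIMSEQ_le add.right_neutral)
    qed
    show ?thesis
    proof (cases "y = 0")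
      case True then show ?thesis using scale[OF y, of 0] by simp
    next
      case False
      define d N where "d = l y - u \<bullet> y" and "N = (norm y)\<^sup>2"
      have n0: "N > 0" using False by (simp add: N_def)
      \<comment> \<open>c = d/N minimises c^2 N - 2 c d; the inequality for this c leaves only d =
        0.\<close>
      have "2 * (d / N) * d \<le> (d / N)\<^sup>2 * N" unfolding d_def N_def by (rule ineq)
      also have "\<dots> = (d / N) * d" using n0 by (simp add: power2_eq_square)
      finally have "d * d / N \<le> 0" by simp
      then have "d * d \<le> 0" using n0 by (simp add: divide_le_0_iff)
      then have "d = 0" by (smt (verit) mult_le_0_iff)
      then show ?thesis by (simp add: d_def)
    qed
  qed
  then show ?thesis using uS by blast
qed

text \<open>Representing the functional of z on S produces the orthogonal projection u of z, and z -
  u is orthogonal to S. Later this serves as an induction principle: a property that cuts out a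
  closed subspace holds everywhere once it holds on a total set.\<close>

lemma closed_subspace_eq_UNIV:
  fixes S :: "'a::{real_inner,complete_space} set"
  assumes S: "subspace S" and cl: "closed S"
    and orth: "\<And>z. (\<forall>x\<in>S. z \<bullet> x = 0) \<Longrightarrow> z = 0"
  shows "S = UNIV"
proof (intro set_eqI iffI UNIV_I)
  fix z :: 'a
  have "\<exists>u\<in>closure S. \<forall>x\<in>S. u \<bullet> x = z \<bullet> x"
    by (rule riesz_on_subspace[OF S, where C = "norm z"])
      (auto simp: inner_simps Cauchy_Schwarz_ineq2)
  then obtain u where "u \<in> S" "\<forall>x\<in>S. (z - u) \<bullet> x = 0" using cl by (auto simp: inner_simps)
  then show "z \<in> S" using orth[of "z - u"] by simp
qed

text \<open>The difference of z and its projection onto S is orthogonal to S, hence by assumption to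
  z, hence to itself. Membership in S is thereby reduced to scalar tests against the orthogonal
  complement.\<close>

lemma closed_subspace_memI:
  fixes S :: "'a::{real_inner,complete_space} set"
  assumes S: "subspace S" and cl: "closed S"
    and orth: "\<And>y. (\<forall>x\<in>S. y \<bullet> x = 0) \<Longrightarrow> z \<bullet> y = 0"
  shows "z \<in> S"
proof -
  have "\<exists>u\<in>closure S. \<forall>x\<in>S. u \<bullet> x = z \<bullet> x"
    by (rule riesz_on_subspace[OF S, where C = "norm z"])
      (auto simp: inner_simps Cauchy_Schwarz_ineq2)
  then obtain u where u: "u \<in> S" "\<forall>x\<in>S. (z - u) \<bullet> x = 0" using cl by (auto simp: inner_simps)
  then have "z \<bullet> (z - u) = 0" using orth by blast
  moreover have "(z - u) \<bullet> u = 0" using u by blast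
  ultimately have "(z - u) \<bullet> (z - u) = 0" by (simp add: inner_simps inner_commute)
  then show ?thesis using u by simp
qed

section \<open>The Hilbert space of square integrable functions\<close>

text \<open>Borel functions on the whole space with \<open>lborel\<close>, so that sections and
  Fubini apply directly. Functions on a domain enter multiplied by an indicator; the Lebesgue
  measurable functions of the statement are replaced by Borel versions at the interface.\<close>

definition sq_int :: "('a::euclidean_space \<Rightarrow> 'b::{real_inner,banach,second_countable_topology}) \<Rightarrow> bool"
  where "sq_int f \<longleftrightarrow> f \<in> borel_measurable lborel \<and> integrable lborel (\<lambda>x. (norm (f x))\<^sup>2)"

lemma sq_int_measurable[measurable_dest]: "sq_int f \<Longrightarrow> f \<in> borel_measurable lborel"
  by (simp add: sq_int_def)

lemma sq_int_bound:
  assumes [measurable]: "f \<in> borel_measurable lborel" and "integrable lborel g"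
    and "AE x in lborel. (norm (f x))\<^sup>2 \<le> g x"
  shows "sq_int f"
  unfolding sq_int_def
proof (intro conjI)
  show "integrable lborel (\<lambda>x. (norm (f x))\<^sup>2)"
    by (rule Bochner_Integration.integrable_bound[OF assms(2)]) (use assms(3) in auto)
qed simp

lemma norm_add_square_le:
  fixes a b :: "'a::real_normed_vector"
  shows "(norm (a + b))\<^sup>2 \<le> 2 * (norm a)\<^sup>2 + 2 * (norm b)\<^sup>2"
proof -
  have "(norm (a + b))\<^sup>2 \<le> (norm a + norm b)\<^sup>2" by (intro power_mono norm_triangle_ineq) auto
  also have "\<dots> \<le> 2 * (norm a)\<^sup>2 + 2 * (norm b)\<^sup>2"
    using sum_squares_bound[of "norm a" "norm b"] by (simp add: power2_sum)
  finally show ?thesis .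
qed

lemma sq_int_add:
  assumes "sq_int f" "sq_int g" shows "sq_int (\<lambda>x. f x + g x)"
proof -
  have [measurable]: "f \<in> borel_measurable lborel" "g \<in> borel_measurable lborel"
    using assms by (auto simp: sq_int_def)
  show ?thesis
    by (rule sq_int_bound[where g = "\<lambda>x. 2 * (norm (f x))\<^sup>2 + 2 * (norm (g x))\<^sup>2"])
      (use assms in \<open>auto simp: sq_int_def norm_add_square_le\<close>)
qed

lemma sq_int_scaleR: "sq_int f \<Longrightarrow> sq_int (\<lambda>x. c *\<^sub>R f x)"
  unfolding sq_int_def by (auto simp: power_mult_distrib)

lemma sq_int_0: "sq_int (\<lambda>x. 0)" by (simp add: sq_int_def)

lemma sq_int_uminus: "sq_int f \<Longrightarrow> sq_int (\<lambda>x. - f x)"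
  unfolding sq_int_def by auto

lemma sq_int_diff: "sq_int f \<Longrightarrow> sq_int g \<Longrightarrow> sq_int (\<lambda>x. f x - g x)"
  using sq_int_add[of f "\<lambda>x. - g x"] sq_int_uminus[of g] by simp

lemma sq_int_mult_bounded:
  fixes c :: "'a::euclidean_space \<Rightarrow> real"
  assumes "sq_int f" and [measurable]: "c \<in> borel_measurable borel" and "\<And>x. \<bar>c x\<bar> \<le> C"
  shows "sq_int (\<lambda>x. c x *\<^sub>R f x)"
proof -
  have [measurable]: "f \<in> borel_measurable lborel" using assms by (auto simp: sq_int_def)
  have "(norm (c x *\<^sub>R f x))\<^sup>2 \<le> C\<^sup>2 * (norm (f x))\<^sup>2" for x
    using power_mono[OF assms(3)[of x], of 2] by (simp add: power_mult_distrib mult_right_mono)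
  then show ?thesis
    by (intro sq_int_bound[where g = "\<lambda>x. C\<^sup>2 * (norm (f x))\<^sup>2"])
      (use assms in \<open>auto simp: sq_int_def\<close>)
qed

lemma sq_int_indicator:
  assumes "sq_int f" "A \<in> sets borel" shows "sq_int (\<lambda>x. indicator A x *\<^sub>R f x)"
  by (rule sq_int_mult_bounded[OF assms(1), where C = 1]) (use assms in \<open>auto simp: indicator_def\<close>)

lemma sq_int_bounded_linear:
  assumes "sq_int f" "bounded_linear p" shows "sq_int (\<lambda>x. p (f x))"
proof -
  interpret p: bounded_linear p by fact
  obtain K where K: "\<And>x. norm (p x) \<le> norm x * K" using p.bounded by blast
  have [measurable]: "f \<in> borel_measurable lborel" using assms by (auto simp: sq_int_def)
  have [measurable]: "p \<in> borel_measurable borel"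
    using p.continuous_on[OF continuous_on_id] by (intro borel_measurable_continuous_onI) auto
  have "(norm (p (f x)))\<^sup>2 \<le> K\<^sup>2 * (norm (f x))\<^sup>2" for x
    using power_mono[OF K[of "f x"], of 2] by (simp add: power_mult_distrib mult.commute)
  then show ?thesis
    by (intro sq_int_bound[where g = "\<lambda>x. K\<^sup>2 * (norm (f x))\<^sup>2"])
      (use assms in \<open>auto simp: sq_int_def\<close>)
qed

lemma sq_int_inner:
  assumes "sq_int f" "sq_int g" shows "integrable lborel (\<lambda>x. f x \<bullet> g x)"
proof -
  have [measurable]: "f \<in> borel_measurable lborel" "g \<in> borel_measurable lborel"
    using assms by (auto simp: sq_int_def)
  have "norm (f x \<bullet> g x) \<le> (norm (f x))\<^sup>2 + (norm (g x))\<^sup>2" for x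
  proof -
    have "norm (f x \<bullet> g x) \<le> norm (f x) * norm (g x)" by (simp add: Cauchy_Schwarz_ineq2)
    also have "\<dots> \<le> (norm (f x))\<^sup>2 + (norm (g x))\<^sup>2"
      using sum_squares_bound[of "norm (f x)" "norm (g x)"]
        mult_nonneg_nonneg[OF norm_ge_zero[of "f x"] norm_ge_zero[of "g x"]] by linarith
    finally show ?thesis .
  qed
  then have le: "AE x in lborel. norm (f x \<bullet> g x) \<le> norm ((norm (f x))\<^sup>2 + (norm (g x))\<^sup>2)" by simp
  have int: "integrable lborel (\<lambda>x. (norm (f x))\<^sup>2 + (norm (g x))\<^sup>2)"
    using assms by (simp add: sq_int_def)
  show ?thesis by (rule Bochner_Integration.integrable_bound[OF int _ le]) simp
qed

text \<open>Elements of the space are the square integrable functions that were chosen, once and for all,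
  to represent their almost-everywhere class.\<close>
definition l2_canon ::
  "('a::euclidean_space \<Rightarrow> 'b::{real_inner,banach,second_countable_topology}) \<Rightarrow> 'a \<Rightarrow> 'b"
  where "l2_canon f = (SOME g. sq_int g \<and> (AE x in lborel. g x = f x))"

lemma l2_canon:
  assumes "sq_int f" shows "sq_int (l2_canon f)" "AE x in lborel. l2_canon f x = f x"
  using someI[of "\<lambda>g. sq_int g \<and> (AE x in lborel. g x = f x)" f] assms
  unfolding l2_canon_def[symmetric] by auto

lemma l2_canon_cong:
  assumes "AE x in lborel. f x = g x" shows "l2_canon f = l2_canon g"
proof -
  have "(AE x in lborel. h x = f x) = (AE x in lborel. h x = g x)" for h
  proof
    assume "AE x in lborel. h x = f x"
    then show "AE x in lborel. h x = g x" using assms by eventually_elim simp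
  next
    assume "AE x in lborel. h x = g x"
    then show "AE x in lborel. h x = f x" using assms by eventually_elim simp
  qed
  then show ?thesis by (simp add: l2_canon_def)
qed

text \<open>Canonical representatives instead of a quotient make \<open>rep\<close> an honest
  function, so integrals of \<open>rep u\<close> need no lifting. The price is that the algebraic
  laws for \<open>rep\<close> hold almost everywhere only.\<close>

typedef (overloaded) ('a, 'b) l2 =
  "{f :: 'a::euclidean_space \<Rightarrow> 'b::{real_inner,banach,second_countable_topology}. sq_int f \<and> l2_canon f = f}"
  morphisms rep Abs_l2
proof -
  have "l2_canon (\<lambda>x. 0) \<in> {f :: 'a \<Rightarrow> 'b. sq_int f \<and> l2_canon f = f}"
    using l2_canon[OF sq_int_0] by (auto intro!: l2_canon_cong)
  then show ?thesis by blast
qed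

text \<open>Total through the default 0 for functions that are not square integrable;
  \<open>slices\<close> relies on this at exceptional times.\<close>

definition toL :: "('a::euclidean_space \<Rightarrow> 'b::{real_inner,banach,second_countable_topology}) \<Rightarrow> ('a, 'b) l2"
  where "toL f = Abs_l2 (l2_canon (if sq_int f then f else (\<lambda>x. 0)))"

lemma sq_int_rep[simp]: "sq_int (rep u)" using rep by auto

lemma rep_measurable[measurable]: "rep u \<in> borel_measurable borel"
  using sq_int_rep[of u] by (simp add: sq_int_def)

lemma rep_toL:
  assumes "sq_int f" shows "AE x in lborel. rep (toL f) x = f x"
proof -
  have "l2_canon f \<in> {f. sq_int f \<and> l2_canon f = f}"
    using l2_canon[OF assms] by (auto intro!: l2_canon_cong)
  then have "rep (toL f) = l2_canon f" using assms by (simp add: toL_def Abs_l2_inverse)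
  then show ?thesis using l2_canon[OF assms] by simp
qed

lemma toL_rep[simp]: "toL (rep u) = u"
  using rep[of u] by (simp add: toL_def rep_inverse)

lemma toL_cong:
  assumes "sq_int f" "sq_int g" "AE x in lborel. f x = g x" shows "toL f = toL g"
  using assms l2_canon_cong by (simp add: toL_def) fastforce

lemma l2_eqI: "AE x in lborel. rep u x = rep v x \<Longrightarrow> u = v"
  by (metis sq_int_rep toL_cong toL_rep)

lemma toL_eqI: "sq_int f \<Longrightarrow> AE x in lborel. rep u x = f x \<Longrightarrow> toL f = u"
  by (metis sq_int_rep toL_cong toL_rep)

lemma toL_not_sq_int: "\<not> sq_int f \<Longrightarrow> toL f = toL (\<lambda>x. 0)"
  by (simp add: toL_def sq_int_0)

instantiation l2 :: (euclidean_space, "{real_inner,banach,second_countable_topology}") real_vector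
begin

definition "0 = toL (\<lambda>x. 0)"
definition "u + v = toL (\<lambda>x. rep u x + rep v x)"
definition "- u = toL (\<lambda>x. - rep u x)"
definition "u - v = toL (\<lambda>x. rep u x - rep v x)"
definition "c *\<^sub>R u = toL (\<lambda>x. c *\<^sub>R rep u x)"
lemma l2_AE:
  shows rep_0: "AE x in lborel. rep (0 :: ('a, 'b) l2) x = 0"
    and rep_add: "AE x in lborel. rep (u + v) x = rep u x + rep v x"
    and rep_uminus: "AE x in lborel. rep (- u) x = - rep u x"
    and rep_diff: "AE x in lborel. rep (u - v) x = rep u x - rep v x"
    and rep_scaleR: "AE x in lborel. rep (c *\<^sub>R u) x = c *\<^sub>R rep u x"
  unfolding zero_l2_def plus_l2_def uminus_l2_def minus_l2_def scaleR_l2_def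
  by (intro rep_toL sq_int_0 sq_int_add sq_int_diff sq_int_uminus sq_int_scaleR sq_int_rep)+

instance
proof
  fix u v w :: "('a, 'b) l2" and a b :: real
  show "u + v + w = u + (v + w)"
    by (rule l2_eqI) (use rep_add[of u v] rep_add[of "u + v" w] rep_add[of v w] rep_add[of u "v + w"] in
      \<open>eventually_elim, simp add: add.assoc\<close>)
  show "u + v = v + u"
    by (rule l2_eqI) (use rep_add[of u v] rep_add[of v u] in \<open>eventually_elim, simp add: add.commute\<close>)
  show "0 + u = u"
    by (rule l2_eqI) (use rep_add[of 0 u] rep_0 in \<open>eventually_elim, simp\<close>)
  show "- u + u = 0"
    by (rule l2_eqI) (use rep_add[of "-u" u] rep_0 rep_uminus[of u] in \<open>eventually_elim, simp\<close>)
  show "u - v = u + - v"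
    by (rule l2_eqI) (use rep_add[of u "-v"] rep_diff[of u v] rep_uminus[of v] in \<open>eventually_elim, simp\<close>)
  show "a *\<^sub>R (u + v) = a *\<^sub>R u + a *\<^sub>R v"
    by (rule l2_eqI) (use rep_add[of u v] rep_add[of "a *\<^sub>R u" "a *\<^sub>R v"] rep_scaleR[of a u]
      rep_scaleR[of a v] rep_scaleR[of a "u+v"] in \<open>eventually_elim, simp add: scaleR_add_right\<close>)
  show "(a + b) *\<^sub>R u = a *\<^sub>R u + b *\<^sub>R u"
    by (rule l2_eqI) (use rep_add[of "a *\<^sub>R u" "b *\<^sub>R u"] rep_scaleR[of a u]
      rep_scaleR[of b u] rep_scaleR[of "a+b" u] in \<open>eventually_elim, simp add: scaleR_add_left\<close>)
  show "a *\<^sub>R b *\<^sub>R u = (a * b) *\<^sub>R u"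
    by (rule l2_eqI) (use rep_scaleR[of a "b *\<^sub>R u"]
      rep_scaleR[of b u] rep_scaleR[of "a*b" u] in \<open>eventually_elim, simp\<close>)
  show "1 *\<^sub>R u = u"
    by (rule l2_eqI) (use rep_scaleR[of 1 u] in \<open>eventually_elim, simp\<close>)
qed

end

instantiation l2 :: (euclidean_space, "{real_inner,banach,second_countable_topology}") real_inner
begin

definition "u \<bullet> v = integral\<^sup>L lborel (\<lambda>x. rep u x \<bullet> rep v x)"
definition "norm (u :: ('a, 'b) l2) = sqrt (u \<bullet> u)"
definition "dist (u :: ('a, 'b) l2) v = norm (u - v)"
definition "sgn (u :: ('a, 'b) l2) = inverse (norm u) *\<^sub>R u"
definition [code del]: "(uniformity :: (('a, 'b) l2 \<times> ('a, 'b) l2) filter) =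
  (INF e\<in>{0 <..}. principal {(x, y). dist x y < e})"
definition [code del]: "open (U :: ('a, 'b) l2 set) \<longleftrightarrow>
  (\<forall>x\<in>U. eventually (\<lambda>(x', y). x' = x \<longrightarrow> y \<in> U) uniformity)"

lemma inner_rep_cong:
  fixes u v u' v' :: "('a, 'b) l2"
  assumes "AE x in lborel. rep u x \<bullet> rep v x = h x" "h \<in> borel_measurable lborel"
  shows "u \<bullet> v = integral\<^sup>L lborel h"
  unfolding inner_l2_def by (rule integral_cong_AE) (use assms in auto)

instance
proof
  fix u v w :: "('a, 'b) l2" and c :: real
  show "dist u v = norm (u - v)" "sgn u = u /\<^sub>R norm u" by (simp_all add: dist_l2_def sgn_l2_def)
  show "norm u = sqrt (u \<bullet> u)" by (simp add: norm_l2_def)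
  show "(uniformity :: (('a, 'b) l2 \<times> ('a, 'b) l2) filter) = (INF e\<in>{0 <..}. principal {(x, y). dist x y < e})"
    by (simp add: uniformity_l2_def)
  show "open (U :: ('a, 'b) l2 set) \<longleftrightarrow> (\<forall>x\<in>U. eventually (\<lambda>(x', y). x' = x \<longrightarrow> y \<in> U) uniformity)" for U
    by (simp add: open_l2_def)
  show "u \<bullet> v = v \<bullet> u" by (simp add: inner_l2_def inner_commute)
  have "(u + v) \<bullet> w = integral\<^sup>L lborel (\<lambda>x. rep u x \<bullet> rep w x + rep v x \<bullet> rep w x)"
    by (rule inner_rep_cong, use rep_add[of u v] in \<open>eventually_elim, simp add: inner_add_left\<close>, simp)
  then show "(u + v) \<bullet> w = u \<bullet> w + v \<bullet> w"
    by (simp add: inner_l2_def sq_int_inner Bochner_Integration.integral_add)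
  have "(c *\<^sub>R u) \<bullet> w = integral\<^sup>L lborel (\<lambda>x. c * (rep u x \<bullet> rep w x))"
    by (rule inner_rep_cong, use rep_scaleR[of c u] in \<open>eventually_elim, simp\<close>, simp)
  then show "(c *\<^sub>R u) \<bullet> w = c * (u \<bullet> w)" by (simp add: inner_l2_def)
  show "0 \<le> u \<bullet> u" by (simp add: inner_l2_def)
  show "(u \<bullet> u = 0) = (u = 0)"
  proof
    assume "u \<bullet> u = 0"
    then have "AE x in lborel. rep u x \<bullet> rep u x = 0"
      unfolding inner_l2_def
      by (subst (asm) integral_nonneg_eq_0_iff_AE) (auto intro!: sq_int_inner)
    then have "AE x in lborel. rep u x = rep 0 x" using rep_0 by eventually_elim simp
    then show "u = 0" by (rule l2_eqI)
  next
    assume "u = 0"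
    moreover have "(0 :: ('a, 'b) l2) \<bullet> 0 = integral\<^sup>L lborel (\<lambda>x::'a. 0)"
      by (rule inner_rep_cong, use rep_0 in \<open>eventually_elim, simp\<close>, simp)
    ultimately show "u \<bullet> u = 0" by simp
  qed
qed

end

lemma toL_0: "toL (\<lambda>x. 0) = 0" by (simp add: zero_l2_def)

lemma inner_toL:
  assumes "sq_int f" "sq_int g" shows "toL f \<bullet> toL g = integral\<^sup>L lborel (\<lambda>x. f x \<bullet> g x)"
proof -
  have [measurable]: "f \<in> borel_measurable lborel" "g \<in> borel_measurable lborel"
    using assms by (auto simp: sq_int_def)
  show ?thesis
    by (rule inner_rep_cong) (use rep_toL[OF assms(1)] rep_toL[OF assms(2)] in \<open>eventually_elim, simp\<close>, simp)
qed

lemma norm_toL: "sq_int f \<Longrightarrow> (norm (toL f))\<^sup>2 = integral\<^sup>L lborel (\<lambda>x. (norm (f x))\<^sup>2)"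
  by (simp add: power2_norm_eq_inner inner_toL)

lemma norm_l2: "(norm (u :: ('a::euclidean_space, 'b::{real_inner,banach,second_countable_topology}) l2))\<^sup>2
    = integral\<^sup>L lborel (\<lambda>x. (norm (rep u x))\<^sup>2)"
  using norm_toL[of "rep u"] by simp

lemma toL_add:
  assumes "sq_int f" "sq_int g" shows "toL (\<lambda>x. f x + g x) = toL f + toL g"
proof (rule toL_eqI)
  show "AE x in lborel. rep (toL f + toL g) x = f x + g x"
    using rep_add[of "toL f" "toL g"] rep_toL[OF assms(1)] rep_toL[OF assms(2)] by eventually_elim simp
qed (intro sq_int_add assms)

lemma toL_diff:
  assumes "sq_int f" "sq_int g" shows "toL (\<lambda>x. f x - g x) = toL f - toL g"
proof (rule toL_eqI)
  show "AE x in lborel. rep (toL f - toL g) x = f x - g x"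
    using rep_diff[of "toL f" "toL g"] rep_toL[OF assms(1)] rep_toL[OF assms(2)] by eventually_elim simp
qed (intro sq_int_diff assms)

lemma toL_scaleR:
  assumes "sq_int f" shows "toL (\<lambda>x. c *\<^sub>R f x) = c *\<^sub>R toL f"
proof (rule toL_eqI)
  show "AE x in lborel. rep (c *\<^sub>R toL f) x = c *\<^sub>R f x"
    using rep_scaleR[of c "toL f"] rep_toL[OF assms(1)] by eventually_elim simp
qed (intro sq_int_scaleR assms)

text \<open>Riesz-Fischer: a fast subsequence converges almost everywhere, Fatou's lemma bounds its
  distance to the pointwise limit, and a Cauchy sequence follows its subsequence.\<close>

instance l2 :: (euclidean_space, "{real_inner,banach,second_countable_topology}") complete_space
proof
  fix X :: "nat \<Rightarrow> ('a, 'b) l2" assume X: "Cauchy X"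
  have "\<exists>N. \<forall>i\<ge>N. \<forall>j\<ge>N. dist (X i) (X j) < (1/4)^k" for k
    using metric_CauchyD[OF X] by simp
  then obtain N where N: "dist (X i) (X j) < (1/4)^k" if "i \<ge> N k" "j \<ge> N k" for i j k by metis
  define r where "r k = (\<Sum>i\<le>k. N i) + k" for k
  have r: "strict_mono r" by (rule strict_mono_Suc_iff[THEN iffD2]) (simp add: r_def)
  have rN: "N k \<le> r k" for k
    unfolding r_def by (rule trans_le_add1) (rule member_le_sum, auto)
  define f where "f k = rep (X (r k))" for k
  have [measurable]: "f k \<in> borel_measurable lborel" for k by (simp add: f_def)
  have fint: "integrable lborel (\<lambda>x. (norm (f i x - f j x))\<^sup>2)" for i j
    using sq_int_diff[OF sq_int_rep[of "X (r i)"] sq_int_rep[of "X (r j)"]]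
    by (simp only: f_def sq_int_def)
  have fdist: "integral\<^sup>L lborel (\<lambda>x. (norm (f i x - f j x))\<^sup>2) = (dist (X (r i)) (X (r j)))\<^sup>2" for i j
    using norm_toL[of "\<lambda>x. f i x - f j x"] toL_diff[of "f i" "f j"] sq_int_diff[of "f i" "f j"]
    by (simp add: f_def dist_norm)
  \<comment> \<open>The weight 2^k still leaves integrals of at most (1/2)^k, and a \<le> 2^k a^2 +
    (1/2)^k turns summability of these squares into absolute convergence of the telescoping
    series.\<close>
  let ?d = "\<lambda>k x. 2^k * (norm (f (Suc k) x - f k x))\<^sup>2"
  have "(\<integral>\<^sup>+x. (\<Sum>k. ennreal (?d k x)) \<partial>lborel) = (\<Sum>k. \<integral>\<^sup>+x. ennreal (?d k x) \<partial>lborel)"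
    by (rule nn_integral_suminf) simp
  also have "\<dots> \<le> (\<Sum>k. ennreal ((1/2)^k))"
  proof (rule suminf_le)
    fix k
    have "(dist (X (r (Suc k))) (X (r k)))\<^sup>2 \<le> ((1/4)^k)\<^sup>2"
    proof (rule power_mono)
      have "N k \<le> r (Suc k)" using rN[of k] strict_mono_less[OF r, of k "Suc k"] by simp
      then show "dist (X (r (Suc k))) (X (r k)) \<le> (1/4)^k" using N[OF _ rN] by (simp add: less_imp_le)
    qed simp
    then have "2^k * (dist (X (r (Suc k))) (X (r k)))\<^sup>2 \<le> 2^k * ((1/4)^k)\<^sup>2" by simp
    also have "\<dots> = (2 * (1/4)^2)^k" by (simp only: power_mult_distrib power_mult[symmetric] mult.commute)
    also have "\<dots> \<le> (1/2)^k" by (rule power_mono) (auto simp: power2_eq_square)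
    finally have le: "2^k * (dist (X (r (Suc k))) (X (r k)))\<^sup>2 \<le> (1/2::real)^k" .
    have "(\<integral>\<^sup>+x. ennreal (?d k x) \<partial>lborel) = ennreal (2^k * (dist (X (r (Suc k))) (X (r k)))\<^sup>2)"
      using fint by (subst nn_integral_eq_integral) (auto simp: fdist)
    then show "(\<integral>\<^sup>+x. ennreal (?d k x) \<partial>lborel) \<le> ennreal ((1/2)^k)"
      using le by (simp add: ennreal_leI)
  qed auto
  also have "\<dots> = ennreal (\<Sum>k. (1/2)^k)" by (rule suminf_ennreal2) (auto intro: summable_geometric)
  also have "\<dots> < \<infinity>" by simp
  finally have "(\<integral>\<^sup>+x. (\<Sum>k. ennreal (?d k x)) \<partial>lborel) \<noteq> \<infinity>" by simp
  then have "AE x in lborel. (\<Sum>k. ennreal (?d k x)) \<noteq> \<infinity>"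
    by (intro nn_integral_noteq_infinite) auto
  then have conv: "AE x in lborel. convergent (\<lambda>k. f k x)"
  proof eventually_elim
    fix x assume "(\<Sum>k. ennreal (?d k x)) \<noteq> \<infinity>"
    then have s: "summable (\<lambda>k. ?d k x)" by (intro summable_suminf_not_top) auto
    have "summable (\<lambda>k. norm (f (Suc k) x - f k x))"
    proof (rule summable_comparison_test')
      show "summable (\<lambda>k. ?d k x + (1/2)^k)" by (intro summable_add s summable_geometric) simp
      fix k :: nat
      let ?a = "norm (f (Suc k) x - f k x)"
      have "0 \<le> 2^k * (?a - (1/2)^k)\<^sup>2" by simp
      also have "\<dots> = 2^k * ?a\<^sup>2 - 2 * ?a + (1/2)^k"
        by (simp add: power2_eq_square algebra_simps power_divide)
      finally have "?a \<le> ?d k x + (1/2)^k" using zero_le_power[of "1/2::real" k] by (smt (verit) norm_ge_zero)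
      then show "norm (norm (f (Suc k) x - f k x)) \<le> ?d k x + (1/2)^k" by simp
    qed
    then have "summable (\<lambda>k. f (Suc k) x - f k x)" by (rule summable_norm_cancel)
    then have "convergent (\<lambda>n. \<Sum>k<n. f (Suc k) x - f k x)" by (simp add: summable_iff_convergent)
    then have "convergent (\<lambda>n. f n x - f 0 x)" by (simp only: sum_lessThan_telescope[of "\<lambda>k. f k x"])
    from convergent_add[OF this convergent_const[of "f 0 x"]] show "convergent (\<lambda>k. f k x)" by simp
  qed
  define g where "g x = lim (\<lambda>k. f k x)" for x
  have [measurable]: "g \<in> borel_measurable lborel"
    unfolding g_def by (rule borel_measurable_lim_metric) simp
  have lim: "AE x in lborel. (\<lambda>k. f k x) \<longlonglongrightarrow> g x"
    using conv by eventually_elim (simp add: g_def convergent_LIMSEQ_iff)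
  have fatou: "(\<integral>\<^sup>+x. ennreal ((norm (f i x - g x))\<^sup>2) \<partial>lborel) \<le> ennreal (e\<^sup>2)"
    if e: "e \<ge> 0" "\<And>j. j \<ge> i \<Longrightarrow> dist (X (r i)) (X (r j)) \<le> e" for i e
  proof -
    have "(\<integral>\<^sup>+x. ennreal ((norm (f i x - g x))\<^sup>2) \<partial>lborel)
        = (\<integral>\<^sup>+x. liminf (\<lambda>j. ennreal ((norm (f i x - f j x))\<^sup>2)) \<partial>lborel)"
    proof (rule nn_integral_cong_AE, use lim in eventually_elim)
      fix x assume "(\<lambda>k. f k x) \<longlonglongrightarrow> g x"
      then have "(\<lambda>j. ennreal ((norm (f i x - f j x))\<^sup>2)) \<longlonglongrightarrow> ennreal ((norm (f i x - g x))\<^sup>2)"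
        by (intro tendsto_intros)
      then show "ennreal ((norm (f i x - g x))\<^sup>2) = liminf (\<lambda>j. ennreal ((norm (f i x - f j x))\<^sup>2))"
        by (intro lim_imp_Liminf[symmetric]) auto
    qed
    also have "\<dots> \<le> liminf (\<lambda>j. \<integral>\<^sup>+x. ennreal ((norm (f i x - f j x))\<^sup>2) \<partial>lborel)"
      by (rule nn_integral_liminf) simp
    also have "\<dots> \<le> liminf (\<lambda>j::nat. ennreal (e\<^sup>2))"
    proof (rule Liminf_mono, rule eventually_sequentiallyI[of i])
      fix j assume "j \<ge> i"
      then have "(dist (X (r i)) (X (r j)))\<^sup>2 \<le> e\<^sup>2" using e by (intro power_mono) auto
      then show "(\<integral>\<^sup>+x. ennreal ((norm (f i x - f j x))\<^sup>2) \<partial>lborel) \<le> ennreal (e\<^sup>2)"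
        using fint by (subst nn_integral_eq_integral) (auto simp: fdist ennreal_leI)
    qed
    also have "\<dots> = ennreal (e\<^sup>2)" by (simp add: Liminf_const)
    finally show ?thesis .
  qed
  have small: "dist (X (r i)) (X (r j)) \<le> (1/4)^i" if "j \<ge> i" for i j
  proof -
    have "N i \<le> r j" using rN[of i] strict_mono_less_eq[OF r, of i j] that by simp
    then show ?thesis using N[OF rN] by (simp add: less_imp_le)
  qed
  have sqd: "sq_int (\<lambda>x. f i x - g x)" for i
    unfolding sq_int_def integrable_iff_bounded
    using fatou[of "(1/4)^i" i] small[of i] by (auto simp: less_top[symmetric] top_unique)
  have sqg: "sq_int g"
    using sq_int_diff[OF sq_int_rep[of "X (r 0)"] sqd[of 0]] by (simp add: f_def)
  have "dist ((X \<circ> r) i) (toL g) \<le> (1/4)^i" for i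
  proof -
    have "(norm (X (r i) - toL g))\<^sup>2 = integral\<^sup>L lborel (\<lambda>x. (norm (f i x - g x))\<^sup>2)"
      using norm_toL[OF sqd[of i]] toL_diff[of "f i" g] sqg by (simp add: f_def)
    moreover have "\<dots> \<le> ((1/4)^i)\<^sup>2"
      using fatou[of "(1/4)^i" i] small[of i] sqd[of i]
      by (simp add: nn_integral_eq_integral sq_int_def)
    ultimately have "(norm (X (r i) - toL g))\<^sup>2 \<le> ((1/4)^i)\<^sup>2" by simp
    then have "norm (X (r i) - toL g) \<le> (1/4)^i" by (rule power2_le_imp_le) simp
    then show ?thesis by (simp add: dist_norm)
  qed
  moreover have "(\<lambda>i. (1/4::real)^i) \<longlonglongrightarrow> 0" by (intro LIMSEQ_power_zero) simp
  ultimately have "(X \<circ> r) \<longlonglongrightarrow> toL g"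
    by (subst tendsto_dist_iff) (rule tendsto_sandwich[OF _ _ tendsto_const], auto)
  then have "X \<longlonglongrightarrow> toL g" by (rule Cauchy_converges_subseq[OF X r])
  then show "convergent X" by (auto simp: convergent_def)
qed

instance l2 :: (euclidean_space, "{real_inner,banach,second_countable_topology}") banach ..

section \<open>Boxes, totality and separability\<close>

definition ratvec :: "'a::euclidean_space set" where
  "ratvec = {x. \<forall>i\<in>Basis. x \<bullet> i \<in> \<rat>}"

text \<open>A countable base that is closed under intersection: it generates the Borel sets and is a
  pi-system.\<close>

definition rat_boxes :: "'a::euclidean_space set set" where
  "rat_boxes = {box a b | a b. a \<in> ratvec \<and> b \<in> ratvec}"

lemma countable_ratvec: "countable (ratvec :: 'a::euclidean_space set)"
proof -
  have "ratvec \<subseteq> (\<lambda>f. \<Sum>i\<in>Basis. f i *\<^sub>R (i::'a)) ` (Basis \<rightarrow>\<^sub>E \<rat>)"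
  proof
    fix x :: 'a assume "x \<in> ratvec"
    then show "x \<in> (\<lambda>f. \<Sum>i\<in>Basis. f i *\<^sub>R (i::'a)) ` (Basis \<rightarrow>\<^sub>E \<rat>)"
      by (intro image_eqI[where x = "restrict (\<lambda>i. x \<bullet> i) Basis"])
        (auto simp: ratvec_def euclidean_representation)
  qed
  moreover have "countable ((\<lambda>f. \<Sum>i\<in>Basis. f i *\<^sub>R (i::'a)) ` (Basis \<rightarrow>\<^sub>E \<rat>))"
    by (intro countable_image countable_PiE finite_Basis countable_rat)
  ultimately show ?thesis by (rule countable_subset)
qed

lemma countable_rat_boxes: "countable (rat_boxes :: 'a::euclidean_space set set)"
proof -
  have "rat_boxes \<subseteq> (\<lambda>(a, b). box a b) ` (ratvec \<times> (ratvec :: 'a set))"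
    by (auto simp: rat_boxes_def)
  moreover have "countable ((\<lambda>(a, b). box a b) ` (ratvec \<times> (ratvec :: 'a set)))"
    by (intro countable_image countable_SIGMA countable_ratvec)
  ultimately show ?thesis by (rule countable_subset)
qed

lemma ex_rat_box:
  fixes x :: "'a::euclidean_space"
  assumes "open M" "x \<in> M"
  shows "\<exists>a\<in>ratvec. \<exists>b\<in>ratvec. x \<in> box a b \<and> box a b \<subseteq> M"
proof -
  obtain f where f: "f \<in> Basis \<rightarrow>\<^sub>E \<rat> \<times> \<rat>"
    "box (\<Sum>i\<in>Basis. fst (f i) *\<^sub>R i) (\<Sum>i\<in>Basis. snd (f i) *\<^sub>R i) \<subseteq> M"
    "x \<in> box (\<Sum>i\<in>Basis. fst (f i) *\<^sub>R i) (\<Sum>i\<in>Basis. snd (f i) *\<^sub>R i)"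
    using open_UNION_box[OF assms(1)] assms(2) by blast
  have "(\<Sum>i\<in>Basis. fst (f i) *\<^sub>R i) \<in> ratvec" "(\<Sum>i\<in>Basis. snd (f i) *\<^sub>R i) \<in> ratvec"
    using f(1) by (auto simp: ratvec_def PiE_iff mem_Times_iff)
  then show ?thesis using f by blast
qed

lemma topological_basis_rat_boxes: "topological_basis (rat_boxes :: 'a::euclidean_space set set)"
proof (rule topological_basisI)
  show "open B'" if "B' \<in> rat_boxes" for B' :: "'a set" using that by (auto simp: rat_boxes_def open_box)
  show "\<exists>B'\<in>rat_boxes. x \<in> B' \<and> B' \<subseteq> O'" if "open O'" "x \<in> O'" for x :: 'a and O'
    using ex_rat_box[OF that] by (fastforce simp: rat_boxes_def)
qed

lemma sets_borel_rat_boxes: "sets borel = sigma_sets UNIV (rat_boxes :: 'a::euclidean_space set set)"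
  using arg_cong[OF borel_eq_countable_basis[OF countable_rat_boxes topological_basis_rat_boxes], of sets]
  by (simp only: sets_measure_of_conv) simp

lemma rat_box_Int:
  fixes a b c d :: "'a::euclidean_space"
  assumes "a \<in> ratvec" "b \<in> ratvec" "c \<in> ratvec" "d \<in> ratvec"
  shows "\<exists>e\<in>ratvec. \<exists>f\<in>ratvec. box a b \<inter> box c d = box e f"
proof -
  let ?e = "\<Sum>i\<in>Basis. max (a \<bullet> i) (c \<bullet> i) *\<^sub>R i" and ?f = "\<Sum>i\<in>Basis. min (b \<bullet> i) (d \<bullet> i) *\<^sub>R i"
  have "box a b \<inter> box c d = box ?e ?f" by (rule box_Int_box)
  moreover have "?e \<in> ratvec" "?f \<in> ratvec" using assms by (auto simp: ratvec_def max_def min_def)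
  ultimately show ?thesis by blast
qed

text \<open>Dynkin's argument over the rational boxes extends the assumption to all Borel sets, and
  a function whose integral over each of them is 0 vanishes almost everywhere.\<close>

lemma AE_zero_if_box_integrals_zero:
  fixes f :: "'a::euclidean_space \<Rightarrow> 'b::{banach,second_countable_topology}"
  assumes f: "integrable lborel f"
    and z: "\<And>a b. a \<in> ratvec \<Longrightarrow> b \<in> ratvec \<Longrightarrow> (LINT x:box a b|lborel. f x) = 0"
  shows "AE x in lborel. f x = 0"
proof (rule sigma_finite_measure.density_zero[OF lborel.sigma_finite_measure_axioms f])
  \<comment> \<open>Complements in the Dynkin induction need the integral over the whole space,
    which no single box provides; it is a limit over exhausting boxes.\<close>
  have all: "integral\<^sup>L lborel f = 0"
  proof -
    let ?a = "\<lambda>n::nat. - (real n *\<^sub>R (\<Sum>i\<in>Basis. i :: 'a))" and ?b = "\<lambda>n::nat. real n *\<^sub>R (\<Sum>i\<in>Basis. i :: 'a)"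
    have "(\<lambda>n. LINT x|lborel. indicator (box (?a n) (?b n)) x *\<^sub>R f x) \<longlonglongrightarrow> (LINT x|lborel. f x)"
    proof (rule integral_dominated_convergence[where w = "\<lambda>x. norm (f x)"])
      show "AE x in lborel. (\<lambda>n. indicator (box (?a n) (?b n)) x *\<^sub>R f x) \<longlonglongrightarrow> f x"
      proof (rule AE_I2)
        fix x :: 'a
        obtain N :: nat where N: "norm x < real N" using reals_Archimedean2 by blast
        have "x \<in> box (?a n) (?b n)" if "n \<ge> N" for n
        proof -
          have "\<bar>x \<bullet> i\<bar> < real n" if "i \<in> Basis" for i
            using Basis_le_norm[OF that, of x] N \<open>n \<ge> N\<close> by linarith
          then show ?thesis by (fastforce simp: mem_box abs_less_iff inner_sum_left inner_Basis if_distrib cong: if_cong)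
        qed
        then have "\<forall>\<^sub>F n in sequentially. indicator (box (?a n) (?b n)) x *\<^sub>R f x = f x"
          by (auto simp: eventually_sequentially intro!: exI[of _ N])
        then show "(\<lambda>n. indicator (box (?a n) (?b n)) x *\<^sub>R f x) \<longlonglongrightarrow> f x"
          by (rule tendsto_eventually)
      qed
    qed (use f in \<open>auto simp: indicator_def intro: integrable_norm\<close>)
    moreover have "(LINT x|lborel. indicator (box (?a n) (?b n)) x *\<^sub>R f x) = 0" for n
    proof -
      have "?a n \<in> ratvec" "?b n \<in> ratvec"
        by (auto simp: ratvec_def inner_sum_left inner_Basis if_distrib cong: if_cong)
      from z[OF this] show ?thesis by (simp add: set_lebesgue_integral_def)
    qed
    ultimately show ?thesis by (simp add: LIMSEQ_const_iff)
  qed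
  have si: "set_integrable lborel A f" if "A \<in> sets borel" for A
    using that f unfolding set_integrable_def by (intro integrable_mult_indicator) auto
  have *: "(LINT x:A|lborel. f x) = 0" if "A \<in> sigma_sets UNIV rat_boxes" for A
  proof -
    have "Int_stable (rat_boxes :: 'a set set)"
    proof (rule Int_stableI)
      fix A B :: "'a set" assume "A \<in> rat_boxes" "B \<in> rat_boxes"
      then obtain a b c d where *: "A = box a b" "B = box c d"
        "a \<in> ratvec" "b \<in> ratvec" "c \<in> ratvec" "d \<in> ratvec" by (auto simp: rat_boxes_def)
      obtain e g where "e \<in> ratvec" "g \<in> ratvec" "box a b \<inter> box c d = box e g"
        using rat_box_Int[OF *(3-6)] by blast
      then show "A \<inter> B \<in> rat_boxes" unfolding rat_boxes_def * by blast
    qed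
    moreover have "rat_boxes \<subseteq> Pow (UNIV :: 'a set)" by simp
    ultimately show ?thesis using that
    proof (induction rule: sigma_sets_induct_disjoint)
      case (basic A) then show ?case using z by (auto simp: rat_boxes_def)
    next
      case empty show ?case by (simp add: set_lebesgue_integral_def)
    next
      case (compl A)
      have A: "A \<in> sets borel"
        using compl(1) by (simp only: sets_borel_rat_boxes)
      have "(LINT x:UNIV - A|lborel. f x) = (LINT x|lborel. f x - indicator A x *\<^sub>R f x)"
        unfolding set_lebesgue_integral_def
        by (intro Bochner_Integration.integral_cong) (auto simp: indicator_def)
      also have "\<dots> = 0"
        using compl(2) si[OF A] f all by (simp add: set_lebesgue_integral_def set_integrable_def)
      finally show ?case .
    next
      case (union A)
      have A: "A i \<in> sets borel" for i
        using union(2) by (auto simp only: sets_borel_rat_boxes)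
      have "(LINT x:(\<Union>i. A i)|lborel. f x) = (\<Sum>i. LINT x:A i|lborel. f x)"
        by (rule lebesgue_integral_countable_add)
          (use A union(1) si in \<open>auto simp: disjoint_family_on_def\<close>)
      then show ?case using union(3) by simp
    qed
  qed
  show "(LINT x:A|lborel. f x) = 0" if "A \<in> sets lborel" for A
    using * that by (simp only: sets_lborel sets_borel_rat_boxes)
qed

lemma sq_int_box_const: "sq_int (\<lambda>x. indicator (box a b) x *\<^sub>R (k::'b::{real_inner,banach,second_countable_topology}))"
proof (rule sq_int_bound[where g = "\<lambda>x. indicator (box a b) x * (norm k)\<^sup>2"])
  have "emeasure lborel (box a b) < \<infinity>" using emeasure_lborel_box_eq[of a b] by simp
  then show "integrable lborel (\<lambda>x. indicator (box a b) x * (norm k)\<^sup>2)" by simp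
qed (auto simp: indicator_def)

lemma sq_int_integrable_on_finite:
  fixes f :: "'a::euclidean_space \<Rightarrow> 'b::{real_inner,banach,second_countable_topology}"
  assumes f: "sq_int f" and A: "A \<in> sets borel" "emeasure lborel A < \<infinity>"
  shows "integrable lborel (\<lambda>x. indicator A x *\<^sub>R f x)"
proof -
  have [measurable]: "f \<in> borel_measurable lborel" "A \<in> sets borel" using f A by (auto simp: sq_int_def)
  have i: "integrable lborel (\<lambda>x. indicator A x + (norm (f x))\<^sup>2 :: real)"
    using f A by (auto simp: sq_int_def)
  have le: "AE x in lborel. norm (indicator A x *\<^sub>R f x) \<le> norm (indicator A x + (norm (f x))\<^sup>2)"
  proof (rule AE_I2)
    fix x
    have "norm (f x) \<le> 1 + (norm (f x))\<^sup>2"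
      using sum_squares_bound[of 1 "norm (f x)"] norm_ge_zero[of "f x"] by (simp del: norm_ge_zero)
    then show "norm (indicator A x *\<^sub>R f x) \<le> norm (indicator A x + (norm (f x))\<^sup>2)"
      by (auto simp: indicator_def)
  qed
  show ?thesis by (rule Bochner_Integration.integrable_bound[OF i _ le]) simp
qed

text \<open>Localisation: f is cut to a box with closure in D, where all box integrals reduce to
  admissible ones, and countably many such boxes cover D. Asking for the closed box inside D leaves
  room for approximating its indicator by functions with compact support in D.\<close>

lemma AE_zero_on_open_if_box_integrals_zero:
  fixes f :: "'a::euclidean_space \<Rightarrow> 'b::{real_inner,banach,second_countable_topology}"
  assumes f: "sq_int f" and D: "open D"
    and z: "\<And>a b. a \<in> ratvec \<Longrightarrow> b \<in> ratvec \<Longrightarrow> cbox a b \<subseteq> D \<Longrightarrow> box a b \<noteq> {} \<Longrightarrow> (LINT x:box a b|lborel. f x) = 0"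
  shows "AE x in lborel. x \<in> D \<longrightarrow> f x = 0"
proof -
  have one: "AE x in lborel. x \<in> box c d \<longrightarrow> f x = 0"
    if cd: "c \<in> ratvec" "d \<in> ratvec" "cbox c d \<subseteq> D" for c d
  proof -
    have "AE x in lborel. indicator (box c d) x *\<^sub>R f x = 0"
    proof (rule AE_zero_if_box_integrals_zero)
      show "integrable lborel (\<lambda>x. indicator (box c d) x *\<^sub>R f x)"
        by (rule sq_int_integrable_on_finite[OF f]) (use emeasure_lborel_box_eq[of c d] in auto)
      fix a b :: 'a assume ab: "a \<in> ratvec" "b \<in> ratvec"
      obtain e g where eg: "e \<in> ratvec" "g \<in> ratvec" "box a b \<inter> box c d = box e g"
        using rat_box_Int[OF ab cd(1,2)] by blast
      have "(LINT x:box a b|lborel. indicator (box c d) x *\<^sub>R f x) = (LINT x:box e g|lborel. f x)"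
        unfolding set_lebesgue_integral_def
        by (intro Bochner_Integration.integral_cong) (auto simp: indicator_def eg(3)[symmetric])
      also have "\<dots> = 0"
      proof (cases "box e g = {}")
        case False
        have "closure (box e g) \<subseteq> closure (box c d)" using eg(3) by (intro closure_mono) auto
        moreover have "closure (box c d) \<subseteq> cbox c d"
          by (rule closure_minimal[OF box_subset_cbox closed_cbox])
        ultimately have "cbox e g \<subseteq> D" using False cd(3) closure_box[of e g] by blast
        then show ?thesis using z eg False by blast
      qed (simp add: set_lebesgue_integral_def)
      finally show "(LINT x:box a b|lborel. indicator (box c d) x *\<^sub>R f x) = 0" .
    qed
    then show ?thesis by eventually_elim (auto simp: indicator_def split: if_splits)
  qed
  let ?I = "{(c, d). c \<in> ratvec \<and> d \<in> ratvec \<and> cbox c d \<subseteq> D}"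
  have "?I \<subseteq> ratvec \<times> ratvec" by auto
  then have "countable ?I" using countable_ratvec by (meson countable_SIGMA countable_subset)
  then have "AE x in lborel. \<forall>cd\<in>?I. x \<in> box (fst cd) (snd cd) \<longrightarrow> f x = 0"
    by (subst AE_ball_countable) (auto intro!: one)
  then show ?thesis
  proof eventually_elim
    fix x assume *: "\<forall>cd\<in>?I. x \<in> box (fst cd) (snd cd) \<longrightarrow> f x = 0"
    show "x \<in> D \<longrightarrow> f x = 0"
    proof
      assume "x \<in> D"
      then obtain e where e: "e > 0" "cball x e \<subseteq> D" using D open_contains_cball by blast
      obtain a b where ab: "a \<in> ratvec" "b \<in> ratvec" "x \<in> box a b" "box a b \<subseteq> ball x e"
        using ex_rat_box[of "ball x e" x] e by auto
      have "closure (box a b) \<subseteq> cball x e"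
        using ab(4) ball_subset_cball by (intro closure_minimal) auto
      then have "cbox a b \<subseteq> D" using e ab(3) closure_box[of a b] by blast
      then show "f x = 0" using * ab by auto
    qed
  qed
qed

lemma inner_toL_const_on:
  fixes u :: "('a::euclidean_space, 'b::{real_inner,banach,second_countable_topology}) l2"
  assumes A: "A \<in> sets borel" "emeasure lborel A < \<infinity>"
    and s: "sq_int (\<lambda>x. indicator A x *\<^sub>R k)"
  shows "u \<bullet> toL (\<lambda>x. indicator A x *\<^sub>R k) = (LINT x:A|lborel. rep u x) \<bullet> k"
proof -
  have i: "integrable lborel (\<lambda>x. indicator A x *\<^sub>R rep u x)"
    by (rule sq_int_integrable_on_finite[OF sq_int_rep A])
  have "u \<bullet> toL (\<lambda>x. indicator A x *\<^sub>R k) = (LINT x|lborel. rep u x \<bullet> (indicator A x *\<^sub>R k))"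
    using inner_toL[OF sq_int_rep[of u] s] by simp
  also have "\<dots> = (LINT x|lborel. (indicator A x *\<^sub>R rep u x) \<bullet> k)" by simp
  also have "\<dots> = (LINT x|lborel. indicator A x *\<^sub>R rep u x) \<bullet> k"
    by (rule integral_inner_left) (use i in auto)
  finally show ?thesis by (simp add: set_lebesgue_integral_def)
qed

text \<open>For each box the vector-valued integral of u is orthogonal to the dense set K, hence
  zero. Allowing an arbitrary dense K makes a countable total set possible.\<close>

lemma l2_zero_if_orth_boxes:
  fixes u :: "('a::euclidean_space, 'b::{real_inner,banach,second_countable_topology}) l2"
  assumes K: "closure K = UNIV"
    and z: "\<And>a b k. a \<in> ratvec \<Longrightarrow> b \<in> ratvec \<Longrightarrow> k \<in> K \<Longrightarrow> u \<bullet> toL (\<lambda>x. indicator (box a b) x *\<^sub>R k) = 0"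
  shows "u = 0"
proof -
  have "(LINT x:box a b|lborel. rep u x) = 0" if ab: "a \<in> ratvec" "b \<in> ratvec" for a b
  proof -
    let ?v = "LINT x:box a b|lborel. rep u x"
    have orth: "?v \<bullet> k = 0" if "k \<in> K" for k
      using z[OF ab that] inner_toL_const_on[of "box a b" k u] emeasure_lborel_box_eq[of a b] sq_int_box_const[of a b k]
      by simp
    have "closed {k. ?v \<bullet> k = 0}" by (intro closed_Collect_eq continuous_intros)
    then have "closure K \<subseteq> {k. ?v \<bullet> k = 0}" using orth by (intro closure_minimal) auto
    then have "?v \<bullet> ?v = 0" using K by blast
    then show ?thesis by (simp only: inner_eq_zero_iff)
  qed
  then have "AE x in lborel. x \<in> UNIV \<longrightarrow> rep u x = 0"
    by (intro AE_zero_on_open_if_box_integrals_zero) auto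
  then have "AE x in lborel. rep u x = rep 0 x" using rep_0 by eventually_elim simp
  then show ?thesis by (rule l2_eqI)
qed

text \<open>Finite combinations with rational coefficients are countable, and their closure is a
  closed subspace containing X because real scalars are limits of rational ones.\<close>

lemma countable_dense_if_countable_total:
  fixes X :: "'a::{real_inner,complete_space} set"
  assumes X: "countable X" and tot: "\<And>z. (\<forall>x\<in>X. z \<bullet> x = 0) \<Longrightarrow> z = 0"
  shows "\<exists>Y::'a set. countable Y \<and> closure Y = UNIV"
proof -
  let ?s = "\<lambda>l. sum_list (map (\<lambda>(q::real, x::'a). q *\<^sub>R x) l)"
  define Y where "Y = ?s ` lists (\<rat> \<times> X)"
  have cY: "countable Y"
    unfolding Y_def using X by (intro countable_image countable_lists countable_SIGMA countable_rat)
  have Y0: "0 \<in> Y" unfolding Y_def by (rule image_eqI[of _ _ "[]"]) auto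
  have Yadd: "x + y \<in> Y" if "x \<in> Y" "y \<in> Y" for x y
  proof -
    obtain k l where "k \<in> lists (\<rat> \<times> X)" "l \<in> lists (\<rat> \<times> X)" "x = ?s k" "y = ?s l"
      using \<open>x \<in> Y\<close> \<open>y \<in> Y\<close> by (auto simp: Y_def)
    then show ?thesis unfolding Y_def by (intro image_eqI[of _ _ "k @ l"]) auto
  qed
  have Yscale: "q *\<^sub>R y \<in> Y" if "q \<in> \<rat>" "y \<in> Y" for q y
  proof -
    obtain l where l: "l \<in> lists (\<rat> \<times> X)" "y = ?s l" using \<open>y \<in> Y\<close> by (auto simp: Y_def)
    have "?s (map (\<lambda>(p, x). (q * p, x)) l) = q *\<^sub>R ?s l" by (induction l) (auto simp: algebra_simps)
    moreover have "map (\<lambda>(p, x). (q * p, x)) l \<in> lists (\<rat> \<times> X)" using l(1) \<open>q \<in> \<rat>\<close> by (induction l) auto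
    ultimately show ?thesis unfolding Y_def using l(2) by (metis image_eqI)
  qed
  have "subspace (closure Y)"
  proof (rule subspaceI)
    show "0 \<in> closure Y" using Y0 closure_subset by blast
    fix x y assume "x \<in> closure Y" "y \<in> closure Y"
    then obtain f g where "\<And>n::nat. f n \<in> Y" "f \<longlonglongrightarrow> x" "\<And>n::nat. g n \<in> Y" "g \<longlonglongrightarrow> y"
      unfolding closure_sequential by blast
    then have "\<And>n. f n + g n \<in> Y" "(\<lambda>n. f n + g n) \<longlonglongrightarrow> x + y" by (auto intro: Yadd tendsto_add)
    then show "x + y \<in> closure Y"
      unfolding closure_sequential by (intro exI[of _ "\<lambda>n. f n + g n"]) simp
  next
    fix c :: real and x assume "x \<in> closure Y"
    then obtain f where f: "\<And>n::nat. f n \<in> Y" "f \<longlonglongrightarrow> x" unfolding closure_sequential by blast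
    have "c \<in> closure \<rat>" by (simp add: Rats_closure_real)
    then obtain q where q: "\<And>n::nat. q n \<in> \<rat>" "q \<longlonglongrightarrow> c" unfolding closure_sequential by blast
    have "\<And>n. q n *\<^sub>R f n \<in> Y" "(\<lambda>n. q n *\<^sub>R f n) \<longlonglongrightarrow> c *\<^sub>R x"
      using f q by (auto intro: Yscale tendsto_scaleR)
    then show "c *\<^sub>R x \<in> closure Y"
      unfolding closure_sequential by (intro exI[of _ "\<lambda>n. q n *\<^sub>R f n"]) simp
  qed
  moreover have "X \<subseteq> closure Y"
  proof
    fix x assume "x \<in> X"
    then have "x \<in> Y" unfolding Y_def by (intro image_eqI[of _ _ "[(1, x)]"]) auto
    then show "x \<in> closure Y" using closure_subset by blast
  qed
  ultimately have "closure Y = UNIV"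
    using tot by (intro closed_subspace_eq_UNIV) (blast | simp)+
  then show ?thesis using cY by blast
qed

lemma second_countable_if_countable_dense:
  fixes Y :: "'a::metric_space set"
  assumes Y: "countable Y" "closure Y = UNIV"
  shows "\<exists>B::'a set set. countable B \<and> open = generate_topology B"
proof -
  define B where "B = (\<lambda>(y, q). ball y q) ` (Y \<times> \<rat>)"
  have "topological_basis B"
  proof (rule topological_basisI)
    show "open B'" if "B' \<in> B" for B' using that by (auto simp: B_def)
    fix O' and x :: 'a assume "open O'" "x \<in> O'"
    then obtain e where e: "e > 0" "ball x e \<subseteq> O'" using open_contains_ball by blast
    obtain q where q: "q \<in> \<rat>" "0 < q" "q < e / 2" using Rats_dense_in_real[of 0 "e/2"] e by auto
    obtain y where y: "y \<in> Y" "dist y x < q"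
      using Y(2) q(2) closure_approachable[of x Y] by auto
    have "ball y q \<subseteq> ball x e"
    proof
      fix z assume "z \<in> ball y q"
      then have "dist x z < q + q" using y dist_triangle[of x z y] by (simp add: dist_commute)
      then show "z \<in> ball x e" using q by simp
    qed
    then show "\<exists>B'\<in>B. x \<in> B' \<and> B' \<subseteq> O'"
      using y q e by (intro bexI[of _ "ball y q"]) (auto simp: B_def)
  qed
  moreover have "countable B" unfolding B_def using Y by (intro countable_image countable_SIGMA countable_rat)
  ultimately show ?thesis using topological_basis_imp_subbasis by blast
qed

text \<open>With this instance \<open>l2\<close> has every property that it demands of its value
  type, so that \<open>(real, ('a, 'b) l2) l2\<close>, the functions of time with values in a
  function space, becomes available.\<close>

instance l2 :: (euclidean_space, "{real_inner,banach,second_countable_topology}") second_countable_topology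
proof
  obtain K :: "'b set" where K: "countable K" "closure K = UNIV"
    using separable[of "UNIV :: 'b set"] by (metis top.extremum_uniqueI)
  define X :: "('a, 'b) l2 set" where
    "X = (\<lambda>(a, b, k). toL (\<lambda>x. indicator (box a b) x *\<^sub>R k)) ` (ratvec \<times> ratvec \<times> K)"
  have "countable X" unfolding X_def using K countable_ratvec by (intro countable_image countable_SIGMA)
  moreover have "z = 0" if "\<forall>x\<in>X. z \<bullet> x = 0" for z
    by (rule l2_zero_if_orth_boxes[OF K(2)]) (use that in \<open>force simp: X_def\<close>)
  ultimately have "\<exists>Y::('a, 'b) l2 set. countable Y \<and> closure Y = UNIV"
    by (rule countable_dense_if_countable_total)
  then obtain Y :: "('a, 'b) l2 set" where "countable Y" "closure Y = UNIV" by blast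
  then show "\<exists>B::('a, 'b) l2 set set. countable B \<and> open = generate_topology B"
    by (rule second_countable_if_countable_dense)
qed

lemma sq_int_square: "sq_int f \<Longrightarrow> integrable lborel (\<lambda>x. (norm (f x))\<^sup>2)"
  by (simp add: sq_int_def)

section \<open>Operators acting on functions of time\<close>

text \<open>Three-epsilon argument: under a uniform norm bound the points of convergence form a
  closed subspace, so a total set decides. The filter is arbitrary because translations are used as
  h tends to 0 and averages along a sequence.\<close>

lemma strong_limit_of_contractions:
  fixes A :: "'i \<Rightarrow> 'a::{real_inner,complete_space} \<Rightarrow> 'a"
  assumes lin: "\<And>h. linear (A h)" and C: "linear C"
    and bd: "\<forall>\<^sub>F h in F. \<forall>x. norm (A h x) \<le> norm x" and Cbd: "\<And>x. norm (C x) \<le> norm x"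
    and X: "\<And>x. x \<in> X \<Longrightarrow> ((\<lambda>h. A h x) \<longlongrightarrow> C x) F"
    and tot: "\<And>z. (\<forall>x\<in>X. z \<bullet> x = 0) \<Longrightarrow> z = 0"
  shows "((\<lambda>h. A h x) \<longlongrightarrow> C x) F"
proof -
  define W where "W = {x. ((\<lambda>h. A h x) \<longlongrightarrow> C x) F}"
  have "subspace W"
  proof (rule subspaceI)
    show "0 \<in> W" using lin C by (simp add: W_def linear_0)
    show "x + y \<in> W" if "x \<in> W" "y \<in> W" for x y
      using that lin C by (auto simp: W_def linear_add intro: tendsto_add)
    show "c *\<^sub>R x \<in> W" if "x \<in> W" for c x
      using that lin C by (auto simp: W_def linear_cmul intro: tendsto_scaleR)
  qed
  moreover have "closed W"
    unfolding closed_sequential_limits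
  proof (intro allI impI, elim conjE)
    fix y l assume y: "\<forall>n::nat. y n \<in> W" "y \<longlonglongrightarrow> l"
    show "l \<in> W"
      unfolding W_def mem_Collect_eq
    proof (rule tendstoI)
      fix e :: real assume e: "e > 0"
      then obtain n where n: "dist (y n) l < e / 3" using y(2) metric_LIMSEQ_D[of y l "e/3"] by auto
      have "\<forall>\<^sub>F h in F. dist (A h (y n)) (C (y n)) < e / 3"
        using y(1) e by (intro tendstoD) (auto simp: W_def)
      then show "\<forall>\<^sub>F h in F. dist (A h l) (C l) < e"
        using bd
      proof eventually_elim
        case (elim h)
        have 1: "norm (A h l - A h (y n)) < e / 3"
          using elim(2)[rule_format, of "l - y n"] n lin by (simp add: linear_diff dist_norm norm_minus_commute)
        have 2: "norm (C (y n) - C l) < e / 3"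
          using Cbd[of "y n - l"] n C by (simp add: linear_diff dist_norm)
        have "norm (A h l - C l) \<le> norm (A h l - A h (y n)) + norm (A h (y n) - C (y n)) + norm (C (y n) - C l)"
          by (smt (verit) norm_triangle_ineq diff_add_cancel add_diff_eq)
        then show ?case using 1 2 elim(1) by (simp add: dist_norm)
      qed
    qed
  qed
  moreover have "X \<subseteq> W" using X by (auto simp: W_def)
  ultimately have "W = UNIV" using tot by (intro closed_subspace_eq_UNIV) (blast | simp)+
  then show ?thesis by (auto simp: W_def)
qed

text \<open>With y a translate of x this is the discrete form of -(x', x) \<ge> 0; the sign of the
  time derivative is drawn from here.\<close>

lemma linear_norm_inner_diff_nonneg:
  fixes x y :: "'a::real_inner"
  assumes "norm y \<le> norm x" shows "x \<bullet> (x - y) \<ge> 0"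
proof -
  have "x \<bullet> y \<le> norm x * norm y" by (rule norm_cauchy_schwarz)
  also have "\<dots> \<le> norm x * norm x" using assms by (intro mult_left_mono) auto
  finally show ?thesis by (simp add: inner_diff_right power2_norm_eq_inner[symmetric] power2_eq_square)
qed

subsection \<open>Pointwise operations\<close>

definition restr :: "'a set \<Rightarrow> ('a::euclidean_space, 'b::{real_inner,banach,second_countable_topology}) l2 \<Rightarrow> ('a, 'b) l2"
  where "restr A u = toL (\<lambda>x. indicator A x *\<^sub>R rep u x)"

definition lmap :: "('b \<Rightarrow> 'c) \<Rightarrow> ('a::euclidean_space, 'b::{real_inner,banach,second_countable_topology}) l2
    \<Rightarrow> ('a, 'c::{real_inner,banach,second_countable_topology}) l2"
  where "lmap p u = toL (\<lambda>x. p (rep u x))"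

text \<open>The elementary tensor of the indicator of A with k. Over bounded intervals these are
  total among functions of time.\<close>

definition tens :: "'a set \<Rightarrow> 'b \<Rightarrow> ('a::euclidean_space, 'b::{real_inner,banach,second_countable_topology}) l2"
  where "tens A k = toL (\<lambda>x. indicator A x *\<^sub>R k)"

lemma rep_restr: "A \<in> sets borel \<Longrightarrow> AE x in lborel. rep (restr A u) x = indicator A x *\<^sub>R rep u x"
  unfolding restr_def by (intro rep_toL sq_int_indicator) auto

lemma rep_lmap: "bounded_linear p \<Longrightarrow> AE x in lborel. rep (lmap p u) x = p (rep u x)"
  unfolding lmap_def by (rule rep_toL, rule sq_int_bounded_linear) auto

lemma sq_int_const_on:
  assumes "A \<in> sets borel" "emeasure lborel A < \<infinity>"
  shows "sq_int (\<lambda>x. indicator A x *\<^sub>R (k::'b::{real_inner,banach,second_countable_topology}))"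
proof (rule sq_int_bound[where g = "\<lambda>x. indicator A x * (norm k)\<^sup>2"])
  show "integrable lborel (\<lambda>x. indicator A x * (norm k)\<^sup>2)" using assms by simp
qed (use assms in \<open>auto simp: indicator_def\<close>)

lemma rep_tens: "A \<in> sets borel \<Longrightarrow> emeasure lborel A < \<infinity> \<Longrightarrow> AE x in lborel. rep (tens A k) x = indicator A x *\<^sub>R k"
  unfolding tens_def by (intro rep_toL sq_int_const_on)

lemma inner_tens:
  "A \<in> sets borel \<Longrightarrow> emeasure lborel A < \<infinity> \<Longrightarrow> u \<bullet> tens A k = (LINT x:A|lborel. rep u x) \<bullet> k"
  unfolding tens_def by (intro inner_toL_const_on sq_int_const_on)

lemma norm_tens:
  assumes "A \<in> sets borel" "emeasure lborel A < \<infinity>"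
  shows "(norm (tens A k))\<^sup>2 = measure lborel A * (norm k)\<^sup>2"
proof -
  have "(norm (tens A k))\<^sup>2 = (LINT x|lborel. (norm (indicator A x *\<^sub>R k))\<^sup>2)"
    unfolding tens_def by (rule norm_toL) (rule sq_int_const_on[OF assms])
  also have "\<dots> = (LINT x|lborel. indicator A x * (norm k)\<^sup>2)"
    by (intro Bochner_Integration.integral_cong) (auto simp: indicator_def)
  also have "\<dots> = measure lborel A * (norm k)\<^sup>2" using assms by simp
  finally show ?thesis .
qed

lemma restr_add:
  assumes A: "A \<in> sets borel"
  shows "restr A (u + v) = restr A u + restr A v"
  by (rule l2_eqI, use rep_restr[OF A, of u] rep_restr[OF A, of v] rep_restr[OF A, of "u + v"] rep_add[of u v]
    rep_add[of "restr A u" "restr A v"] in \<open>eventually_elim, simp add: scaleR_add_right\<close>)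

lemma restr_scaleR:
  assumes A: "A \<in> sets borel"
  shows "restr A (c *\<^sub>R u) = c *\<^sub>R restr A u"
  by (rule l2_eqI, use rep_restr[OF A, of u] rep_restr[OF A, of "c *\<^sub>R u"] rep_scaleR[of c u]
    rep_scaleR[of c "restr A u"] in \<open>eventually_elim, simp\<close>)

lemma linear_restr: "A \<in> sets borel \<Longrightarrow> linear (restr A)"
  by (intro linearI restr_add restr_scaleR)

lemma restr_diff: "A \<in> sets borel \<Longrightarrow> restr A (u - v) = restr A u - restr A v"
  by (simp add: linear_diff linear_restr)

lemma inner_restr:
  assumes [measurable]: "A \<in> sets borel"
  shows "restr A u \<bullet> v = (LINT x|lborel. indicator A x * (rep u x \<bullet> rep v x))"
  by (rule inner_rep_cong, use rep_restr[OF assms, of u] in \<open>eventually_elim, simp\<close>, simp)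

lemma restr_adj: "A \<in> sets borel \<Longrightarrow> restr A u \<bullet> v = u \<bullet> restr A v"
  using inner_restr[of A u v] inner_restr[of A v u] by (simp add: inner_commute)

lemma restr_restr:
  assumes A: "A \<in> sets borel"
  shows "restr A (restr A u) = restr A u"
  by (rule l2_eqI, use rep_restr[OF A, of u] rep_restr[OF A, of "restr A u"] in \<open>eventually_elim, simp add: indicator_def\<close>)

lemma norm_restr: assumes "A \<in> sets borel" shows "norm (restr A u) \<le> norm u"
proof -
  have "(norm (restr A u))\<^sup>2 = restr A u \<bullet> u" using assms
    by (simp add: power2_norm_eq_inner restr_adj restr_restr inner_commute)
  also have "\<dots> \<le> norm (restr A u) * norm u" by (rule norm_cauchy_schwarz)
  finally have *: "norm (restr A u) * norm (restr A u) \<le> norm (restr A u) * norm u" by (simp add: power2_eq_square)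
  show ?thesis
  proof (cases "norm (restr A u) = 0")
    case False
    then show ?thesis using * mult_le_cancel_left_pos[of "norm (restr A u)"] by simp
  qed simp
qed

lemma lmap_add:
  assumes p: "bounded_linear p"
  shows "lmap p (u + v) = lmap p u + lmap p v"
  by (rule l2_eqI, use rep_lmap[OF p, of u] rep_lmap[OF p, of v] rep_lmap[OF p, of "u + v"] rep_add[of u v]
    rep_add[of "lmap p u" "lmap p v"] in \<open>eventually_elim, simp add: bounded_linear.linear[OF p] linear_add\<close>)

lemma lmap_scaleR:
  assumes p: "bounded_linear p"
  shows "lmap p (c *\<^sub>R u) = c *\<^sub>R lmap p u"
  by (rule l2_eqI, use rep_lmap[OF p, of u] rep_lmap[OF p, of "c *\<^sub>R u"] rep_scaleR[of c u]
    rep_scaleR[of c "lmap p u"] in \<open>eventually_elim, simp add: bounded_linear.linear[OF p] linear_cmul\<close>)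

lemma linear_lmap: "bounded_linear p \<Longrightarrow> linear (lmap p)"
  by (intro linearI lmap_add lmap_scaleR)

lemma lmap_diff: "bounded_linear p \<Longrightarrow> lmap p (u - v) = lmap p u - lmap p v"
  by (simp add: linear_diff linear_lmap)

lemma norm_lmap:
  assumes p: "bounded_linear p" and K: "\<And>x. norm (p x) \<le> K * norm x" and K0: "K \<ge> 0"
  shows "norm (lmap p u) \<le> K * norm u"
proof -
  have "(norm (lmap p u))\<^sup>2 = (LINT x|lborel. (norm (p (rep u x)))\<^sup>2)"
    unfolding lmap_def by (rule norm_toL, rule sq_int_bounded_linear[OF _ p]) auto
  also have "\<dots> \<le> (LINT x|lborel. K\<^sup>2 * (norm (rep u x))\<^sup>2)"
  proof (rule integral_mono)
    show "integrable lborel (\<lambda>x. (norm (p (rep u x)))\<^sup>2)"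
      by (rule sq_int_square[OF sq_int_bounded_linear[OF sq_int_rep p]])
    show "integrable lborel (\<lambda>x. K\<^sup>2 * (norm (rep u x))\<^sup>2)"
      using sq_int_square[OF sq_int_rep[of u]] by simp
    show "(norm (p (rep u x)))\<^sup>2 \<le> K\<^sup>2 * (norm (rep u x))\<^sup>2" for x
      using power_mono[OF K[of "rep u x"], of 2] by (simp add: power_mult_distrib)
  qed
  also have "\<dots> = (K * norm u)\<^sup>2" by (simp add: norm_l2[of u] power_mult_distrib)
  finally show ?thesis by (rule power2_le_imp_le) (use K0 in simp)
qed

lemma bounded_linear_lmap: assumes "bounded_linear p" shows "bounded_linear (lmap p)"
proof -
  obtain K where K: "K > 0" "\<And>x. norm (p x) \<le> norm x * K"
    using bounded_linear.pos_bounded[OF assms] by blast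
  show ?thesis
    using norm_lmap[OF assms, of K] K
    by (intro bounded_linear_intro[of _ K] lmap_add lmap_scaleR assms) (auto simp: mult.commute)
qed

lemma lmap_restr:
  assumes p: "bounded_linear p" and A: "A \<in> sets borel"
  shows "lmap p (restr A u) = restr A (lmap p u)"
  by (rule l2_eqI, use rep_lmap[OF p, of u] rep_restr[OF A, of u] rep_lmap[OF p, of "restr A u"] rep_restr[OF A, of "lmap p u"] in
    \<open>eventually_elim, simp add: bounded_linear.linear[OF p] linear_cmul\<close>)

lemma lmap_tens:
  assumes p: "bounded_linear p" and A: "A \<in> sets borel" and m: "emeasure lborel A < \<infinity>"
  shows "lmap p (tens A k) = tens A (p k)"
  by (rule l2_eqI, use rep_lmap[OF p, of "tens A k"] rep_tens[OF A m, of k] rep_tens[OF A m, of "p k"] in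
    \<open>eventually_elim, simp add: bounded_linear.linear[OF p] linear_cmul\<close>)

lemma l2_zero_if_orth_tens:
  assumes "\<And>a b k. u \<bullet> tens {a<..<b::real} k = 0" shows "u = 0"
  by (rule l2_zero_if_orth_boxes[of UNIV]) (use assms in \<open>auto simp: tens_def box_real\<close>)

subsection \<open>Integrals over an interval\<close>

text \<open>The explicit case distinction makes measurability in the end points automatic. The value
  is 0 when b \<le> a.\<close>

definition iint :: "(real \<Rightarrow> 'b::{banach,second_countable_topology}) \<Rightarrow> real \<Rightarrow> real \<Rightarrow> 'b" where
  "iint f a b = (LINT s|lborel. (if a < s \<and> s < b then f s else 0))"

lemma iint_eq: "iint f a b = (LINT s:{a<..<b}|lborel. f s)"
  unfolding iint_def set_lebesgue_integral_def
  by (intro Bochner_Integration.integral_cong) (auto simp: indicator_def)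

lemma emeasure_Ioo_finite: "emeasure lborel {a<..<b::real} < \<infinity>"
  by (cases "a \<le> b") auto

lemma iint_integrable:
  fixes f :: "real \<Rightarrow> 'b::{real_inner,banach,second_countable_topology}"
  assumes "sq_int f" shows "integrable lborel (\<lambda>s. if a < s \<and> s < b then f s else 0)"
proof -
  have "integrable lborel (\<lambda>s. indicator {a<..<b} s *\<^sub>R f s)"
    by (rule sq_int_integrable_on_finite[OF assms]) (simp_all add: emeasure_Ioo_finite[simplified])
  moreover have "(\<lambda>s. indicator {a<..<b} s *\<^sub>R f s) = (\<lambda>s. if a < s \<and> s < b then f s else 0)"
    by (auto simp: indicator_def)
  ultimately show ?thesis by simp
qed

lemma iint_measurable[measurable]:
  fixes f :: "real \<Rightarrow> 'b::{banach,second_countable_topology}"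
  assumes [measurable]: "f \<in> borel_measurable borel" "g \<in> borel_measurable borel" "h \<in> borel_measurable borel"
  shows "(\<lambda>t::real. iint f (g t) (h t)) \<in> borel_measurable borel"
  unfolding iint_def by measurable

lemma iint_cong_AE:
  assumes "AE s in lborel. a < s \<longrightarrow> s < b \<longrightarrow> f s = g s"
    and [measurable]: "f \<in> borel_measurable borel" "g \<in> borel_measurable borel"
  shows "iint f a b = iint g a b"
  unfolding iint_def by (rule integral_cong_AE) (use assms in \<open>auto elim: eventually_mono\<close>)

lemma iint_add:
  fixes f g :: "real \<Rightarrow> 'b::{real_inner,banach,second_countable_topology}"
  assumes "sq_int f" "sq_int g" shows "iint (\<lambda>s. f s + g s) a b = iint f a b + iint g a b"
  unfolding iint_def
  by (subst Bochner_Integration.integral_add[symmetric])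
    (auto intro!: iint_integrable assms Bochner_Integration.integral_cong)

lemma iint_scaleR: "iint (\<lambda>s. c *\<^sub>R f s) a b = c *\<^sub>R iint f a b"
proof -
  have "(\<lambda>s. if a < s \<and> s < b then c *\<^sub>R f s else 0) = (\<lambda>s. c *\<^sub>R (if a < s \<and> s < b then f s else 0))" by auto
  then show ?thesis by (simp only: iint_def integral_scaleR_right)
qed

lemma iint_diff:
  fixes f g :: "real \<Rightarrow> 'b::{real_inner,banach,second_countable_topology}"
  assumes "sq_int f" "sq_int g" shows "iint (\<lambda>s. f s - g s) a b = iint f a b - iint g a b"
  unfolding iint_def
  by (subst Bochner_Integration.integral_diff[symmetric])
    (auto intro!: iint_integrable assms Bochner_Integration.integral_cong)

lemma iint_shift:
  fixes f :: "real \<Rightarrow> 'b::{banach,second_countable_topology}"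
  shows "iint (\<lambda>s. f (s + h)) a b = iint f (a + h) (b + h)"
proof -
  let ?F = "\<lambda>s. if a + h < s \<and> s < b + h then f s else 0"
  have "(LINT s|lborel. ?F s) = (LINT s|lborel. ?F (h + s))"
    using lborel_integral_real_affine[of 1 ?F h, OF one_neq_zero] by (simp only: mult_1 abs_one scaleR_one)
  also have "(\<lambda>s. ?F (h + s)) = (\<lambda>s. if a < s \<and> s < b then f (s + h) else 0)"
    by (auto simp: add.commute)
  finally show ?thesis by (simp add: iint_def)
qed

lemma iint_split:
  fixes f :: "real \<Rightarrow> 'b::{real_inner,banach,second_countable_topology}"
  assumes "sq_int f" "a \<le> b" "b \<le> c" shows "iint f a c = iint f a b + iint f b c"
proof -
  have [measurable]: "f \<in> borel_measurable borel" using assms(1) by (simp add: sq_int_def)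
  have "iint f a c = (LINT s|lborel. (if a < s \<and> s < b then f s else 0) + (if b < s \<and> s < c then f s else 0))"
    unfolding iint_def
  proof (rule integral_cong_AE)
    show "AE s in lborel. (if a < s \<and> s < c then f s else 0) =
        (if a < s \<and> s < b then f s else 0) + (if b < s \<and> s < c then f s else 0)"
      using AE_lborel_singleton[of b] by eventually_elim (use assms in auto)
  qed simp_all
  then show ?thesis
    by (simp add: iint_def Bochner_Integration.integral_add iint_integrable assms)
qed

lemma iint_bounded_linear:
  fixes f :: "real \<Rightarrow> 'b::{real_inner,banach,second_countable_topology}"
  assumes "bounded_linear p" "sq_int f" shows "p (iint f a b) = iint (\<lambda>s. p (f s)) a b"
proof -
  have "p (iint f a b) = (LINT s|lborel. p (if a < s \<and> s < b then f s else 0))"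
    unfolding iint_def by (rule integral_bounded_linear[OF assms(1) iint_integrable[OF assms(2)], symmetric])
  also have "\<dots> = iint (\<lambda>s. p (f s)) a b"
    unfolding iint_def
    by (intro Bochner_Integration.integral_cong) (auto simp: bounded_linear.linear[OF assms(1)] linear_0)
  finally show ?thesis .
qed

text \<open>Cauchy-Schwarz for f cut to (a, b) against the constant v on (a, b), where v is the
  integral itself; then |v|^2 is cancelled.\<close>

lemma iint_norm_square:
  fixes f :: "real \<Rightarrow> 'b::{real_inner,banach,second_countable_topology}"
  assumes f: "sq_int f" and ab: "a \<le> b"
  shows "(norm (iint f a b))\<^sup>2 \<le> (b - a) * (LINT s|lborel. (if a < s \<and> s < b then (norm (f s))\<^sup>2 else 0))"
proof -
  let ?v = "iint f a b" and ?A = "{a<..<b}"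
  have A: "?A \<in> sets borel" "emeasure lborel ?A < \<infinity>" using ab by auto
  have fA: "sq_int (\<lambda>x. indicator ?A x *\<^sub>R f x)" by (rule sq_int_indicator[OF f]) simp
  have n: "(norm (toL (\<lambda>x. indicator ?A x *\<^sub>R f x)))\<^sup>2 = (LINT s|lborel. (if a < s \<and> s < b then (norm (f s))\<^sup>2 else 0))"
    unfolding norm_toL[OF fA] by (intro Bochner_Integration.integral_cong) (auto simp: indicator_def)
  have "(norm ?v)\<^sup>2 = toL f \<bullet> tens ?A ?v"
  proof -
    have "(LINT x:?A|lborel. rep (toL f) x) = (LINT x:?A|lborel. f x)"
      using rep_toL[OF f] f unfolding set_lebesgue_integral_def
      by (intro integral_cong_AE) (auto simp: sq_int_def elim: eventually_mono)
    then show ?thesis using inner_tens[OF A, of "toL f" ?v] by (simp add: power2_norm_eq_inner iint_eq)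
  qed
  also have "\<dots> = toL (\<lambda>x. indicator ?A x *\<^sub>R f x) \<bullet> tens ?A ?v"
    unfolding tens_def inner_toL[OF f sq_int_const_on[OF A]] inner_toL[OF fA sq_int_const_on[OF A]]
    by (intro Bochner_Integration.integral_cong) (auto simp: indicator_def)
  also have "\<dots> \<le> norm (toL (\<lambda>x. indicator ?A x *\<^sub>R f x)) * norm (tens ?A ?v)" by (rule norm_cauchy_schwarz)
  finally have "((norm ?v)\<^sup>2)\<^sup>2 \<le> (norm (toL (\<lambda>x. indicator ?A x *\<^sub>R f x)) * norm (tens ?A ?v))\<^sup>2"
    by (intro power_mono) auto
  also have "\<dots> = (LINT s|lborel. (if a < s \<and> s < b then (norm (f s))\<^sup>2 else 0)) * ((b - a) * (norm ?v)\<^sup>2)"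
    using ab by (simp add: power_mult_distrib n norm_tens[OF A])
  finally have *: "(norm ?v)\<^sup>2 * (norm ?v)\<^sup>2 \<le>
      ((b - a) * (LINT s|lborel. (if a < s \<and> s < b then (norm (f s))\<^sup>2 else 0))) * (norm ?v)\<^sup>2"
    by (simp add: power2_eq_square[of "(norm ?v)\<^sup>2"] mult_ac)
  show ?thesis
  proof (cases "?v = 0")
    case True
    have "0 \<le> (LINT s|lborel. (if a < s \<and> s < b then (norm (f s))\<^sup>2 else 0))"
      by (intro Bochner_Integration.integral_nonneg) auto
    then show ?thesis using True ab by simp
  next
    case False
    then have "(norm ?v)\<^sup>2 > 0" by simp
    then show ?thesis using * mult_le_cancel_right_pos by blast
  qed
qed

lemma iint_norm_square_le:
  fixes u :: "(real, 'b::{real_inner,banach,second_countable_topology}) l2"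
  assumes ab: "a \<le> b" shows "(norm (iint (rep u) a b))\<^sup>2 \<le> (b - a) * (norm u)\<^sup>2"
proof -
  have "(LINT s|lborel. (if a < s \<and> s < b then (norm (rep u s))\<^sup>2 else 0)) \<le> (LINT s|lborel. (norm (rep u s))\<^sup>2)"
  proof (rule integral_mono)
    have i: "integrable lborel (\<lambda>s. (norm (rep u s))\<^sup>2)" using sq_int_square[OF sq_int_rep[of u]] by simp
    then show "integrable lborel (\<lambda>s. (norm (rep u s))\<^sup>2)" .
    show "integrable lborel (\<lambda>s. if a < s \<and> s < b then (norm (rep u s))\<^sup>2 else 0)"
      by (rule Bochner_Integration.integrable_bound[OF i]) auto
  qed auto
  then have "(b - a) * (LINT s|lborel. (if a < s \<and> s < b then (norm (rep u s))\<^sup>2 else 0)) \<le> (b - a) * (norm u)\<^sup>2"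
    unfolding norm_l2 using ab by (intro mult_left_mono) auto
  then show ?thesis using iint_norm_square[OF sq_int_rep ab, of u] by linarith
qed

subsection \<open>Translations in time\<close>

lemma AE_translate:
  fixes h :: real
  assumes "AE t in lborel. P t" shows "AE t in lborel. P (t + h)"
proof -
  have "distr lborel borel ((+) h) = lborel" by (rule lborel_distr_plus)
  then have "AE t in distr lborel borel ((+) h). P t" using assms by (simp only:)
  from AE_distrD[OF _ this] have "AE t in lborel. P (h + t)" by simp
  then show ?thesis by (simp add: add.commute)
qed

lemma integral_translate:
  fixes f :: "real \<Rightarrow> 'b::{banach,second_countable_topology}"
  shows "(LINT t|lborel. f (t + h)) = (LINT t|lborel. f t)"
  using lborel_integral_real_affine[of 1 f h, OF one_neq_zero]
  by (simp only: mult_1 abs_one scaleR_one add.commute)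

lemma sq_int_translate:
  fixes f :: "real \<Rightarrow> 'b::{real_inner,banach,second_countable_topology}"
  assumes "sq_int f" shows "sq_int (\<lambda>t. f (t + h))"
proof -
  have [measurable]: "f \<in> borel_measurable borel" using assms by (simp add: sq_int_def)
  have "integrable lborel (\<lambda>t. (norm (f (h + 1 * t)))\<^sup>2)"
    by (rule lborel_integrable_real_affine[where f = "\<lambda>t. (norm (f t))\<^sup>2"])
      (use sq_int_square[OF assms] in auto)
  then have "integrable lborel (\<lambda>t. (norm (f (t + h)))\<^sup>2)" by (simp only: mult_1 add.commute)
  then show ?thesis by (simp add: sq_int_def)
qed

text \<open>For h > 0 the graph moves to earlier times, for h < 0 to later ones. The cut keeps
  everything inside (0, T), and zeros enter at the vacated end if u vanishes outside (0, T).\<close>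

definition shift :: "real \<Rightarrow> real \<Rightarrow> (real, 'b::{real_inner,banach,second_countable_topology}) l2 \<Rightarrow> (real, 'b) l2"
  where "shift T h u = toL (\<lambda>t. indicator {0<..<T} t *\<^sub>R rep u (t + h))"

lemma sq_int_shift:
  fixes u :: "(real, 'b::{real_inner,banach,second_countable_topology}) l2"
  shows "sq_int (\<lambda>t. indicator {0<..<T} t *\<^sub>R rep u (t + h))"
  by (rule sq_int_indicator[OF sq_int_translate[OF sq_int_rep]]) simp

lemma rep_shift: "AE t in lborel. rep (shift T h u) t = indicator {0<..<T} t *\<^sub>R rep u (t + h)"
  unfolding shift_def by (rule rep_toL[OF sq_int_shift])

lemma shift_add: "shift T h (u + v) = shift T h u + shift T h v"
  by (rule l2_eqI, use rep_shift[of T h u] rep_shift[of T h v] rep_shift[of T h "u + v"]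
    AE_translate[OF rep_add[of u v], of h] rep_add[of "shift T h u" "shift T h v"] in
    \<open>eventually_elim, simp add: scaleR_add_right\<close>)

lemma shift_scaleR: "shift T h (c *\<^sub>R u) = c *\<^sub>R shift T h u"
  by (rule l2_eqI, use rep_shift[of T h u] rep_shift[of T h "c *\<^sub>R u"]
    AE_translate[OF rep_scaleR[of c u], of h] rep_scaleR[of c "shift T h u"] in
    \<open>eventually_elim, simp\<close>)

lemma linear_shift: "linear (shift T h)"
  by (intro linearI shift_add shift_scaleR)

lemma norm_shift: "norm (shift T h u) \<le> norm u"
proof -
  have "(norm (shift T h u))\<^sup>2 \<le> (norm (toL (\<lambda>t. rep u (t + h))))\<^sup>2"
    unfolding shift_def norm_toL[OF sq_int_shift] norm_toL[OF sq_int_translate[OF sq_int_rep]]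
    by (rule integral_mono)
      (use sq_int_square[OF sq_int_shift] sq_int_square[OF sq_int_translate[OF sq_int_rep]] in
        \<open>auto simp: indicator_def\<close>)
  also have "\<dots> = (norm u)\<^sup>2"
    unfolding norm_toL[OF sq_int_translate[OF sq_int_rep]] norm_l2[of u]
    by (rule integral_translate[of "\<lambda>t. (norm (rep u t))\<^sup>2" h])
  finally show ?thesis by (rule power2_le_imp_le) simp
qed

lemma lmap_shift:
  assumes p: "bounded_linear p" shows "lmap p (shift T h u) = shift T h (lmap p u)"
  by (rule l2_eqI, use rep_lmap[OF p, of "shift T h u"] rep_shift[of T h u] rep_shift[of T h "lmap p u"]
    AE_translate[OF rep_lmap[OF p, of u], of h] in
    \<open>eventually_elim, simp add: bounded_linear.linear[OF p] linear_cmul\<close>)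

definition supported :: "real \<Rightarrow> (real, 'b::{real_inner,banach,second_countable_topology}) l2 \<Rightarrow> bool"
  where "supported T u \<longleftrightarrow> restr {0<..<T} u = u"

lemma supportedD: assumes "supported T u" shows "AE t in lborel. t \<notin> {0<..<T} \<longrightarrow> rep u t = 0"
proof -
  have "AE t in lborel. rep (restr {0<..<T} u) t = indicator {0<..<T} t *\<^sub>R rep u t" by (rule rep_restr) simp
  then have "AE t in lborel. rep u t = indicator {0<..<T} t *\<^sub>R rep u t" using assms by (simp add: supported_def)
  then show ?thesis by eventually_elim (auto simp: indicator_def)
qed

lemma supportedI: assumes "AE t in lborel. t \<notin> {0<..<T} \<longrightarrow> rep u t = 0" shows "supported T u"
proof -
  have "AE t in lborel. rep (restr {0<..<T} u) t = indicator {0<..<T} t *\<^sub>R rep u t" by (rule rep_restr) simp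
  then have "AE t in lborel. rep (restr {0<..<T} u) t = rep u t"
    using assms by eventually_elim (auto simp: indicator_def)
  then show ?thesis by (auto simp: supported_def intro: l2_eqI)
qed

lemma supported_shift: "supported T (shift T h u)"
  by (rule supportedI, use rep_shift[of T h u] in \<open>eventually_elim, simp add: indicator_def\<close>)

lemma supported_diff: "supported T u \<Longrightarrow> supported T v \<Longrightarrow> supported T (u - v)"
  by (simp add: supported_def restr_diff)

lemma supported_lmap: "bounded_linear p \<Longrightarrow> supported T u \<Longrightarrow> supported T (lmap p u)"
  by (simp add: supported_def lmap_restr[symmetric])

lemma inner_restr_supported: "supported T g \<Longrightarrow> g \<bullet> restr {0<..<T} u = g \<bullet> u"
  by (metis borel_open open_greaterThanLessThan restr_adj supported_def)

text \<open>Change of variables in time; the supports of u and v take over the role of the two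
  cuts.\<close>

lemma shift_adj:
  fixes u v :: "(real, 'b::{real_inner,banach,second_countable_topology}) l2"
  assumes u: "supported T u" and v: "supported T v"
  shows "shift T h u \<bullet> v = u \<bullet> shift T (- h) v"
proof -
  have "shift T h u \<bullet> v = (LINT t|lborel. rep u (t + h) \<bullet> rep v t)"
    by (rule inner_rep_cong, use rep_shift[of T h u] supportedD[OF v] in
      \<open>eventually_elim, auto simp: indicator_def\<close>, measurable)
  also have "\<dots> = (LINT t|lborel. rep u t \<bullet> rep v (t + - h))"
    using integral_translate[of "\<lambda>t. rep u t \<bullet> rep v (t + - h)" h] by simp
  also have "\<dots> = u \<bullet> shift T (- h) v"
    by (rule inner_rep_cong[symmetric], use rep_shift[of T "- h" v] supportedD[OF u] in
      \<open>eventually_elim, auto simp: indicator_def\<close>, measurable)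
  finally show ?thesis .
qed

text \<open>Meant for functions that agree except within distance h of two points: the two windows
  have total length 4h.\<close>

lemma norm_toL_diff_square_le:
  fixes f g :: "real \<Rightarrow> 'b::{real_inner,banach,second_countable_topology}"
  assumes f: "sq_int f" and g: "sq_int g" and h: "h \<ge> 0"
    and le: "\<And>t. (norm (f t - g t))\<^sup>2 \<le> c * (indicator {a-h..a+h} t + indicator {b-h..b+h} t)"
  shows "(norm (toL f - toL g))\<^sup>2 \<le> 4 * h * c"
proof -
  have i: "integrable lborel (indicator {x-h..x+h} :: real \<Rightarrow> real)" for x
    using h by (intro integrable_real_indicator) auto
  have "(norm (toL f - toL g))\<^sup>2 = (LINT t|lborel. (norm (f t - g t))\<^sup>2)"
    using norm_toL[OF sq_int_diff[OF f g]] toL_diff[OF f g] by simp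
  also have "\<dots> \<le> (LINT t|lborel. c * (indicator {a-h..a+h} t + indicator {b-h..b+h} t))"
    by (rule integral_mono[OF sq_int_square[OF sq_int_diff[OF f g]] _ le])
      (intro integrable_mult_right Bochner_Integration.integrable_add i)
  also have "\<dots> = 4 * h * c" using h by (simp add: Bochner_Integration.integral_add[OF i i])
  finally show ?thesis .
qed

lemma tendsto_if_square_le:
  fixes A :: "'i \<Rightarrow> 'a::real_normed_vector"
  assumes le: "\<forall>\<^sub>F h in F. (norm (A h - B))\<^sup>2 \<le> 4 * r h * c" and r: "(r \<longlongrightarrow> 0) F"
  shows "(A \<longlongrightarrow> B) F"
proof -
  have "((\<lambda>h. sqrt (4 * r h * c)) \<longlongrightarrow> sqrt (4 * 0 * c)) F" by (intro tendsto_intros r)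
  moreover have "\<forall>\<^sub>F h in F. norm (A h - B) \<le> sqrt (4 * r h * c)"
    using le by eventually_elim (rule real_le_rsqrt)
  ultimately have "((\<lambda>h. A h - B) \<longlongrightarrow> 0) F"
    by (intro Lim_null_comparison[of "\<lambda>h. A h - B" "\<lambda>h. sqrt (4 * r h * c)"]) auto
  then show ?thesis by (simp add: LIM_zero_iff)
qed

text \<open>Contractivity of translations reduces the claim to \<open>tens {a<..<b} k\<close>, whose
  translate by h differs from it only within |h| of the end points.\<close>

lemma shift_tendsto:
  fixes u :: "(real, 'b::{real_inner,banach,second_countable_topology}) l2"
  shows "((\<lambda>h. shift T h u) \<longlongrightarrow> restr {0<..<T} u) (at 0)"
proof (rule strong_limit_of_contractions[where A = "shift T" and C = "restr {0<..<T}" and X = "{tens {a<..<b} k | a b k. True}"])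
  show "linear (restr {0<..<T})" by (rule linear_restr) simp
  show "norm (restr {0<..<T} x) \<le> norm x" for x :: "(real, 'b) l2" by (rule norm_restr) simp
  show "z = 0" if "\<forall>x\<in>{tens {a<..<b} k | a b k. True}. z \<bullet> x = 0" for z :: "(real, 'b) l2"
    by (rule l2_zero_if_orth_tens) (use that in blast)
  fix x :: "(real, 'b) l2" assume "x \<in> {tens {a<..<b} k | a b k. True}"
  then obtain a b k where x: "x = tens {a<..<b} k" by blast
  have xAE: "AE t in lborel. rep x t = indicator {a<..<b} t *\<^sub>R k"
    unfolding x by (rule rep_tens) (simp_all add: emeasure_Ioo_finite[simplified])
  have sq: "sq_int (\<lambda>t. indicator {a<..<b} t *\<^sub>R k)" using emeasure_Ioo_finite by (intro sq_int_const_on) auto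
  have sq1: "sq_int (\<lambda>t. indicator {0<..<T} t *\<^sub>R (indicator {a<..<b} (t + h) *\<^sub>R k))" for h
    by (rule sq_int_indicator[OF sq_int_translate[OF sq]]) simp
  have s: "shift T h x = toL (\<lambda>t. indicator {0<..<T} t *\<^sub>R (indicator {a<..<b} (t + h) *\<^sub>R k))" for h
    by (rule toL_eqI[symmetric, OF sq1], use rep_shift[of T h x] AE_translate[OF xAE, of h] in
      \<open>eventually_elim, simp\<close>)
  have r: "restr {0<..<T} x = toL (\<lambda>t. indicator {0<..<T} t *\<^sub>R (indicator {a<..<b} (t + 0) *\<^sub>R k))"
    by (rule toL_eqI[symmetric, OF sq1], use rep_restr[of "{0<..<T}" x, simplified] xAE in
      \<open>eventually_elim, simp\<close>)
  have le: "(norm (shift T h x - restr {0<..<T} x))\<^sup>2 \<le> 4 * \<bar>h\<bar> * (norm k)\<^sup>2" for h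
    unfolding s r
  proof (rule norm_toL_diff_square_le[OF sq1 sq1])
    fix t
    show "(norm (indicator {0<..<T} t *\<^sub>R (indicator {a<..<b} (t + h) *\<^sub>R k) -
        indicator {0<..<T} t *\<^sub>R (indicator {a<..<b} (t + 0) *\<^sub>R k)))\<^sup>2
      \<le> (norm k)\<^sup>2 * (indicator {a - \<bar>h\<bar>..a + \<bar>h\<bar>} t + indicator {b - \<bar>h\<bar>..b + \<bar>h\<bar>} t)"
      by (auto simp: indicator_def)
  qed simp
  show "((\<lambda>h. shift T h x) \<longlongrightarrow> restr {0<..<T} x) (at 0)"
    by (rule tendsto_if_square_le[OF always_eventually tendsto_rabs_zero[OF tendsto_ident_at]]) (rule allI, rule le)
qed (auto simp: linear_shift norm_shift)

subsection \<open>Backward integration and forward averages\<close>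

definition Jop :: "real \<Rightarrow> (real, 'b::{real_inner,banach,second_countable_topology}) l2 \<Rightarrow> (real, 'b) l2"
  where "Jop T u = toL (\<lambda>t. if 0 < t \<and> t < T then iint (rep u) t T else 0)"

lemma Jop_integrand_bound:
  "(norm (if 0 < t \<and> t < T then iint (rep u) t T else 0))\<^sup>2 \<le> indicator {0<..<T} t * (T * (norm u)\<^sup>2)"
proof (cases "0 < t \<and> t < T")
  case True
  have "(norm (iint (rep u) t T))\<^sup>2 \<le> (T - t) * (norm u)\<^sup>2" using True by (intro iint_norm_square_le) auto
  also have "\<dots> \<le> T * (norm u)\<^sup>2" using True by (intro mult_right_mono) auto
  finally show ?thesis using True by simp
qed auto

lemma sq_int_Jop: "sq_int (\<lambda>t. if 0 < t \<and> t < T then iint (rep u) t T else 0)"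
proof (rule sq_int_bound[where g = "\<lambda>t. indicator {0<..<T} t * (T * (norm u)\<^sup>2)"])
  show "integrable lborel (\<lambda>t. indicator {0<..<T} t * (T * (norm u)\<^sup>2))"
    using emeasure_Ioo_finite[of 0 T] by simp
qed (simp, rule AE_I2, rule Jop_integrand_bound)

lemma rep_Jop: "AE t in lborel. rep (Jop T u) t = (if 0 < t \<and> t < T then iint (rep u) t T else 0)"
  unfolding Jop_def by (rule rep_toL[OF sq_int_Jop])

lemma norm_Jop: assumes "T \<ge> 0" shows "norm (Jop T u) \<le> T * norm u"
proof -
  have "(norm (Jop T u))\<^sup>2 \<le> (LINT t|lborel. indicator {0<..<T} t * (T * (norm u)\<^sup>2))"
    unfolding Jop_def norm_toL[OF sq_int_Jop]
    by (rule integral_mono[OF sq_int_square[OF sq_int_Jop] _ Jop_integrand_bound])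
      (use emeasure_Ioo_finite[of 0 T] in simp)
  also have "\<dots> = (T * norm u)\<^sup>2" using assms by (simp add: power_mult_distrib power2_eq_square[of T])
  finally show ?thesis by (rule power2_le_imp_le) (use assms in simp)
qed

lemma iint_rep_add: "iint (rep (u + v)) a b = iint (rep u) a b + iint (rep v) a b"
proof -
  have "iint (rep (u + v)) a b = iint (\<lambda>s. rep u s + rep v s) a b"
    by (rule iint_cong_AE) (use rep_add[of u v] in \<open>auto elim: eventually_mono\<close>)
  then show ?thesis by (simp add: iint_add)
qed

lemma iint_rep_diff: "iint (rep (u - v)) a b = iint (rep u) a b - iint (rep v) a b"
proof -
  have "iint (rep (u - v)) a b = iint (\<lambda>s. rep u s - rep v s) a b"
    by (rule iint_cong_AE) (use rep_diff[of u v] in \<open>auto elim: eventually_mono\<close>)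
  then show ?thesis by (simp add: iint_diff)
qed

lemma iint_rep_scaleR: "iint (rep (c *\<^sub>R u)) a b = c *\<^sub>R iint (rep u) a b"
proof -
  have "iint (rep (c *\<^sub>R u)) a b = iint (\<lambda>s. c *\<^sub>R rep u s) a b"
    by (rule iint_cong_AE) (use rep_scaleR[of c u] in \<open>auto elim: eventually_mono\<close>)
  then show ?thesis by (simp add: iint_scaleR)
qed

lemma Jop_add: "Jop T (u + v) = Jop T u + Jop T v"
  by (rule l2_eqI, use rep_Jop[of T u] rep_Jop[of T v] rep_Jop[of T "u + v"] rep_add[of "Jop T u" "Jop T v"] in
    \<open>eventually_elim, simp add: iint_rep_add\<close>)

lemma Jop_scaleR: "Jop T (c *\<^sub>R u) = c *\<^sub>R Jop T u"
  by (rule l2_eqI, use rep_Jop[of T u] rep_Jop[of T "c *\<^sub>R u"] rep_scaleR[of c "Jop T u"] in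
    \<open>eventually_elim, simp add: iint_rep_scaleR\<close>)

lemma linear_Jop: "linear (Jop T)"
  by (intro linearI Jop_add Jop_scaleR)

lemma Jop_diff: "Jop T (u - v) = Jop T u - Jop T v"
  by (simp add: linear_diff linear_Jop)

lemma supported_Jop: "supported T (Jop T u)"
  by (rule supportedI, use rep_Jop[of T u] in \<open>eventually_elim, simp\<close>)

lemma iint_rep_lmap:
  assumes p: "bounded_linear p" shows "iint (rep (lmap p u)) a b = p (iint (rep u) a b)"
proof -
  have [measurable]: "(\<lambda>s. p (rep u s)) \<in> borel_measurable borel"
    using sq_int_measurable[OF sq_int_bounded_linear[OF sq_int_rep p]] by simp
  have "iint (rep (lmap p u)) a b = iint (\<lambda>s. p (rep u s)) a b"
    by (rule iint_cong_AE) (use rep_lmap[OF p, of u] in \<open>auto elim: eventually_mono\<close>)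
  then show ?thesis by (simp add: iint_bounded_linear[OF p])
qed

lemma lmap_Jop:
  assumes p: "bounded_linear p" shows "lmap p (Jop T u) = Jop T (lmap p u)"
  by (rule l2_eqI, use rep_lmap[OF p, of "Jop T u"] rep_Jop[of T u] rep_Jop[of T "lmap p u"] in
    \<open>eventually_elim, simp add: iint_rep_lmap[OF p] bounded_linear.linear[OF p] linear_0\<close>)

text \<open>The Steklov average without its factor 1/h. In this normalisation it is, on (0, T),
  exactly what \<open>Jop\<close> makes of w - w(. + h).\<close>

definition avg :: "real \<Rightarrow> (real, 'b::{real_inner,banach,second_countable_topology}) l2 \<Rightarrow> (real, 'b) l2"
  where "avg h u = toL (\<lambda>t. iint (rep u) t (t + h))"

text \<open>Cauchy-Schwarz on each window gives one factor h and Tonelli the other, since each s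
  belongs to the windows of a set of t of measure h. Nonnegative integrals are used because
  integrability is itself a consequence.\<close>

lemma avg_nn_integral:
  fixes u :: "(real, 'b::{real_inner,banach,second_countable_topology}) l2"
  assumes h: "h \<ge> 0"
  shows "(\<integral>\<^sup>+t. ennreal ((norm (iint (rep u) t (t + h)))\<^sup>2) \<partial>lborel) \<le> ennreal ((h * norm u)\<^sup>2)"
proof -
  let ?F = "\<lambda>t s. if t < s \<and> s < t + h then (norm (rep u s))\<^sup>2 else 0"
  have i: "integrable lborel (\<lambda>s. (norm (rep u s))\<^sup>2)" by (rule sq_int_square[OF sq_int_rep])
  have iF: "integrable lborel (?F t)" for t
    by (rule Bochner_Integration.integrable_bound[OF i]) auto
  have "(\<integral>\<^sup>+t. ennreal ((norm (iint (rep u) t (t + h)))\<^sup>2) \<partial>lborel)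
      \<le> (\<integral>\<^sup>+t. ennreal h * (\<integral>\<^sup>+s. ennreal (?F t s) \<partial>lborel) \<partial>lborel)"
  proof (rule nn_integral_mono)
    fix t
    have "(norm (iint (rep u) t (t + h)))\<^sup>2 \<le> h * (LINT s|lborel. ?F t s)"
      using iint_norm_square[OF sq_int_rep, of t "t + h" u] h by simp
    then have "ennreal ((norm (iint (rep u) t (t + h)))\<^sup>2) \<le> ennreal (h * (LINT s|lborel. ?F t s))"
      by (rule ennreal_leI)
    also have "\<dots> = ennreal h * (\<integral>\<^sup>+s. ennreal (?F t s) \<partial>lborel)"
      using h by (subst nn_integral_eq_integral[OF iF]) (auto simp: ennreal_mult')
    finally show "ennreal ((norm (iint (rep u) t (t + h)))\<^sup>2) \<le> ennreal h * (\<integral>\<^sup>+s. ennreal (?F t s) \<partial>lborel)" .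
  qed
  also have "\<dots> = ennreal h * (\<integral>\<^sup>+t. (\<integral>\<^sup>+s. ennreal (?F t s) \<partial>lborel) \<partial>lborel)"
    by (rule nn_integral_cmult) measurable
  also have "(\<integral>\<^sup>+t. (\<integral>\<^sup>+s. ennreal (?F t s) \<partial>lborel) \<partial>lborel) = (\<integral>\<^sup>+s. (\<integral>\<^sup>+t. ennreal (?F t s) \<partial>lborel) \<partial>lborel)"
    by (rule lborel_pair.Fubini'[symmetric]) measurable
  also have "\<dots> = (\<integral>\<^sup>+s. ennreal h * ennreal ((norm (rep u s))\<^sup>2) \<partial>lborel)"
  proof (rule nn_integral_cong)
    fix s
    have "(\<integral>\<^sup>+t. ennreal (?F t s) \<partial>lborel) = (\<integral>\<^sup>+t. ennreal ((norm (rep u s))\<^sup>2) * indicator {s-h<..<s} t \<partial>lborel)"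
      by (intro nn_integral_cong) (auto simp: indicator_def)
    also have "\<dots> = ennreal ((norm (rep u s))\<^sup>2) * emeasure lborel {s-h<..<s}"
      by (rule nn_integral_cmult_indicator) simp
    finally show "(\<integral>\<^sup>+t. ennreal (?F t s) \<partial>lborel) = ennreal h * ennreal ((norm (rep u s))\<^sup>2)"
      using h by (simp add: mult.commute)
  qed
  also have "\<dots> = ennreal h * (\<integral>\<^sup>+s. ennreal ((norm (rep u s))\<^sup>2) \<partial>lborel)"
    by (rule nn_integral_cmult) measurable
  also have "(\<integral>\<^sup>+s. ennreal ((norm (rep u s))\<^sup>2) \<partial>lborel) = ennreal ((norm u)\<^sup>2)"
    by (subst nn_integral_eq_integral[OF i]) (auto simp: norm_l2)
  also have "ennreal h * (ennreal h * ennreal ((norm u)\<^sup>2)) = ennreal ((h * norm u)\<^sup>2)"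
    using h by (simp add: ennreal_mult'[symmetric] power2_eq_square mult_ac)
  finally show ?thesis .
qed

lemma sq_int_avg: assumes "h \<ge> 0" shows "sq_int (\<lambda>t. iint (rep u) t (t + h))"
  unfolding sq_int_def integrable_iff_bounded
  using le_less_trans[OF avg_nn_integral[OF assms, of u] ennreal_less_top] by simp

lemma rep_avg: assumes "h \<ge> 0" shows "AE t in lborel. rep (avg h u) t = iint (rep u) t (t + h)"
  unfolding avg_def by (rule rep_toL[OF sq_int_avg[OF assms]])

lemma norm_avg:
  fixes u :: "(real, 'b::{real_inner,banach,second_countable_topology}) l2"
  assumes h: "h \<ge> 0" shows "norm (avg h u) \<le> h * norm u"
proof -
  have "ennreal ((norm (avg h u))\<^sup>2) \<le> ennreal ((h * norm u)\<^sup>2)"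
    unfolding avg_def norm_toL[OF sq_int_avg[OF h]]
    using avg_nn_integral[OF h, of u] by (subst nn_integral_eq_integral[symmetric]) (auto intro: sq_int_square[OF sq_int_avg[OF h]])
  then have "(norm (avg h u))\<^sup>2 \<le> (h * norm u)\<^sup>2" by (simp add: ennreal_le_iff)
  then show ?thesis by (rule power2_le_imp_le) (use h in simp)
qed

lemma avg_add:
  assumes h: "h \<ge> 0" shows "avg h (u + v) = avg h u + avg h v"
  by (rule l2_eqI, use rep_avg[OF h, of u] rep_avg[OF h, of v] rep_avg[OF h, of "u + v"] rep_add[of "avg h u" "avg h v"] in
    \<open>eventually_elim, simp add: iint_rep_add\<close>)

lemma avg_scaleR:
  assumes h: "h \<ge> 0" shows "avg h (c *\<^sub>R u) = c *\<^sub>R avg h u"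
  by (rule l2_eqI, use rep_avg[OF h, of u] rep_avg[OF h, of "c *\<^sub>R u"] rep_scaleR[of c "avg h u"] in
    \<open>eventually_elim, simp add: iint_rep_scaleR\<close>)

lemma avg_tendsto:
  fixes u :: "(real, 'b::{real_inner,banach,second_countable_topology}) l2"
  shows "(\<lambda>n. real (Suc n) *\<^sub>R avg (1 / real (Suc n)) u) \<longlonglongrightarrow> u"
proof (rule strong_limit_of_contractions[where A = "\<lambda>n u. real (Suc n) *\<^sub>R avg (1 / real (Suc n)) u"
      and X = "{tens {a<..<b} k | a b k. True}" and C = "\<lambda>x. x"])
  show "linear (\<lambda>u. real (Suc n) *\<^sub>R avg (1 / real (Suc n)) u)" for n
    by (rule linearI) (simp_all add: avg_add avg_scaleR scaleR_add_right mult.commute)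
  have "norm (real (Suc n) *\<^sub>R avg (1 / real (Suc n)) x) \<le> norm x" for n and x :: "(real, 'b) l2"
    using mult_left_mono[OF norm_avg[of "1 / real (Suc n)" x], of "real (Suc n)"] by simp
  then show "\<forall>\<^sub>F n in sequentially. \<forall>x::(real, 'b) l2. norm (real (Suc n) *\<^sub>R avg (1 / real (Suc n)) x) \<le> norm x"
    by simp
  show "z = 0" if "\<forall>x\<in>{tens {a<..<b} k | a b k. True}. z \<bullet> x = 0" for z :: "(real, 'b) l2"
    by (rule l2_zero_if_orth_tens) (use that in blast)
  fix x :: "(real, 'b) l2" assume "x \<in> {tens {a<..<b} k | a b k. True}"
  then obtain a b k where x: "x = tens {a<..<b} k" by blast
  have sq: "sq_int (\<lambda>t. indicator {a<..<b} t *\<^sub>R k)" using emeasure_Ioo_finite by (intro sq_int_const_on) auto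
  have xAE: "AE t in lborel. rep x t = indicator {a<..<b} t *\<^sub>R k"
    unfolding x tens_def by (rule rep_toL[OF sq])
  let ?m = "\<lambda>t h. measure lborel ({t<..<t+h} \<inter> {a<..<b})"
  have ii: "iint (rep x) t (t + h) = ?m t h *\<^sub>R k" for t h
  proof -
    have "iint (rep x) t (t + h) = iint (\<lambda>s. indicator {a<..<b} s *\<^sub>R k) t (t + h)"
      by (rule iint_cong_AE) (use xAE sq in \<open>auto simp: sq_int_def elim: eventually_mono\<close>)
    also have "\<dots> = (LINT s|lborel. indicator ({t<..<t+h} \<inter> {a<..<b}) s *\<^sub>R k)"
      unfolding iint_def by (intro Bochner_Integration.integral_cong) (auto simp: indicator_def)
    also have "\<dots> = ?m t h *\<^sub>R k"
    proof (rule has_bochner_integral_integral_eq[OF has_bochner_integral_scaleR_left])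
      show "has_bochner_integral lborel (indicator ({t<..<t+h} \<inter> {a<..<b})) (?m t h)"
      proof (rule has_bochner_integral_real_indicator)
        have "emeasure lborel ({t<..<t+h} \<inter> {a<..<b}) \<le> emeasure lborel {a<..<b}"
          by (rule emeasure_mono) auto
        then show "emeasure lborel ({t<..<t+h} \<inter> {a<..<b}) < \<infinity>" using emeasure_Ioo_finite le_less_trans by blast
      qed simp
    qed
    finally show ?thesis .
  qed
  have le: "(norm (real (Suc n) *\<^sub>R avg (1 / real (Suc n)) x - x))\<^sup>2 \<le> 4 * (1 / real (Suc n)) * (norm k)\<^sup>2" for n
  proof -
    define h where "h = 1 / real (Suc n)"
    have h: "h > 0" and hn: "real (Suc n) = 1 / h" by (simp_all add: h_def)
    have sqa: "sq_int (\<lambda>t. ?m t h *\<^sub>R k)" using sq_int_avg[of h x] h by (simp add: ii)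
    have e1: "real (Suc n) *\<^sub>R avg (1 / real (Suc n)) x = toL (\<lambda>t. (1 / h) *\<^sub>R (?m t h *\<^sub>R k))"
      unfolding toL_scaleR[OF sqa] avg_def ii hn by simp
    have e2: "x = toL (\<lambda>t. indicator {a<..<b} t *\<^sub>R k)" by (simp add: x tens_def)
    have "(norm (toL (\<lambda>t. (1 / h) *\<^sub>R (?m t h *\<^sub>R k)) - toL (\<lambda>t. indicator {a<..<b} t *\<^sub>R k)))\<^sup>2 \<le> 4 * h * (norm k)\<^sup>2"
    proof (rule norm_toL_diff_square_le[OF sq_int_scaleR[OF sqa] sq])
      fix t
      have "?m t h \<le> measure lborel {t<..<t+h}"
        by (rule measure_mono_fmeasurable) (auto simp: fmeasurable_def emeasure_Ioo_finite[simplified])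
      then have m: "0 \<le> ?m t h" "?m t h \<le> h" using h by auto
      have th: "0 \<le> ?m t h / h" "?m t h / h \<le> 1" using m h by auto
      have n: "(norm ((1 / h) *\<^sub>R (?m t h *\<^sub>R k) - indicator {a<..<b} t *\<^sub>R k))\<^sup>2
          = (?m t h / h - indicator {a<..<b} t)\<^sup>2 * (norm k)\<^sup>2"
        by (simp add: scaleR_left_diff_distrib[symmetric] power_mult_distrib)
      \<comment> \<open>Farther than h from both end points the window (t, t + h) lies inside (a, b)
        or misses it, and the mean equals the indicator; near them the error is at most 1.\<close>
      have "(?m t h / h - indicator {a<..<b} t)\<^sup>2 \<le> indicator {a-h..a+h} t + indicator {b-h..b+h} t"
      proof (cases "t \<in> {a-h..a+h} \<union> {b-h..b+h}")
        case True
        have "\<bar>?m t h / h - indicator {a<..<b} t\<bar> \<le> 1" using th by (auto simp: indicator_def abs_le_iff)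
        then have "(?m t h / h - indicator {a<..<b} t)\<^sup>2 \<le> 1" by (simp add: abs_square_le_1)
        moreover have "(1::real) \<le> indicator {a-h..a+h} t + indicator {b-h..b+h} t"
          using True by (auto simp: indicator_def)
        ultimately show ?thesis by linarith
      next
        case False
        have "?m t h = h * indicator {a<..<b} t"
        proof (cases "t \<in> {a<..<b}")
          case True
          then have "{t<..<t+h} \<inter> {a<..<b} = {t<..<t+h}" using False by auto
          then show ?thesis using True h by simp
        next
          case F2: False
          then have "{t<..<t+h} \<inter> {a<..<b} = {}" using False by auto
          then show ?thesis using F2 by simp
        qed
        then show ?thesis using h False by simp
      qed
      then show "(norm ((1 / h) *\<^sub>R (?m t h *\<^sub>R k) - indicator {a<..<b} t *\<^sub>R k))\<^sup>2
          \<le> (norm k)\<^sup>2 * (indicator {a-h..a+h} t + indicator {b-h..b+h} t)"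
        unfolding n by (subst mult.commute) (rule mult_left_mono, auto)
    qed (use h in simp)
    then show ?thesis unfolding e1[unfolded] using e2 h_def by metis
  qed
  have lim: "(\<lambda>n. 1 / real (Suc n)) \<longlonglongrightarrow> 0" by (rule LIMSEQ_Suc[OF lim_1_over_n])
  show "(\<lambda>n. real (Suc n) *\<^sub>R avg (1 / real (Suc n)) x) \<longlonglongrightarrow> x"
    by (rule tendsto_if_square_le[OF always_eventually lim]) (rule allI, rule le)
qed (auto intro: linearI)

lemma iint_beyond:
  fixes u :: "(real, 'b::{real_inner,banach,second_countable_topology}) l2"
  assumes u: "supported T u" and a: "T \<le> a" shows "iint (rep u) a b = 0"
proof -
  have "iint (rep u) a b = iint (\<lambda>s. 0) a b"
    by (rule iint_cong_AE, use supportedD[OF u] in eventually_elim) (use a in auto)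
  then show ?thesis by (simp add: iint_def)
qed

lemma iint_rep_shift:
  assumes "0 \<le> t" shows "iint (rep (shift T h u)) t T = iint (rep u) (t + h) (T + h)"
proof -
  have "iint (rep (shift T h u)) t T = iint (\<lambda>s. rep u (s + h)) t T"
    by (rule iint_cong_AE, use rep_shift[of T h u] in eventually_elim) (use assms in auto)
  then show ?thesis by (simp add: iint_shift)
qed

text \<open>As w vanishes beyond T and a \<ge> 0, the integral starting at t + a may be stopped at T
  or continued to T + a without change.\<close>

lemma Jop_shift:
  assumes w: "supported T w" and a: "a \<ge> 0" shows "Jop T (shift T a w) = shift T a (Jop T w)"
proof (rule l2_eqI, use rep_Jop[of T "shift T a w"] rep_shift[of T a "Jop T w"] AE_translate[OF rep_Jop[of T w], of a] in eventually_elim)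
  case (elim t)
  show ?case
  proof (cases "0 < t \<and> t < T")
    case True
    have "iint (rep (shift T a w)) t T = iint (rep w) (t + a) (T + a)" by (rule iint_rep_shift) (use True in simp)
    moreover have "iint (rep w) (t + a) (T + a) = iint (rep w) (t + a) T" if "t + a < T"
      using iint_split[OF sq_int_rep, of "t + a" T "T + a" w] iint_beyond[OF w order_refl, of "T + a"] that a by simp
    moreover have "iint (rep w) (t + a) (T + a) = 0" if "\<not> t + a < T"
      using iint_beyond[OF w, of "t + a"] that by simp
    ultimately show ?thesis using True elim a by auto
  next
    case False then show ?thesis using elim by auto
  qed
qed

text \<open>The integral of w(s) - w(s + h) over (t, T) telescopes to that of w over (t, t + h),
  since w vanishes beyond T. Up to the factor 1/h the argument of J is -w' and the result is w, so
  this identity takes the place of integration by parts in time.\<close>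

lemma Jop_diff_shift:
  assumes w: "supported T w" and h: "h \<ge> 0"
  shows "Jop T (w - shift T h w) = restr {0<..<T} (avg h w)"
proof (rule l2_eqI, use rep_Jop[of T "w - shift T h w"] rep_restr[of "{0<..<T}" "avg h w", simplified] rep_avg[OF h, of w] in eventually_elim)
  case (elim t)
  show ?case
  proof (cases "0 < t \<and> t < T")
    case True
    have "iint (rep (w - shift T h w)) t T = iint (rep w) t T - iint (rep w) (t + h) (T + h)"
      using True by (simp add: iint_rep_diff iint_rep_shift)
    also have "iint (rep w) t T = iint (rep w) t (T + h)"
      using iint_split[OF sq_int_rep, of t T "T + h" w] iint_beyond[OF w order_refl, of "T + h"] True h by simp
    also have "iint (rep w) t (T + h) - iint (rep w) (t + h) (T + h) = iint (rep w) t (t + h)"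
      using iint_split[OF sq_int_rep, of t "t + h" "T + h" w] True h by simp
    finally show ?thesis using elim True by simp
  next
    case False then show ?thesis using elim by auto
  qed
qed

text \<open>This is the inequality \<open>- (\<psi>, \<psi>') \<ge> 0\<close> for functions that vanish at the final time.\<close>
lemma inner_Jop_nonneg:
  assumes z: "supported T z" shows "z \<bullet> Jop T z \<ge> 0"
proof -
  have "Jop T z \<bullet> (real (Suc n) *\<^sub>R avg (1 / real (Suc n)) z) \<ge> 0" for n
  proof -
    let ?h = "1 / real (Suc n)"
    have "Jop T z \<bullet> avg ?h z = Jop T z \<bullet> restr {0<..<T} (avg ?h z)"
      by (rule inner_restr_supported[OF supported_Jop, symmetric])
    \<comment> \<open>J commutes with the shift, so the average of z is x - y with x = J z and y its
      translate; the scalar product with x has a sign.\<close>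
    also have "restr {0<..<T} (avg ?h z) = Jop T z - shift T ?h (Jop T z)"
      using Jop_diff_shift[OF z, of ?h] Jop_shift[OF z, of ?h] by (simp add: Jop_diff)
    also have "Jop T z \<bullet> (Jop T z - shift T ?h (Jop T z)) \<ge> 0"
      by (rule linear_norm_inner_diff_nonneg[OF norm_shift])
    finally show ?thesis by simp
  qed
  moreover have "(\<lambda>n. Jop T z \<bullet> (real (Suc n) *\<^sub>R avg (1 / real (Suc n)) z)) \<longlonglongrightarrow> Jop T z \<bullet> z"
    by (intro tendsto_intros avg_tendsto)
  ultimately show ?thesis by (simp add: LIMSEQ_le_const inner_commute)
qed

section \<open>Abstract parabolic equations\<close>

lemma bounded_linear_inner_left': "bounded_linear (\<lambda>x. x \<bullet> n)"
  by (rule bounded_linear_inner_left)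

lemma AE_inner_zero_if_orth_tens:
  fixes u :: "(real, 'e::{real_inner,banach,second_countable_topology}) l2"
  assumes "\<And>a b. u \<bullet> tens {a<..<b} n = 0"
  shows "AE t in lborel. rep u t \<bullet> n = 0"
proof -
  have "lmap (\<lambda>x. x \<bullet> n) u = 0"
  proof (rule l2_zero_if_orth_tens)
    fix a b c :: real
    have t1: "AE t in lborel. rep (tens {a<..<b} n) t = indicator {a<..<b} t *\<^sub>R n"
      by (rule rep_tens) (simp_all add: emeasure_Ioo_finite[simplified])
    have t2: "AE t in lborel. rep (tens {a<..<b} c) t = indicator {a<..<b} t *\<^sub>R c"
      by (rule rep_tens) (simp_all add: emeasure_Ioo_finite[simplified])
    have "lmap (\<lambda>x. x \<bullet> n) u \<bullet> tens {a<..<b} c = (LINT t|lborel. c * (rep u t \<bullet> rep (tens {a<..<b} n) t))"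
      by (rule inner_rep_cong, use t1 t2 rep_lmap[OF bounded_linear_inner_left', of n u] in
        \<open>eventually_elim, simp\<close>, measurable)
    also have "\<dots> = c * (u \<bullet> tens {a<..<b} n)" by (simp add: inner_l2_def)
    finally show "lmap (\<lambda>x. x \<bullet> n) u \<bullet> tens {a<..<b} c = 0" using assms by simp
  qed
  then have "AE t in lborel. rep (0 :: (real, real) l2) t = rep u t \<bullet> n"
    using rep_lmap[OF bounded_linear_inner_left', of n u] by simp
  then show ?thesis using rep_0[where ?'a = real and ?'b = real] by eventually_elim simp
qed

text \<open>Separability replaces N by a countable subset, so that one null set of times serves all
  n; the closure follows at each fixed time by continuity.\<close>

lemma AE_inner_zero_on_set:
  fixes u :: "(real, 'e::{real_inner,banach,second_countable_topology}) l2"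
  assumes "\<And>a b n. n \<in> N \<Longrightarrow> u \<bullet> tens {a<..<b} n = 0"
  shows "AE t in lborel. \<forall>n\<in>closure N. rep u t \<bullet> n = 0"
proof -
  obtain N' where N': "countable N'" "N' \<subseteq> N" "N \<subseteq> closure N'" using separable[of N] by metis
  have "AE t in lborel. \<forall>n\<in>N'. rep u t \<bullet> n = 0"
    using N' assms by (subst AE_ball_countable) (auto intro!: AE_inner_zero_if_orth_tens)
  then show ?thesis
  proof eventually_elim
    case (elim t)
    have "closed {n. rep u t \<bullet> n = 0}" by (intro closed_Collect_eq continuous_intros)
    then have "closure N' \<subseteq> {n. rep u t \<bullet> n = 0}" using elim by (intro closure_minimal) auto
    moreover have "closure N \<subseteq> closure N'" using N'(3) by (simp add: closure_minimal)
    ultimately show ?case by blast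
  qed
qed

lemma norm_restr_square:
  assumes A: "A \<in> sets borel"
  shows "(norm (restr A u))\<^sup>2 = (LINT x|lborel. indicator A x * (norm (rep u x))\<^sup>2)"
proof -
  have "(norm (restr A u))\<^sup>2 = restr A u \<bullet> u"
    using A by (simp add: power2_norm_eq_inner restr_adj restr_restr inner_commute)
  then show ?thesis by (simp add: inner_restr[OF A] power2_norm_eq_inner)
qed

lemma norm_le_if_inner_le:
  fixes z :: "'a::real_inner"
  assumes z: "z \<in> closure X" and C: "C \<ge> 0" and le: "\<And>x. x \<in> X \<Longrightarrow> \<bar>z \<bullet> x\<bar> \<le> C * norm x"
  shows "norm z \<le> C"
proof -
  have "closed {x. \<bar>z \<bullet> x\<bar> \<le> C * norm x}" by (intro closed_Collect_le continuous_intros)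
  then have "closure X \<subseteq> {x. \<bar>z \<bullet> x\<bar> \<le> C * norm x}" using le by (intro closure_minimal) auto
  then have "norm z * norm z \<le> C * norm z" using z by (auto simp: power2_norm_eq_inner[symmetric] power2_eq_square)
  then show ?thesis
  proof (cases "z = 0")
    case False
    then show ?thesis using \<open>norm z * norm z \<le> C * norm z\<close> mult_le_cancel_right_pos[of "norm z"] by simp
  qed (use C in simp)
qed

lemma tens_split:
  fixes k :: "'e::{real_inner,banach,second_countable_topology}"
  assumes "a \<le> b" "b \<le> c"
  shows "tens {a<..<c::real} k = tens {a<..<b} k + tens {b<..<c} k"
proof -
  have t: "AE t in lborel. rep (tens {x<..<y} k) t = indicator {x<..<y} t *\<^sub>R k" for x y :: real
    by (rule rep_tens) (simp_all add: emeasure_Ioo_finite[simplified])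
  show ?thesis
  proof (rule l2_eqI, use t[of a b] t[of b c] t[of a c] rep_add[of "tens {a<..<b} k" "tens {b<..<c} k"]
      AE_lborel_singleton[of b] in eventually_elim)
    case (elim x) then show ?case using assms by (auto simp: indicator_def)
  qed
qed

text \<open>The scaled primitive is k before s, 0 after s + h and a ramp in between, hence close to
  k on (0, s') for every s' in [s, s + h]. The free choice of s' yields both one-sided difference
  quotients later.\<close>

lemma Jop_tens_approx:
  fixes k :: "'e::{real_inner,banach,second_countable_topology}"
  assumes s: "0 \<le> s" "s + h \<le> T" "h > 0" "s \<le> s'" "s' \<le> s + h"
  shows "(norm ((1/h) *\<^sub>R Jop T (tens {s<..<s+h} k) - tens {0<..<s'} k))\<^sup>2 \<le> 4 * h * (norm k)\<^sup>2"
proof -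
  let ?x = "tens {s<..<s+h} k" and ?m = "\<lambda>t. measure lborel ({t<..<T} \<inter> {s<..<s+h})"
  have sq: "sq_int (\<lambda>t. indicator {a<..<b::real} t *\<^sub>R k)" for a b
    by (rule sq_int_const_on) (simp_all add: emeasure_Ioo_finite[simplified])
  have xAE: "AE t in lborel. rep ?x t = indicator {s<..<s+h} t *\<^sub>R k"
    unfolding tens_def by (rule rep_toL[OF sq])
  have ii: "iint (rep ?x) t T = ?m t *\<^sub>R k" for t
  proof -
    have "iint (rep ?x) t T = iint (\<lambda>r. indicator {s<..<s+h} r *\<^sub>R k) t T"
      by (rule iint_cong_AE) (use xAE sq in \<open>auto simp: sq_int_def elim: eventually_mono\<close>)
    also have "\<dots> = (LINT r|lborel. indicator ({t<..<T} \<inter> {s<..<s+h}) r *\<^sub>R k)"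
      unfolding iint_def by (intro Bochner_Integration.integral_cong) (auto simp: indicator_def)
    also have "\<dots> = ?m t *\<^sub>R k"
    proof (rule has_bochner_integral_integral_eq[OF has_bochner_integral_scaleR_left])
      show "has_bochner_integral lborel (indicator ({t<..<T} \<inter> {s<..<s+h})) (?m t)"
      proof (rule has_bochner_integral_real_indicator)
        have "emeasure lborel ({t<..<T} \<inter> {s<..<s+h}) \<le> emeasure lborel {s<..<s+h}"
          by (rule emeasure_mono) auto
        then show "emeasure lborel ({t<..<T} \<inter> {s<..<s+h}) < \<infinity>" using emeasure_Ioo_finite le_less_trans by blast
      qed simp
    qed
    finally show ?thesis .
  qed
  have sqJ: "sq_int (\<lambda>t. if 0 < t \<and> t < T then ?m t *\<^sub>R k else 0)" using sq_int_Jop[of T ?x] unfolding ii .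
  have e1: "(1/h) *\<^sub>R Jop T ?x = toL (\<lambda>t. (1/h) *\<^sub>R (if 0 < t \<and> t < T then ?m t *\<^sub>R k else 0))"
    unfolding toL_scaleR[OF sqJ] Jop_def ii ..
  show ?thesis
    unfolding e1 tens_def[of "{0<..<s'}"]
  proof (rule norm_toL_diff_square_le[OF sq_int_scaleR[OF sqJ] sq, where a = s' and b = s'])
    fix t
    have "?m t \<le> measure lborel {s<..<s+h}"
      by (rule measure_mono_fmeasurable) (auto simp: fmeasurable_def emeasure_Ioo_finite[simplified])
    then have m: "0 \<le> ?m t" "?m t \<le> h" using s by auto
    define f where "f = (if 0 < t \<and> t < T then ?m t / h else 0)"
    have f: "0 \<le> f" "f \<le> 1" using m s by (auto simp: f_def)
    have n: "(norm ((1/h) *\<^sub>R (if 0 < t \<and> t < T then ?m t *\<^sub>R k else 0) - indicator {0<..<s'} t *\<^sub>R k))\<^sup>2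
        = (f - indicator {0<..<s'} t)\<^sup>2 * (norm k)\<^sup>2"
    proof -
      have "(1/h) *\<^sub>R (if 0 < t \<and> t < T then ?m t *\<^sub>R k else 0) = f *\<^sub>R k" by (simp add: f_def)
      then show ?thesis by (simp only: scaleR_left_diff_distrib[symmetric]) (simp add: power_mult_distrib)
    qed
    have "(f - indicator {0<..<s'} t)\<^sup>2 \<le> indicator {s'-h..s'+h} t + indicator {s'-h..s'+h} t"
    proof (cases "t \<in> {s'-h..s'+h}")
      case True
      have "\<bar>f - indicator {0<..<s'} t\<bar> \<le> 1" using f by (auto simp: indicator_def abs_le_iff)
      then have "(f - indicator {0<..<s'} t)\<^sup>2 \<le> 1" by (simp add: abs_square_le_1)
      then show ?thesis using True by simp
    next
      case False
      have "f = indicator {0<..<s'} t"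
      proof (cases "t \<in> {0<..<s'}")
        case True
        then have "t < s" using False s by auto
        then have "{t<..<T} \<inter> {s<..<s+h} = {s<..<s+h}" using s by auto
        then have "?m t = h" using s by simp
        then show ?thesis using True \<open>t < s\<close> s by (simp add: f_def)
      next
        case F2: False
        have "f = 0"
        proof (cases "0 < t \<and> t < T")
          case True
          then have "t > s + h" using False F2 s by auto
          then have "{t<..<T} \<inter> {s<..<s+h} = {}" by auto
          then show ?thesis by (simp add: f_def)
        qed (auto simp: f_def)
        then show ?thesis using F2 by simp
      qed
      then show ?thesis by simp
    qed
    then show "(norm ((1/h) *\<^sub>R (if 0 < t \<and> t < T then ?m t *\<^sub>R k else 0) - indicator {0<..<s'} t *\<^sub>R k))\<^sup>2
        \<le> (norm k)\<^sup>2 * (indicator {s'-h..s'+h} t + indicator {s'-h..s'+h} t)"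
      unfolding n by (subst mult.commute) (rule mult_left_mono, auto)
  qed (use s in simp)
qed

text \<open>'e will be L_2(R^n; R x R^n), S the space H^1 inside it and 'h the pivot space L_2(R^n).
  S is a set and not a type of its own because it depends on the domain.\<close>

locale gelfand =
  fixes T :: real
    and S :: "'e::{real_inner,banach,second_countable_topology} set"
    and p :: "'e \<Rightarrow> 'h::{real_inner,banach,second_countable_topology}"
  assumes T: "T > 0" and S: "subspace S" and Scl: "closed S" and p: "bounded_linear p"
begin

definition V :: "(real, 'e) l2 set" where
  "V = {u. AE t in lborel. rep u t \<in> S \<and> (t \<notin> {0<..<T} \<longrightarrow> rep u t = 0)}"

abbreviation P :: "(real, 'e) l2 \<Rightarrow> (real, 'h) l2" where "P \<equiv> lmap p"

lemma V_supported: "u \<in> V \<Longrightarrow> supported T u"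
  unfolding V_def mem_Collect_eq by (rule supportedI) (auto elim: eventually_mono)

lemma V_S: "u \<in> V \<Longrightarrow> AE t in lborel. rep u t \<in> S"
  unfolding V_def mem_Collect_eq by (auto elim: eventually_mono)

lemma V_I: assumes "AE t in lborel. rep u t \<in> S" "supported T u" shows "u \<in> V"
  unfolding V_def mem_Collect_eq using assms(1) supportedD[OF assms(2)] by eventually_elim simp

text \<open>Membership in S at almost every time, rewritten as a family of continuous linear
  equations; closedness of V is then immediate, without passing to subsequences that converge almost
  everywhere.\<close>

lemma V_eq: "V = {u. restr {0<..<T} u = u \<and> (\<forall>a b. \<forall>n\<in>{n. \<forall>x\<in>S. n \<bullet> x = 0}. u \<bullet> tens {a<..<b} n = 0)}"
proof (intro set_eqI iffI)
  fix u assume u: "u \<in> V"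
  have "u \<bullet> tens {a<..<b} n = 0" if n: "\<forall>x\<in>S. n \<bullet> x = 0" for a b n
  proof -
    have t1: "AE t in lborel. rep (tens {a<..<b} n) t = indicator {a<..<b} t *\<^sub>R n"
      by (rule rep_tens) (simp_all add: emeasure_Ioo_finite[simplified])
    have "u \<bullet> tens {a<..<b} n = (LINT t::real|lborel. 0)"
      by (rule inner_rep_cong, use t1 V_S[OF u] in eventually_elim) (use n in \<open>auto simp: inner_commute\<close>)
    then show ?thesis by simp
  qed
  then show "u \<in> {u. restr {0<..<T} u = u \<and> (\<forall>a b. \<forall>n\<in>{n. \<forall>x\<in>S. n \<bullet> x = 0}. u \<bullet> tens {a<..<b} n = 0)}"
    using V_supported[OF u] by (auto simp: supported_def)
next
  fix u assume u: "u \<in> {u. restr {0<..<T} u = u \<and> (\<forall>a b. \<forall>n\<in>{n. \<forall>x\<in>S. n \<bullet> x = 0}. u \<bullet> tens {a<..<b} n = 0)}"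
  have "AE t in lborel. \<forall>n\<in>closure {n. \<forall>x\<in>S. n \<bullet> x = 0}. rep u t \<bullet> n = 0"
    by (rule AE_inner_zero_on_set) (use u in blast)
  then have "AE t in lborel. rep u t \<in> S"
  proof eventually_elim
    case (elim t)
    show ?case
    proof (rule closed_subspace_memI[OF S Scl])
      fix y assume y: "\<forall>x\<in>S. y \<bullet> x = 0"
      have "y \<in> closure {n. \<forall>x\<in>S. n \<bullet> x = 0}" by (rule subsetD[OF closure_subset]) (use y in simp)
      then show "rep u t \<bullet> y = 0" using elim by blast
    qed
  qed
  moreover have "supported T u" using u by (simp add: supported_def)
  ultimately show "u \<in> V" by (rule V_I)
qed

lemma V_subspace: "subspace V"
  unfolding V_eq
  by (rule subspaceI) (auto simp: restr_add restr_scaleR inner_add_left linear_0[OF linear_restr])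

lemma V_closed: "closed V"
proof -
  have "bounded_linear (restr {0<..<T} :: (real, 'e) l2 \<Rightarrow> _)"
    by (rule bounded_linear_intro[of _ 1]) (auto simp: restr_add restr_scaleR norm_restr)
  then have c: "continuous_on UNIV (restr {0<..<T} :: (real, 'e) l2 \<Rightarrow> _)"
    by (rule linear_continuous_on)
  have "closed {u :: (real, 'e) l2. restr {0<..<T} u = u}"
    by (rule closed_Collect_eq[OF c continuous_on_id])
  moreover have "closed {u :: (real, 'e) l2. u \<bullet> tens {a<..<b} n = 0}" for a b n
    by (intro closed_Collect_eq continuous_intros)
  moreover have "V = {u. restr {0<..<T} u = u} \<inter> (\<Inter>a. \<Inter>b. \<Inter>n\<in>{n. \<forall>x\<in>S. n \<bullet> x = 0}. {u. u \<bullet> tens {a<..<b} n = 0})"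
    unfolding V_eq by auto
  ultimately show ?thesis by (simp only:) (intro closed_Int closed_INT ballI)
qed

lemma V_add: "u \<in> V \<Longrightarrow> v \<in> V \<Longrightarrow> u + v \<in> V" by (rule subspace_add[OF V_subspace])
lemma V_diff: "u \<in> V \<Longrightarrow> v \<in> V \<Longrightarrow> u - v \<in> V" by (rule subspace_diff[OF V_subspace])
lemma V_scale: "u \<in> V \<Longrightarrow> c *\<^sub>R u \<in> V" by (rule subspace_scale[OF V_subspace])

lemma V_shift: assumes "u \<in> V" shows "shift T h u \<in> V"
proof (rule V_I[OF _ supported_shift])
  show "AE t in lborel. rep (shift T h u) t \<in> S"
    using AE_translate[OF V_S[OF assms], of h] rep_shift[of T h u]
    by eventually_elim (simp add: subspace_scale[OF S])
qed

lemma V_restr: assumes "u \<in> V" "A \<in> sets borel" shows "restr A u \<in> V"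
  unfolding V_def mem_Collect_eq
  using V_S[OF assms(1)] supportedD[OF V_supported[OF assms(1)]] rep_restr[OF assms(2), of u]
  by eventually_elim (simp add: subspace_scale[OF S])

text \<open>The integral is orthogonal to everything that is orthogonal to S.\<close>

lemma iint_in_S: assumes "u \<in> V" shows "iint (rep u) a b \<in> S"
proof (rule closed_subspace_memI[OF S Scl])
  fix y assume y: "\<forall>x\<in>S. y \<bullet> x = 0"
  have "iint (rep u) a b \<bullet> y = iint (\<lambda>s. rep u s \<bullet> y) a b"
    by (rule iint_bounded_linear[OF bounded_linear_inner_left' sq_int_rep])
  also have "\<dots> = iint (\<lambda>s. 0) a b"
    by (rule iint_cong_AE, use V_S[OF assms] in eventually_elim) (use y in \<open>auto simp: inner_commute\<close>)
  finally show "iint (rep u) a b \<bullet> y = 0" by (simp add: iint_def)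
qed

lemma V_Jop: assumes "u \<in> V" shows "Jop T u \<in> V"
proof (rule V_I[OF _ supported_Jop])
  show "AE t in lborel. rep (Jop T u) t \<in> S"
    using rep_Jop[of T u] by eventually_elim (simp add: iint_in_S[OF assms] subspace_0[OF S])
qed

lemma V_tens: assumes "k \<in> S" "0 \<le> a" "b \<le> T" shows "tens {a<..<b} k \<in> V"
proof -
  have t1: "AE t in lborel. rep (tens {a<..<b} k) t = indicator {a<..<b} t *\<^sub>R k"
    by (rule rep_tens) (simp_all add: emeasure_Ioo_finite[simplified])
  show ?thesis
    unfolding V_def mem_Collect_eq using t1
    by eventually_elim (use assms subspace_0[OF S] in \<open>auto simp: indicator_def\<close>)
qed

subsection \<open>Existence for the linear equation (Lions)\<close>

text \<open>The weak formulation of \<open>u' = g\<close>, \<open>u(0) = 0\<close>: every test function that vanishes at the final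
  time is \<open>Jop T \<omega>\<close>, where \<open>- \<omega>\<close> is its time derivative.\<close>
definition weak_eq :: "(real, 'e) l2 \<Rightarrow> (real, 'e) l2 \<Rightarrow> bool" where
  "weak_eq u g \<longleftrightarrow> u \<in> V \<and> (\<forall>\<omega>\<in>V. P u \<bullet> P \<omega> = g \<bullet> Jop T \<omega>)"

text \<open>Lions' projection argument. Each test function J \<omega> induces a functional on V,
  represented by some k. Coercivity along u = J \<omega> bounds J \<omega> by k, so that k
  determines the pairing of g with J \<omega> as a bounded functional of k, and the Riesz vector of
  that functional solves the equation.\<close>

lemma linear_exists:
  assumes M: "bounded_linear M" and c: "c > 0"
    and coer: "\<And>u. u \<in> V \<Longrightarrow> M u \<bullet> u \<ge> c * (norm u)\<^sup>2"
  shows "\<exists>u. weak_eq u (g - M u)"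
proof -
  \<comment> \<open>The range of the adjoint problem: all k that represent (P u, P \<omega>) + (M u,
    J \<omega>), as a functional of u, for some \<omega>.\<close>
  define R where "R = {k \<in> V. \<exists>\<omega>\<in>V. \<forall>u\<in>V. k \<bullet> u = P u \<bullet> P \<omega> + M u \<bullet> Jop T \<omega>}"
  have Madd: "M (x + y) = M x + M y" and Mscale: "M (r *\<^sub>R x) = r *\<^sub>R M x" for x y r
    using bounded_linear.linear[OF M] by (auto simp: linear_add linear_cmul)
  have ex: "\<exists>k\<in>V. \<forall>u\<in>V. k \<bullet> u = P u \<bullet> P \<omega> + M u \<bullet> Jop T \<omega>" for \<omega>
  proof -
    obtain KP where KP: "\<And>x. norm (P x) \<le> norm x * KP"
      using bounded_linear.bounded[OF bounded_linear_lmap[OF p]] by blast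
    obtain KM where KM: "\<And>x. norm (M x) \<le> norm x * KM" using bounded_linear.bounded[OF M] by blast
    have "\<exists>k\<in>closure V. \<forall>u\<in>V. k \<bullet> u = P u \<bullet> P \<omega> + M u \<bullet> Jop T \<omega>"
    proof (rule riesz_on_subspace[OF V_subspace, where C = "KP * norm (P \<omega>) + KM * norm (Jop T \<omega>)"])
      fix x
      have "\<bar>P x \<bullet> P \<omega> + M x \<bullet> Jop T \<omega>\<bar> \<le> norm (P x) * norm (P \<omega>) + norm (M x) * norm (Jop T \<omega>)"
        using Cauchy_Schwarz_ineq2[of "P x" "P \<omega>"] Cauchy_Schwarz_ineq2[of "M x" "Jop T \<omega>"] by linarith
      also have "\<dots> \<le> (norm x * KP) * norm (P \<omega>) + (norm x * KM) * norm (Jop T \<omega>)"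
        by (intro add_mono mult_right_mono KP KM) auto
      finally show "\<bar>P x \<bullet> P \<omega> + M x \<bullet> Jop T \<omega>\<bar> \<le> (KP * norm (P \<omega>) + KM * norm (Jop T \<omega>)) * norm x"
        by (simp add: algebra_simps)
    qed (simp_all add: lmap_add[OF p] lmap_scaleR[OF p] Madd Mscale inner_add_left algebra_simps)
    then show ?thesis using V_closed by simp
  qed
  \<comment> \<open>Insert u = J \<omega>: the first term becomes the scalar product of J (P
    \<omega>) with P \<omega>, which is nonnegative, and the second is coercive.\<close>
  have est: "c * norm (Jop T \<omega>) \<le> norm k"
    if w: "\<omega> \<in> V" and k: "\<forall>u\<in>V. k \<bullet> u = P u \<bullet> P \<omega> + M u \<bullet> Jop T \<omega>" for k \<omega>
  proof -
    have "P (Jop T \<omega>) \<bullet> P \<omega> \<ge> 0"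
      using inner_Jop_nonneg[OF supported_lmap[OF p V_supported[OF w]]] by (simp add: lmap_Jop[OF p] inner_commute)
    moreover have "c * (norm (Jop T \<omega>))\<^sup>2 \<le> M (Jop T \<omega>) \<bullet> Jop T \<omega>" by (rule coer[OF V_Jop[OF w]])
    moreover have "k \<bullet> Jop T \<omega> \<le> norm k * norm (Jop T \<omega>)" by (rule norm_cauchy_schwarz)
    ultimately have *: "(c * norm (Jop T \<omega>)) * norm (Jop T \<omega>) \<le> norm k * norm (Jop T \<omega>)"
      using k V_Jop[OF w] by (simp add: power2_eq_square mult.assoc)
    show ?thesis
    proof (cases "Jop T \<omega> = 0")
      case False
      then show ?thesis using * mult_le_cancel_right_pos[of "norm (Jop T \<omega>)"] by simp
    qed simp
  qed
  \<comment> \<open>\<omega> itself is a choice, but J \<omega> is determined by k: the estimate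
    with k = 0 applies to differences. Hence \<open>l\<close> below is well defined and
    linear.\<close>
  define sel where "sel k = (SOME \<omega>. \<omega> \<in> V \<and> (\<forall>u\<in>V. k \<bullet> u = P u \<bullet> P \<omega> + M u \<bullet> Jop T \<omega>))" for k
  have sel: "sel k \<in> V" "\<forall>u\<in>V. k \<bullet> u = P u \<bullet> P (sel k) + M u \<bullet> Jop T (sel k)" if "k \<in> R" for k
    using someI_ex[of "\<lambda>\<omega>. \<omega> \<in> V \<and> (\<forall>u\<in>V. k \<bullet> u = P u \<bullet> P \<omega> + M u \<bullet> Jop T \<omega>)"] that
    unfolding sel_def[symmetric] by (auto simp: R_def)
  define l where "l k = g \<bullet> Jop T (sel k)" for k
  have l_eq: "l k = g \<bullet> Jop T \<omega>"
    if k: "k \<in> R" and w: "\<omega> \<in> V" "\<forall>u\<in>V. k \<bullet> u = P u \<bullet> P \<omega> + M u \<bullet> Jop T \<omega>" for k \<omega>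
  proof -
    have "c * norm (Jop T (sel k - \<omega>)) \<le> norm (0 :: (real, 'e) l2)"
      by (rule est) (use sel[OF k] w in \<open>auto simp: V_diff lmap_diff[OF p] Jop_diff inner_diff_right\<close>)
    then have "Jop T (sel k) = Jop T \<omega>" using c by (simp add: Jop_diff mult_le_0_iff)
    then show ?thesis by (simp add: l_def)
  qed
  have Rsub: "subspace R"
  proof (rule subspaceI)
    show "0 \<in> R"
      unfolding R_def using subspace_0[OF V_subspace]
      by (auto intro!: bexI[of _ 0] simp: linear_0[OF linear_lmap[OF p]] linear_0[OF linear_Jop])
    fix x y assume "x \<in> R" "y \<in> R"
    then show "x + y \<in> R" unfolding R_def using sel[of x] sel[of y]
      by (auto intro!: bexI[of _ "sel x + sel y"] V_add simp: R_def lmap_add[OF p] Jop_add inner_add_left inner_add_right)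
  next
    fix r x assume "x \<in> R"
    then show "r *\<^sub>R x \<in> R" unfolding R_def using sel[of x]
      by (auto intro!: bexI[of _ "r *\<^sub>R sel x"] V_scale simp: R_def lmap_scaleR[OF p] Jop_scaleR algebra_simps)
  qed
  have "\<exists>u\<in>closure R. \<forall>k\<in>R. u \<bullet> k = l k"
  proof (rule riesz_on_subspace[OF Rsub, where C = "norm g / c"])
    fix x y assume xy: "x \<in> R" "y \<in> R"
    have "l (x + y) = g \<bullet> Jop T (sel x + sel y)"
      by (rule l_eq) (use xy sel[OF xy(1)] sel[OF xy(2)] in
        \<open>auto simp: subspace_add[OF Rsub] V_add lmap_add[OF p] Jop_add inner_add_left inner_add_right\<close>)
    then show "l (x + y) = l x + l y" by (simp add: l_def Jop_add inner_add_right)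
  next
    fix r x assume x: "x \<in> R"
    have "l (r *\<^sub>R x) = g \<bullet> Jop T (r *\<^sub>R sel x)"
      by (rule l_eq) (use x sel[OF x] in
        \<open>auto simp: subspace_scale[OF Rsub] V_scale lmap_scaleR[OF p] Jop_scaleR algebra_simps\<close>)
    then show "l (r *\<^sub>R x) = r * l x" by (simp add: l_def Jop_scaleR)
  next
    fix x assume x: "x \<in> R"
    have "\<bar>l x\<bar> \<le> norm g * norm (Jop T (sel x))" unfolding l_def by (rule Cauchy_Schwarz_ineq2)
    also have "\<dots> \<le> norm g * (norm x / c)"
      using est[OF sel[OF x]] c by (intro mult_left_mono) (auto simp: field_simps)
    finally show "\<bar>l x\<bar> \<le> norm g / c * norm x" by simp
  qed
  then obtain u where u: "u \<in> closure R" "\<forall>k\<in>R. u \<bullet> k = l k" by blast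
  have uV: "u \<in> V"
    using u(1) closure_minimal[OF _ V_closed, of R] by (auto simp: R_def)
  have "P u \<bullet> P \<omega> = (g - M u) \<bullet> Jop T \<omega>" if w: "\<omega> \<in> V" for \<omega>
  proof -
    obtain k where k: "k \<in> V" "\<forall>u\<in>V. k \<bullet> u = P u \<bullet> P \<omega> + M u \<bullet> Jop T \<omega>" using ex[of \<omega>] by blast
    then have kR: "k \<in> R" using w by (auto simp: R_def)
    have "u \<bullet> k = g \<bullet> Jop T \<omega>" using u(2) kR l_eq[OF kR w k(2)] by simp
    moreover have "k \<bullet> u = P u \<bullet> P \<omega> + M u \<bullet> Jop T \<omega>" using k(2) uV by blast
    ultimately show ?thesis by (simp add: inner_commute[of k u] inner_diff_left)
  qed
  then show ?thesis using uV unfolding weak_eq_def by blast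
qed

subsection \<open>The energy inequality\<close>

lemma weak_eq_diff: "weak_eq u g \<Longrightarrow> weak_eq v h \<Longrightarrow> weak_eq (u - v) (g - h)"
  by (auto simp: weak_eq_def V_diff lmap_diff[OF p] inner_diff_left)

text \<open>w minus its shift stands for -h w', and J turns it into an integral of w over short
  windows.\<close>

lemma weak_eq_shift_test:
  assumes u: "weak_eq u g" and w: "w \<in> V" and h: "h \<ge> 0"
  shows "P u \<bullet> (P w - shift T h (P w)) = g \<bullet> restr {0<..<T} (avg h w)"
proof -
  have "w - shift T h w \<in> V" by (intro V_diff V_shift w)
  then have "P u \<bullet> P (w - shift T h w) = g \<bullet> Jop T (w - shift T h w)" using u by (simp add: weak_eq_def)
  then show ?thesis
    by (simp add: Jop_diff_shift[OF V_supported[OF w] h] lmap_diff[OF p] lmap_shift[OF p])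
qed

text \<open>Since u is not of the form J \<omega>, it is approached: with w = u the left-hand side
  of the shift test is nonnegative, and after division by h the averages on the right converge to
  u.\<close>

lemma energy:
  assumes u: "weak_eq u g" shows "g \<bullet> u \<ge> 0"
proof -
  have uV: "u \<in> V" using u by (simp add: weak_eq_def)
  have "0 \<le> restr {0<..<T} g \<bullet> (real (Suc n) *\<^sub>R avg (1 / real (Suc n)) u)" for n
  proof -
    have "0 \<le> P u \<bullet> (P u - shift T (1 / real (Suc n)) (P u))"
      by (rule linear_norm_inner_diff_nonneg[OF norm_shift])
    also have "\<dots> = g \<bullet> restr {0<..<T} (avg (1 / real (Suc n)) u)"
      by (rule weak_eq_shift_test[OF u uV]) simp
    finally show ?thesis by (simp add: restr_adj)
  qed
  moreover have "(\<lambda>n. restr {0<..<T} g \<bullet> (real (Suc n) *\<^sub>R avg (1 / real (Suc n)) u)) \<longlonglongrightarrow> restr {0<..<T} g \<bullet> u"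
    by (intro tendsto_intros avg_tendsto)
  ultimately have "0 \<le> restr {0<..<T} g \<bullet> u" by (simp add: LIMSEQ_le_const)
  also have "\<dots> = g \<bullet> u" using V_supported[OF uV] by (simp add: restr_adj supported_def)
  finally show ?thesis .
qed

end

lemma subspace_closure:
  fixes A :: "'a::real_normed_vector set"
  assumes "subspace A" shows "subspace (closure A)"
proof (rule subspaceI)
  show "0 \<in> closure A" using subspace_0[OF assms] closure_subset by blast
  fix x y assume "x \<in> closure A" "y \<in> closure A"
  then obtain f g where fg: "\<And>n::nat. f n \<in> A" "f \<longlonglongrightarrow> x" "\<And>n::nat. g n \<in> A" "g \<longlonglongrightarrow> y"
    unfolding closure_sequential by blast
  have "(\<lambda>n. f n + g n) \<longlonglongrightarrow> x + y" by (intro tendsto_add fg)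
  then show "x + y \<in> closure A"
    unfolding closure_sequential using fg subspace_add[OF assms] by (intro exI[of _ "\<lambda>n. f n + g n"]) simp
next
  fix c :: real and x assume "x \<in> closure A"
  then obtain f where f: "\<And>n::nat. f n \<in> A" "f \<longlonglongrightarrow> x" unfolding closure_sequential by blast
  have "(\<lambda>n. c *\<^sub>R f n) \<longlonglongrightarrow> c *\<^sub>R x" by (intro tendsto_scaleR tendsto_const f)
  then show "c *\<^sub>R x \<in> closure A"
    unfolding closure_sequential using f subspace_scale[OF assms] by (intro exI[of _ "\<lambda>n. c *\<^sub>R f n"]) simp
qed

context gelfand begin

subsection \<open>The semilinear equation\<close>

text \<open>The difference d of the solutions satisfies c |d|^2 + \<kappa> |P d|^2 \<le> C r |d|,
  and C r |d| - c |d|^2 is at most C^2 r^2 / (4c). With C^2 \<le> c \<kappa> this leaves |P d|^2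
  \<le> r^2 / 4.\<close>

lemma semilinear_estimate:
  assumes M: "bounded_linear M" and c: "c > 0" and \<kappa>: "\<kappa> > 0" and C: "C \<ge> 0" "C\<^sup>2 \<le> c * \<kappa>"
    and coer: "\<And>u. u \<in> V \<Longrightarrow> M u \<bullet> u \<ge> c * (norm u)\<^sup>2 + \<kappa> * (norm (P u))\<^sup>2"
    and g: "norm (g - h) \<le> C * r" and r: "r \<ge> 0"
    and u: "weak_eq u (g - M u)" and v: "weak_eq v (h - M v)"
  shows "norm (P (u - v)) \<le> 1/2 * r"
proof -
  let ?d = "u - v"
  have "weak_eq ?d ((g - h) - M ?d)"
    using weak_eq_diff[OF u v] by (simp add: linear_diff[OF bounded_linear.linear[OF M]] algebra_simps)
  then have "0 \<le> ((g - h) - M ?d) \<bullet> ?d" by (rule energy)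
  then have "M ?d \<bullet> ?d \<le> (g - h) \<bullet> ?d" by (simp add: inner_diff_left)
  also have "\<dots> \<le> norm (g - h) * norm ?d" by (rule norm_cauchy_schwarz)
  also have "\<dots> \<le> C * r * norm ?d" using g by (intro mult_right_mono) auto
  finally have 1: "c * (norm ?d)\<^sup>2 + \<kappa> * (norm (P ?d))\<^sup>2 \<le> C * r * norm ?d"
    using coer[of ?d] V_diff u v by (auto simp: weak_eq_def intro: order_trans)
  have "0 \<le> (C * r - 2 * c * norm ?d)\<^sup>2" by simp
  also have "\<dots> = C\<^sup>2 * r\<^sup>2 - 4 * c * (C * r * norm ?d) + 4 * c * (c * (norm ?d)\<^sup>2)"
    by (simp add: power2_eq_square algebra_simps)
  finally have 2: "4 * c * (C * r * norm ?d) - 4 * c * (c * (norm ?d)\<^sup>2) \<le> C\<^sup>2 * r\<^sup>2" by simp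
  have "4 * c * (\<kappa> * (norm (P ?d))\<^sup>2) \<le> 4 * c * (C * r * norm ?d - c * (norm ?d)\<^sup>2)"
    using 1 c by (intro mult_left_mono) auto
  also have "\<dots> \<le> C\<^sup>2 * r\<^sup>2" using 2 by (simp add: algebra_simps)
  also have "\<dots> \<le> (c * \<kappa>) * r\<^sup>2" using C by (intro mult_right_mono) auto
  finally have "(c * \<kappa>) * (4 * (norm (P ?d))\<^sup>2) \<le> (c * \<kappa>) * r\<^sup>2" by (simp add: algebra_simps)
  then have "4 * (norm (P ?d))\<^sup>2 \<le> r\<^sup>2" using c \<kappa> by (simp add: mult_le_cancel_left_pos)
  then have "(norm (P ?d))\<^sup>2 \<le> (1/2 * r)\<^sup>2" by (simp add: power_mult_distrib power_divide)
  then show ?thesis by (rule power2_le_imp_le) (use r in simp)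
qed

lemma semilinear_exists:
  assumes M: "bounded_linear M" and c: "c > 0" and \<kappa>: "\<kappa> > 0" and C: "C \<ge> 0" "C\<^sup>2 \<le> c * \<kappa>"
    and coer: "\<And>u. u \<in> V \<Longrightarrow> M u \<bullet> u \<ge> c * (norm u)\<^sup>2 + \<kappa> * (norm (P u))\<^sup>2"
    and G: "\<And>y z. norm (G y - G z) \<le> C * norm (y - z)"
  shows "\<exists>u. weak_eq u (G (P u) - M u)"
proof -
  have "\<exists>u. weak_eq u (G y - M u)" for y
  proof (rule linear_exists[OF M c])
    fix u assume "u \<in> V"
    then show "c * (norm u)\<^sup>2 \<le> M u \<bullet> u" using coer[of u] \<kappa> by (smt (verit) mult_nonneg_nonneg zero_le_power2)
  qed
  then obtain N where N: "weak_eq (N y) (G y - M (N y))" for y by metis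
  have "norm (P (N y) - P (N z)) \<le> 1/2 * norm (y - z)" for y z
    using semilinear_estimate[OF M c \<kappa> C coer G _ N N] by (simp add: lmap_diff[OF p])
  then have "\<exists>!y. P (N y) = y" by (intro banach_fix_type[where c = "1/2"]) (auto simp: dist_norm)
  then obtain y where "P (N y) = y" by blast
  then show ?thesis using N[of y] by metis
qed

text \<open>The conclusion concerns P u only, that is, the functions without their gradients;
  uniqueness in the statement asks for exactly this.\<close>

lemma semilinear_unique:
  assumes M: "bounded_linear M" and c: "c > 0" and \<kappa>: "\<kappa> > 0" and C: "C \<ge> 0" "C\<^sup>2 \<le> c * \<kappa>"
    and coer: "\<And>u. u \<in> V \<Longrightarrow> M u \<bullet> u \<ge> c * (norm u)\<^sup>2 + \<kappa> * (norm (P u))\<^sup>2"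
    and G: "\<And>y z. norm (G y - G z) \<le> C * norm (y - z)"
    and u: "weak_eq u (G (P u) - M u)" and v: "weak_eq v (G (P v) - M v)"
  shows "P u = P v"
proof -
  have "norm (P (u - v)) \<le> 1/2 * norm (P u - P v)"
    by (rule semilinear_estimate[OF M c \<kappa> C coer G _ u v]) auto
  then show ?thesis by (simp add: lmap_diff[OF p])
qed

subsection \<open>Continuity in time\<close>

text \<open>Local energy bound: the test function is u cut at \<tau>, so that a term at \<tau>
  survives, namely the mass of P u on (\<tau> - h, \<tau>) as the excess of (0, \<tau>) over (0,
  \<tau> - h). The linear rate in h amounts to a bound for |u(\<tau>)|^2 before u(\<tau>) has a
  meaning.\<close>

lemma energy_interval:
  assumes u: "weak_eq u g" and t: "0 < h" "h < \<tau>" "\<tau> \<le> T"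
  shows "(norm (restr {\<tau>-h<..<\<tau>} (P u)))\<^sup>2 \<le> 2 * h * (norm g * norm u)"
proof -
  have uV: "u \<in> V" using u by (simp add: weak_eq_def)
  define w where "w = restr {0<..<\<tau>} u"
  have w: "w \<in> V" unfolding w_def by (rule V_restr[OF uV]) simp
  define y where "y = P u"
  have Pw: "P w = restr {0<..<\<tau>} y" by (simp add: w_def y_def lmap_restr[OF p])
  let ?s = "shift T h (P w)"
  have "y \<bullet> (P w - ?s) = g \<bullet> restr {0<..<T} (avg h w)"
    unfolding y_def by (rule weak_eq_shift_test[OF u w]) (use t in simp)
  also have "\<dots> \<le> norm g * norm (restr {0<..<T} (avg h w))" by (rule norm_cauchy_schwarz)
  also have "\<dots> \<le> norm g * (h * norm u)"
  proof (rule mult_left_mono)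
    have "norm (restr {0<..<T} (avg h w)) \<le> norm (avg h w)" by (rule norm_restr) simp
    also have "\<dots> \<le> h * norm w" by (rule norm_avg) (use t in simp)
    also have "\<dots> \<le> h * norm u" unfolding w_def using t by (intro mult_left_mono norm_restr) auto
    finally show "norm (restr {0<..<T} (avg h w)) \<le> h * norm u" .
  qed simp
  finally have 1: "y \<bullet> P w - y \<bullet> ?s \<le> h * (norm g * norm u)" by (simp add: inner_diff_right mult_ac)
  have 2: "y \<bullet> P w = (norm (P w))\<^sup>2"
    unfolding Pw by (simp add: power2_norm_eq_inner restr_adj restr_restr)
  \<comment> \<open>The translate of a function living on (0, \<tau>) lives on (0, \<tau> - h), so
    it meets only that part of y.\<close>
  have "restr {0<..<\<tau>-h} ?s = ?s"
  proof (rule l2_eqI, use rep_restr[of "{0<..<\<tau>-h}" ?s, simplified] rep_shift[of T h "P w"]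
      AE_translate[OF rep_restr[of "{0<..<\<tau>}" y, simplified], of h] in eventually_elim)
    case (elim t) then show ?case using t by (auto simp: indicator_def Pw)
  qed
  then have "y \<bullet> ?s = restr {0<..<\<tau>-h} y \<bullet> ?s" by (metis restr_adj borel_open open_greaterThanLessThan)
  also have "\<dots> \<le> norm (restr {0<..<\<tau>-h} y) * norm ?s" by (rule norm_cauchy_schwarz)
  also have "\<dots> \<le> norm (restr {0<..<\<tau>-h} y) * norm (P w)" by (intro mult_left_mono norm_shift) auto
  finally have 3: "2 * (y \<bullet> ?s) \<le> (norm (restr {0<..<\<tau>-h} y))\<^sup>2 + (norm (P w))\<^sup>2"
    using sum_squares_bound[of "norm (restr {0<..<\<tau>-h} y)" "norm (P w)"] by linarith
  have i: "integrable lborel (\<lambda>x. indicator A x * (norm (rep y x))\<^sup>2)" if "A \<in> sets borel" for A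
    using integrable_mult_indicator[OF _ sq_int_square[OF sq_int_rep[of y]], of A] that by simp
  have 4: "(norm (P w))\<^sup>2 = (norm (restr {0<..<\<tau>-h} y))\<^sup>2 + (norm (restr {\<tau>-h<..<\<tau>} y))\<^sup>2"
  proof -
    have "(norm (P w))\<^sup>2 = (LINT x|lborel. indicator {0<..<\<tau>-h} x * (norm (rep y x))\<^sup>2
        + indicator {\<tau>-h<..<\<tau>} x * (norm (rep y x))\<^sup>2)"
      unfolding Pw by (subst norm_restr_square, simp, rule integral_cong_AE, simp, simp,
        use AE_lborel_singleton[of "\<tau>-h"] in eventually_elim) (use t in \<open>auto simp: indicator_def\<close>)
    also have "\<dots> = (LINT x|lborel. indicator {0<..<\<tau>-h} x * (norm (rep y x))\<^sup>2)
        + (LINT x|lborel. indicator {\<tau>-h<..<\<tau>} x * (norm (rep y x))\<^sup>2)"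
      by (rule Bochner_Integration.integral_add) (auto intro!: i)
    finally show ?thesis by (simp add: norm_restr_square)
  qed
  show ?thesis using 1 2 3 4 by (simp add: y_def)
qed

text \<open>The left side is what (u(\<tau>), p k) should be. It is the limit of means of (P u, p k)
  over (\<tau> - h, \<tau>); the local energy bound contributes sqrt h and the norm of the constant
  p k another sqrt h, against the factor 1/h.\<close>

lemma source_bound:
  assumes u: "weak_eq u g" and t: "0 \<le> \<tau>" "\<tau> \<le> T" and k: "k \<in> S"
  shows "\<bar>g \<bullet> tens {0<..<\<tau>} k\<bar> \<le> sqrt (2 * (norm g * norm u)) * norm (p k)"
proof (cases "\<tau> = 0")
  case True
  have "tens {0<..<\<tau>} k = 0" by (simp add: True tens_def toL_0)
  then show ?thesis by simp
next
  case False
  then have t0: "\<tau> > 0" using t by simp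
  let ?B = "sqrt (2 * (norm g * norm u)) * norm (p k)"
  let ?x = "\<lambda>h. (1/h) *\<^sub>R Jop T (tens {\<tau>-h<..<\<tau>} k)"
  have le: "\<bar>g \<bullet> ?x h\<bar> \<le> ?B" if h: "0 < h" "h < \<tau>" for h
  proof -
    let ?A = "{\<tau>-h<..<\<tau>}"
    have "tens ?A k \<in> V" by (rule V_tens[OF k]) (use h t in auto)
    then have "g \<bullet> Jop T (tens ?A k) = P u \<bullet> P (tens ?A k)" using u by (simp add: weak_eq_def)
    also have "P (tens ?A k) = tens ?A (p k)"
      by (rule lmap_tens[OF p]) (simp_all add: emeasure_Ioo_finite[simplified])
    also have "tens ?A (p k) = restr ?A (tens ?A (p k))"
    proof (rule l2_eqI, use rep_restr[of ?A "tens ?A (p k)", simplified]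
        rep_tens[of ?A "p k", OF _ emeasure_Ioo_finite, simplified] in eventually_elim)
      case (elim x) then show ?case by (auto simp: indicator_def)
    qed
    also have "P u \<bullet> restr ?A (tens ?A (p k)) = restr ?A (P u) \<bullet> tens ?A (p k)" by (simp add: restr_adj)
    finally have "\<bar>g \<bullet> Jop T (tens ?A k)\<bar> \<le> norm (restr ?A (P u)) * norm (tens ?A (p k))"
      by (simp add: Cauchy_Schwarz_ineq2)
    also have "\<dots> \<le> sqrt (2 * h * (norm g * norm u)) * (sqrt h * norm (p k))"
    proof (rule mult_mono)
      show "norm (restr ?A (P u)) \<le> sqrt (2 * h * (norm g * norm u))"
        by (rule real_le_rsqrt[OF energy_interval[OF u h t(2)]])
      have "(norm (tens ?A (p k)))\<^sup>2 = h * (norm (p k))\<^sup>2"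
        using h by (subst norm_tens) (simp_all add: emeasure_Ioo_finite[simplified])
      then have "norm (tens ?A (p k)) = sqrt (h * (norm (p k))\<^sup>2)" by (metis norm_ge_zero real_sqrt_unique)
      then show "norm (tens ?A (p k)) \<le> sqrt h * norm (p k)" by (simp add: real_sqrt_mult)
    qed (use h in auto)
    also have "\<dots> = h * ?B"
    proof -
      have "sqrt (2 * h * (norm g * norm u)) = sqrt h * sqrt (2 * (norm g * norm u))"
        by (simp add: real_sqrt_mult mult_ac)
      then show ?thesis using h by (simp add: mult_ac)
    qed
    finally show ?thesis using h by (simp add: field_simps)
  qed
  have "(?x \<longlongrightarrow> tens {0<..<\<tau>} k) (at_right 0)"
  proof (rule tendsto_if_square_le[where r = "\<lambda>h. h" and c = "(norm k)\<^sup>2"])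
    have "\<forall>\<^sub>F h in at_right 0. h < \<tau>" "\<forall>\<^sub>F h in at_right 0. (0::real) < h"
      using t0 by (auto intro: eventually_at_right_less simp: eventually_at_right[of 0 \<tau>])
    then show "\<forall>\<^sub>F h in at_right 0. (norm (?x h - tens {0<..<\<tau>} k))\<^sup>2 \<le> 4 * h * (norm k)\<^sup>2"
    proof eventually_elim
      case (elim h)
      then show ?case using Jop_tens_approx[of "\<tau> - h" h T \<tau> k] t by simp
    qed
  qed (rule tendsto_ident_at)
  then have "((\<lambda>h. \<bar>g \<bullet> ?x h\<bar>) \<longlongrightarrow> \<bar>g \<bullet> tens {0<..<\<tau>} k\<bar>) (at_right 0)" by (intro tendsto_intros)
  moreover have "\<forall>\<^sub>F h in at_right 0. \<bar>g \<bullet> ?x h\<bar> \<le> ?B"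
  proof -
    have "\<forall>\<^sub>F h in at_right 0. h < \<tau>" "\<forall>\<^sub>F h in at_right 0. (0::real) < h"
      using t0 by (auto intro: eventually_at_right_less simp: eventually_at_right[of 0 \<tau>])
    then show ?thesis by eventually_elim (rule le)
  qed
  ultimately show ?thesis by (rule tendsto_upperbound) simp
qed

text \<open>The translation is moved onto the test function, where it commutes with J. The gap (0,
  a) left by moving u to later times is filled with zeros, in accordance with the initial value
  0.\<close>

lemma weak_eq_shift:
  assumes u: "weak_eq u g" and g: "supported T g" and a: "a \<ge> 0"
  shows "weak_eq (u - shift T (- a) u) (g - shift T (- a) g)"
proof -
  have uV: "u \<in> V" using u by (simp add: weak_eq_def)
  have "P (u - shift T (- a) u) \<bullet> P \<omega> = (g - shift T (- a) g) \<bullet> Jop T \<omega>" if w: "\<omega> \<in> V" for \<omega>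
  proof -
    have "shift T (- a) (P u) \<bullet> P \<omega> = P u \<bullet> shift T a (P \<omega>)"
      using shift_adj[OF supported_lmap[OF p V_supported[OF uV]] supported_lmap[OF p V_supported[OF w]], of "- a"] by simp
    then have "P (u - shift T (- a) u) \<bullet> P \<omega> = P u \<bullet> P (\<omega> - shift T a \<omega>)"
      by (simp add: lmap_diff[OF p] lmap_shift[OF p] inner_diff_left inner_diff_right)
    also have "\<dots> = g \<bullet> Jop T (\<omega> - shift T a \<omega>)" using u V_diff[OF w V_shift[OF w]] by (simp add: weak_eq_def)
    also have "\<dots> = g \<bullet> Jop T \<omega> - g \<bullet> shift T a (Jop T \<omega>)"
      by (simp add: Jop_diff Jop_shift[OF V_supported[OF w] a] inner_diff_right)
    also have "g \<bullet> shift T a (Jop T \<omega>) = shift T (- a) g \<bullet> Jop T \<omega>"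
      using shift_adj[OF g supported_Jop, of "- a" \<omega>] by simp
    finally show ?thesis by (simp add: inner_diff_left)
  qed
  then show ?thesis using V_diff[OF uV V_shift[OF uV]] by (simp add: weak_eq_def)
qed

lemma shift_tens:
  assumes "0 \<le> a" "a \<le> t" "t \<le> T"
  shows "shift T a (tens {0<..<t} k) = tens {0<..<t-a} k"
proof -
  have r: "AE x in lborel. rep (tens {0<..<s} k) x = indicator {0<..<s} x *\<^sub>R k" for s :: real
    by (rule rep_tens) (simp_all add: emeasure_Ioo_finite[simplified])
  show ?thesis
  proof (rule l2_eqI, use rep_shift[of T a "tens {0<..<t} k"] AE_translate[OF r[of t], of a] r[of "t-a"] in eventually_elim)
    case (elim x) then show ?case using assms by (auto simp: indicator_def)
  qed
qed

text \<open>The candidate for u(\<tau>). The bound of \<open>source_bound\<close> involves k through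
  p k alone, which makes the pairing with g a well-defined bounded functional on the image of
  S.\<close>

lemma primitive_exists:
  assumes u: "weak_eq u g" and t: "0 \<le> \<tau>" "\<tau> \<le> T"
  shows "\<exists>z\<in>closure (p ` S). \<forall>k\<in>S. z \<bullet> p k = g \<bullet> tens {0<..<\<tau>} k"
proof -
  let ?C = "sqrt (2 * (norm g * norm u))"
  have lin: "linear p" using p by (rule bounded_linear.linear)
  define sel where "sel x = (SOME k. k \<in> S \<and> p k = x)" for x
  have sel: "sel x \<in> S" "p (sel x) = x" if "x \<in> p ` S" for x
    using someI_ex[of "\<lambda>k. k \<in> S \<and> p k = x"] that unfolding sel_def[symmetric] by auto
  have I: "{0<..<\<tau>} \<in> sets borel" "emeasure lborel {0<..<\<tau>} < \<infinity>" using emeasure_Ioo_finite by auto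
  have F: "g \<bullet> tens {0<..<\<tau>} k = (LINT x:{0<..<\<tau>}|lborel. rep g x) \<bullet> k" for k by (rule inner_tens[OF I])
  have wd: "g \<bullet> tens {0<..<\<tau>} k = g \<bullet> tens {0<..<\<tau>} k'" if "k \<in> S" "k' \<in> S" "p k = p k'" for k k'
  proof -
    have "\<bar>g \<bullet> tens {0<..<\<tau>} (k - k')\<bar> \<le> ?C * norm (p (k - k'))"
      by (rule source_bound[OF u t]) (simp add: that subspace_diff[OF S])
    then show ?thesis using that by (simp add: linear_diff[OF lin] F inner_diff_right)
  qed
  have sub: "subspace (p ` S)" using lin S by (rule linear_subspace_image)
  have "\<exists>z\<in>closure (p ` S). \<forall>x\<in>p ` S. z \<bullet> x = g \<bullet> tens {0<..<\<tau>} (sel x)"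
  proof (rule riesz_on_subspace[OF sub, where C = ?C])
    fix x y assume xy: "x \<in> p ` S" "y \<in> p ` S"
    have "g \<bullet> tens {0<..<\<tau>} (sel (x + y)) = g \<bullet> tens {0<..<\<tau>} (sel x + sel y)"
      by (rule wd) (use sel[of x] sel[of y] sel[of "x + y"] xy in \<open>auto simp: subspace_add[OF sub] subspace_add[OF S] linear_add[OF lin]\<close>)
    then show "g \<bullet> tens {0<..<\<tau>} (sel (x + y)) = g \<bullet> tens {0<..<\<tau>} (sel x) + g \<bullet> tens {0<..<\<tau>} (sel y)"
      by (simp add: F inner_add_right)
  next
    fix c x assume x: "x \<in> p ` S"
    have "g \<bullet> tens {0<..<\<tau>} (sel (c *\<^sub>R x)) = g \<bullet> tens {0<..<\<tau>} (c *\<^sub>R sel x)"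
      by (rule wd) (use sel[of x] sel[of "c *\<^sub>R x"] x in \<open>auto simp: subspace_scale[OF sub] subspace_scale[OF S] linear_cmul[OF lin]\<close>)
    then show "g \<bullet> tens {0<..<\<tau>} (sel (c *\<^sub>R x)) = c * (g \<bullet> tens {0<..<\<tau>} (sel x))" by (simp add: F)
  next
    fix x assume "x \<in> p ` S"
    then show "\<bar>g \<bullet> tens {0<..<\<tau>} (sel x)\<bar> \<le> ?C * norm x"
      using source_bound[OF u t sel(1), of x] sel(2)[of x] by simp
  qed
  then obtain z where z: "z \<in> closure (p ` S)" "\<forall>x\<in>p ` S. z \<bullet> x = g \<bullet> tens {0<..<\<tau>} (sel x)" by blast
  have "z \<bullet> p k = g \<bullet> tens {0<..<\<tau>} k" if "k \<in> S" for k
  proof -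
    have "z \<bullet> p k = g \<bullet> tens {0<..<\<tau>} (sel (p k))" using z(2) that by blast
    also have "\<dots> = g \<bullet> tens {0<..<\<tau>} k" by (rule wd) (use sel[of "p k"] that in auto)
    finally show ?thesis .
  qed
  then show ?thesis using z(1) by blast
qed

text \<open>Z t represents g integrated over (0, t). Its increment from s to t is the value at t
  belonging to the difference of u and its translate by t - s, so continuity of translations in L_2
  makes Z continuous. That Z agrees with P u is seen by differentiating the integrals of (P u, p
  k).\<close>

lemma continuous_representative:
  assumes u: "weak_eq u g" and g: "supported T g"
  shows "\<exists>Z. continuous_on {0..T} Z \<and> Z 0 = 0 \<and> (AE t in lborel. t \<in> {0<..<T} \<longrightarrow> p (rep u t) = Z t)"
proof -
  have uV: "u \<in> V" using u by (simp add: weak_eq_def)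
  let ?R = "closure (p ` S)"
  have lin: "linear p" using p by (rule bounded_linear.linear)
  have Rsub: "subspace ?R" by (rule subspace_closure[OF linear_subspace_image[OF lin S]])
  have "\<forall>t\<in>{0..T}. \<exists>z. z \<in> ?R \<and> (\<forall>k\<in>S. z \<bullet> p k = g \<bullet> tens {0<..<t} k)"
  proof
    fix t assume "t \<in> {0..T}"
    then have "0 \<le> t" "t \<le> T" by auto
    from primitive_exists[OF u this] show "\<exists>z. z \<in> ?R \<and> (\<forall>k\<in>S. z \<bullet> p k = g \<bullet> tens {0<..<t} k)"
      by (simp only: Bex_def)
  qed
  from bchoice[OF this] obtain Z where ZR: "\<And>t. t \<in> {0..T} \<Longrightarrow> Z t \<in> ?R"
    and Zk: "\<And>t k. t \<in> {0..T} \<Longrightarrow> k \<in> S \<Longrightarrow> Z t \<bullet> p k = g \<bullet> tens {0<..<t} k" by blast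
  have Z0: "Z 0 = 0"
  proof -
    have "norm (Z 0) \<le> 0"
    proof (rule norm_le_if_inner_le[OF ZR])
      fix x assume "x \<in> p ` S"
      then show "\<bar>Z 0 \<bullet> x\<bar> \<le> 0 * norm x" using Zk[of 0] T by (auto simp: tens_def toL_0)
    qed (use T in auto)
    then show ?thesis by simp
  qed
  \<comment> \<open>\<open>source_bound\<close> for u minus its translate, whose source is g minus
    its translate. Of the two norms under the root only that of the source gets small; the other is
    at most 2 |u|.\<close>
  have est: "norm (Z t - Z s) \<le> sqrt (4 * norm u * norm (g - shift T (- (t - s)) g))"
    if st: "0 \<le> s" "s \<le> t" "t \<le> T" for s t
  proof -
    define a where "a = t - s"
    have a: "a \<ge> 0" "a \<le> t" "t - a = s" using st by (auto simp: a_def)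
    let ?g = "g - shift T (- a) g" and ?u = "u - shift T (- a) u"
    have we: "weak_eq ?u ?g" by (rule weak_eq_shift[OF u g a(1)])
    have "norm (Z t - Z s) \<le> sqrt (2 * (norm ?g * norm ?u))"
    proof (rule norm_le_if_inner_le[where X = "p ` S"])
      show "Z t - Z s \<in> ?R" using ZR[of t] ZR[of s] st by (intro subspace_diff[OF Rsub]) auto
      fix x assume "x \<in> p ` S"
      then obtain k where k: "k \<in> S" "x = p k" by blast
      have "shift T (- a) g \<bullet> tens {0<..<t} k = g \<bullet> tens {0<..<s} k"
        using shift_adj[OF g V_supported[OF V_tens[OF k(1)]], of 0 t "- a"] shift_tens[OF a(1,2) st(3), of k] st a(3)
        by simp
      then have "(Z t - Z s) \<bullet> x = ?g \<bullet> tens {0<..<t} k"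
        using Zk[of t k] Zk[of s k] st k by (simp add: inner_diff_left)
      then show "\<bar>(Z t - Z s) \<bullet> x\<bar> \<le> sqrt (2 * (norm ?g * norm ?u)) * norm x"
        using source_bound[OF we _ _ k(1), of t] st k(2) by simp
    qed simp
    also have "\<dots> \<le> sqrt (4 * norm u * norm ?g)"
    proof (rule real_sqrt_le_mono)
      have "norm ?u \<le> norm u + norm (shift T (- a) u)" by (rule norm_triangle_ineq4)
      also have "\<dots> \<le> 2 * norm u" using norm_shift[of T "- a" u] by simp
      finally have "norm ?g * norm ?u \<le> norm ?g * (2 * norm u)" by (intro mult_left_mono) auto
      then show "2 * (norm ?g * norm ?u) \<le> 4 * norm u * norm ?g" by (simp add: algebra_simps)
    qed
    finally show ?thesis by (simp add: a_def)
  qed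
  have cont: "continuous_on {0..T} Z"
    unfolding continuous_on_iff
  proof (intro ballI allI impI)
    fix t e assume t: "t \<in> {0..T}" and e: "e > (0::real)"
    define e' where "e' = e\<^sup>2 / (4 * norm u + 1)"
    have pos: "4 * norm u + 1 > 0" using norm_ge_zero[of u] by linarith
    have e': "e' > 0" unfolding e'_def using e pos by simp
    have "((\<lambda>h. shift T h g) \<longlongrightarrow> g) (at 0)" using shift_tendsto[of T g] g by (simp add: supported_def)
    from tendstoD[OF this e'] obtain d where d: "d > 0" "\<And>h. h \<noteq> 0 \<Longrightarrow> \<bar>h\<bar> < d \<Longrightarrow> norm (g - shift T h g) < e'"
      unfolding eventually_at by (auto simp: dist_norm norm_minus_commute)
    have main: "norm (Z b - Z a) < e" if ab: "0 \<le> a" "a < b" "b \<le> T" "b - a < d" for a b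
    proof -
      have "norm (g - shift T (- (b - a)) g) < e'" by (rule d(2)) (use ab in auto)
      then have "4 * norm u * norm (g - shift T (- (b - a)) g) \<le> 4 * norm u * e'" by (intro mult_left_mono) auto
      also have "\<dots> < (4 * norm u + 1) * e'" using e' by (simp add: algebra_simps)
      also have "\<dots> = e\<^sup>2" using pos by (simp add: e'_def)
      finally have "sqrt (4 * norm u * norm (g - shift T (- (b - a)) g)) < sqrt (e\<^sup>2)" by (rule real_sqrt_less_mono)
      then show ?thesis using est[of a b] ab e by simp
    qed
    have "dist (Z t') (Z t) < e" if t': "t' \<in> {0..T}" "dist t' t < d" for t'
    proof (cases t' t rule: linorder_cases)
      case less
      then show ?thesis using main[of t' t] t t' by (simp add: dist_norm dist_real_def norm_minus_commute)
    next
      case equal then show ?thesis using e by simp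
    next
      case greater
      then show ?thesis using main[of t t'] t t' by (simp add: dist_norm dist_real_def)
    qed
    then show "\<exists>d>0. \<forall>t'\<in>{0..T}. dist t' t < d \<longrightarrow> dist (Z t') (Z t) < e" using d(1) by blast
  qed
  define zf where "zf t = indicator {0<..<T} t *\<^sub>R Z t" for t
  have sqz: "sq_int zf"
  proof -
    obtain B where B: "\<And>t. t \<in> {0..T} \<Longrightarrow> norm (Z t) \<le> B"
      using compact_imp_bounded[OF compact_continuous_image[OF cont compact_Icc]] unfolding bounded_iff
      by (metis imageI)
    have [measurable]: "zf \<in> borel_measurable borel"
      unfolding zf_def by (rule borel_measurable_continuous_on_indicator) (auto intro: continuous_on_subset[OF cont])
    show ?thesis
    proof (rule sq_int_bound[where g = "\<lambda>t. indicator {0<..<T} t * B\<^sup>2"])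
      show "integrable lborel (\<lambda>t. indicator {0<..<T} t * B\<^sup>2)" using emeasure_Ioo_finite[of 0 T] by simp
      show "AE t in lborel. (norm (zf t))\<^sup>2 \<le> indicator {0<..<T} t * B\<^sup>2"
        by (rule AE_I2) (auto simp: zf_def indicator_def intro!: power_mono B)
    qed simp
  qed
  \<comment> \<open>The primitive of (P u, p k). Its difference quotients are g tested with ramps,
    which tend to the pairing that defines (Z t, p k), so the fundamental theorem of calculus
    applies to m.\<close>
  define m where "m k t = P u \<bullet> tens {0<..<t} (p k)" for k t
  have minc: "m k (s + h) - m k s = g \<bullet> Jop T (tens {s<..<s+h} k)"
    if k: "k \<in> S" and s: "0 \<le> s" "0 \<le> h" "s + h \<le> T" for k s h
  proof -
    have "m k (s + h) - m k s = P u \<bullet> tens {s<..<s+h} (p k)"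
      unfolding m_def using tens_split[of 0 s "s + h" "p k"] s by (simp add: inner_add_right)
    also have "tens {s<..<s+h} (p k) = P (tens {s<..<s+h} k)"
      by (rule lmap_tens[OF p, symmetric]) (simp_all add: emeasure_Ioo_finite[simplified])
    also have "P u \<bullet> P (tens {s<..<s+h} k) = g \<bullet> Jop T (tens {s<..<s+h} k)"
      using u V_tens[OF k, of s "s + h"] s by (simp add: weak_eq_def)
    finally show ?thesis .
  qed
  have approx: "\<bar>(m k (s + h) - m k s) / h - Z s' \<bullet> p k\<bar> \<le> norm g * sqrt (4 * h * (norm k)\<^sup>2)"
    if k: "k \<in> S" and s: "0 \<le> s" "0 < h" "s + h \<le> T" "s \<le> s'" "s' \<le> s + h" for k s h s'
  proof -
    have "(m k (s + h) - m k s) / h - Z s' \<bullet> p k = g \<bullet> ((1/h) *\<^sub>R Jop T (tens {s<..<s+h} k) - tens {0<..<s'} k)"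
      using minc[OF k s(1) _ s(3)] Zk[of s' k] k s by (simp add: inner_diff_right)
    also have "\<bar>\<dots>\<bar> \<le> norm g * norm ((1/h) *\<^sub>R Jop T (tens {s<..<s+h} k) - tens {0<..<s'} k)"
      by (rule Cauchy_Schwarz_ineq2)
    also have "\<dots> \<le> norm g * sqrt (4 * h * (norm k)\<^sup>2)"
      by (intro mult_left_mono real_le_rsqrt Jop_tens_approx) (use s in auto)
    finally show ?thesis .
  qed
  have deriv: "(m k has_real_derivative Z t \<bullet> p k) (at t within {0..T})" if k: "k \<in> S" and t: "t \<in> {0..T}" for k t
    unfolding has_field_derivative_iff
  proof (rule LIM_zero_cancel, rule Lim_null_comparison)
    show "\<forall>\<^sub>F t' in at t within {0..T}. norm ((m k t' - m k t) / (t' - t) - Z t \<bullet> p k) \<le> norm g * sqrt (4 * \<bar>t' - t\<bar> * (norm k)\<^sup>2)"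
      unfolding eventually_at
    proof (intro exI[of _ 1] conjI ballI impI, simp)
      fix t' assume "t' \<in> {0..T}" "t' \<noteq> t \<and> dist t' t < 1"
      then consider "t < t'" | "t' < t" by linarith
      then show "norm ((m k t' - m k t) / (t' - t) - Z t \<bullet> p k) \<le> norm g * sqrt (4 * \<bar>t' - t\<bar> * (norm k)\<^sup>2)"
      proof cases
        case 1
        then show ?thesis using approx[OF k, of t "t' - t" t] t \<open>t' \<in> {0..T}\<close> by simp
      next
        case 2
        have "(m k t' - m k t) / (t' - t) = (m k t - m k t') / (t - t')"
          by (metis minus_diff_eq minus_divide_divide)
        then show ?thesis using approx[OF k, of t' "t - t'" t] 2 t \<open>t' \<in> {0..T}\<close> by simp
      qed
    qed
    have "((\<lambda>t'. norm g * sqrt (4 * \<bar>t' - t\<bar> * (norm k)\<^sup>2)) \<longlongrightarrow> norm g * sqrt (4 * \<bar>t - t\<bar> * (norm k)\<^sup>2)) (at t within {0..T})"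
      by (intro tendsto_intros)
    then show "((\<lambda>t'. norm g * sqrt (4 * \<bar>t' - t\<bar> * (norm k)\<^sup>2)) \<longlongrightarrow> 0) (at t within {0..T})" by simp
  qed
  have ftc: "(LINT x:{a..b}|lborel. Z x \<bullet> p k) = m k b - m k a" if k: "k \<in> S" and ab: "0 \<le> a" "a \<le> b" "b \<le> T" for a b k
  proof -
    have c: "continuous_on {a..b} (\<lambda>x. Z x \<bullet> p k)"
      using ab by (intro continuous_intros continuous_on_subset[OF cont]) auto
    have "((\<lambda>x. Z x \<bullet> p k) has_integral (m k b - m k a)) {a..b}"
    proof (rule fundamental_theorem_of_calculus[OF ab(2)])
      fix x assume "x \<in> {a..b}"
      then have "(m k has_real_derivative Z x \<bullet> p k) (at x within {a..b})"
        using ab by (intro has_field_derivative_subset[OF deriv[OF k]]) auto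
      then show "(m k has_vector_derivative Z x \<bullet> p k) (at x within {a..b})"
        by (simp add: has_real_derivative_iff_has_vector_derivative)
    qed
    moreover have "(LINT x:{a..b}|lborel. Z x \<bullet> p k) = integral {a..b} (\<lambda>x. Z x \<bullet> p k)"
      by (rule set_borel_integral_eq_integral(2)[OF borel_integrable_atLeastAtMost'[OF c]])
    ultimately show ?thesis by (simp add: integral_unique)
  qed
  define d where "d = P u - toL zf"
  have tAE: "AE x in lborel. rep (tens {a<..<b} k) x = indicator {a<..<b} x *\<^sub>R k" for a b :: real and k :: 'h
    by (rule rep_tens) (simp_all add: emeasure_Ioo_finite[simplified])
  have orth0: "d \<bullet> tens {a<..<b} (p k) = 0" if k: "k \<in> S" and ab: "0 \<le> a" "a \<le> b" "b \<le> T" for a b k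
  proof -
    have "toL zf \<bullet> tens {a<..<b} (p k) = (LINT x|lborel. zf x \<bullet> (indicator {a<..<b} x *\<^sub>R p k))"
      unfolding tens_def by (rule inner_toL[OF sqz sq_int_const_on]) (simp_all add: emeasure_Ioo_finite[simplified])
    also have "\<dots> = (LINT x:{a..b}|lborel. Z x \<bullet> p k)"
      unfolding set_lebesgue_integral_def
    proof (rule integral_cong_AE)
      have "(\<lambda>x. indicator {a..b} x *\<^sub>R (Z x \<bullet> p k)) \<in> borel_measurable borel"
        by (rule borel_measurable_continuous_on_indicator) (use ab in \<open>auto intro!: continuous_intros continuous_on_subset[OF cont]\<close>)
      then show "(\<lambda>x. indicator {a..b} x *\<^sub>R (Z x \<bullet> p k)) \<in> borel_measurable lborel" by simp
      show "(\<lambda>x. zf x \<bullet> (indicator {a<..<b} x *\<^sub>R p k)) \<in> borel_measurable lborel"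
        using sqz by (auto simp: sq_int_def)
      show "AE x in lborel. zf x \<bullet> (indicator {a<..<b} x *\<^sub>R p k) = indicator {a..b} x *\<^sub>R (Z x \<bullet> p k)"
        using AE_lborel_singleton[of a] AE_lborel_singleton[of b]
        by eventually_elim (use ab in \<open>auto simp: zf_def indicator_def\<close>)
    qed
    also have "\<dots> = m k b - m k a" by (rule ftc[OF k ab])
    also have "\<dots> = P u \<bullet> tens {a<..<b} (p k)"
      unfolding m_def using tens_split[of 0 a b "p k"] ab by (simp add: inner_add_right)
    finally show ?thesis by (simp add: d_def inner_diff_left)
  qed
  have zfs: "supported T (toL zf)"
    by (rule supportedI, use rep_toL[OF sqz] in \<open>eventually_elim, simp add: zf_def\<close>)
  have ds: "supported T d"
    unfolding d_def by (intro supported_diff supported_lmap[OF p] V_supported uV zfs)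
  have orth: "d \<bullet> tens {a<..<b} (p k) = 0" if k: "k \<in> S" for a b k
  proof -
    \<comment> \<open>An arbitrary interval is clipped to (0, T); the outer maximum keeps
      \<open>?a \<le> ?b\<close> when nothing of it is left.\<close>
    let ?a = "max 0 a" and ?b = "max (max 0 a) (min T b)"
    have "restr {0<..<T} (tens {a<..<b} (p k)) = tens {?a<..<?b} (p k)"
    proof (rule l2_eqI, use rep_restr[of "{0<..<T}" "tens {a<..<b} (p k)", simplified] tAE[of a b "p k"] tAE[of ?a ?b "p k"] in eventually_elim)
      case (elim x) then show ?case by (auto simp: indicator_def)
    qed
    then have "d \<bullet> tens {a<..<b} (p k) = d \<bullet> tens {?a<..<?b} (p k)"
      using inner_restr_supported[OF ds, of "tens {a<..<b} (p k)"] by simp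
    also have "\<dots> = 0"
    proof (cases "max 0 a \<le> T")
      case True then show ?thesis by (intro orth0[OF k]) auto
    next
      case False
      then have "{?a<..<?b} = {}" by auto
      then show ?thesis by (simp add: tens_def toL_0)
    qed
    finally show ?thesis .
  qed
  have "AE t in lborel. \<forall>n\<in>?R. rep d t \<bullet> n = 0"
    by (rule AE_inner_zero_on_set) (use orth in auto)
  then have "AE t in lborel. t \<in> {0<..<T} \<longrightarrow> p (rep u t) = Z t"
    using rep_diff[of "P u" "toL zf"] rep_toL[OF sqz] rep_lmap[OF p, of u] V_S[OF uV]
  proof eventually_elim
    case (elim t)
    show ?case
    proof
      assume t: "t \<in> {0<..<T}"
      have dt: "rep d t = p (rep u t) - Z t" using elim t by (simp add: d_def zf_def)
      have "p (rep u t) \<in> ?R" by (rule subsetD[OF closure_subset]) (use elim(5) in simp)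
      moreover have "Z t \<in> ?R" using ZR t by simp
      ultimately have "rep d t \<in> ?R" unfolding dt by (rule subspace_diff[OF Rsub])
      then have "rep d t \<bullet> rep d t = 0" using elim(1) by blast
      then show "p (rep u t) = Z t" using dt by simp
    qed
  qed
  then show ?thesis using cont Z0 by blast
qed

end

section \<open>Smooth functions\<close>

lemma pd_eqI: "(f has_derivative f') (at x) \<Longrightarrow> pd f v x = f' v"
  unfolding pd_def by (simp add: frechet_derivative_at[symmetric])

lemma smooth_fun_differentiable: "smooth_fun f \<Longrightarrow> f differentiable (at x)"
  by (auto elim: smooth_fun.cases)

lemma smooth_fun_pd: "smooth_fun f \<Longrightarrow> i \<in> Basis \<Longrightarrow> smooth_fun (pd f i)"
  by (auto elim: smooth_fun.cases)

lemma smooth_fun_has_derivative: "smooth_fun f \<Longrightarrow> (f has_derivative (\<lambda>v. pd f v x)) (at x)"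
  using smooth_fun_differentiable[of f x] unfolding pd_def by (simp add: frechet_derivative_works)

lemma smooth_fun_continuous: "smooth_fun f \<Longrightarrow> continuous_on A f"
  using smooth_fun_differentiable
  by (intro continuous_at_imp_continuous_on ballI differentiable_imp_continuous_within)

lemma smooth_fun_measurable: "smooth_fun f \<Longrightarrow> f \<in> borel_measurable borel"
  by (intro borel_measurable_continuous_onI smooth_fun_continuous)

lemma smooth_fun_coinduct:
  assumes "X f" "\<And>f x. X f \<Longrightarrow> f differentiable (at x)" "\<And>f i. X f \<Longrightarrow> i \<in> Basis \<Longrightarrow> X (pd f i)"
  shows "smooth_fun f"
  by (rule smooth_fun.coinduct[of X, OF assms(1)]) (use assms(2,3) in blast)

lemma pd_linear: "f differentiable (at x) \<Longrightarrow> linear (\<lambda>v. pd f v x)"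
  unfolding pd_def by (simp add: linear_frechet_derivative)

lemma pd_real: "f differentiable (at x) \<Longrightarrow> pd f (v::real) x = v * pd f 1 x"
  using linear_cmul[OF pd_linear, of f x v 1] by simp

text \<open>Serves as coinduction invariant for \<open>smooth_fun\<close>: the derivative of a
  product, an inverse or a composite does not have the same shape, but it stays in this
  closure.\<close>

inductive smooth_alg :: "('a::euclidean_space \<Rightarrow> real) \<Rightarrow> bool" where
  base: "smooth_fun f \<Longrightarrow> smooth_alg f"
| add: "smooth_alg f \<Longrightarrow> smooth_alg g \<Longrightarrow> smooth_alg (\<lambda>x. f x + g x)"
| mult: "smooth_alg f \<Longrightarrow> smooth_alg g \<Longrightarrow> smooth_alg (\<lambda>x. f x * g x)"
| inv: "smooth_alg f \<Longrightarrow> (\<And>x. f x \<noteq> 0) \<Longrightarrow> smooth_alg (\<lambda>x. inverse (f x))"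
| comp: "smooth_fun (h :: real \<Rightarrow> real) \<Longrightarrow> smooth_alg f \<Longrightarrow> smooth_alg (\<lambda>x. h (f x))"

lemma smooth_fun_const: "smooth_fun (\<lambda>x. c)"
proof (rule smooth_fun_coinduct[of "\<lambda>f. \<exists>c. f = (\<lambda>x. c)"])
  fix f :: "'a \<Rightarrow> real" and i assume "\<exists>c. f = (\<lambda>x. c)"
  then have "pd f i = (\<lambda>x. 0)" by (auto intro!: ext pd_eqI[where f' = "\<lambda>v. 0"])
  then show "\<exists>c. pd f i = (\<lambda>x. c)" by blast
qed auto

lemma smooth_fun_bounded_linear: assumes "bounded_linear f" shows "smooth_fun f"
proof (rule smooth_fun.intros)
  have d: "(f has_derivative f) (at x)" for x by (rule bounded_linear_imp_has_derivative[OF assms])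
  then show "\<forall>x. f differentiable (at x)" by (auto simp: differentiable_def)
  have "pd f i = (\<lambda>x. f i)" for i by (rule ext) (rule pd_eqI[OF d])
  then show "\<forall>i\<in>Basis. smooth_fun (pd f i)" by (simp add: smooth_fun_const)
qed

lemma smooth_alg_step:
  "smooth_alg f \<Longrightarrow> (\<forall>x. f differentiable (at x)) \<and> (\<forall>i\<in>Basis. smooth_alg (pd f i))"
proof (induction rule: smooth_alg.induct)
  case (base f)
  then show ?case by (auto intro: smooth_alg.base smooth_fun_pd smooth_fun_differentiable)
next
  case (add f g)
  have d: "(f has_derivative (\<lambda>v. pd f v x)) (at x)" "(g has_derivative (\<lambda>v. pd g v x)) (at x)" for x
    using add.IH unfolding pd_def by (auto simp: frechet_derivative_works)
  have "pd (\<lambda>x. f x + g x) i = (\<lambda>x. pd f i x + pd g i x)" for i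
    by (rule ext) (rule pd_eqI[OF has_derivative_add[OF d]])
  then show ?case using add.IH by (auto intro: smooth_alg.add differentiable_add)
next
  case (mult f g)
  have d: "(f has_derivative (\<lambda>v. pd f v x)) (at x)" "(g has_derivative (\<lambda>v. pd g v x)) (at x)" for x
    using mult.IH unfolding pd_def by (auto simp: frechet_derivative_works)
  have "pd (\<lambda>x. f x * g x) i = (\<lambda>x. f x * pd g i x + pd f i x * g x)" for i
    by (rule ext) (rule pd_eqI[OF has_derivative_mult[OF d]])
  then show ?case using mult.IH mult.hyps by (auto intro!: smooth_alg.add smooth_alg.mult differentiable_mult)
next
  case (inv f)
  have d: "(f has_derivative (\<lambda>v. pd f v x)) (at x)" for x
    using inv.IH unfolding pd_def by (auto simp: frechet_derivative_works)
  have di: "((\<lambda>x. inverse (f x)) has_derivative (\<lambda>v. - (inverse (f x) * pd f v x * inverse (f x)))) (at x)" for x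
    by (rule Deriv.has_derivative_inverse[OF inv.hyps(2) d])
  have "pd (\<lambda>x. inverse (f x)) i = (\<lambda>x. (- 1) * (inverse (f x) * pd f i x * inverse (f x)))" for i
    by (rule ext) (simp add: pd_eqI[OF di])
  moreover have "smooth_alg (\<lambda>x. (- 1) * (inverse (f x) * pd f i x * inverse (f x)))" if "i \<in> Basis" for i
    using inv that by (intro smooth_alg.mult smooth_alg.inv smooth_alg.base[OF smooth_fun_const]) auto
  ultimately show ?case using di by (auto simp: differentiable_def)
next
  case (comp h f)
  have d: "(f has_derivative (\<lambda>v. pd f v x)) (at x)" for x
    using comp.IH unfolding pd_def by (auto simp: frechet_derivative_works)
  have dc: "((\<lambda>x. h (f x)) has_derivative (\<lambda>v. pd h (pd f v x) (f x))) (at x)" for x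
    by (rule has_derivative_compose[OF d smooth_fun_has_derivative[OF comp.hyps(1)]])
  have "pd (\<lambda>x. h (f x)) i = (\<lambda>x. pd f i x * pd h 1 (f x))" for i
    by (rule ext) (rule trans[OF pd_eqI[OF dc] pd_real[OF smooth_fun_differentiable[OF comp.hyps(1)]]])
  moreover have "smooth_alg (\<lambda>x. pd f i x * pd h 1 (f x))" if "i \<in> Basis" for i
    by (rule smooth_alg.mult[OF _ smooth_alg.comp[OF smooth_fun_pd[OF comp.hyps(1)] comp.hyps(2)]]) (use comp.IH that in auto)
  ultimately show ?case using dc by (auto simp: differentiable_def)
qed

lemma smooth_fun_alg: "smooth_alg f \<Longrightarrow> smooth_fun f"
  by (rule smooth_fun_coinduct[of smooth_alg]) (use smooth_alg_step in auto)

lemma smooth_fun_add: "smooth_fun f \<Longrightarrow> smooth_fun g \<Longrightarrow> smooth_fun (\<lambda>x. f x + g x)"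
  by (rule smooth_fun_alg, rule smooth_alg.add) (rule smooth_alg.base, assumption)+

lemma smooth_fun_mult: "smooth_fun f \<Longrightarrow> smooth_fun g \<Longrightarrow> smooth_fun (\<lambda>x. f x * g x)"
  by (rule smooth_fun_alg, rule smooth_alg.mult) (rule smooth_alg.base, assumption)+

lemma smooth_fun_inverse: "smooth_fun f \<Longrightarrow> (\<And>x. f x \<noteq> 0) \<Longrightarrow> smooth_fun (\<lambda>x. inverse (f x))"
  by (rule smooth_fun_alg, rule smooth_alg.inv, rule smooth_alg.base)

lemma smooth_fun_compose: "smooth_fun (h::real \<Rightarrow> real) \<Longrightarrow> smooth_fun f \<Longrightarrow> smooth_fun (\<lambda>x. h (f x))"
  by (rule smooth_fun_alg, rule smooth_alg.comp, assumption, rule smooth_alg.base)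

lemma smooth_fun_cmult: "smooth_fun f \<Longrightarrow> smooth_fun (\<lambda>x. c * f x)"
  by (rule smooth_fun_mult[OF smooth_fun_const])

lemma smooth_fun_diff: "smooth_fun f \<Longrightarrow> smooth_fun g \<Longrightarrow> smooth_fun (\<lambda>x. f x - g x)"
  using smooth_fun_add[OF _ smooth_fun_cmult[of g "-1"], of f] by simp

lemma smooth_fun_sum: "(\<And>i. i \<in> I \<Longrightarrow> smooth_fun (f i)) \<Longrightarrow> smooth_fun (\<lambda>x. \<Sum>i\<in>I. f i x)"
  by (induction I rule: infinite_finite_induct) (auto intro: smooth_fun_const smooth_fun_add)

lemma smooth_fun_prod: "(\<And>i. i \<in> I \<Longrightarrow> smooth_fun (f i)) \<Longrightarrow> smooth_fun (\<lambda>x. \<Prod>i\<in>I. f i x)"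
  by (induction I rule: infinite_finite_induct) (auto intro: smooth_fun_const smooth_fun_mult)

lemma smooth_fun_inner: "smooth_fun (\<lambda>x. x \<bullet> i)"
  by (rule smooth_fun_bounded_linear[OF bounded_linear_inner_left])

lemma smooth_fun_norm_square: "smooth_fun (\<lambda>x::'a::euclidean_space. (norm x)\<^sup>2)"
proof -
  have "(\<lambda>x::'a. (norm x)\<^sup>2) = (\<lambda>x. \<Sum>i\<in>Basis. (x \<bullet> i) * (x \<bullet> i))"
    by (rule ext) (simp add: power2_norm_eq_inner euclidean_inner[of x x for x])
  then show ?thesis by (simp add: smooth_fun_sum smooth_fun_mult smooth_fun_inner)
qed

lemma pd_mult:
  "f differentiable (at x) \<Longrightarrow> g differentiable (at x) \<Longrightarrow> pd (\<lambda>x. f x * g x) v x = f x * pd g v x + pd f v x * g x"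
  unfolding pd_def[of f] pd_def[of g]
  by (rule pd_eqI[OF has_derivative_mult]) (auto simp: frechet_derivative_works)

lemma pd_compose:
  assumes "smooth_fun (h::real \<Rightarrow> real)" "f differentiable (at x)"
  shows "pd (\<lambda>x. h (f x)) v x = pd h 1 (f x) * pd f v x"
proof -
  have d: "(f has_derivative (\<lambda>v. pd f v x)) (at x)"
    using assms(2) unfolding pd_def by (auto simp: frechet_derivative_works)
  show ?thesis
    using pd_eqI[OF has_derivative_compose[OF d smooth_fun_has_derivative[OF assms(1)]], of v]
      pd_real[OF smooth_fun_differentiable[OF assms(1)], of "pd f v x"] by (simp add: mult.commute)
qed

lemma pd_cong_open:
  assumes "open U" "x \<in> U" "\<And>y. y \<in> U \<Longrightarrow> f y = g y"
  shows "pd f v x = pd g v x" "g differentiable (at x) \<Longrightarrow> f differentiable (at x)"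
proof -
  have *: "(f has_derivative F) (at x) \<longleftrightarrow> (g has_derivative F) (at x)" for F
    using has_derivative_transform_within_open[of f F x UNIV U g] has_derivative_transform_within_open[of g F x UNIV U f] assms
    by auto
  show "pd f v x = pd g v x" by (simp add: pd_def frechet_derivative_def *)
  show "g differentiable (at x) \<Longrightarrow> f differentiable (at x)" by (simp add: differentiable_def *)
qed

text \<open>D and the complement of K are open and cover the space; on the first the extension is f,
  on the second it is 0. The partial derivatives have the same description, which is therefore the
  coinduction invariant.\<close>

lemma smooth_fun_extend_by_zero:
  assumes D: "open D" and K: "closed K" "K \<subseteq> D" and f: "smooth_fun f" and z: "\<And>x. x \<in> D - K \<Longrightarrow> f x = 0"
  shows "smooth_fun (\<lambda>x. if x \<in> D then f x else 0)"
proof (rule smooth_fun_coinduct[of "\<lambda>h. \<exists>f. smooth_fun f \<and> (\<forall>x\<in>D-K. f x = 0) \<and> h = (\<lambda>x. if x \<in> D then f x else 0)"])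
  show "\<exists>g. smooth_fun g \<and> (\<forall>x\<in>D-K. g x = 0) \<and> (\<lambda>x. if x \<in> D then f x else 0) = (\<lambda>x. if x \<in> D then g x else 0)"
    using f z by blast
next
  fix h :: "'a \<Rightarrow> real" assume "\<exists>f. smooth_fun f \<and> (\<forall>x\<in>D-K. f x = 0) \<and> h = (\<lambda>x. if x \<in> D then f x else 0)"
  then obtain f where f: "smooth_fun f" "\<And>x. x \<in> D - K \<Longrightarrow> f x = 0" and h: "h = (\<lambda>x. if x \<in> D then f x else 0)" by blast
  have oK: "open (- K)" using K(1) by (rule open_Compl)
  have z: "h y = 0" if "y \<in> - K" for y using that f(2) by (auto simp: h)
  show "h differentiable (at x)" for x
  proof (cases "x \<in> D")
    case True
    show ?thesis by (rule pd_cong_open(2)[OF D True _ smooth_fun_differentiable[OF f(1)]]) (simp add: h)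
  next
    case False
    then have "x \<in> - K" using K by auto
    show ?thesis by (rule pd_cong_open(2)[OF oK \<open>x \<in> - K\<close>, of h "\<lambda>x. 0"]) (use z in auto)
  qed
  fix i :: 'a assume i: "i \<in> Basis"
  have "pd h i x = (if x \<in> D then pd f i x else 0)" for x
  proof (cases "x \<in> D")
    case True
    have "pd h i x = pd f i x" by (rule pd_cong_open(1)[OF D True]) (simp add: h)
    then show ?thesis using True by simp
  next
    case False
    then have "x \<in> - K" using K by auto
    have "pd h i x = pd (\<lambda>x. 0) i x" by (rule pd_cong_open(1)[OF oK \<open>x \<in> - K\<close>]) (use z in auto)
    then show ?thesis using False by (simp add: pd_eqI[OF has_derivative_const])
  qed
  moreover have "pd f i x = 0" if "x \<in> D - K" for x
  proof -
    have "pd f i x = pd (\<lambda>x. 0) i x" by (rule pd_cong_open(1)[OF open_Diff[OF D K(1)] that]) (use f(2) in auto)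
    then show ?thesis by (simp add: pd_eqI[OF has_derivative_const])
  qed
  ultimately show "\<exists>g. smooth_fun g \<and> (\<forall>x\<in>D-K. g x = 0) \<and> pd h i = (\<lambda>x. if x \<in> D then g x else 0)"
    using smooth_fun_pd[OF f(1) i] by blast
qed

subsection \<open>A smooth step\<close>

text \<open>x^(-k) exp(-1/x) for x > 0. The derivative of one member is a combination of two others,
  so the span \<open>flat_span\<close> of the family is closed under differentiation.\<close>

definition flat :: "nat \<Rightarrow> real \<Rightarrow> real" where
  "flat k x = (if x > 0 then (1/x)^k * exp (- (1/x)) else 0)"

text \<open>A single term of the exponential series, y^(k+2) / (k+2)! \<le> exp y with y = 1/x. The
  quadratic decay is what makes the difference quotients at 0 vanish.\<close>

lemma flat_bound: "0 \<le> flat k x" "flat k x \<le> fact (k + 2) * x\<^sup>2"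
proof -
  show "0 \<le> flat k x" by (simp add: flat_def)
  show "flat k x \<le> fact (k + 2) * x\<^sup>2"
  proof (cases "x > 0")
    case True
    define y F where "y = 1 / x" and "F = (fact (k + 2) :: real)"
    have y: "y > 0" using True by (simp add: y_def)
    have F: "F > 0" unfolding F_def by (rule fact_gt_zero)
    have "(\<Sum>n\<in>{k + 2}. y^n /\<^sub>R fact n) \<le> (\<Sum>n. y^n /\<^sub>R fact n)"
      by (rule sum_le_suminf) (use y sums_summable[OF exp_converges[of y]] in auto)
    then have "y ^ (k + 2) /\<^sub>R F \<le> exp y"
      using sums_unique[OF exp_converges[of y]] unfolding F_def by (metis finite.emptyI sum.empty sum.insert empty_iff add.right_neutral)
    then have "y ^ (k + 2) \<le> F * exp y" using F by (simp add: field_simps)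
    then have "y ^ k * y\<^sup>2 * exp (- y) \<le> F * exp y * exp (- y)"
      by (intro mult_right_mono) (simp_all only: power_add exp_ge_zero)
    also have "\<dots> = F" by (simp add: exp_minus)
    finally have "y ^ k * exp (- y) \<le> F / y\<^sup>2" using y by (simp add: field_simps)
    also have "F / y\<^sup>2 = F * x\<^sup>2" by (simp add: y_def power_divide)
    finally show ?thesis using True unfolding F_def[symmetric] by (simp add: flat_def y_def)
  qed (simp add: flat_def)
qed

lemma flat_deriv: "(flat k has_real_derivative (- real k * flat (k + 1) x + flat (k + 2) x)) (at x)"
proof (cases x "0::real" rule: linorder_cases)
  case less
  have "\<forall>\<^sub>F y in nhds x. flat k y = 0"
    using less eventually_nhds_in_open[of "{..<0::real}" x] by (auto elim!: eventually_mono simp: flat_def)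
  then have "(flat k has_real_derivative 0) (at x)" by (subst DERIV_cong_ev[OF refl _ refl]) auto
  then show ?thesis using less by (simp add: flat_def)
next
  case greater
  have ev: "\<forall>\<^sub>F y in nhds x. flat k y = (1/y)^k * exp (- (1/y))"
    using greater eventually_nhds_in_open[of "{0::real<..}" x] by (auto elim!: eventually_mono simp: flat_def)
  have d1: "((\<lambda>y. 1/y) has_real_derivative - (1/x\<^sup>2)) (at x)"
    using greater by (auto intro!: derivative_eq_intros simp: power2_eq_square)
  note DERIV_mult[OF DERIV_power[OF d1, of k] DERIV_chain2[OF DERIV_exp DERIV_minus[OF d1]]]
  moreover have "of_nat k * (- (1/x\<^sup>2) * (1/x)^(k - Suc 0)) * exp (- (1/x)) + exp (- (1/x)) * - (- (1/x\<^sup>2)) * (1/x)^k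
      = - real k * flat (k + 1) x + flat (k + 2) x"
    using greater by (cases k) (auto simp: flat_def power2_eq_square power_add divide_inverse algebra_simps)
  ultimately show ?thesis by (subst DERIV_cong_ev[OF refl ev refl]) simp
next
  case equal
  have "((\<lambda>y. (flat k y - flat k 0) / (y - 0)) \<longlongrightarrow> 0) (at 0)"
  proof (rule Lim_null_comparison[where g = "\<lambda>y. fact (k + 2) * \<bar>y\<bar>"])
    have "norm ((flat k y - flat k 0) / (y - 0)) \<le> fact (k + 2) * \<bar>y\<bar>" for y
    proof -
      have "\<bar>flat k y\<bar> \<le> (fact (k + 2) * \<bar>y\<bar>) * \<bar>y\<bar>"
        using flat_bound[of k y] by (simp add: power2_eq_square mult.assoc)
      then show ?thesis by (cases "y = 0") (auto simp: flat_def[of k 0] abs_divide divide_le_eq)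
    qed
    then show "\<forall>\<^sub>F y in at 0. norm ((flat k y - flat k 0) / (y - 0)) \<le> fact (k + 2) * \<bar>y\<bar>" by simp
    have "((\<lambda>y::real. fact (k + 2) * \<bar>y\<bar>) \<longlongrightarrow> fact (k + 2) * \<bar>0\<bar>) (at 0)" by (intro tendsto_intros)
    then show "((\<lambda>y::real. fact (k + 2) * \<bar>y\<bar>) \<longlongrightarrow> 0) (at 0)" by simp
  qed
  then have "(flat k has_real_derivative 0) (at 0)" by (simp add: has_field_derivative_iff)
  then show ?thesis using equal by (simp add: flat_def)
qed

inductive flat_span :: "(real \<Rightarrow> real) \<Rightarrow> bool" where
  "flat_span (flat k)"
| "flat_span f \<Longrightarrow> flat_span g \<Longrightarrow> flat_span (\<lambda>x. f x + g x)"
| "flat_span f \<Longrightarrow> flat_span (\<lambda>x. c * f x)"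

lemma flat_span_step: "flat_span f \<Longrightarrow> \<exists>g. flat_span g \<and> (\<forall>x. (f has_real_derivative g x) (at x))"
proof (induction rule: flat_span.induct)
  case (1 k)
  show ?case
    by (rule exI[of _ "\<lambda>x. - real k * flat (k + 1) x + flat (k + 2) x"]) (intro conjI allI flat_span.intros flat_deriv)
next
  case (2 f g)
  then obtain f' g' where "flat_span f'" "\<And>x. (f has_real_derivative f' x) (at x)"
    "flat_span g'" "\<And>x. (g has_real_derivative g' x) (at x)" by blast
  then show ?case by (intro exI[of _ "\<lambda>x. f' x + g' x"] conjI allI flat_span.intros(2) DERIV_add)
next
  case (3 f c)
  then obtain f' where "flat_span f'" "\<And>x. (f has_real_derivative f' x) (at x)" by blast
  then show ?case by (intro exI[of _ "\<lambda>x. c * f' x"] conjI allI flat_span.intros(3) DERIV_cmult)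
qed

lemma pd_real_derivative: "(f has_real_derivative d) (at x) \<Longrightarrow> pd f 1 x = d"
  by (simp add: has_field_derivative_def pd_eqI[where f' = "(*) d"])

lemma smooth_fun_flat: "smooth_fun (flat k)"
proof (rule smooth_fun_coinduct[of flat_span, OF flat_span.intros(1)])
  fix f assume "flat_span f"
  then obtain g where g: "flat_span g" "\<And>x. (f has_real_derivative g x) (at x)" using flat_span_step by blast
  show "f differentiable (at x)" for x using g(2)[of x] real_differentiable_def by blast
  have "pd f 1 = g" using pd_real_derivative[OF g(2)] by auto
  then show "flat_span (pd f i)" if "i \<in> Basis" for i using that g(1) by simp
qed

text \<open>A smooth transition from 0 for x \<le> 0 to 1 for x \<ge> 1; the denominator is positive
  because x or 1 - x is.\<close>

definition sstep :: "real \<Rightarrow> real" where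
  "sstep x = flat 0 x * inverse (flat 0 x + flat 0 (1 - x))"

lemma sstep_denominator: "flat 0 x + flat 0 (1 - x) > 0"
  by (cases "x > 0") (auto simp: flat_def intro: add_pos_nonneg)

lemma smooth_fun_sstep: "smooth_fun sstep"
proof -
  have "smooth_fun (\<lambda>x::real. 1 - x)"
    by (rule smooth_fun_diff[OF smooth_fun_const smooth_fun_bounded_linear[OF bounded_linear_ident]])
  then have "smooth_fun (\<lambda>x. flat 0 x + flat 0 (1 - x))"
    by (intro smooth_fun_add smooth_fun_flat smooth_fun_compose[OF smooth_fun_flat])
  then have "smooth_fun (\<lambda>x. flat 0 x * inverse (flat 0 x + flat 0 (1 - x)))"
    by (intro smooth_fun_mult smooth_fun_flat smooth_fun_inverse) (auto simp: less_imp_neq[OF sstep_denominator, symmetric])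
  then show ?thesis by (simp add: sstep_def[abs_def])
qed

lemma sstep_eq_0: "x \<le> 0 \<Longrightarrow> sstep x = 0" by (simp add: sstep_def flat_def)
lemma sstep_eq_1: "x \<ge> 1 \<Longrightarrow> sstep x = 1" by (simp add: sstep_def flat_def)

lemma sstep_range: "0 \<le> sstep x" "sstep x \<le> 1"
proof -
  have n: "0 \<le> flat 0 x" "0 \<le> flat 0 (1 - x)" by (rule flat_bound(1))+
  show "0 \<le> sstep x" unfolding sstep_def using n sstep_denominator[of x] by simp
  have "sstep x = flat 0 x / (flat 0 x + flat 0 (1 - x))" by (simp add: sstep_def divide_inverse)
  also have "\<dots> \<le> 1" using n sstep_denominator[of x] by (simp add: divide_le_eq)
  finally show "sstep x \<le> 1" .
qed

subsection \<open>Compactly supported smooth functions\<close>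

text \<open>The test functions C_c^\<infinity>(D), required to be smooth on the whole space, so that
  extension by zero is built in.\<close>

definition ccinf :: "'a::euclidean_space set \<Rightarrow> ('a \<Rightarrow> real) \<Rightarrow> bool" where
  "ccinf D f \<longleftrightarrow> smooth_fun f \<and> compact (closure {x. f x \<noteq> 0}) \<and> closure {x. f x \<noteq> 0} \<subseteq> D"

lemma ccinfI:
  assumes "smooth_fun f" "compact K" "K \<subseteq> D" "\<And>x. x \<notin> K \<Longrightarrow> f x = 0" shows "ccinf D f"
proof -
  have "closure {x. f x \<noteq> 0} \<subseteq> K" using assms(2,4) by (intro closure_minimal compact_imp_closed) auto
  moreover from this have "compact (closure {x. f x \<noteq> 0})"
    using assms(2) by (metis closed_closure compact_Int_closed inf.absorb_iff2)
  ultimately show ?thesis using assms by (auto simp: ccinf_def)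
qed

lemma ccinf_smooth: "ccinf D f \<Longrightarrow> smooth_fun f"
  by (simp add: ccinf_def)

lemma ccinf_support: "ccinf D f \<Longrightarrow> \<exists>K. compact K \<and> K \<subseteq> D \<and> (\<forall>x. x \<notin> K \<longrightarrow> f x = 0)"
  using closure_subset[of "{x. f x \<noteq> 0}"] unfolding ccinf_def by (intro exI[of _ "closure {x. f x \<noteq> 0}"]) auto

lemma ccinf_pd: assumes "ccinf D f" "i \<in> Basis" shows "ccinf D (pd f i)"
proof -
  obtain K where K: "smooth_fun f" "compact K" "K \<subseteq> D" "\<And>x. x \<notin> K \<Longrightarrow> f x = 0" using ccinf_smooth[OF assms(1)] ccinf_support[OF assms(1)] by blast
  have "pd f i x = 0" if "x \<notin> K" for x
  proof -
    have "pd f i x = pd (\<lambda>x. 0) i x"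
      by (rule pd_cong_open(1)[of "- K"]) (use K that in \<open>auto simp: compact_imp_closed open_Compl\<close>)
    then show ?thesis by (simp add: pd_eqI[OF has_derivative_const])
  qed
  then show ?thesis using K smooth_fun_pd[OF K(1) assms(2)] by (intro ccinfI) auto
qed

lemma ccinf_bounded: assumes "ccinf D f" obtains C where "\<And>x. \<bar>f x\<bar> \<le> C"
proof -
  obtain K where K: "smooth_fun f" "compact K" "\<And>x. x \<notin> K \<Longrightarrow> f x = 0" using ccinf_smooth[OF assms] ccinf_support[OF assms] by blast
  obtain C where C: "\<And>y. y \<in> f ` K \<Longrightarrow> norm y \<le> C"
    using compact_imp_bounded[OF compact_continuous_image[OF smooth_fun_continuous[OF K(1)] K(2)]]
    unfolding bounded_iff by blast
  have "\<bar>f x\<bar> \<le> max C 0" for x using C[of "f x"] K(3)[of x] by (cases "x \<in> K") auto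
  then show ?thesis using that by blast
qed

lemma ccinf_integrable_bound:
  assumes "ccinf D f" obtains C K where "compact K" "K \<subseteq> D" "C \<ge> 0" "\<And>x. \<bar>f x\<bar> \<le> C * indicator K x"
proof -
  obtain C where C: "\<And>x. \<bar>f x\<bar> \<le> C" using ccinf_bounded[OF assms] by blast
  obtain K where K: "compact K" "K \<subseteq> D" "\<And>x. x \<notin> K \<Longrightarrow> f x = 0" using ccinf_smooth[OF assms] ccinf_support[OF assms] by blast
  have "C \<ge> 0" using C[of undefined] by (meson abs_ge_zero order_trans)
  moreover have "\<bar>f x\<bar> \<le> C * indicator K x" for x using C[of x] K(3)[of x] by (cases "x \<in> K") auto
  ultimately show ?thesis using that[OF K(1,2)] by blast
qed

lemma sq_int_ccinf: assumes "ccinf D f" shows "sq_int f"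
proof -
  obtain C K where K: "compact K" "C \<ge> 0" "\<And>x. \<bar>f x\<bar> \<le> C * indicator K x"
    by (rule ccinf_integrable_bound[OF assms]) blast
  have [measurable]: "f \<in> borel_measurable borel" using assms smooth_fun_measurable by (auto simp: ccinf_def)
  show ?thesis
  proof (rule sq_int_bound[where g = "\<lambda>x. C\<^sup>2 * indicator K x"])
    show "integrable lborel (\<lambda>x. C\<^sup>2 * indicator K x)"
      using emeasure_compact_finite[OF K(1)] K(1) by (auto intro!: integrable_real_indicator borel_compact)
    have "(norm (f x))\<^sup>2 \<le> C\<^sup>2 * indicator K x" for x
    proof -
      have "(norm (f x))\<^sup>2 \<le> (C * indicator K x)\<^sup>2" using K(3)[of x] by (intro power_mono) auto
      also have "\<dots> = C\<^sup>2 * indicator K x" by (simp add: indicator_def)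
      finally show ?thesis .
    qed
    then show "AE x in lborel. (norm (f x))\<^sup>2 \<le> C\<^sup>2 * indicator K x" by simp
  qed simp
qed

text \<open>Each factor rises within distance 1/n of a face, so the product is 0 off the open box
  and tends to its indicator.\<close>

definition box_bump :: "'a::euclidean_space \<Rightarrow> 'a \<Rightarrow> nat \<Rightarrow> 'a \<Rightarrow> real" where
  "box_bump a b n x = (\<Prod>i\<in>Basis. sstep (real n * (x \<bullet> i - a \<bullet> i)) * sstep (real n * (b \<bullet> i - x \<bullet> i)))"

lemma smooth_fun_box_bump: "smooth_fun (box_bump a b n)"
  unfolding box_bump_def[abs_def]
  by (intro smooth_fun_prod smooth_fun_mult smooth_fun_compose[OF smooth_fun_sstep] smooth_fun_cmult
    smooth_fun_diff smooth_fun_inner smooth_fun_const)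

lemma box_bump_range: "0 \<le> box_bump a b n x" "box_bump a b n x \<le> 1"
  unfolding box_bump_def by (auto intro!: prod_nonneg prod_le_1 mult_le_one mult_nonneg_nonneg sstep_range)

lemma box_bump_outside: "x \<notin> box a b \<Longrightarrow> box_bump a b n x = 0"
proof -
  assume "x \<notin> box a b"
  then obtain i where i: "i \<in> Basis" "x \<bullet> i \<le> a \<bullet> i \<or> b \<bullet> i \<le> x \<bullet> i" by (auto simp: mem_box not_less)
  then have "sstep (real n * (x \<bullet> i - a \<bullet> i)) * sstep (real n * (b \<bullet> i - x \<bullet> i)) = 0"
    by (auto intro!: sstep_eq_0 simp: mult_le_0_iff)
  then show "box_bump a b n x = 0" unfolding box_bump_def using i by (auto intro!: prod_zero bexI[of _ i])
qed

lemma box_bump_tendsto: "(\<lambda>n. box_bump a b n x) \<longlonglongrightarrow> indicator (box a b) x"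
proof (cases "x \<in> box a b")
  case True
  have one: "\<forall>\<^sub>F n in sequentially. sstep (real n * c) = 1" if "c > 0" for c :: real
  proof -
    obtain N :: nat where "1 / c < real N" using reals_Archimedean2 by blast
    then have "1 \<le> real n * c" if "n \<ge> N" for n using that \<open>c > 0\<close> by (simp add: divide_less_eq) (smt (verit) mult_right_mono of_nat_mono)
    then show ?thesis by (auto simp: eventually_sequentially intro!: exI[of _ N] sstep_eq_1)
  qed
  have "\<forall>\<^sub>F n in sequentially. \<forall>i\<in>Basis. sstep (real n * (x \<bullet> i - a \<bullet> i)) = 1 \<and> sstep (real n * (b \<bullet> i - x \<bullet> i)) = 1"
    using True by (intro eventually_ball_finite finite_Basis ballI eventually_conj one) (auto simp: mem_box)
  then have "\<forall>\<^sub>F n in sequentially. box_bump a b n x = indicator (box a b) x"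
    by eventually_elim (simp add: box_bump_def True)
  then show ?thesis by (rule tendsto_eventually)
next
  case False then show ?thesis by (simp add: box_bump_outside)
qed

lemma ccinf_box_bump: "cbox a b \<subseteq> D \<Longrightarrow> ccinf D (box_bump a b n)"
  by (rule ccinfI[OF smooth_fun_box_bump compact_cbox]) (use box_bump_outside box_subset_cbox in blast)+

text \<open>Fundamental lemma of the calculus of variations: bumps converge boundedly to indicators
  of boxes with closure in D, and integrals over such boxes decide.\<close>

lemma AE_zero_if_orth_ccinf:
  fixes f :: "'a::euclidean_space \<Rightarrow> real"
  assumes f: "sq_int f" and D: "open D" and z: "\<And>\<psi>. ccinf D \<psi> \<Longrightarrow> (LINT x|lborel. f x * \<psi> x) = 0"
  shows "AE x in lborel. x \<in> D \<longrightarrow> f x = 0"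
proof (rule AE_zero_on_open_if_box_integrals_zero[OF f D])
  fix a b :: 'a assume ab: "cbox a b \<subseteq> D"
  have [measurable]: "f \<in> borel_measurable borel" using f by (simp add: sq_int_def)
  have [measurable]: "box_bump a b n \<in> borel_measurable borel" for n
    by (rule smooth_fun_measurable[OF smooth_fun_box_bump])
  have i: "integrable lborel (\<lambda>x. indicator (box a b) x *\<^sub>R f x)"
    by (rule sq_int_integrable_on_finite[OF f]) (use emeasure_lborel_box_eq[of a b] in auto)
  have "(\<lambda>n. LINT x|lborel. f x * box_bump a b n x) \<longlonglongrightarrow> (LINT x|lborel. indicator (box a b) x *\<^sub>R f x)"
  proof (rule integral_dominated_convergence[where w = "\<lambda>x. norm (indicator (box a b) x *\<^sub>R f x)"])
    show "integrable lborel (\<lambda>x. norm (indicator (box a b) x *\<^sub>R f x))" using i by (rule integrable_norm)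
    show "AE x in lborel. (\<lambda>n. f x * box_bump a b n x) \<longlonglongrightarrow> indicator (box a b) x *\<^sub>R f x"
      using tendsto_mult[OF tendsto_const box_bump_tendsto] by (intro AE_I2) (auto simp: mult.commute)
    show "AE x in lborel. norm (f x * box_bump a b n x) \<le> norm (indicator (box a b) x *\<^sub>R f x)" for n
    proof (rule AE_I2)
      fix x
      show "norm (f x * box_bump a b n x) \<le> norm (indicator (box a b) x *\<^sub>R f x)"
        using box_bump_range[where a = a and b = b and n = n and x = x] box_bump_outside[where a = a and b = b and n = n and x = x]
        by (cases "x \<in> box a b") (auto simp: abs_mult mult_left_le)
    qed
  qed auto
  moreover have "(LINT x|lborel. f x * box_bump a b n x) = 0" for n by (rule z[OF ccinf_box_bump[OF ab]])
  ultimately show "(LINT x:box a b|lborel. f x) = 0" by (simp add: set_lebesgue_integral_def LIMSEQ_const_iff)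
qed

text \<open>By translation invariance every difference quotient of f has integral 0, and dominated
  convergence carries this over to the derivative.\<close>

lemma integral_pd_eq_0:
  fixes f :: "'a::euclidean_space \<Rightarrow> real"
  assumes f: "ccinf UNIV f" and i: "i \<in> Basis"
  shows "(LINT x|lborel. pd f i x) = 0"
proof -
  obtain K where K: "smooth_fun f" "compact K" "\<And>x. x \<notin> K \<Longrightarrow> f x = 0" using ccinf_smooth[OF f] ccinf_support[OF f] by blast
  obtain C where C: "\<And>x. \<bar>pd f i x\<bar> \<le> C" using ccinf_bounded[OF ccinf_pd[OF f i]] by blast
  have C0: "C \<ge> 0" using C[of 0] by (meson abs_ge_zero order_trans)
  have [measurable]: "f \<in> borel_measurable borel" "pd f i \<in> borel_measurable borel"
    using K smooth_fun_pd[OF K(1) i] smooth_fun_measurable by auto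
  have fi: "integrable lborel f"
  proof -
    have "integrable lborel (\<lambda>x. indicator K x *\<^sub>R f x)"
      by (rule sq_int_integrable_on_finite[OF sq_int_ccinf[OF f]]) (use K emeasure_compact_finite borel_compact in auto)
    moreover have "(\<lambda>x. indicator K x *\<^sub>R f x) = f" by (rule ext) (use K(3) in \<open>auto simp: indicator_def\<close>)
    ultimately show ?thesis by simp
  qed
  define h where "h n = 1 / real (Suc n)" for n
  have h: "h n > 0" "h n \<le> 1" for n by (auto simp: h_def)
  have h0: "h \<longlonglongrightarrow> 0" unfolding h_def by (rule LIMSEQ_Suc[OF lim_1_over_n])
  define q where "q n x = (f (h n *\<^sub>R i + x) - f x) / h n" for n x
  have [measurable]: "q n \<in> borel_measurable borel" for n unfolding q_def by measurable
  have tr: "integrable lborel (\<lambda>x. f (v + x))" "(LINT x|lborel. f (v + x)) = (LINT x|lborel. f x)" for v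
    using integrable_distr_eq[of "(+) v" lborel borel f] integral_distr[of "(+) v" lborel borel f] fi
    by (simp_all add: lborel_distr_plus)
  have q0: "(LINT x|lborel. q n x) = 0" for n
    unfolding q_def using tr fi by simp
  obtain B where B: "\<And>x. x \<in> K \<Longrightarrow> norm x \<le> B" using compact_imp_bounded[OF K(2)] unfolding bounded_iff by blast
  \<comment> \<open>Steps are at most 1, so the quotient vanishes outside the ball of radius B + 1;
    inside it the mean value theorem gives C.\<close>
  have lip: "\<bar>q n x\<bar> \<le> C * indicator (cball 0 (B + 1)) x" for n x
  proof (cases "x \<in> cball 0 (B + 1)")
    case True
    have "norm (f (h n *\<^sub>R i + x) - f x) \<le> C * h n"
    proof -
      have d: "((\<lambda>r. f (r *\<^sub>R i + x)) has_real_derivative pd f i (r *\<^sub>R i + x)) (at r)" for r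
      proof -
        have "((\<lambda>r. f (r *\<^sub>R i + x)) has_derivative (\<lambda>s. pd f (s *\<^sub>R i) (r *\<^sub>R i + x))) (at r)"
          by (rule has_derivative_compose[OF _ smooth_fun_has_derivative[OF K(1)]]) (auto intro!: derivative_eq_intros)
        moreover have "(\<lambda>s. pd f (s *\<^sub>R i) (r *\<^sub>R i + x)) = (*) (pd f i (r *\<^sub>R i + x))"
          by (rule ext) (simp add: linear_cmul[OF pd_linear[OF smooth_fun_differentiable[OF K(1)]]])
        ultimately show ?thesis by (simp add: has_field_derivative_def)
      qed
      obtain z where "f (h n *\<^sub>R i + x) - f (0 *\<^sub>R i + x) = (h n - 0) * pd f i (z *\<^sub>R i + x)"
        using MVT2[of 0 "h n" "\<lambda>r. f (r *\<^sub>R i + x)" "\<lambda>r. pd f i (r *\<^sub>R i + x)"] h d by blast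
      then show ?thesis using mult_left_mono[OF C[of "z *\<^sub>R i + x"], of "h n"] h[of n] by (simp add: abs_mult mult.commute)
    qed
    then show ?thesis using h[of n] True by (simp add: q_def divide_le_eq)
  next
    case False
    have "x \<notin> K" using False B[of x] by auto
    moreover have "h n *\<^sub>R i + x \<notin> K"
    proof
      assume "h n *\<^sub>R i + x \<in> K"
      then have "norm (h n *\<^sub>R i + x) \<le> B" by (rule B)
      moreover have "norm x \<le> norm (h n *\<^sub>R i + x) + norm (h n *\<^sub>R i)" using norm_triangle_ineq4[of "h n *\<^sub>R i + x" "h n *\<^sub>R i"] by simp
      moreover have "norm (h n *\<^sub>R i) \<le> 1" using h[of n] i by simp
      ultimately show False using False by simp
    qed
    ultimately show ?thesis using K(3) C0 by (simp add: q_def)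
  qed
  have "(\<lambda>n. LINT x|lborel. q n x) \<longlonglongrightarrow> (LINT x|lborel. pd f i x)"
  proof (rule integral_dominated_convergence[where w = "\<lambda>x. C * indicator (cball 0 (B + 1)) x"])
    show "integrable lborel (\<lambda>x. C * indicator (cball (0::'a) (B + 1)) x)"
      using emeasure_compact_finite[OF compact_cball[of "0::'a" "B + 1"]] by (auto intro!: integrable_real_indicator)
    show "AE x in lborel. (\<lambda>n. q n x) \<longlonglongrightarrow> pd f i x"
    proof (rule AE_I2)
      fix x
      have "((\<lambda>r. f (r *\<^sub>R i + x)) has_derivative (\<lambda>s. pd f (s *\<^sub>R i) (0 *\<^sub>R i + x))) (at 0)"
        by (rule has_derivative_compose[OF _ smooth_fun_has_derivative[OF K(1)]]) (auto intro!: derivative_eq_intros)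
      moreover have "(\<lambda>s. pd f (s *\<^sub>R i) x) = (*) (pd f i x)"
        by (rule ext) (simp add: linear_cmul[OF pd_linear[OF smooth_fun_differentiable[OF K(1)]]])
      ultimately have "((\<lambda>r. f (r *\<^sub>R i + x)) has_real_derivative pd f i x) (at 0)" by (simp add: has_field_derivative_def)
      then have l: "((\<lambda>r. (f (r *\<^sub>R i + x) - f x) / r) \<longlongrightarrow> pd f i x) (at 0)" by (simp add: has_field_derivative_iff)
      have "filterlim h (at 0) sequentially"
        unfolding filterlim_at using h0 h(1) by (auto intro!: always_eventually simp: less_imp_neq[symmetric])
      from filterlim_compose[OF l this] show "(\<lambda>n. q n x) \<longlonglongrightarrow> pd f i x" by (simp add: q_def)
    qed
  qed (use lip in auto)
  then show ?thesis by (simp add: q0 LIMSEQ_const_iff)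
qed

text \<open>The product f g has compact support because g has; the integral of its derivative is
  0.\<close>

lemma integration_by_parts:
  fixes f g :: "'a::euclidean_space \<Rightarrow> real"
  assumes f: "smooth_fun f" and g: "ccinf UNIV g" and i: "i \<in> Basis"
  shows "(LINT x|lborel. f x * pd g i x) = - (LINT x|lborel. pd f i x * g x)"
proof -
  have int: "integrable lborel (\<lambda>x. u x * v x)" if u: "smooth_fun u" and v: "ccinf UNIV v" for u v :: "'a \<Rightarrow> real"
  proof -
    obtain K where K: "smooth_fun v" "compact K" "\<And>x. x \<notin> K \<Longrightarrow> v x = 0" using ccinf_smooth[OF v] ccinf_support[OF v] by blast
    have c: "ccinf UNIV (\<lambda>x. u x * v x)" by (rule ccinfI[OF smooth_fun_mult[OF u K(1)] K(2)]) (use K(3) in auto)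
    have "integrable lborel (\<lambda>x. indicator K x *\<^sub>R (u x * v x))"
      by (rule sq_int_integrable_on_finite[OF sq_int_ccinf[OF c]]) (use K emeasure_compact_finite borel_compact in auto)
    moreover have "(\<lambda>x. indicator K x *\<^sub>R (u x * v x)) = (\<lambda>x. u x * v x)" by (rule ext) (use K(3) in \<open>auto simp: indicator_def\<close>)
    ultimately show ?thesis by simp
  qed
  obtain K where K: "smooth_fun g" "compact K" "\<And>x. x \<notin> K \<Longrightarrow> g x = 0" using ccinf_smooth[OF g] ccinf_support[OF g] by blast
  have "ccinf UNIV (\<lambda>x. f x * g x)" by (rule ccinfI[OF smooth_fun_mult[OF f K(1)] K(2)]) (use K(3) in auto)
  then have "0 = (LINT x|lborel. pd (\<lambda>x. f x * g x) i x)" using integral_pd_eq_0[OF _ i] by simp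
  also have "\<dots> = (LINT x|lborel. f x * pd g i x + pd f i x * g x)"
    by (simp add: pd_mult smooth_fun_differentiable f K(1))
  also have "\<dots> = (LINT x|lborel. f x * pd g i x) + (LINT x|lborel. pd f i x * g x)"
    by (intro Bochner_Integration.integral_add int f smooth_fun_pd i ccinf_pd g)
  finally show ?thesis by simp
qed

section \<open>Lebesgue and Borel measurable functions\<close>

lemma lebesgue_measurable_if_AE_eq:
  assumes F: "F \<in> borel_measurable borel" and eq: "AE x in lborel. f x = F x"
  shows "f \<in> borel_measurable lebesgue"
proof -
  obtain N where N: "N \<in> null_sets lborel" "{x. f x \<noteq> F x} \<subseteq> N"
  proof (rule AE_E3[OF eq])
    fix N assume N: "\<And>x. x \<in> space lborel - N \<Longrightarrow> f x = F x" "N \<in> null_sets lborel"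
    show thesis by (rule that[OF N(2)]) (use N(1) in auto)
  qed
  have NL: "N \<in> null_sets lebesgue" using N(1) by (rule null_sets_completionI)
  show ?thesis
  proof (rule measurableI)
    fix A :: "'b set" assume A: "A \<in> sets borel"
    have eq: "f -` A = (F -` A - N) \<union> (f -` A \<inter> N)" using N(2) by auto
    have "F -` A \<in> sets lborel" using measurable_sets[OF F A] by simp
    then have 1: "F -` A - N \<in> sets lebesgue" using N(1) by (intro sets_completionI_sets) auto
    have "f -` A \<inter> N \<in> null_sets lebesgue" by (rule null_sets_completion_subset[OF _ NL]) auto
    then have "(F -` A - N) \<union> (f -` A \<inter> N) \<in> sets lebesgue" by (intro sets.Un 1 null_setsD2)
    then show "f -` A \<inter> space lebesgue \<in> sets lebesgue" using eq by simp
  qed simp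
qed

lemma AE_lebesgue_on_iff:
  assumes "D \<in> sets borel" shows "(AE x in lebesgue_on D. P x) \<longleftrightarrow> (AE x in lborel. x \<in> D \<longrightarrow> P x)"
  using assms by (subst AE_restrict_space_iff) (auto simp: AE_completion_iff)

text \<open>The gate between two languages: assertions over \<open>lebesgue_on D\<close> about f
  become assertions over \<open>lborel\<close> about any Borel F that equals f almost everywhere on
  D.\<close>

lemma lebesgue_on_conv:
  fixes f F :: "'a::euclidean_space \<Rightarrow> 'b::{banach,second_countable_topology}"
  assumes D: "D \<in> sets borel" and F[measurable]: "F \<in> borel_measurable borel"
    and eq: "AE x in lborel. x \<in> D \<longrightarrow> f x = F x"
  shows lebesgue_on_measurable: "f \<in> borel_measurable (lebesgue_on D)"
    and lebesgue_on_integrable: "integrable (lebesgue_on D) f \<longleftrightarrow> integrable lborel (\<lambda>x. indicator D x *\<^sub>R F x)"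
    and lebesgue_on_integral: "integral\<^sup>L (lebesgue_on D) f = integral\<^sup>L lborel (\<lambda>x. indicator D x *\<^sub>R F x)"
proof -
  have [measurable]: "D \<in> sets borel" by fact
  have DL: "D \<inter> space lebesgue \<in> sets lebesgue" using D by auto
  have F1: "(\<lambda>x. indicator D x *\<^sub>R F x) \<in> borel_measurable borel" by measurable
  have eq1: "AE x in lborel. indicator D x *\<^sub>R f x = indicator D x *\<^sub>R F x"
    using eq by eventually_elim (auto simp: indicator_def)
  have m: "(\<lambda>x. indicator D x *\<^sub>R f x) \<in> borel_measurable lebesgue"
    by (rule lebesgue_measurable_if_AE_eq[OF F1 eq1])
  show "f \<in> borel_measurable (lebesgue_on D)" using m DL by (simp add: borel_measurable_restrict_space_iff)
  have F2: "(\<lambda>x. indicator D x *\<^sub>R F x) \<in> borel_measurable lebesgue" by (rule measurable_completion) (use F1 in simp)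
  have eq2: "AE x in lebesgue. indicator D x *\<^sub>R f x = indicator D x *\<^sub>R F x" using eq1 by (rule AE_completion)
  have "integrable (lebesgue_on D) f \<longleftrightarrow> integrable lebesgue (\<lambda>x. indicator D x *\<^sub>R f x)"
    by (rule integrable_restrict_space[OF DL])
  also have "\<dots> \<longleftrightarrow> integrable lebesgue (\<lambda>x. indicator D x *\<^sub>R F x)" by (rule integrable_cong_AE[OF m F2 eq2])
  also have "\<dots> \<longleftrightarrow> integrable lborel (\<lambda>x. indicator D x *\<^sub>R F x)" by (rule integrable_completion) (use F1 in simp)
  finally show "integrable (lebesgue_on D) f \<longleftrightarrow> integrable lborel (\<lambda>x. indicator D x *\<^sub>R F x)" .
  have "integral\<^sup>L (lebesgue_on D) f = integral\<^sup>L lebesgue (\<lambda>x. indicator D x *\<^sub>R f x)"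
    by (rule integral_restrict_space[OF DL])
  also have "\<dots> = integral\<^sup>L lebesgue (\<lambda>x. indicator D x *\<^sub>R F x)" by (rule integral_cong_AE[OF m F2 eq2])
  also have "\<dots> = integral\<^sup>L lborel (\<lambda>x. indicator D x *\<^sub>R F x)" by (rule integral_completion) (use F1 in simp)
  finally show "integral\<^sup>L (lebesgue_on D) f = integral\<^sup>L lborel (\<lambda>x. indicator D x *\<^sub>R F x)" .
qed

lemma lebesgue_ex_borel:
  fixes f :: "'a::euclidean_space \<Rightarrow> 'b::euclidean_space"
  assumes f: "f \<in> borel_measurable lebesgue"
  shows "\<exists>F\<in>borel_measurable borel. AE x in lborel. f x = F x"
proof -
  have "\<exists>G\<in>borel_measurable lborel. AE x in lborel. f x \<bullet> i = G x" for i
    by (rule completion_ex_borel_measurable_real) (use f in measurable)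
  then obtain G where G: "\<And>i. G i \<in> borel_measurable lborel" "\<And>i. AE x in lborel. f x \<bullet> i = G i x" by metis
  have [measurable]: "G i \<in> borel_measurable borel" for i using G(1)[of i] by simp
  have "AE x in lborel. \<forall>i\<in>Basis. f x \<bullet> i = G i x" using G(2) by (simp add: AE_ball_countable countable_finite)
  then have "AE x in lborel. f x = (\<Sum>i\<in>Basis. G i x *\<^sub>R i)"
  proof eventually_elim
    case (elim x)
    have "f x = (\<Sum>i\<in>Basis. (f x \<bullet> i) *\<^sub>R i)" by (rule euclidean_representation[symmetric])
    also have "\<dots> = (\<Sum>i\<in>Basis. G i x *\<^sub>R i)" using elim by (intro sum.cong) auto
    finally show ?case .
  qed
  then show ?thesis by (intro bexI[of _ "\<lambda>x. \<Sum>i\<in>Basis. G i x *\<^sub>R i"]) auto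
qed

lemma lebesgue_on_ex_borel:
  fixes f :: "'a::euclidean_space \<Rightarrow> 'b::euclidean_space"
  assumes D: "D \<in> sets borel" and f: "f \<in> borel_measurable (lebesgue_on D)"
  shows "\<exists>F\<in>borel_measurable borel. AE x in lborel. indicator D x *\<^sub>R f x = F x"
proof (rule lebesgue_ex_borel)
  have "D \<inter> space lebesgue \<in> sets lebesgue" using D by auto
  then show "(\<lambda>x. indicator D x *\<^sub>R f x) \<in> borel_measurable lebesgue"
    using f by (simp add: borel_measurable_restrict_space_iff)
qed

text \<open>Tonelli for the exceptional set, with time as the outer variable although it is the
  second component.\<close>

lemma AE_swap:
  fixes P :: "'a::euclidean_space \<times> real \<Rightarrow> bool"
  assumes "AE q in lborel. P q" shows "AE t in lborel. AE x in lborel. P (x, t)"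
proof -
  obtain N where N: "N \<in> null_sets lborel" "{q. \<not> P q} \<subseteq> N"
  proof (rule AE_E3[OF assms])
    fix N assume N: "\<And>q. q \<in> space lborel - N \<Longrightarrow> P q" "N \<in> null_sets lborel"
    show thesis by (rule that[OF N(2)]) (use N(1) in auto)
  qed
  have Nb[measurable]: "N \<in> sets borel" using N(1) by auto
  have m: "indicator N \<in> borel_measurable (lborel \<Otimes>\<^sub>M (lborel :: real measure))" by (simp add: lborel_prod)
  have "(\<integral>\<^sup>+t. (\<integral>\<^sup>+x. indicator N (x, t) \<partial>lborel) \<partial>lborel) = integral\<^sup>N (lborel \<Otimes>\<^sub>M lborel) (indicator N)"
    by (rule lborel_pair.nn_integral_snd[OF m])
  also have "\<dots> = 0" using N(1) by (simp add: lborel_prod null_sets_def)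
  finally have z: "(\<integral>\<^sup>+t. (\<integral>\<^sup>+x. indicator N (x, t) \<partial>lborel) \<partial>lborel) = 0" .
  have "(\<lambda>t. \<integral>\<^sup>+x. indicator N (x, t) \<partial>lborel) \<in> borel_measurable lborel" using m by measurable
  with z have "AE t in lborel. (\<integral>\<^sup>+x. indicator N (x, t) \<partial>lborel) = 0" by (simp add: nn_integral_0_iff_AE)
  then show ?thesis
  proof eventually_elim
    case (elim t)
    have "(\<lambda>x. indicator N (x, t) :: ennreal) \<in> borel_measurable lborel" by measurable
    then have "AE x in lborel. indicator N (x, t) = (0::ennreal)" using elim by (simp add: nn_integral_0_iff_AE)
    then show ?case by eventually_elim (use N(2) in \<open>auto simp: indicator_def split: if_splits\<close>)
  qed
qed

section \<open>Functions of space and time as functions of time with values in a function space\<close>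

text \<open>By Lindelof an open set is a countable union of balls, and preimages of balls are
  sublevel sets of distances.\<close>

lemma borel_measurable_if_dist:
  fixes f :: "real \<Rightarrow> 'c::{metric_space,second_countable_topology}"
  assumes "\<And>c. (\<lambda>t. dist (f t) c) \<in> borel_measurable borel"
  shows "f \<in> borel_measurable borel"
proof (rule borel_measurableI)
  fix U :: "'c set" assume U: "open U"
  let ?F = "{ball c e | c e. ball c e \<subseteq> U}"
  have op: "\<And>B. B \<in> ?F \<Longrightarrow> open B" by auto
  obtain F where F: "F \<subseteq> ?F" "countable F" "\<Union>F = \<Union>?F" by (rule Lindelof[of ?F, OF op])
  have "\<Union>?F = U"
  proof
    show "U \<subseteq> \<Union>?F"
    proof
      fix x assume "x \<in> U"
      then obtain e where "e > 0" "ball x e \<subseteq> U" using U open_contains_ball by blast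
      then have "ball x e \<in> ?F" "x \<in> ball x e" by auto
      then show "x \<in> \<Union>?F" by (rule UnionI)
    qed
  qed blast
  then have "f -` U \<inter> space borel = (\<Union>B\<in>F. f -` B)" using F(3) by auto
  also have "\<dots> \<in> sets borel"
  proof -
    have m: "f -` B \<in> sets borel" if "B \<in> F" for B
    proof -
    from that obtain c e where B: "B = ball c e" using F(1) by blast
    have "f -` B = {t \<in> space borel. dist (f t) c < e}" by (auto simp: B dist_commute)
    also have "\<dots> \<in> sets borel" using assms[of c] by measurable
    finally show "f -` B \<in> sets borel" .
    qed
    show ?thesis by (rule sets.countable_UN'[OF F(2)]) (use m in auto)
  qed
  finally show "f -` U \<inter> space borel \<in> sets borel" .
qed

text \<open>The section at time t as an element of L_2; on the null set of times where it is not
  square integrable, \<open>toL\<close> returns 0.\<close>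

definition slices :: "('a::euclidean_space \<times> real \<Rightarrow> 'b::{real_inner,banach,second_countable_topology}) \<Rightarrow> real \<Rightarrow> ('a, 'b) l2"
  where "slices w t = toL (\<lambda>x. w (x, t))"

context
  fixes w :: "'a::euclidean_space \<times> real \<Rightarrow> 'b::{real_inner,banach,second_countable_topology}"
  assumes w: "sq_int w"
begin

lemma slices_meas: "w \<in> borel_measurable (borel \<Otimes>\<^sub>M borel)"
  using w by (simp add: sq_int_def borel_prod)

lemma slices_int: "integrable (lborel \<Otimes>\<^sub>M lborel) (\<lambda>(x, t). (norm (w (x, t)))\<^sup>2)"
  using sq_int_square[OF w] by (simp add: lborel_prod case_prod_unfold)

lemma slice_measurable: "(\<lambda>x. w (x, t)) \<in> borel_measurable borel"
proof -
  note [measurable] = slices_meas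
  show ?thesis by measurable
qed

lemma AE_slices_sq_int: "AE t in lborel. sq_int (\<lambda>x. w (x, t))"
  using lborel_pair.AE_integrable_snd[OF slices_int]
  by eventually_elim (auto simp: sq_int_def slice_measurable)

text \<open>An explicit formula whose measurability in t is evident; it feeds the metric criterion
  for measurability of \<open>slices w\<close>.\<close>

lemma slices_dist:
  "dist (slices w t) c = (if (\<integral>\<^sup>+x. ennreal ((norm (w (x, t)))\<^sup>2) \<partial>lborel) < \<infinity>
     then sqrt (LINT x|lborel. (norm (w (x, t) - rep c x))\<^sup>2) else norm c)"
proof (cases "integrable lborel (\<lambda>x. (norm (w (x, t)))\<^sup>2)")
  have iff: "integrable lborel (\<lambda>x. (norm (w (x, t)))\<^sup>2) \<longleftrightarrow> (\<integral>\<^sup>+x. ennreal ((norm (w (x, t)))\<^sup>2) \<partial>lborel) < \<infinity>"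
    using slice_measurable[of t] by (simp add: integrable_iff_bounded)
  case True
  then have s: "sq_int (\<lambda>x. w (x, t))" by (simp add: sq_int_def slice_measurable)
  have "(norm (slices w t - c))\<^sup>2 = (LINT x|lborel. (norm (w (x, t) - rep c x))\<^sup>2)"
    using norm_toL[OF sq_int_diff[OF s sq_int_rep[of c]]] toL_diff[OF s sq_int_rep[of c]] by (simp add: slices_def)
  then have "norm (slices w t - c) = sqrt (LINT x|lborel. (norm (w (x, t) - rep c x))\<^sup>2)"
    by (metis norm_ge_zero real_sqrt_unique)
  then show ?thesis using True[unfolded iff] by (simp add: dist_norm)
next
  have iff: "integrable lborel (\<lambda>x. (norm (w (x, t)))\<^sup>2) \<longleftrightarrow> (\<integral>\<^sup>+x. ennreal ((norm (w (x, t)))\<^sup>2) \<partial>lborel) < \<infinity>"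
    using slice_measurable[of t] by (simp add: integrable_iff_bounded)
  case False
  then have "\<not> sq_int (\<lambda>x. w (x, t))" by (simp add: sq_int_def)
  then have "slices w t = 0" unfolding slices_def by (simp add: toL_not_sq_int toL_0)
  then show ?thesis using False[unfolded iff] by (simp add: dist_norm)
qed

lemma slices_measurable: "slices w \<in> borel_measurable borel"
proof (rule borel_measurable_if_dist)
  fix c :: "('a, 'b) l2"
  note [measurable] = slices_meas
  show "(\<lambda>t. dist (slices w t) c) \<in> borel_measurable borel"
    unfolding slices_dist by measurable
qed

lemma sq_int_slices: "sq_int (slices w)"
proof -
  have i: "integrable lborel (\<lambda>t. LINT x|lborel. (norm (w (x, t)))\<^sup>2)"
    using lborel_pair.integrable_snd[OF slices_int] by simp
  have "AE t in lborel. (norm (slices w t))\<^sup>2 \<le> (LINT x|lborel. (norm (w (x, t)))\<^sup>2)"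
    using AE_slices_sq_int by eventually_elim (simp add: slices_def norm_toL)
  then show ?thesis by (intro sq_int_bound[OF _ i]) (use slices_measurable in auto)
qed

lemma AE_rep_slices: "AE t in lborel. AE x in lborel. rep (rep (toL (slices w)) t) x = w (x, t)"
  using rep_toL[OF sq_int_slices] AE_slices_sq_int
proof eventually_elim
  case (elim t)
  then show ?case using rep_toL[OF elim(2)] by (simp add: slices_def)
qed

end

lemma inner_slices:
  fixes v w :: "'a::euclidean_space \<times> real \<Rightarrow> 'b::{real_inner,banach,second_countable_topology}"
  assumes v: "sq_int v" and w: "sq_int w"
  shows "toL (slices v) \<bullet> toL (slices w) = (LINT q|lborel. v q \<bullet> w q)"
proof -
  have [measurable]: "v \<in> borel_measurable (borel \<Otimes>\<^sub>M borel)" "w \<in> borel_measurable (borel \<Otimes>\<^sub>M borel)"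
    using v w by (simp_all add: sq_int_def borel_prod)
  have i: "integrable (lborel \<Otimes>\<^sub>M lborel) (\<lambda>(x, t). v (x, t) \<bullet> w (x, t))"
    using sq_int_inner[OF v w] by (simp add: lborel_prod case_prod_unfold)
  have "toL (slices v) \<bullet> toL (slices w) = (LINT t|lborel. slices v t \<bullet> slices w t)"
    by (rule inner_toL[OF sq_int_slices[OF v] sq_int_slices[OF w]])
  also have "\<dots> = (LINT t|lborel. (LINT x|lborel. v (x, t) \<bullet> w (x, t)))"
  proof (rule integral_cong_AE)
    have [measurable]: "slices v \<in> borel_measurable borel" "slices w \<in> borel_measurable borel"
      using slices_measurable v w by auto
    show "(\<lambda>t. slices v t \<bullet> slices w t) \<in> borel_measurable lborel" by measurable
    show "AE t in lborel. slices v t \<bullet> slices w t = (LINT x|lborel. v (x, t) \<bullet> w (x, t))"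
      using AE_slices_sq_int[OF v] AE_slices_sq_int[OF w] by eventually_elim (simp add: slices_def inner_toL)
  qed measurable
  also have "\<dots> = (LINT q|lborel. v q \<bullet> w q)"
    using lborel_pair.integral_snd[OF i] by (simp add: lborel_prod case_prod_unfold)
  finally show ?thesis .
qed

lemma slices_add:
  assumes v: "sq_int v" and w: "sq_int w"
  shows "toL (slices (\<lambda>q. v q + w q)) = toL (slices v) + toL (slices w)"
proof -
  have "AE t in lborel. slices (\<lambda>q. v q + w q) t = slices v t + slices w t"
    using AE_slices_sq_int[OF v] AE_slices_sq_int[OF w] by eventually_elim (simp add: slices_def toL_add)
  then show ?thesis
    unfolding toL_add[OF sq_int_slices[OF v] sq_int_slices[OF w], symmetric]
    by (intro toL_cong sq_int_slices sq_int_add v w)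
qed

lemma slices_scaleR:
  assumes w: "sq_int w"
  shows "toL (slices (\<lambda>q. c *\<^sub>R w q)) = c *\<^sub>R toL (slices w)"
proof -
  have "AE t in lborel. slices (\<lambda>q. c *\<^sub>R w q) t = c *\<^sub>R slices w t"
    using AE_slices_sq_int[OF w] by eventually_elim (simp add: slices_def toL_scaleR)
  then show ?thesis
    unfolding toL_scaleR[OF sq_int_slices[OF w], symmetric]
    by (intro toL_cong sq_int_slices sq_int_scaleR w)
qed

lemma norm_slices: assumes w: "sq_int w" shows "norm (toL (slices w)) = norm (toL w)"
  using inner_slices[OF w w] inner_toL[OF w w] by (simp add: norm_eq_sqrt_inner)

text \<open>The canonical isometry from L_2 of space-time into L_2 in time with values in L_2 in
  space; \<open>surj_iota\<close> makes it bijective.\<close>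

definition iota :: "('a::euclidean_space \<times> real, 'b::{real_inner,banach,second_countable_topology}) l2 \<Rightarrow> (real, ('a, 'b) l2) l2"
  where "iota w = toL (slices (rep w))"

lemma slices_cong:
  assumes v: "sq_int v" and w: "sq_int w" and eq: "AE q in lborel. v q = w q"
  shows "toL (slices v) = toL (slices w)"
proof (rule toL_cong[OF sq_int_slices[OF v] sq_int_slices[OF w]])
  show "AE t in lborel. slices v t = slices w t"
    using AE_slices_sq_int[OF v] AE_slices_sq_int[OF w] AE_swap[OF eq]
    by eventually_elim (unfold slices_def, rule toL_cong)
qed

lemma iota_toL: "sq_int w \<Longrightarrow> iota (toL w) = toL (slices w)"
  unfolding iota_def by (rule slices_cong[OF sq_int_rep _ rep_toL])

lemma iota_add: "iota (u + v) = iota u + iota v"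
  using iota_toL[OF sq_int_add[OF sq_int_rep[of u] sq_int_rep[of v]]] slices_add[OF sq_int_rep[of u] sq_int_rep[of v]]
  by (simp add: toL_add iota_def)

lemma iota_scaleR: "iota (c *\<^sub>R u) = c *\<^sub>R iota u"
  using iota_toL[OF sq_int_scaleR[OF sq_int_rep[of u]]] slices_scaleR[OF sq_int_rep[of u]]
  by (simp add: toL_scaleR iota_def)

lemma linear_iota: "linear iota" by (intro linearI iota_add iota_scaleR)

lemma norm_iota: "norm (iota u) = norm u"
  using norm_slices[OF sq_int_rep[of u]] by (simp add: iota_def)

lemma inj_iota: "inj iota"
  using linear_iota norm_iota by (metis linear_injective_0 norm_eq_zero)

text \<open>The range is closed since the map is isometric, and it contains every tensor of an
  interval with a function of space; these are total.\<close>

lemma surj_iota: "surj (iota :: ('a::euclidean_space \<times> real, 'b::{real_inner,banach,second_countable_topology}) l2 \<Rightarrow> _)"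
proof (rule closed_subspace_eq_UNIV)
  let ?i = "iota :: ('a \<times> real, 'b) l2 \<Rightarrow> _"
  show "subspace (range ?i)" by (rule linear_subspace_image[OF linear_iota subspace_UNIV])
  show "closed (range ?i)"
    unfolding closed_sequential_limits
  proof (intro allI impI, elim conjE)
    fix y l assume "\<forall>n::nat. y n \<in> range ?i" and l: "y \<longlonglongrightarrow> l"
    then have "\<forall>n. \<exists>x. y n = ?i x" by blast
    from choice[OF this] obtain x where x: "\<And>n. y n = ?i (x n)" by blast
    have d: "dist (x m) (x n) = dist (y m) (y n)" for m n
      using norm_iota[of "x m - x n"] by (simp add: x dist_norm linear_diff[OF linear_iota])
    have "Cauchy y" using l by (rule LIMSEQ_imp_Cauchy)
    then have "Cauchy x" by (simp add: Cauchy_def d)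
    then obtain z where z: "x \<longlonglongrightarrow> z" using Cauchy_convergent_iff convergent_def by blast
    have "bounded_linear ?i"
      by (rule bounded_linear_intro[of _ 1]) (simp_all add: iota_add iota_scaleR norm_iota)
    then have "(\<lambda>n. ?i (x n)) \<longlonglongrightarrow> ?i z" using z by (rule bounded_linear.tendsto)
    then have "y \<longlonglongrightarrow> ?i z" unfolding x[symmetric] .
    then have "l = ?i z" by (rule LIMSEQ_unique[OF l])
    then show "l \<in> range ?i" by simp
  qed
  fix z :: "(real, ('a, 'b) l2) l2" assume z: "\<forall>x\<in>range ?i. z \<bullet> x = 0"
  show "z = 0"
  proof (rule l2_zero_if_orth_tens)
    fix a b :: real and k :: "('a, 'b) l2"
    let ?w = "\<lambda>q. indicator {a<..<b} (snd q) *\<^sub>R rep k (fst q) :: 'b"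
    have [measurable]: "?w \<in> borel_measurable (borel \<Otimes>\<^sub>M borel)" by measurable
    have "integrable (lborel \<Otimes>\<^sub>M lborel) (\<lambda>q. (norm (?w q))\<^sup>2)"
    proof (rule lborel_pair.Fubini_integrable)
      have e: "(LINT t|lborel. norm ((norm (?w (x, t)))\<^sup>2)) = (norm (rep k x))\<^sup>2 * measure lborel {a<..<b}" for x
      proof -
        have "(\<lambda>t. norm ((norm (?w (x, t)))\<^sup>2)) = (\<lambda>t. (norm (rep k x))\<^sup>2 * indicator {a<..<b} t)"
          by (auto simp: indicator_def)
        then show ?thesis by simp
      qed
      show "integrable lborel (\<lambda>x. LINT t|lborel. norm ((norm (?w (x, t)))\<^sup>2))"
        unfolding e using sq_int_square[OF sq_int_rep[of k]] by simp
      have "integrable lborel (\<lambda>t. (norm (?w (x, t)))\<^sup>2)" for x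
      proof -
        have "(\<lambda>t. (norm (?w (x, t)))\<^sup>2) = (\<lambda>t. (norm (rep k x))\<^sup>2 * indicator {a<..<b} t)"
          by (auto simp: indicator_def)
        then show ?thesis using emeasure_Ioo_finite[of a b] by simp
      qed
      then show "AE x in lborel. integrable lborel (\<lambda>t. (norm (?w (x, t)))\<^sup>2)" by simp
    qed measurable
    then have w: "sq_int ?w" by (simp add: sq_int_def lborel_prod borel_prod[symmetric])
    have "slices ?w t = indicator {a<..<b} t *\<^sub>R k" for t
      using toL_scaleR[OF sq_int_rep[of k], of "indicator {a<..<b} t"] by (simp add: slices_def)
    then have "slices ?w = (\<lambda>t. indicator {a<..<b} t *\<^sub>R k)" by (rule ext)
    then have "tens {a<..<b} k = toL (slices ?w)" by (simp only: tens_def)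
    also have "\<dots> = ?i (toL ?w)" using iota_toL[OF w] by simp
    finally show "z \<bullet> tens {a<..<b} k = 0" using z by simp
  qed
qed

text \<open>A jointly measurable function behind a class of functions of time. Through it the
  abstract solution becomes a function u x t as in the statement.\<close>

definition fnQ :: "(real, ('a::euclidean_space, 'b::{real_inner,banach,second_countable_topology}) l2) l2 \<Rightarrow> 'a \<times> real \<Rightarrow> 'b"
  where "fnQ U = rep (inv iota U)"

lemma sq_int_fnQ: "sq_int (fnQ U)" by (simp add: fnQ_def)

lemma slices_fnQ: "toL (slices (fnQ U)) = U"
  using surj_f_inv_f[OF surj_iota, of U] by (simp add: fnQ_def iota_def)

lemma fnQ_slices: assumes "sq_int w" shows "AE q in lborel. fnQ (toL (slices w)) q = w q"
proof -
  have "inv iota (toL (slices w)) = toL w" using inv_f_f[OF inj_iota, of "toL w"] by (simp add: iota_toL[OF assms])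
  then show ?thesis using rep_toL[OF assms] by (simp add: fnQ_def)
qed

lemma AE_fnQ: "AE t in lborel. AE x in lborel. rep (rep U t) x = fnQ U (x, t)"
  using AE_rep_slices[OF sq_int_fnQ[of U]] by (simp add: slices_fnQ)

lemma inner_fnQ: "U \<bullet> W = (LINT q|lborel. fnQ U q \<bullet> fnQ W q)"
  using inner_slices[OF sq_int_fnQ[of U] sq_int_fnQ[of W]] by (simp add: slices_fnQ)

lemma fnQ_add: "AE q in lborel. fnQ (U + W) q = fnQ U q + fnQ W q"
  using fnQ_slices[OF sq_int_add[OF sq_int_fnQ[of U] sq_int_fnQ[of W]]] slices_add[OF sq_int_fnQ[of U] sq_int_fnQ[of W]]
  by (simp add: slices_fnQ)

lemma fnQ_scaleR: "AE q in lborel. fnQ (c *\<^sub>R U) q = c *\<^sub>R fnQ U q"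
  using fnQ_slices[OF sq_int_scaleR[OF sq_int_fnQ[of U]]] slices_scaleR[OF sq_int_fnQ[of U]]
  by (simp add: slices_fnQ)

lemma fnQ_measurable[measurable]: "fnQ U \<in> borel_measurable borel"
  using sq_int_fnQ[of U] by (simp add: sq_int_def)

lemma norm_fnQ: "(norm U)\<^sup>2 = (LINT q|lborel. (norm (fnQ U q))\<^sup>2)"
  by (simp add: power2_norm_eq_inner inner_fnQ)

section \<open>The spatial energy space\<close>

lemma axis_Basis: "axis i (1::real) \<in> Basis" by simp

lemma grad_nth: "grad \<psi> x $ i = pd \<psi> (axis i 1) x" by (simp add: grad_def)

lemma grad_continuous: "smooth_fun \<psi> \<Longrightarrow> continuous_on UNIV (grad \<psi>)"
  unfolding grad_def[abs_def] by (intro continuous_on_vec_lambda smooth_fun_continuous smooth_fun_pd axis_Basis)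

lemma grad_measurable: "smooth_fun \<psi> \<Longrightarrow> grad \<psi> \<in> borel_measurable borel"
  by (intro borel_measurable_continuous_onI grad_continuous)

lemma norm_vec_square: "(norm (v :: real^'n))\<^sup>2 = (\<Sum>i\<in>UNIV. (v $ i)\<^sup>2)"
  unfolding power2_norm_eq_inner inner_vec_def by (simp add: power2_eq_square)

lemma grad_add: "smooth_fun f \<Longrightarrow> smooth_fun g \<Longrightarrow> grad (\<lambda>x. f x + g x) x = grad f x + grad g x"
  by (simp add: vec_eq_iff grad_nth pd_eqI[OF has_derivative_add[OF smooth_fun_has_derivative smooth_fun_has_derivative]])

lemma pd_cmult: "smooth_fun f \<Longrightarrow> pd (\<lambda>x. c * f x) v x = c * pd f v x"
  by (rule pd_eqI[OF has_derivative_mult_right[OF smooth_fun_has_derivative]])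

lemma grad_cmult: "smooth_fun f \<Longrightarrow> grad (\<lambda>x. c * f x) x = c *\<^sub>R grad f x"
  by (simp add: vec_eq_iff grad_nth pd_cmult)

text \<open>A function with its gradient, extended by 0 off D; the L_2 norm of the pair is the norm
  of W_2^1(D).\<close>

definition pairf :: "'a set \<Rightarrow> ('a \<Rightarrow> real) \<Rightarrow> ('a \<Rightarrow> real^'n) \<Rightarrow> 'a \<Rightarrow> real \<times> (real^'n)" where
  "pairf D v g x = indicator D x *\<^sub>R (v x, g x)"

lemma norm_pairf: "(norm (pairf D v g x))\<^sup>2 = indicator D x * (v x)\<^sup>2 + indicator D x * (norm (g x))\<^sup>2"
  by (simp add: pairf_def indicator_def norm_Pair)

lemma inner_pairf: "pairf D v g x \<bullet> pairf D v' g' x = indicator D x * (v x * v' x + g x \<bullet> g' x)"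
  by (simp add: pairf_def indicator_def)

lemma sq_int_pairf:
  fixes v :: "'a::euclidean_space \<Rightarrow> real" and g :: "'a \<Rightarrow> real^'n"
  assumes [measurable]: "D \<in> sets borel" "v \<in> borel_measurable borel" "g \<in> borel_measurable borel"
    and "integrable lborel (\<lambda>x. indicator D x * (v x)\<^sup>2)" "integrable lborel (\<lambda>x. indicator D x * (norm (g x))\<^sup>2)"
  shows "sq_int (pairf D v g)"
  unfolding sq_int_def norm_pairf
proof
  have "pairf D v g = (\<lambda>x. indicator D x *\<^sub>R (v x, g x))" by (rule ext) (rule pairf_def)
  then show "pairf D v g \<in> borel_measurable lborel" by simp
qed (use assms(4,5) in simp)

lemma L2_borel:
  assumes "open D" "v \<in> borel_measurable borel"
  shows "L2 D v \<longleftrightarrow> integrable lborel (\<lambda>x. indicator D x * (v x)\<^sup>2)"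
proof -
  have [measurable]: "v \<in> borel_measurable borel" "D \<in> sets borel" using assms by auto
  show ?thesis
    unfolding L2_def using lebesgue_on_measurable[of D v v] lebesgue_on_integrable[of D "\<lambda>x. (v x)\<^sup>2" "\<lambda>x. (v x)\<^sup>2"]
    by simp
qed

lemma smooth_vanishing_sq_int:
  assumes D: "open D" and \<psi>: "smooth_vanishing D \<psi>" shows "sq_int (pairf D \<psi> (grad \<psi>))"
proof (rule sq_int_pairf)
  have s: "smooth_fun \<psi>" using \<psi> by (simp add: smooth_vanishing_def)
  show "\<psi> \<in> borel_measurable borel" "grad \<psi> \<in> borel_measurable borel" using s by (auto intro: smooth_fun_measurable grad_measurable)
  show "integrable lborel (\<lambda>x. indicator D x * (\<psi> x)\<^sup>2)"
    using \<psi> L2_borel[OF D smooth_fun_measurable[OF s]] by (simp add: smooth_vanishing_def)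
  have "integrable lborel (\<lambda>x. indicator D x * (pd \<psi> (axis i 1) x)\<^sup>2)" for i
    using \<psi> L2_borel[OF D smooth_fun_measurable[OF smooth_fun_pd[OF s axis_Basis[of i]]]] by (simp add: smooth_vanishing_def)
  then have "integrable lborel (\<lambda>x. \<Sum>i\<in>UNIV. indicator D x * (pd \<psi> (axis i 1) x)\<^sup>2)"
    by (rule Bochner_Integration.integrable_sum)
  then show "integrable lborel (\<lambda>x. indicator D x * (norm (grad \<psi> x))\<^sup>2)"
    by (simp only: norm_vec_square grad_nth sum_distrib_left)
qed (use D in auto)

lemma smooth_vanishingI:
  assumes D: "open D" and s: "smooth_fun \<psi>" and z: "\<And>x. x \<in> frontier D \<Longrightarrow> \<psi> x = 0" and q: "sq_int (pairf D \<psi> (grad \<psi>))"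
  shows "smooth_vanishing D \<psi>"
proof -
  have [measurable]: "D \<in> sets borel" "\<psi> \<in> borel_measurable borel" using D smooth_fun_measurable[OF s] by auto
  have m[measurable]: "pd \<psi> (axis i 1) \<in> borel_measurable borel" for i
    by (rule smooth_fun_measurable[OF smooth_fun_pd[OF s axis_Basis]])
  have i: "integrable lborel (\<lambda>x. indicator D x * (\<psi> x)\<^sup>2 + indicator D x * (norm (grad \<psi> x))\<^sup>2)"
    using sq_int_square[OF q] by (simp add: norm_pairf)
  have "integrable lborel (\<lambda>x. indicator D x * (\<psi> x)\<^sup>2)"
    by (rule Bochner_Integration.integrable_bound[OF i]) (auto simp: indicator_def)
  moreover have "integrable lborel (\<lambda>x. indicator D x * (pd \<psi> (axis i 1) x)\<^sup>2)" for i
  proof (rule Bochner_Integration.integrable_bound[OF i])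
    have "(pd \<psi> (axis i 1) x)\<^sup>2 \<le> (norm (grad \<psi> x))\<^sup>2" for x
      using component_le_norm_cart[of "grad \<psi> x" i] by (simp add: grad_nth abs_le_square_iff[symmetric])
    then show "AE x in lborel. norm (indicator D x * (pd \<psi> (axis i 1) x)\<^sup>2) \<le> norm (indicator D x * (\<psi> x)\<^sup>2 + indicator D x * (norm (grad \<psi> x))\<^sup>2)"
      by (intro AE_I2) (auto simp: indicator_def add_increasing)
  qed measurable
  ultimately show ?thesis using s z L2_borel[OF D] m smooth_fun_measurable[OF s] by (simp add: smooth_vanishing_def)
qed

definition Sgen :: "(real^'n) set \<Rightarrow> (real^'n, real \<times> (real^'n)) l2 set" where
  "Sgen D = {toL (pairf D \<psi> (grad \<psi>)) | \<psi>. smooth_vanishing D \<psi>}"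

text \<open>H^1 as the closure of the graph of the gradient: limit function and limit gradient stay
  together, as \<open>H1 D v g\<close> presents them.\<close>

definition Hsp :: "(real^'n) set \<Rightarrow> (real^'n, real \<times> (real^'n)) l2 set" where
  "Hsp D = closure (Sgen D)"

lemma subspace_Sgen: assumes D: "open D" shows "subspace (Sgen D)"
proof (rule subspaceI)
  have g0: "grad (\<lambda>x. 0) = (\<lambda>x. 0)" by (rule ext) (simp add: vec_eq_iff grad_nth pd_eqI[OF has_derivative_const])
  have p0: "pairf D (\<lambda>x. 0) (grad (\<lambda>x. 0)) = (\<lambda>x. 0)" by (rule ext) (simp add: pairf_def g0 zero_prod_def)
  have "smooth_vanishing D (\<lambda>x. 0)"
    by (rule smooth_vanishingI[OF D smooth_fun_const]) (simp_all add: p0 sq_int_0)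
  moreover have "toL (pairf D (\<lambda>x. 0) (grad (\<lambda>x. 0))) = 0" by (simp add: p0 toL_0)
  ultimately show "0 \<in> Sgen D" unfolding Sgen_def by force
  fix x y assume "x \<in> Sgen D" "y \<in> Sgen D"
  then obtain \<psi> \<phi> where *: "smooth_vanishing D \<psi>" "x = toL (pairf D \<psi> (grad \<psi>))"
    "smooth_vanishing D \<phi>" "y = toL (pairf D \<phi> (grad \<phi>))" by (auto simp: Sgen_def)
  have s: "smooth_fun \<psi>" "smooth_fun \<phi>" using * by (auto simp: smooth_vanishing_def)
  have e: "pairf D (\<lambda>x. \<psi> x + \<phi> x) (grad (\<lambda>x. \<psi> x + \<phi> x)) = (\<lambda>x. pairf D \<psi> (grad \<psi>) x + pairf D \<phi> (grad \<phi>) x)"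
    by (rule ext) (simp add: pairf_def grad_add[OF s] indicator_def)
  have "smooth_vanishing D (\<lambda>x. \<psi> x + \<phi> x)"
    by (rule smooth_vanishingI[OF D smooth_fun_add[OF s]], use * in \<open>simp add: smooth_vanishing_def\<close>)
      (unfold e, intro sq_int_add smooth_vanishing_sq_int D *)
  moreover have "x + y = toL (pairf D (\<lambda>x. \<psi> x + \<phi> x) (grad (\<lambda>x. \<psi> x + \<phi> x)))"
    unfolding e * by (rule toL_add[symmetric]) (intro smooth_vanishing_sq_int D *)+
  ultimately show "x + y \<in> Sgen D" unfolding Sgen_def by blast
next
  fix c x assume "x \<in> Sgen D"
  then obtain \<psi> where *: "smooth_vanishing D \<psi>" "x = toL (pairf D \<psi> (grad \<psi>))" by (auto simp: Sgen_def)
  have s: "smooth_fun \<psi>" using * by (auto simp: smooth_vanishing_def)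
  have e: "pairf D (\<lambda>x. c * \<psi> x) (grad (\<lambda>x. c * \<psi> x)) = (\<lambda>x. c *\<^sub>R pairf D \<psi> (grad \<psi>) x)"
    by (rule ext) (simp add: pairf_def grad_cmult[OF s] indicator_def)
  have "smooth_vanishing D (\<lambda>x. c * \<psi> x)"
    by (rule smooth_vanishingI[OF D smooth_fun_cmult[OF s]], use * in \<open>simp add: smooth_vanishing_def\<close>)
      (unfold e, intro sq_int_scaleR smooth_vanishing_sq_int D *)
  moreover have "c *\<^sub>R x = toL (pairf D (\<lambda>x. c * \<psi> x) (grad (\<lambda>x. c * \<psi> x)))"
    unfolding e * by (rule toL_scaleR[symmetric]) (intro smooth_vanishing_sq_int D *)
  ultimately show "c *\<^sub>R x \<in> Sgen D" unfolding Sgen_def by blast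
qed

lemma subspace_Hsp: "open D \<Longrightarrow> subspace (Hsp D)"
  unfolding Hsp_def by (rule subspace_closure[OF subspace_Sgen])

lemma closed_Hsp: "closed (Hsp D)" by (simp add: Hsp_def)

lemma borel_measurable_fst_snd:
  fixes f :: "'a \<Rightarrow> 'b::topological_space \<times> 'c::topological_space"
  assumes "f \<in> borel_measurable M"
  shows "(\<lambda>x. fst (f x)) \<in> borel_measurable M" "(\<lambda>x. snd (f x)) \<in> borel_measurable M"
  by (rule borel_measurable_continuous_on[OF _ assms], intro continuous_intros)+

lemma integrable_summand:
  fixes a b :: "'a \<Rightarrow> real"
  assumes i: "integrable M (\<lambda>x. a x + b x)" and "\<And>x. 0 \<le> a x" "\<And>x. 0 \<le> b x"
    and "a \<in> borel_measurable M" "b \<in> borel_measurable M"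
  shows "integrable M a" "integrable M b"
  by (rule Bochner_Integration.integrable_bound[OF i], use assms in simp, rule AE_I2, use assms in \<open>simp add: abs_of_nonneg\<close>)+

lemma tendsto_zero_if_square:
  fixes f :: "'i \<Rightarrow> real"
  assumes "((\<lambda>j. (f j)\<^sup>2) \<longlongrightarrow> 0) F" shows "(f \<longlongrightarrow> 0) F"
proof -
  have "((\<lambda>j. sqrt ((f j)\<^sup>2)) \<longlongrightarrow> sqrt 0) F" by (intro tendsto_intros assms)
  then show ?thesis by (simp add: tendsto_rabs_zero_iff)
qed

text \<open>The two integrals that must tend to 0 in \<open>H1\<close> are the two summands of one
  squared distance to k, so both do exactly when the pairs converge to k.\<close>

lemma H1_iff:
  fixes k :: "(real^'n, real \<times> (real^'n)) l2"
  assumes D: "open D" and ae: "AE x in lborel. x \<in> D \<longrightarrow> rep k x = (v x, g x)"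
    and off: "AE x in lborel. x \<notin> D \<longrightarrow> rep k x = 0"
  shows "H1 D v g \<longleftrightarrow> k \<in> Hsp D"
proof -
  have [measurable]: "D \<in> sets borel" using D by simp
  have Db: "D \<in> sets borel" by simp
  note [measurable] = borel_measurable_fst_snd[OF rep_measurable[of k]]
  have aev: "AE x in lborel. x \<in> D \<longrightarrow> v x = fst (rep k x)" and aeg: "AE x in lborel. x \<in> D \<longrightarrow> g x = snd (rep k x)"
    using ae by (eventually_elim, simp)+
  have k2: "integrable lborel (\<lambda>x. (norm (rep k x))\<^sup>2)" by (rule sq_int_square[OF sq_int_rep])
  have iv: "integrable lborel (\<lambda>x. indicator D x *\<^sub>R (fst (rep k x))\<^sup>2)"
    by (rule Bochner_Integration.integrable_bound[OF k2], measurable, rule AE_I2, auto simp: indicator_def norm_prod_def)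
  have ig: "integrable lborel (\<lambda>x. indicator D x *\<^sub>R (norm (snd (rep k x)))\<^sup>2)"
    by (rule Bochner_Integration.integrable_bound[OF k2], measurable, rule AE_I2, auto simp: indicator_def norm_prod_def)
  have base: "L2 D v" "g \<in> borel_measurable (lebesgue_on D)" "integrable (lebesgue_on D) (\<lambda>x. (norm (g x))\<^sup>2)"
  proof -
    have e1: "AE x in lborel. x \<in> D \<longrightarrow> (v x)\<^sup>2 = (fst (rep k x))\<^sup>2" using aev by eventually_elim simp
    have e2: "AE x in lborel. x \<in> D \<longrightarrow> (norm (g x))\<^sup>2 = (norm (snd (rep k x)))\<^sup>2" using aeg by eventually_elim simp
    show "L2 D v" unfolding L2_def
      using lebesgue_on_measurable[OF Db _ aev] lebesgue_on_integrable[OF Db _ e1] iv by simp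
    show "g \<in> borel_measurable (lebesgue_on D)" by (rule lebesgue_on_measurable[OF Db _ aeg]) simp
    show "integrable (lebesgue_on D) (\<lambda>x. (norm (g x))\<^sup>2)" using lebesgue_on_integrable[OF Db _ e2] ig by simp
  qed
  define A where "A \<psi> = integral\<^sup>L (lebesgue_on D) (\<lambda>x. (\<psi> x - v x)\<^sup>2)" for \<psi>
  define B where "B \<psi> = integral\<^sup>L (lebesgue_on D) (\<lambda>x. (norm (grad \<psi> x - g x))\<^sup>2)" for \<psi>
  have AB: "A \<psi> \<ge> 0" "B \<psi> \<ge> 0" for \<psi> by (simp_all add: A_def B_def)
  have dist: "(norm (toL (pairf D \<psi> (grad \<psi>)) - k))\<^sup>2 = A \<psi> + B \<psi>" if \<psi>: "smooth_vanishing D \<psi>" for \<psi>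
  proof -
    have s: "smooth_fun \<psi>" using \<psi> by (simp add: smooth_vanishing_def)
    have [measurable]: "\<psi> \<in> borel_measurable borel" "grad \<psi> \<in> borel_measurable borel"
      using s by (auto intro: smooth_fun_measurable grad_measurable)
    have q: "sq_int (pairf D \<psi> (grad \<psi>))" by (rule smooth_vanishing_sq_int[OF D \<psi>])
    have qd: "sq_int (\<lambda>x. pairf D \<psi> (grad \<psi>) x - rep k x)" by (rule sq_int_diff[OF q sq_int_rep])
    let ?a = "\<lambda>x. indicator D x *\<^sub>R (\<psi> x - fst (rep k x))\<^sup>2" and ?b = "\<lambda>x. indicator D x *\<^sub>R (norm (grad \<psi> x - snd (rep k x)))\<^sup>2"
    have n: "AE x in lborel. (norm (pairf D \<psi> (grad \<psi>) x - rep k x))\<^sup>2 = ?a x + ?b x"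
      using off by eventually_elim (auto simp: pairf_def indicator_def norm_prod_def)
    have qm: "(\<lambda>x. (norm (pairf D \<psi> (grad \<psi>) x - rep k x))\<^sup>2) \<in> borel_measurable lborel"
      using qd by (auto simp: sq_int_def)
    have iab: "integrable lborel (\<lambda>x. ?a x + ?b x)"
      using sq_int_square[OF qd] integrable_cong_AE[OF qm _ n] by simp
    have ia: "integrable lborel ?a" by (rule integrable_summand(1)[OF iab]) simp_all
    have ib: "integrable lborel ?b" by (rule integrable_summand(2)[OF iab]) simp_all
    have "(norm (toL (pairf D \<psi> (grad \<psi>)) - k))\<^sup>2 = (LINT x|lborel. (norm (pairf D \<psi> (grad \<psi>) x - rep k x))\<^sup>2)"
      using norm_toL[OF qd] toL_diff[OF q sq_int_rep[of k]] by simp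
    also have "\<dots> = (LINT x|lborel. ?a x + ?b x)" by (rule integral_cong_AE[OF qm _ n]) simp
    also have "\<dots> = (LINT x|lborel. ?a x) + (LINT x|lborel. ?b x)" by (rule Bochner_Integration.integral_add[OF ia ib])
    also have "(LINT x|lborel. ?a x) = A \<psi>"
      unfolding A_def by (rule lebesgue_on_integral[OF Db, symmetric], simp, use aev in eventually_elim) simp
    also have "(LINT x|lborel. ?b x) = B \<psi>"
      unfolding B_def by (rule lebesgue_on_integral[OF Db, symmetric], simp, use aeg in eventually_elim) simp
    finally show ?thesis .
  qed
  show ?thesis
  proof
    assume "H1 D v g"
    then obtain \<psi>s where ps: "\<And>j. smooth_vanishing D (\<psi>s j)" "(\<lambda>j. A (\<psi>s j)) \<longlonglongrightarrow> 0" "(\<lambda>j. B (\<psi>s j)) \<longlonglongrightarrow> 0"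
      unfolding H1_def A_def B_def by blast
    have "(\<lambda>j. A (\<psi>s j) + B (\<psi>s j)) \<longlonglongrightarrow> 0 + 0" by (intro tendsto_add ps)
    then have "(\<lambda>j. (norm (toL (pairf D (\<psi>s j) (grad (\<psi>s j))) - k))\<^sup>2) \<longlonglongrightarrow> 0" by (simp add: dist ps)
    then have "(\<lambda>j. norm (toL (pairf D (\<psi>s j) (grad (\<psi>s j))) - k)) \<longlonglongrightarrow> 0" by (rule tendsto_zero_if_square)
    then have "(\<lambda>j. toL (pairf D (\<psi>s j) (grad (\<psi>s j)))) \<longlonglongrightarrow> k" by (simp add: tendsto_norm_zero_iff LIM_zero_iff)
    moreover have "toL (pairf D (\<psi>s j) (grad (\<psi>s j))) \<in> Sgen D" for j using ps(1) by (auto simp: Sgen_def)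
    ultimately show "k \<in> Hsp D"
      unfolding Hsp_def closure_sequential by (intro exI[of _ "\<lambda>j. toL (pairf D (\<psi>s j) (grad (\<psi>s j)))"]) simp
  next
    assume "k \<in> Hsp D"
    then obtain s where s: "\<And>j::nat. s j \<in> Sgen D" "s \<longlonglongrightarrow> k" unfolding Hsp_def closure_sequential by blast
    have "\<forall>j. \<exists>\<psi>. smooth_vanishing D \<psi> \<and> s j = toL (pairf D \<psi> (grad \<psi>))" using s(1) by (auto simp: Sgen_def)
    from choice[OF this] obtain \<psi>s where ps: "\<And>j. smooth_vanishing D (\<psi>s j)" "\<And>j. s j = toL (pairf D (\<psi>s j) (grad (\<psi>s j)))" by blast
    have "(\<lambda>j. (norm (s j - k))\<^sup>2) \<longlonglongrightarrow> (norm (k - k))\<^sup>2" by (intro tendsto_intros s)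
    then have l: "(\<lambda>j. A (\<psi>s j) + B (\<psi>s j)) \<longlonglongrightarrow> 0" by (simp add: ps dist)
    have "(\<lambda>j. A (\<psi>s j)) \<longlonglongrightarrow> 0"
      by (rule tendsto_sandwich[OF _ _ tendsto_const l]) (auto intro!: always_eventually AB)
    moreover have "(\<lambda>j. B (\<psi>s j)) \<longlonglongrightarrow> 0"
      by (rule tendsto_sandwich[OF _ _ tendsto_const l]) (auto intro!: always_eventually AB)
    ultimately show "H1 D v g" unfolding H1_def using base ps(1) unfolding A_def B_def by blast
  qed
qed

lemma toL_dominated_convergence:
  fixes f :: "nat \<Rightarrow> 'a::euclidean_space \<Rightarrow> 'b::{real_inner,banach,second_countable_topology}"
  assumes [measurable]: "\<And>n. f n \<in> borel_measurable borel" "g \<in> borel_measurable borel"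
    and w: "integrable lborel w" and le: "\<And>n x. (norm (f n x))\<^sup>2 \<le> w x" and lim: "\<And>x. (\<lambda>n. f n x) \<longlonglongrightarrow> g x"
  shows "sq_int g" "\<And>n. sq_int (f n)" "(\<lambda>n. toL (f n)) \<longlonglongrightarrow> toL g"
proof -
  have gle: "(norm (g x))\<^sup>2 \<le> w x" for x
  proof (rule LIMSEQ_le_const2)
    show "(\<lambda>n. (norm (f n x))\<^sup>2) \<longlonglongrightarrow> (norm (g x))\<^sup>2" by (intro tendsto_intros lim)
  qed (use le in auto)
  show g: "sq_int g" by (rule sq_int_bound[OF _ w]) (use gle in auto)
  show f: "sq_int (f n)" for n by (rule sq_int_bound[OF _ w]) (use le in auto)
  have "(\<lambda>n. LINT x|lborel. (norm (f n x - g x))\<^sup>2) \<longlonglongrightarrow> (LINT x::'a|lborel. 0)"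
  proof (rule integral_dominated_convergence[where w = "\<lambda>x. 4 * w x"])
    show "AE x in lborel. (\<lambda>n. (norm (f n x - g x))\<^sup>2) \<longlonglongrightarrow> 0"
    proof (rule AE_I2)
      fix x
      have "(\<lambda>n. (norm (f n x - g x))\<^sup>2) \<longlonglongrightarrow> (norm (g x - g x))\<^sup>2" by (intro tendsto_intros lim)
      then show "(\<lambda>n. (norm (f n x - g x))\<^sup>2) \<longlonglongrightarrow> 0" by simp
    qed
    show "AE x in lborel. norm ((norm (f n x - g x))\<^sup>2) \<le> 4 * w x" for n
    proof (rule AE_I2)
      fix x
      have "(norm (f n x + - g x))\<^sup>2 \<le> 2 * (norm (f n x))\<^sup>2 + 2 * (norm (- g x))\<^sup>2" by (rule norm_add_square_le)
      then show "norm ((norm (f n x - g x))\<^sup>2) \<le> 4 * w x" using le[of n x] gle[of x] by simp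
    qed
  qed (use w in auto)
  moreover have "(LINT x|lborel. (norm (f n x - g x))\<^sup>2) = (norm (toL (f n) - toL g))\<^sup>2" for n
    using norm_toL[OF sq_int_diff[OF f g]] toL_diff[OF f g] by simp
  ultimately have "(\<lambda>n. (norm (toL (f n) - toL g))\<^sup>2) \<longlonglongrightarrow> 0" by simp
  then have "(\<lambda>n. norm (toL (f n) - toL g)) \<longlonglongrightarrow> 0" by (rule tendsto_zero_if_square)
  then show "(\<lambda>n. toL (f n)) \<longlonglongrightarrow> toL g" by (simp add: tendsto_norm_zero_iff LIM_zero_iff)
qed

subsection \<open>Test functions are dense\<close>

lemma pd_const: "pd (\<lambda>x. c) v x = 0" by (rule pd_eqI[OF has_derivative_const])

lemma sstep_deriv_outside: assumes "s < 0 \<or> s > 1" shows "pd sstep 1 s = 0"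
  using assms
proof
  assume "s < 0"
  have "pd sstep 1 s = pd (\<lambda>s. 0) 1 s"
    by (rule pd_cong_open(1)[of "{..<0}"]) (use \<open>s < 0\<close> in \<open>auto simp: sstep_eq_0\<close>)
  then show ?thesis by (simp add: pd_const)
next
  assume "s > 1"
  have "pd sstep 1 s = pd (\<lambda>s. 1) 1 s"
    by (rule pd_cong_open(1)[of "{1<..}"]) (use \<open>s > 1\<close> in \<open>auto simp: sstep_eq_1\<close>)
  then show ?thesis by (simp add: pd_const)
qed

lemma sstep_deriv_bounded: "\<exists>C\<ge>0. \<forall>s. \<bar>pd sstep 1 s\<bar> \<le> C"
proof -
  have "continuous_on {0..1} (pd sstep 1)"
    by (rule smooth_fun_continuous[OF smooth_fun_pd[OF smooth_fun_sstep]]) simp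
  then have "bounded (pd sstep 1 ` {0..1})" by (intro compact_imp_bounded compact_continuous_image) auto
  then obtain C where C: "\<And>y. y \<in> pd sstep 1 ` {0..1} \<Longrightarrow> norm y \<le> C" unfolding bounded_iff by blast
  have "\<bar>pd sstep 1 s\<bar> \<le> max C 0" for s
  proof (cases "s \<in> {0..1}")
    case True then show ?thesis using C[of "pd sstep 1 s"] by auto
  next
    case False then show ?thesis using sstep_deriv_outside[of s] by auto
  qed
  then show ?thesis by (intro exI[of _ "max C 0"]) auto
qed

text \<open>A smooth substitute for the soft thresholding \<open>s \<mapsto> sgn s * max 0 (\<bar>s\<bar> - 1)\<close>.\<close>
definition thr :: "real \<Rightarrow> real" where "thr s = s * sstep (s * s - 1)"

lemma smooth_fun_ident: "smooth_fun (\<lambda>s::real. s)"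
  by (rule smooth_fun_bounded_linear[OF bounded_linear_ident])

lemma smooth_fun_thr: "smooth_fun thr"
  unfolding thr_def[abs_def]
  by (intro smooth_fun_mult smooth_fun_compose[OF smooth_fun_sstep] smooth_fun_diff smooth_fun_const smooth_fun_ident)

lemma thr_le: "\<bar>thr s\<bar> \<le> \<bar>s\<bar>"
  using sstep_range[of "s * s - 1"] by (simp add: thr_def abs_mult mult_left_le)

lemma thr_eq_0: "\<bar>s\<bar> \<le> 1 \<Longrightarrow> thr s = 0"
proof -
  assume "\<bar>s\<bar> \<le> 1"
  then have "s\<^sup>2 \<le> 1" by (simp add: abs_square_le_1)
  then show "thr s = 0" by (simp add: thr_def sstep_eq_0 power2_eq_square)
qed

lemma thr_eq_self: "s * s \<ge> 2 \<Longrightarrow> thr s = s" by (simp add: thr_def sstep_eq_1)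

lemma pd_thr: "pd thr 1 s = 2 * (s * s) * pd sstep 1 (s * s - 1) + sstep (s * s - 1)"
proof -
  have sq: "smooth_fun (\<lambda>s::real. s * s - 1)" by (intro smooth_fun_diff smooth_fun_mult smooth_fun_const smooth_fun_ident)
  have c: "smooth_fun (\<lambda>s::real. sstep (s * s - 1))" by (rule smooth_fun_compose[OF smooth_fun_sstep sq])
  have 1: "pd (\<lambda>s::real. s) 1 s = 1" by (rule pd_real_derivative) (rule DERIV_ident)
  have 2: "pd (\<lambda>s::real. s * s - 1) 1 s = 2 * s" by (rule pd_real_derivative) (auto intro!: derivative_eq_intros)
  have "pd thr 1 s = s * pd (\<lambda>s. sstep (s * s - 1)) 1 s + pd (\<lambda>s. s) 1 s * sstep (s * s - 1)"
    unfolding thr_def[abs_def] by (rule pd_mult[OF smooth_fun_differentiable[OF smooth_fun_ident] smooth_fun_differentiable[OF c]])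
  also have "pd (\<lambda>s. sstep (s * s - 1)) 1 s = pd sstep 1 (s * s - 1) * pd (\<lambda>s::real. s * s - 1) 1 s"
    by (rule pd_compose[OF smooth_fun_sstep smooth_fun_differentiable[OF sq]])
  finally show ?thesis by (simp add: 1 2)
qed

lemma pd_thr_0: "pd thr 1 0 = 0"
  by (simp add: pd_thr sstep_deriv_outside sstep_eq_0)

lemma pd_thr_1: "s * s > 2 \<Longrightarrow> pd thr 1 s = 1"
  by (simp add: pd_thr sstep_deriv_outside sstep_eq_1)

lemma pd_thr_bounded: "\<exists>C\<ge>0. \<forall>s. \<bar>pd thr 1 s\<bar> \<le> C"
proof -
  obtain C where C: "C \<ge> 0" "\<And>s. \<bar>pd sstep 1 s\<bar> \<le> C" using sstep_deriv_bounded by blast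
  have "\<bar>pd thr 1 s\<bar> \<le> 4 * C + 1" for s
  proof -
    have "\<bar>2 * (s * s) * pd sstep 1 (s * s - 1)\<bar> \<le> 4 * C"
    proof (cases "s * s - 1 > 1")
      case True then show ?thesis using C(1) by (simp add: sstep_deriv_outside)
    next
      case False
      then have "\<bar>2 * (s * s)\<bar> * \<bar>pd sstep 1 (s * s - 1)\<bar> \<le> 4 * C" by (intro mult_mono C) auto
      then show ?thesis by (simp only: abs_mult)
    qed
    moreover have "\<bar>sstep (s * s - 1)\<bar> \<le> 1" using sstep_range[of "s * s - 1"] by simp
    ultimately show ?thesis unfolding pd_thr by linarith
  qed
  then show ?thesis using C(1) by (intro exI[of _ "4 * C + 1"]) auto
qed

text \<open>1 where a |x|^2 < 1 and 0 where a |x|^2 \<ge> 2; the square of the norm avoids its kink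
  at the origin.\<close>

definition cutoff :: "real \<Rightarrow> 'a::euclidean_space \<Rightarrow> real" where
  "cutoff a x = 1 - sstep (a * (norm x)\<^sup>2 - 1)"

lemma smooth_fun_cutoff: "smooth_fun (cutoff a)"
  unfolding cutoff_def[abs_def]
  by (intro smooth_fun_diff smooth_fun_compose[OF smooth_fun_sstep] smooth_fun_const smooth_fun_cmult smooth_fun_norm_square)

lemma cutoff_range: "0 \<le> cutoff a x" "cutoff a x \<le> 1"
  using sstep_range[of "a * (norm x)\<^sup>2 - 1"] by (simp_all add: cutoff_def)

lemma pd_cutoff:
  "pd (cutoff a) v x = - (pd sstep 1 (a * (norm x)\<^sup>2 - 1) * (2 * a * (x \<bullet> v)))"
proof -
  let ?q = "\<lambda>x. a * (norm x)\<^sup>2 - 1"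
  have q: "smooth_fun ?q" by (intro smooth_fun_diff smooth_fun_const smooth_fun_cmult smooth_fun_norm_square)
  have "(?q has_derivative (\<lambda>v. 2 * a * (x \<bullet> v))) (at x)"
    unfolding power2_norm_eq_inner by (auto intro!: derivative_eq_intros simp: inner_commute)
  then have "pd ?q v x = 2 * a * (x \<bullet> v)" by (rule pd_eqI)
  then have s: "pd (\<lambda>x. sstep (?q x)) v x = pd sstep 1 (?q x) * (2 * a * (x \<bullet> v))"
    using pd_compose[OF smooth_fun_sstep smooth_fun_differentiable[OF q], of v x] by simp
  have "((\<lambda>x. 1 - sstep (?q x)) has_derivative (\<lambda>v. 0 - pd (\<lambda>x. sstep (?q x)) v x)) (at x)"
    by (intro has_derivative_diff has_derivative_const smooth_fun_has_derivative smooth_fun_compose[OF smooth_fun_sstep q])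
  then have "pd (cutoff a) v x = 0 - pd (\<lambda>x. sstep (?q x)) v x" unfolding cutoff_def[abs_def] by (rule pd_eqI)
  then show ?thesis unfolding s by simp
qed

lemma cutoff_near: assumes "a * (norm x)\<^sup>2 < 1" shows "cutoff a x = 1" "pd (cutoff a) v x = 0"
  using assms by (simp_all add: cutoff_def sstep_eq_0 pd_cutoff sstep_deriv_outside)

lemma cutoff_far: "a * (norm x)\<^sup>2 \<ge> 2 \<Longrightarrow> cutoff a x = 0"
  by (simp add: cutoff_def sstep_eq_1)

lemma pd_cutoff_bounded: "\<exists>C\<ge>0. \<forall>a x v. 0 < a \<longrightarrow> a \<le> 1 \<longrightarrow> norm v \<le> 1 \<longrightarrow> \<bar>pd (cutoff a) v x\<bar> \<le> C"
proof -
  obtain C where C: "C \<ge> 0" "\<And>s. \<bar>pd sstep 1 s\<bar> \<le> C" using sstep_deriv_bounded by blast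
  have "\<bar>pd (cutoff a) v x\<bar> \<le> C * 4" if a: "0 < a" "a \<le> 1" and v: "norm v \<le> 1" for a v and x :: 'a
  proof (cases "a * (norm x)\<^sup>2 - 1 > 1")
    case True then show ?thesis using C(1) by (simp add: pd_cutoff sstep_deriv_outside)
  next
    case False
    \<comment> \<open>In the transition layer a |x|^2 \<le> 2; together with a \<le> 1 this bounds a
      |x|, uniformly in a.\<close>
    have "(a * norm x)\<^sup>2 = a * (a * (norm x)\<^sup>2)" by (simp add: power2_eq_square)
    also have "\<dots> \<le> 1 * 2" using a False by (intro mult_mono) auto
    finally have "(a * norm x)\<^sup>2 \<le> 2\<^sup>2" by simp
    then have "a * norm x \<le> 2" by (rule power2_le_imp_le) simp
    moreover have "\<bar>x \<bullet> v\<bar> \<le> norm x * norm v" by (rule Cauchy_Schwarz_ineq2)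
    then have "\<bar>x \<bullet> v\<bar> \<le> norm x" using v by (smt (verit) mult_left_le norm_ge_zero)
    then have "a * \<bar>x \<bullet> v\<bar> \<le> a * norm x" using a by (intro mult_left_mono) auto
    ultimately have "a * \<bar>x \<bullet> v\<bar> \<le> 2" by (rule order_trans[rotated])
    then have "\<bar>2 * a * (x \<bullet> v)\<bar> \<le> 4" using a by (simp add: abs_mult)
    then have "\<bar>pd sstep 1 (a * (norm x)\<^sup>2 - 1)\<bar> * \<bar>2 * a * (x \<bullet> v)\<bar> \<le> C * 4" by (intro mult_mono C) auto
    then show ?thesis by (simp only: pd_cutoff abs_minus_cancel abs_mult)
  qed
  then show ?thesis using C(1) by (intro exI[of _ "C * 4"]) auto
qed

definition Cgen :: "(real^'n) set \<Rightarrow> (real^'n, real \<times> (real^'n)) l2 set" where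
  "Cgen D = {toL (pairf D \<psi> (grad \<psi>)) | \<psi>. ccinf D \<psi>}"

lemma ccinf_smooth_vanishing:
  fixes D :: "(real^'n) set"
  assumes D: "open D" and \<psi>: "ccinf D \<psi>" shows "smooth_vanishing D \<psi>"
proof (rule smooth_vanishingI[OF D ccinf_smooth[OF \<psi>]])
  obtain K where K: "K \<subseteq> D" "\<And>x. x \<notin> K \<Longrightarrow> \<psi> x = 0" using ccinf_support[OF \<psi>] by blast
  show "\<psi> x = 0" if "x \<in> frontier D" for x using that K D by (auto simp: frontier_def interior_open)
  have s: "smooth_fun \<psi>" by (rule ccinf_smooth[OF \<psi>])
  show "sq_int (pairf D \<psi> (grad \<psi>))"
  proof (rule sq_int_pairf)
    have ii: "integrable lborel (\<lambda>x. indicator D x * (f x)\<^sup>2)" if "ccinf D f" for f :: "real^'n \<Rightarrow> real"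
      using integrable_mult_indicator[OF _ sq_int_square[OF sq_int_ccinf[OF that]], of D] D by simp
    show "integrable lborel (\<lambda>x. indicator D x * (\<psi> x)\<^sup>2)" by (rule ii[OF \<psi>])
    have "integrable lborel (\<lambda>x. \<Sum>i\<in>UNIV. indicator D x * (pd \<psi> (axis i 1) x)\<^sup>2)"
      by (intro Bochner_Integration.integrable_sum ii ccinf_pd[OF \<psi>] axis_Basis)
    then show "integrable lborel (\<lambda>x. indicator D x * (norm (grad \<psi> x))\<^sup>2)"
      by (simp only: norm_vec_square grad_nth sum_distrib_left)
  qed (use D s smooth_fun_measurable grad_measurable in auto)
qed

text \<open>Values are truncated rather than the domain: (1/k) thr (k \<psi>) vanishes where
  |\<psi>| \<le> 1/k, hence near the frontier, and a cutoff at large |x| supplies compactness. The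
  gradients converge to grad \<psi> where \<psi> is nonzero but to 0 on the zero set, whence the
  modified gradient of the limit.\<close>

lemma truncation_approx:
  fixes D :: "(real^'n) set"
  assumes D: "open D" and \<psi>: "smooth_vanishing D \<psi>"
  shows "\<exists>f. (\<forall>n::nat. ccinf D (f n)) \<and>
    (\<lambda>n. toL (pairf D (f n) (grad (f n)))) \<longlonglongrightarrow> toL (pairf D \<psi> (\<lambda>x. if \<psi> x = 0 then 0 else grad \<psi> x)) \<and>
    sq_int (pairf D \<psi> (\<lambda>x. if \<psi> x = 0 then 0 else grad \<psi> x))"
proof -
  let ?G = "\<lambda>x. if \<psi> x = 0 then 0 else grad \<psi> x"
  have [measurable]: "D \<in> sets borel" using D by simp
  have s: "smooth_fun \<psi>" and van: "\<And>x. x \<in> frontier D \<Longrightarrow> \<psi> x = 0" using \<psi> by (auto simp: smooth_vanishing_def)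
  have [measurable]: "\<psi> \<in> borel_measurable borel" "grad \<psi> \<in> borel_measurable borel"
    using s by (auto intro: smooth_fun_measurable grad_measurable)
  obtain C1 where C1: "C1 \<ge> 0" "\<And>r. \<bar>pd thr 1 r\<bar> \<le> C1" using pd_thr_bounded by blast
  obtain C2 where C2: "C2 \<ge> 0" "\<And>a v x. 0 < a \<Longrightarrow> a \<le> 1 \<Longrightarrow> norm v \<le> 1 \<Longrightarrow> \<bar>pd (cutoff a) v (x::real^'n)\<bar> \<le> C2"
    using pd_cutoff_bounded by blast
  define k where "k n = real (Suc n)" for n
  have k: "k n \<ge> 1" for n by (simp add: k_def)
  have k0: "k n > 0" for n using k[of n] by linarith
  \<comment> \<open>With this scale the cutoff is 1 for |x| < k n, and a n \<le> 1 keeps its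
    derivatives uniformly bounded.\<close>
  define a where "a n = 1 / (k n)\<^sup>2" for n
  have a: "0 < a n" "a n \<le> 1" for n using k[of n] k0[of n] by (auto simp: a_def one_le_power)
  define g where "g n x = (1 / k n) * thr (k n * \<psi> x)" for n x
  define h where "h n x = cutoff (a n) x * g n x" for n x
  \<comment> \<open>h may be nonzero outside D, where nothing is known about \<psi>. It vanishes on
    D - K, so cutting it to D preserves smoothness.\<close>
  define f where "f n x = (if x \<in> D then h n x else 0)" for n x
  have sg: "smooth_fun (g n)" for n
    unfolding g_def[abs_def] by (intro smooth_fun_cmult smooth_fun_compose[OF smooth_fun_thr] s)
  have sh: "smooth_fun (h n)" for n unfolding h_def[abs_def] by (intro smooth_fun_mult smooth_fun_cutoff sg)
  \<comment> \<open>On this compact set |\<psi>| is at least 1/k, so it avoids the frontier and lies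
    in D. The cutoff is 0 from radius sqrt 2 k on, well inside the radius 2k.\<close>
  define K where "K n = closure D \<inter> cball 0 (2 * k n) \<inter> {x. 1 / k n \<le> \<bar>\<psi> x\<bar>}" for n
  have clK: "closed {x. 1 / k n \<le> \<bar>\<psi> x\<bar>}" for n
    by (intro closed_Collect_le continuous_intros smooth_fun_continuous[OF s])
  have K: "compact (K n)" for n
    unfolding K_def by (intro compact_Int_closed clK closed_Int_compact closed_closure compact_cball)
  have KD: "K n \<subseteq> D" for n
  proof
    fix x assume x: "x \<in> K n"
    then have "\<psi> x \<noteq> 0" using k0[of n] by (auto simp: K_def)
    then have "x \<notin> frontier D" using van by blast
    then show "x \<in> D" using x D by (auto simp: K_def frontier_def interior_open)
  qed
  have hz: "h n x = 0" if "x \<in> D - K n" for n x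
  proof (cases "x \<in> cball 0 (2 * k n)")
    case True
    then have "\<bar>\<psi> x\<bar> < 1 / k n" using that closure_subset[of D] by (auto simp: K_def)
    then have "\<bar>k n * \<psi> x\<bar> \<le> 1" using k0[of n] by (simp add: abs_mult field_simps)
    then show ?thesis by (simp add: h_def g_def thr_eq_0)
  next
    case False
    then have "(2 * k n)\<^sup>2 \<le> (norm x)\<^sup>2" using k0[of n] by (intro power_mono) auto
    then have "4 * (k n)\<^sup>2 \<le> (norm x)\<^sup>2" by (simp add: power_mult_distrib)
    then have "2 * (k n)\<^sup>2 \<le> (norm x)\<^sup>2" using zero_le_power2[of "k n"] by linarith
    then have "a n * (norm x)\<^sup>2 \<ge> 2" using k0[of n] by (simp add: a_def field_simps)
    then show ?thesis by (simp add: h_def cutoff_far)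
  qed
  have sf: "smooth_fun (f n)" for n
    unfolding f_def[abs_def] by (rule smooth_fun_extend_by_zero[OF D compact_imp_closed[OF K] KD sh hz])
  have cf: "ccinf D (f n)" for n
    by (rule ccinfI[OF sf K KD]) (use hz in \<open>auto simp: f_def\<close>)
  have pdg: "pd (g n) v x = pd thr 1 (k n * \<psi> x) * pd \<psi> v x" for n v x
  proof -
    have "pd (g n) v x = (1 / k n) * pd (\<lambda>x. thr (k n * \<psi> x)) v x"
      unfolding g_def[abs_def] by (rule pd_cmult) (intro smooth_fun_compose[OF smooth_fun_thr] smooth_fun_cmult s)
    also have "pd (\<lambda>x. thr (k n * \<psi> x)) v x = pd thr 1 (k n * \<psi> x) * pd (\<lambda>x. k n * \<psi> x) v x"
      by (rule pd_compose[OF smooth_fun_thr smooth_fun_differentiable[OF smooth_fun_cmult[OF s]]])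
    also have "pd (\<lambda>x. k n * \<psi> x) v x = k n * pd \<psi> v x" by (rule pd_cmult[OF s])
    finally show ?thesis using k0[of n] by simp
  qed
  have pdf: "pd (f n) v x = cutoff (a n) x * (pd thr 1 (k n * \<psi> x) * pd \<psi> v x) + pd (cutoff (a n)) v x * g n x"
    if "x \<in> D" for n v x
  proof -
    have "pd (f n) v x = pd (h n) v x" by (rule pd_cong_open(1)[OF D that]) (simp add: f_def)
    also have "\<dots> = cutoff (a n) x * pd (g n) v x + pd (cutoff (a n)) v x * g n x"
      unfolding h_def[abs_def] by (rule pd_mult[OF smooth_fun_differentiable[OF smooth_fun_cutoff] smooth_fun_differentiable[OF sg]])
    finally show ?thesis by (simp only: pdg)
  qed
  have gle: "\<bar>g n x\<bar> \<le> \<bar>\<psi> x\<bar>" for n x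
    using thr_le[of "k n * \<psi> x"] k0[of n] by (simp add: g_def abs_mult field_simps)
  have fle: "(f n x)\<^sup>2 \<le> (\<psi> x)\<^sup>2" for n x
  proof -
    have "\<bar>cutoff (a n) x\<bar> * \<bar>g n x\<bar> \<le> 1 * \<bar>\<psi> x\<bar>" using cutoff_range[of "a n" x] by (intro mult_mono gle) auto
    then have "\<bar>f n x\<bar> \<le> \<bar>\<psi> x\<bar>" by (auto simp: f_def h_def abs_mult)
    then show ?thesis by (simp add: abs_le_square_iff)
  qed
  have dle: "(pd (f n) (axis i 1) x)\<^sup>2 \<le> 2 * (C1\<^sup>2 * (pd \<psi> (axis i 1) x)\<^sup>2) + 2 * (C2\<^sup>2 * (\<psi> x)\<^sup>2)" if x: "x \<in> D" for n i x
  proof -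
    have 1: "\<bar>cutoff (a n) x * (pd thr 1 (k n * \<psi> x) * pd \<psi> (axis i 1) x)\<bar> \<le> 1 * (C1 * \<bar>pd \<psi> (axis i 1) x\<bar>)"
      unfolding abs_mult using cutoff_range[of "a n" x] by (intro mult_mono C1) auto
    have 2: "\<bar>pd (cutoff (a n)) (axis i 1) x * g n x\<bar> \<le> C2 * \<bar>\<psi> x\<bar>"
      unfolding abs_mult using C2(1) by (intro mult_mono C2(2) a gle) auto
    have "(pd (f n) (axis i 1) x)\<^sup>2 \<le> 2 * (cutoff (a n) x * (pd thr 1 (k n * \<psi> x) * pd \<psi> (axis i 1) x))\<^sup>2 + 2 * (pd (cutoff (a n)) (axis i 1) x * g n x)\<^sup>2"
      unfolding pdf[OF x] using norm_add_square_le[of "cutoff (a n) x * (pd thr 1 (k n * \<psi> x) * pd \<psi> (axis i 1) x)" "pd (cutoff (a n)) (axis i 1) x * g n x"]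
      by simp
    also have "\<dots> \<le> 2 * (C1 * \<bar>pd \<psi> (axis i 1) x\<bar>)\<^sup>2 + 2 * (C2 * \<bar>\<psi> x\<bar>)\<^sup>2"
      using power_mono[OF 1, of 2] power_mono[OF 2, of 2] by simp
    finally show ?thesis by (simp add: power_mult_distrib)
  qed
  let ?N = "real CARD('n)"
  define w where "w x = indicator D x * (\<psi> x)\<^sup>2 + (2 * C1\<^sup>2 * (indicator D x * (norm (grad \<psi> x))\<^sup>2) + ?N * (2 * (C2\<^sup>2 * (indicator D x * (\<psi> x)\<^sup>2))))" for x
  have psi2: "integrable lborel (\<lambda>x. indicator D x * (\<psi> x)\<^sup>2 + indicator D x * (norm (grad \<psi> x))\<^sup>2)"
    using sq_int_square[OF smooth_vanishing_sq_int[OF D \<psi>]] by (simp add: norm_pairf)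
  have i1: "integrable lborel (\<lambda>x. indicator D x * (\<psi> x)\<^sup>2)" by (rule integrable_summand(1)[OF psi2]) simp_all
  have i2: "integrable lborel (\<lambda>x. indicator D x * (norm (grad \<psi> x))\<^sup>2)" by (rule integrable_summand(2)[OF psi2]) simp_all
  have iw: "integrable lborel w"
    unfolding w_def[abs_def] by (intro Bochner_Integration.integrable_add integrable_mult_right i1 i2)
  have wle: "(norm (pairf D (f n) (grad (f n)) x))\<^sup>2 \<le> w x" for n x
  proof (cases "x \<in> D")
    case True
    have "(norm (grad (f n) x))\<^sup>2 \<le> (\<Sum>i\<in>(UNIV::'n set). 2 * (C1\<^sup>2 * (pd \<psi> (axis i 1) x)\<^sup>2) + 2 * (C2\<^sup>2 * (\<psi> x)\<^sup>2))"
      unfolding norm_vec_square grad_nth by (intro sum_mono dle True)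
    also have "\<dots> = 2 * C1\<^sup>2 * (norm (grad \<psi> x))\<^sup>2 + ?N * (2 * (C2\<^sup>2 * (\<psi> x)\<^sup>2))"
      unfolding norm_vec_square grad_nth by (simp add: sum.distrib sum_distrib_left mult.assoc)
    finally show ?thesis using fle[of n x] True by (simp add: norm_pairf w_def)
  next
    case False then show ?thesis by (simp add: norm_pairf w_def)
  qed
  have lim: "(\<lambda>n. pairf D (f n) (grad (f n)) x) \<longlonglongrightarrow> pairf D \<psi> ?G x" for x
  proof (cases "x \<in> D")
    case True
    \<comment> \<open>From this index on the approximant equals the limit at x exactly. If \<psi> x
      = 0, the quotient is 0 by convention and only |x| counts.\<close>
    obtain N :: nat where N: "norm x + 2 / \<bar>\<psi> x\<bar> < real N" using reals_Archimedean2 by blast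
    have "pairf D (f n) (grad (f n)) x = pairf D \<psi> ?G x" if n: "n \<ge> N" for n
    proof -
      have kn: "norm x + 2 / \<bar>\<psi> x\<bar> < k n" using N n by (simp add: k_def)
      have nonneg: "0 \<le> 2 / \<bar>\<psi> x\<bar>" by simp
      have "norm x < k n" using kn nonneg by linarith
      then have "(norm x)\<^sup>2 < (k n)\<^sup>2" by (intro power_strict_mono) auto
      then have near: "a n * (norm x)\<^sup>2 < 1" using k0[of n] by (simp add: a_def field_simps)
      note c = cutoff_near[OF near]
      have fx: "f n x = g n x" using True c by (simp add: f_def h_def)
      have gr: "grad (f n) x = pd thr 1 (k n * \<psi> x) *\<^sub>R grad \<psi> x"
        by (simp add: vec_eq_iff grad_nth pdf[OF True] c)
      show ?thesis
      proof (cases "\<psi> x = 0")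
        case True
        then show ?thesis using fx gr by (simp add: pairf_def g_def thr_eq_0 pd_thr_0)
      next
        case False
        have "2 / \<bar>\<psi> x\<bar> < k n" using kn norm_ge_zero[of x] by linarith
        then have "2 < \<bar>k n * \<psi> x\<bar>" using False k0[of n] by (simp add: abs_mult field_simps)
        then have "2\<^sup>2 < \<bar>k n * \<psi> x\<bar>\<^sup>2" by (intro power_strict_mono) auto
        then have "2 < (k n * \<psi> x) * (k n * \<psi> x)" by (simp add: power2_eq_square)
        then show ?thesis using False fx gr k0[of n] by (simp add: pairf_def g_def thr_eq_self pd_thr_1)
      qed
    qed
    then have "\<forall>\<^sub>F n in sequentially. pairf D (f n) (grad (f n)) x = pairf D \<psi> ?G x"
      by (auto simp: eventually_sequentially)
    then show ?thesis by (rule tendsto_eventually)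
  next
    case False then show ?thesis by (simp add: pairf_def)
  qed
  have fm: "pairf D (f n) (grad (f n)) \<in> borel_measurable borel" for n
    using smooth_vanishing_sq_int[OF D ccinf_smooth_vanishing[OF D cf]] by (simp add: sq_int_def)
  have gm: "pairf D \<psi> ?G \<in> borel_measurable borel"
    unfolding pairf_def[abs_def] by measurable
  show ?thesis
    using toL_dominated_convergence[OF fm gm iw wle lim] cf by blast
qed

text \<open>Integration by parts as an orthogonality: (\<psi>, grad \<psi>) is perpendicular to (d_i
  \<phi>, \<phi> e_i). In this form it passes to limits in L_2 and pins down the weak
  gradient.\<close>

lemma weak_gradient_identity:
  fixes D :: "(real^'n) set"
  assumes D: "open D" and \<psi>: "smooth_vanishing D \<psi>" and \<phi>: "ccinf D \<phi>"
  shows "toL (pairf D \<psi> (grad \<psi>)) \<bullet> toL (pairf D (pd \<phi> (axis i 1)) (\<lambda>x. \<phi> x *\<^sub>R axis i 1)) = 0"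
    and "sq_int (pairf D (pd \<phi> (axis i 1)) (\<lambda>x. \<phi> x *\<^sub>R axis i 1))"
proof -
  have s: "smooth_fun \<psi>" using \<psi> by (simp add: smooth_vanishing_def)
  have p: "ccinf D (pd \<phi> (axis i 1))" by (rule ccinf_pd[OF \<phi> axis_Basis])
  have [measurable]: "\<phi> \<in> borel_measurable borel" "pd \<phi> (axis i 1) \<in> borel_measurable borel" "D \<in> sets borel"
    using smooth_fun_measurable[OF ccinf_smooth[OF \<phi>]] smooth_fun_measurable[OF ccinf_smooth[OF p]] D by auto
  have ii: "integrable lborel (\<lambda>x. indicator D x * (f x)\<^sup>2)" if "ccinf D f" for f :: "real^'n \<Rightarrow> real"
    using integrable_mult_indicator[OF _ sq_int_square[OF sq_int_ccinf[OF that]], of D] D by simp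
  show sq: "sq_int (pairf D (pd \<phi> (axis i 1)) (\<lambda>x. \<phi> x *\<^sub>R axis i 1))"
  proof (rule sq_int_pairf)
    show "integrable lborel (\<lambda>x. indicator D x * (norm (\<phi> x *\<^sub>R axis i (1::real)))\<^sup>2)" using ii[OF \<phi>] by simp
  qed (use ii[OF p] in auto)
  have cU: "ccinf UNIV \<phi>" using \<phi> by (simp add: ccinf_def)
  have z: "\<phi> x = 0" "pd \<phi> (axis i 1) x = 0" if "x \<notin> D" for x
  proof -
    show "\<phi> x = 0" using ccinf_support[OF \<phi>] that by blast
    show "pd \<phi> (axis i 1) x = 0" using ccinf_support[OF p] that by blast
  qed
  have int: "integrable lborel (\<lambda>x. u x * v x)" if u: "smooth_fun u" and v: "ccinf D v" for u v :: "real^'n \<Rightarrow> real"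
  proof -
    obtain K where K: "compact K" "K \<subseteq> D" "\<And>x. x \<notin> K \<Longrightarrow> v x = 0" using ccinf_support[OF v] by blast
    have c: "ccinf D (\<lambda>x. u x * v x)" by (rule ccinfI[OF smooth_fun_mult[OF u ccinf_smooth[OF v]] K(1,2)]) (use K(3) in auto)
    have "integrable lborel (\<lambda>x. indicator K x *\<^sub>R (u x * v x))"
      by (rule sq_int_integrable_on_finite[OF sq_int_ccinf[OF c]]) (use K emeasure_compact_finite borel_compact in auto)
    moreover have "(\<lambda>x. indicator K x *\<^sub>R (u x * v x)) = (\<lambda>x. u x * v x)" by (rule ext) (use K(3) in \<open>auto simp: indicator_def\<close>)
    ultimately show ?thesis by simp
  qed
  have "toL (pairf D \<psi> (grad \<psi>)) \<bullet> toL (pairf D (pd \<phi> (axis i 1)) (\<lambda>x. \<phi> x *\<^sub>R axis i 1))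
      = (LINT x|lborel. pairf D \<psi> (grad \<psi>) x \<bullet> pairf D (pd \<phi> (axis i 1)) (\<lambda>x. \<phi> x *\<^sub>R axis i 1) x)"
    by (rule inner_toL[OF smooth_vanishing_sq_int[OF D \<psi>] sq])
  also have "\<dots> = (LINT x|lborel. \<psi> x * pd \<phi> (axis i 1) x + pd \<psi> (axis i 1) x * \<phi> x)"
  proof (rule Bochner_Integration.integral_cong[OF refl])
    fix x
    show "pairf D \<psi> (grad \<psi>) x \<bullet> pairf D (pd \<phi> (axis i 1)) (\<lambda>x. \<phi> x *\<^sub>R axis i 1) x = \<psi> x * pd \<phi> (axis i 1) x + pd \<psi> (axis i 1) x * \<phi> x"
      unfolding inner_pairf using z[of x] by (cases "x \<in> D") (simp_all add: inner_axis grad_nth mult.commute)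
  qed
  also have "\<dots> = (LINT x|lborel. \<psi> x * pd \<phi> (axis i 1) x) + (LINT x|lborel. pd \<psi> (axis i 1) x * \<phi> x)"
    by (intro Bochner_Integration.integral_add int s smooth_fun_pd[OF s axis_Basis] p \<phi>)
  also have "\<dots> = 0" using integration_by_parts[OF s cU axis_Basis[of i]] by simp
  finally show "toL (pairf D \<psi> (grad \<psi>)) \<bullet> toL (pairf D (pd \<phi> (axis i 1)) (\<lambda>x. \<phi> x *\<^sub>R axis i 1)) = 0" .
qed

text \<open>The gradient of \<open>\<psi>\<close> vanishes almost everywhere on the zero set of \<open>\<psi>\<close>, because
  the truncations converge to \<open>\<psi>\<close> and weak gradients are unique.\<close>
lemma Hsp_eq_closure_Cgen:
  fixes D :: "(real^'n) set"
  assumes D: "open D" shows "Hsp D = closure (Cgen D)"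
proof
  have "Cgen D \<subseteq> Sgen D" using ccinf_smooth_vanishing[OF D] by (auto simp: Cgen_def Sgen_def)
  then show "closure (Cgen D) \<subseteq> Hsp D" unfolding Hsp_def by (rule closure_mono)
  have "m \<in> closure (Cgen D)" if m: "m \<in> Sgen D" for m
  proof -
    obtain \<psi> where \<psi>: "smooth_vanishing D \<psi>" and mp: "m = toL (pairf D \<psi> (grad \<psi>))" using m by (auto simp: Sgen_def)
    have s: "smooth_fun \<psi>" using \<psi> by (simp add: smooth_vanishing_def)
    have [measurable]: "D \<in> sets borel" "\<psi> \<in> borel_measurable borel" "grad \<psi> \<in> borel_measurable borel"
      using D s by (auto intro: smooth_fun_measurable grad_measurable)
    let ?G = "\<lambda>x. if \<psi> x = 0 then 0 else grad \<psi> x"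
    obtain f where f: "\<And>n::nat. ccinf D (f n)"
      "(\<lambda>n. toL (pairf D (f n) (grad (f n)))) \<longlonglongrightarrow> toL (pairf D \<psi> ?G)" and sG: "sq_int (pairf D \<psi> ?G)"
      using truncation_approx[OF D \<psi>] by blast
    have sq: "sq_int (pairf D \<psi> (grad \<psi>))" by (rule smooth_vanishing_sq_int[OF D \<psi>])
    \<comment> \<open>On D this is grad \<psi> on the zero set of \<psi> and 0 elsewhere. Both pairs
      obey the weak identity with the same first component, so d is orthogonal to all test
      functions.\<close>
    define d where "d x = indicator D x *\<^sub>R (grad \<psi> x - ?G x)" for x
    have pd: "pairf D \<psi> (grad \<psi>) x - pairf D \<psi> ?G x = (0, d x)" for x
      by (simp add: pairf_def d_def indicator_def)
    have orth: "(LINT x|lborel. (d x $ i) * \<phi> x) = 0" if \<phi>: "ccinf D \<phi>" for \<phi> i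
    proof -
      let ?e = "pairf D (pd \<phi> (axis i 1)) (\<lambda>x. \<phi> x *\<^sub>R axis i 1)"
      have se: "sq_int ?e" by (rule weak_gradient_identity(2)[OF D \<psi> \<phi>])
      have "(\<lambda>n. toL (pairf D (f n) (grad (f n))) \<bullet> toL ?e) \<longlonglongrightarrow> toL (pairf D \<psi> ?G) \<bullet> toL ?e" by (intro tendsto_intros f)
      moreover have "toL (pairf D (f n) (grad (f n))) \<bullet> toL ?e = 0" for n
        by (rule weak_gradient_identity(1)[OF D ccinf_smooth_vanishing[OF D f(1)] \<phi>])
      ultimately have "toL (pairf D \<psi> ?G) \<bullet> toL ?e = 0" by (simp add: LIMSEQ_const_iff)
      then have "0 = (toL (pairf D \<psi> (grad \<psi>)) - toL (pairf D \<psi> ?G)) \<bullet> toL ?e"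
        using weak_gradient_identity(1)[OF D \<psi> \<phi>, of i] by (simp add: inner_diff_left)
      also have "\<dots> = (LINT x|lborel. (pairf D \<psi> (grad \<psi>) x - pairf D \<psi> ?G x) \<bullet> ?e x)"
        unfolding toL_diff[OF sq sG, symmetric] by (rule inner_toL[OF sq_int_diff[OF sq sG] se])
      also have "\<dots> = (LINT x|lborel. (d x $ i) * \<phi> x)"
      proof (rule Bochner_Integration.integral_cong[OF refl])
        fix x
        have "x \<notin> D \<Longrightarrow> d x = 0" by (simp add: d_def)
        then show "(pairf D \<psi> (grad \<psi>) x - pairf D \<psi> ?G x) \<bullet> ?e x = (d x $ i) * \<phi> x"
          unfolding pd by (cases "x \<in> D") (simp_all add: pairf_def inner_axis mult.commute)
      qed
      finally show ?thesis by simp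
    qed
    have sd: "sq_int d"
    proof (rule sq_int_bound[OF _ sq_int_square[OF sq_int_diff[OF sq sG]]])
      show "d \<in> borel_measurable lborel" unfolding d_def[abs_def] by measurable
      show "AE x in lborel. (norm (d x))\<^sup>2 \<le> (norm (pairf D \<psi> (grad \<psi>) x - pairf D \<psi> ?G x))\<^sup>2"
        unfolding pd by (simp add: norm_Pair)
    qed
    have "AE x in lborel. x \<in> D \<longrightarrow> d x $ i = 0" for i
      by (rule AE_zero_if_orth_ccinf[OF _ D orth]) (rule sq_int_bounded_linear[OF sd bounded_linear_vec_nth])
    then have "AE x in lborel. \<forall>i. x \<in> D \<longrightarrow> d x $ i = 0" by (intro AE_all_countable[THEN iffD2] allI)
    then have "AE x in lborel. pairf D \<psi> (grad \<psi>) x = pairf D \<psi> ?G x"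
    proof eventually_elim
      case (elim x)
      have "d x = 0"
      proof (cases "x \<in> D")
        case True then show ?thesis using elim by (simp add: vec_eq_iff)
      qed (simp add: d_def)
      then have "pairf D \<psi> (grad \<psi>) x - pairf D \<psi> ?G x = 0" by (simp only: pd zero_prod_def)
      then show ?case by simp
    qed
    then have "m = toL (pairf D \<psi> ?G)" unfolding mp by (rule toL_cong[OF sq sG])
    then have l: "(\<lambda>n. toL (pairf D (f n) (grad (f n)))) \<longlonglongrightarrow> m" using f(2) by simp
    have "\<And>n. toL (pairf D (f n) (grad (f n))) \<in> Cgen D" using f(1) by (auto simp: Cgen_def)
    then show ?thesis unfolding closure_sequential using l by (intro exI[of _ "\<lambda>n. toL (pairf D (f n) (grad (f n)))"]) simp
  qed
  then show "Hsp D \<subseteq> closure (Cgen D)" unfolding Hsp_def by (simp add: closure_minimal subsetI)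
qed

section \<open>The space-time cylinder\<close>

lemma fnQ_lmap:
  assumes p: "bounded_linear p" shows "AE q in lborel. fnQ (lmap (lmap p) U) q = p (fnQ U q)"
proof -
  let ?w = "\<lambda>q. p (fnQ U q)"
  have w: "sq_int ?w" by (rule sq_int_bounded_linear[OF sq_int_fnQ p])
  have "lmap (lmap p) U = toL (slices ?w)"
  proof (rule toL_eqI[symmetric, OF sq_int_slices[OF w]])
    show "AE t in lborel. rep (lmap (lmap p) U) t = slices ?w t"
      using rep_lmap[OF bounded_linear_lmap[OF p], of U] AE_fnQ[of U] AE_slices_sq_int[OF w]
    proof eventually_elim
      case (elim t)
      have "AE x in lborel. rep (lmap p (rep U t)) x = ?w (x, t)"
        using rep_lmap[OF p, of "rep U t"] elim(2) by eventually_elim simp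
      then have "slices ?w t = lmap p (rep U t)" unfolding slices_def by (rule toL_eqI[OF elim(3)])
      then show ?case using elim(1) by simp
    qed
  qed
  then show ?thesis using fnQ_slices[OF w] by simp
qed

text \<open>Vanishing off D is the closed condition \<open>restr D u = u\<close>, which the
  generators satisfy.\<close>

lemma Hsp_off:
  fixes D :: "(real^'n) set"
  assumes D: "open D" and k: "k \<in> Hsp D" shows "AE x in lborel. x \<notin> D \<longrightarrow> rep k x = 0"
proof -
  have Db: "D \<in> sets borel" using D by simp
  have "bounded_linear (restr D :: (real^'n, real \<times> (real^'n)) l2 \<Rightarrow> _)"
    using Db by (intro bounded_linear_intro[of _ 1]) (auto simp: restr_add restr_scaleR norm_restr)
  then have c: "continuous_on UNIV (restr D :: (real^'n, real \<times> (real^'n)) l2 \<Rightarrow> _)"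
    by (rule linear_continuous_on)
  have "closed {u :: (real^'n, real \<times> (real^'n)) l2. restr D u = u}"
    by (rule closed_Collect_eq[OF c continuous_on_id])
  moreover have "Sgen D \<subseteq> {u. restr D u = u}"
  proof
    fix u assume "u \<in> Sgen D"
    then obtain \<psi> where "smooth_vanishing D \<psi>" and u: "u = toL (pairf D \<psi> (grad \<psi>))" by (auto simp: Sgen_def)
    then have q: "sq_int (pairf D \<psi> (grad \<psi>))" by (intro smooth_vanishing_sq_int[OF D])
    have "AE x in lborel. rep (restr D u) x = rep u x"
      using rep_restr[OF Db, of u] rep_toL[OF q] unfolding u by eventually_elim (simp add: pairf_def indicator_def)
    then show "u \<in> {u. restr D u = u}" using l2_eqI by blast
  qed
  ultimately have "Hsp D \<subseteq> {u. restr D u = u}" unfolding Hsp_def by (intro closure_minimal)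
  then have "restr D k = k" using k by blast
  then have "AE x in lborel. rep k x = indicator D x *\<^sub>R rep k x" using rep_restr[OF Db, of k] by simp
  then show ?thesis by eventually_elim (auto simp: indicator_def)
qed

lemma smooth_fun_section:
  fixes F :: "'a::euclidean_space \<times> real \<Rightarrow> real"
  assumes F: "smooth_fun F"
  shows "pd (\<lambda>x. F (x, t)) v x = pd F (v, 0) (x, t)" "smooth_fun (\<lambda>x. F (x, t))"
proof -
  have d: "((\<lambda>x. F (x, t)) has_derivative (\<lambda>v. pd F (v, 0) (x, t))) (at x)" if "smooth_fun F" for F :: "'a \<times> real \<Rightarrow> real" and x
    by (rule has_derivative_compose[OF _ smooth_fun_has_derivative[OF that]]) (auto intro!: derivative_eq_intros)
  show "pd (\<lambda>x. F (x, t)) v x = pd F (v, 0) (x, t)" by (rule pd_eqI[OF d[OF F]])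
  show "smooth_fun (\<lambda>x. F (x, t))"
  proof (rule smooth_fun_coinduct[of "\<lambda>h. \<exists>F. smooth_fun F \<and> h = (\<lambda>x. F (x, t))"])
    show "\<exists>G. smooth_fun G \<and> (\<lambda>x. F (x, t)) = (\<lambda>x. G (x, t))" using F by blast
    fix h :: "'a \<Rightarrow> real" assume "\<exists>F. smooth_fun F \<and> h = (\<lambda>x. F (x, t))"
    then obtain F :: "'a \<times> real \<Rightarrow> real" where F: "smooth_fun F" "h = (\<lambda>x. F (x, t))" by blast
    show "h differentiable (at x)" for x unfolding F(2) using d[OF F(1)] by (auto simp: differentiable_def)
    fix i :: 'a assume "i \<in> Basis"
    then have "(i, 0::real) \<in> Basis" by (simp add: Basis_prod_def)
    then have "smooth_fun (pd F (i, 0))" by (rule smooth_fun_pd[OF F(1)])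
    moreover have "pd h i = (\<lambda>x. pd F (i, 0) (x, t))" unfolding F(2) by (rule ext) (rule pd_eqI[OF d[OF F(1)]])
    ultimately show "\<exists>G. smooth_fun G \<and> pd h i = (\<lambda>x. G (x, t))" by blast
  qed
qed

locale cylinder =
  fixes T :: real and D :: "(real^'n) set"
  assumes Tpos: "T > 0" and Dopen: "open D"

text \<open>In this instance V is X^1, as pairs of a function and its gradient extended by 0, and P
  is the embedding into X^0.\<close>

sublocale cylinder \<subseteq> gelfand T "Hsp D" "lmap fst :: (real^'n, real \<times> (real^'n)) l2 \<Rightarrow> (real^'n, real) l2"
  by (rule gelfand.intro[OF Tpos subspace_Hsp[OF Dopen] closed_Hsp bounded_linear_lmap[OF bounded_linear_fst]])

context cylinder begin

abbreviation Q :: "((real^'n) \<times> real) set" where "Q \<equiv> cyl D T"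

lemma Q_open: "open Q" unfolding cyl_def by (intro open_Times Dopen) auto
lemma Q_borel[measurable]: "Q \<in> sets borel" using Q_open by simp
lemma D_borel[measurable]: "D \<in> sets borel" using Dopen by simp

lemma P_fnQ: "AE q in lborel. fnQ (P U) q = fst (fnQ U q)"
  by (rule fnQ_lmap[OF bounded_linear_fst])

lemma fnQ_off: assumes U: "U \<in> V" shows "AE q in lborel. fnQ U q = indicator Q q *\<^sub>R fnQ U q"
proof -
  let ?w = "\<lambda>q. indicator Q q *\<^sub>R fnQ U q"
  have w: "sq_int ?w" by (rule sq_int_indicator[OF sq_int_fnQ]) simp
  have "toL (slices ?w) = U"
  proof (rule toL_eqI[OF sq_int_slices[OF w]])
    show "AE t in lborel. rep U t = slices ?w t"
      using AE_fnQ[of U] AE_slices_sq_int[OF w] U[unfolded V_def mem_Collect_eq]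
    proof eventually_elim
      case (elim t)
      have off: "AE x in lborel. x \<notin> D \<longrightarrow> rep (rep U t) x = 0" by (rule Hsp_off[OF Dopen]) (use elim in blast)
      have "AE x in lborel. rep (rep U t) x = ?w (x, t)"
      proof (cases "t \<in> {0<..<T}")
        case True
        show ?thesis using elim(1) off by eventually_elim (use True in \<open>auto simp: cyl_def indicator_def\<close>)
      next
        case False
        then have "rep U t = 0" using elim(3) by blast
        then show ?thesis using rep_0[where ?'a = "real^'n" and ?'b = "real \<times> (real^'n)"] False
          by (auto simp: cyl_def)
      qed
      then show ?case unfolding slices_def by (rule toL_eqI[OF elim(2), symmetric])
    qed
  qed
  then show ?thesis using fnQ_slices[OF w] by simp
qed

text \<open>Ties a vector of V to the functions u and G of the statement. It is a relation because u
  and G are arbitrary off Q and on null sets, and the predicates of the statement speak of such raw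
  functions.\<close>

definition corr :: "(real, (real^'n, real \<times> (real^'n)) l2) l2 \<Rightarrow> (real^'n \<Rightarrow> real \<Rightarrow> real) \<Rightarrow> (real^'n \<Rightarrow> real \<Rightarrow> real^'n) \<Rightarrow> bool"
  where "corr U u G \<longleftrightarrow> U \<in> V \<and>
    (AE q in lborel. fnQ U q = indicator Q q *\<^sub>R (u (fst q) (snd q), G (fst q) (snd q)))"

lemma corr_V: "corr U u G \<Longrightarrow> U \<in> V" by (simp add: corr_def)

lemma corr_AE: "corr U u G \<Longrightarrow> AE q in lborel. fnQ U q = indicator Q q *\<^sub>R (u (fst q) (snd q), G (fst q) (snd q))"
  by (simp add: corr_def)

lemma corrI:
  assumes "U \<in> V" "AE q in lborel. q \<in> Q \<longrightarrow> fnQ U q = (u (fst q) (snd q), G (fst q) (snd q))" shows "corr U u G"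
  unfolding corr_def
proof
  show "AE q in lborel. fnQ U q = indicator Q q *\<^sub>R (u (fst q) (snd q), G (fst q) (snd q))"
    using assms(2) fnQ_off[OF assms(1)]
  proof eventually_elim
    case (elim q) then show ?case by (cases "q \<in> Q") (auto simp: zero_prod_def)
  qed
qed (rule assms)

lemma corr_fnQ: "U \<in> V \<Longrightarrow> corr U (\<lambda>x t. fst (fnQ U (x, t))) (\<lambda>x t. snd (fnQ U (x, t)))"
  by (rule corrI) auto

lemma corr_lin:
  assumes "corr U u G" "corr W w H"
  shows "corr (a *\<^sub>R U + c *\<^sub>R W) (\<lambda>x t. a * u x t + c * w x t) (\<lambda>x t. a *\<^sub>R G x t + c *\<^sub>R H x t)"
proof (rule corrI)
  show "a *\<^sub>R U + c *\<^sub>R W \<in> V" using assms by (intro V_add V_scale corr_V)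
  show "AE q in lborel. q \<in> Q \<longrightarrow> fnQ (a *\<^sub>R U + c *\<^sub>R W) q =
      (a * u (fst q) (snd q) + c * w (fst q) (snd q), a *\<^sub>R G (fst q) (snd q) + c *\<^sub>R H (fst q) (snd q))"
    using corr_AE[OF assms(1)] corr_AE[OF assms(2)] fnQ_add[of "a *\<^sub>R U" "c *\<^sub>R W"] fnQ_scaleR[of a U] fnQ_scaleR[of c W]
    by eventually_elim simp
qed

text \<open>The condition of \<open>X1\<close> at almost every time, read through
  \<open>H1_iff\<close>, says that the slices take values in \<open>Hsp D\<close>; the other parts
  of \<open>X1\<close> follow from square integrability of w.\<close>

lemma X1_slices:
  assumes w: "sq_int w" and ae: "AE q in lborel. w q = indicator Q q *\<^sub>R (u (fst q) (snd q), G (fst q) (snd q))"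
  shows "X1 D T u G \<longleftrightarrow> toL (slices w) \<in> V"
proof -
  have [measurable]: "w \<in> borel_measurable borel" using w by (simp add: sq_int_def)
  note [measurable] = borel_measurable_fst_snd[OF this]
  have au: "AE q in lborel. q \<in> Q \<longrightarrow> u (fst q) (snd q) = fst (w q)" and aG: "AE q in lborel. q \<in> Q \<longrightarrow> G (fst q) (snd q) = snd (w q)"
    using ae by (eventually_elim, simp)+
  have au2: "AE q in lborel. q \<in> Q \<longrightarrow> (u (fst q) (snd q))\<^sup>2 = (fst (w q))\<^sup>2"
    and aG2: "AE q in lborel. q \<in> Q \<longrightarrow> (norm (G (fst q) (snd q)))\<^sup>2 = (norm (snd (w q)))\<^sup>2"
    using ae by (eventually_elim, simp)+
  have i: "integrable lborel (\<lambda>q. indicator Q q *\<^sub>R (fst (w q))\<^sup>2)" "integrable lborel (\<lambda>q. indicator Q q *\<^sub>R (norm (snd (w q)))\<^sup>2)"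
    by (rule Bochner_Integration.integrable_bound[OF sq_int_square[OF w]], measurable, rule AE_I2,
        auto simp: indicator_def norm_prod_def)+
  have A: "X0 D T u" unfolding X0_def
    using lebesgue_on_measurable[OF Q_borel _ au] lebesgue_on_integrable[OF Q_borel _ au2] i(1) by simp
  have B: "(\<lambda>q. G (fst q) (snd q)) \<in> borel_measurable (lebesgue_on Q)" by (rule lebesgue_on_measurable[OF Q_borel _ aG]) simp
  have C: "integrable (lebesgue_on Q) (\<lambda>q. (norm (G (fst q) (snd q)))\<^sup>2)" using lebesgue_on_integrable[OF Q_borel _ aG2] i(2) by simp
  let ?U = "toL (slices w)"
  have "AE t in lborel. (t \<in> {0<..<T} \<longrightarrow> H1 D (\<lambda>x. u x t) (\<lambda>x. G x t)) \<longleftrightarrow> (rep ?U t \<in> Hsp D \<and> (t \<notin> {0<..<T} \<longrightarrow> rep ?U t = 0))"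
    using AE_rep_slices[OF w] AE_swap[OF ae]
  proof eventually_elim
    case (elim t)
    have e: "AE x in lborel. rep (rep ?U t) x = indicator Q (x, t) *\<^sub>R (u x t, G x t)"
      using elim by eventually_elim simp
    show ?case
    proof (cases "t \<in> {0<..<T}")
      case True
      have "H1 D (\<lambda>x. u x t) (\<lambda>x. G x t) \<longleftrightarrow> rep ?U t \<in> Hsp D"
        by (rule H1_iff[OF Dopen]; use e in eventually_elim) (use True in \<open>auto simp: cyl_def zero_prod_def indicator_def\<close>)
      then show ?thesis using True by simp
    next
      case False
      have "AE x in lborel. rep (rep ?U t) x = rep 0 x"
        using e rep_0[where ?'a = "real^'n" and ?'b = "real \<times> (real^'n)"] by eventually_elim (use False in \<open>auto simp: cyl_def zero_prod_def\<close>)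
      then have "rep ?U t = 0" by (rule l2_eqI)
      then show ?thesis using False subspace_0[OF subspace_Hsp[OF Dopen]] by auto
    qed
  qed
  note iff = this
  have "(AE t in lborel. t \<in> {0<..<T} \<longrightarrow> H1 D (\<lambda>x. u x t) (\<lambda>x. G x t)) \<longleftrightarrow> ?U \<in> V"
    unfolding V_def mem_Collect_eq
  proof
    assume "AE t in lborel. t \<in> {0<..<T} \<longrightarrow> H1 D (\<lambda>x. u x t) (\<lambda>x. G x t)"
    then show "AE t in lborel. rep ?U t \<in> Hsp D \<and> (t \<notin> {0<..<T} \<longrightarrow> rep ?U t = 0)" using iff by eventually_elim blast
  next
    assume "AE t in lborel. rep ?U t \<in> Hsp D \<and> (t \<notin> {0<..<T} \<longrightarrow> rep ?U t = 0)"
    then show "AE t in lborel. t \<in> {0<..<T} \<longrightarrow> H1 D (\<lambda>x. u x t) (\<lambda>x. G x t)" using iff by eventually_elim blast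
  qed
  then show ?thesis unfolding X1_def using A B C by (subst AE_lebesgue_on_iff) auto
qed

lemma corr_X1: assumes "corr U u G" shows "X1 D T u G"
  using X1_slices[OF sq_int_fnQ corr_AE[OF assms]] corr_V[OF assms] by (simp add: slices_fnQ)

lemma corr_ex_if_X1: assumes X: "X1 D T u G" shows "\<exists>U. corr U u G"
proof -
  let ?F = "\<lambda>q. (u (fst q) (snd q), G (fst q) (snd q))"
  have "?F \<in> borel_measurable (lebesgue_on Q)" using X by (auto simp: X1_def X0_def intro: borel_measurable_Pair)
  from lebesgue_on_ex_borel[OF Q_borel this] obtain w where
    w: "w \<in> borel_measurable borel" and e: "AE q in lborel. indicator Q q *\<^sub>R ?F q = w q" by blast
  note [measurable] = w
  have "integrable (lebesgue_on Q) (\<lambda>q. (u (fst q) (snd q))\<^sup>2 + (norm (G (fst q) (snd q)))\<^sup>2)"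
    using X by (auto simp: X1_def X0_def)
  moreover have "AE q in lborel. q \<in> Q \<longrightarrow> (u (fst q) (snd q))\<^sup>2 + (norm (G (fst q) (snd q)))\<^sup>2 = (norm (w q))\<^sup>2"
    using e
  proof eventually_elim
    case (elim q) show ?case by (simp add: elim[symmetric] norm_Pair)
  qed
  ultimately have "integrable lborel (\<lambda>q. indicator Q q *\<^sub>R (norm (w q))\<^sup>2)"
    using lebesgue_on_integrable[OF Q_borel, of "\<lambda>q. (norm (w q))\<^sup>2"] by simp
  then have sq: "sq_int w"
  proof (rule sq_int_bound[rotated])
    show "AE q in lborel. (norm (w q))\<^sup>2 \<le> indicator Q q *\<^sub>R (norm (w q))\<^sup>2"
      using e
    proof eventually_elim
      case (elim q) show ?case by (cases "q \<in> Q") (simp_all add: elim[symmetric])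
    qed
  qed simp
  have ae: "AE q in lborel. w q = indicator Q q *\<^sub>R ?F q" using e by eventually_elim simp
  have "toL (slices w) \<in> V" using X1_slices[OF sq ae] X by simp
  moreover have "AE q in lborel. q \<in> Q \<longrightarrow> fnQ (toL (slices w)) q = ?F q"
    using ae fnQ_slices[OF sq] by eventually_elim simp
  ultimately show ?thesis using corrI by blast
qed

lemma corr_X1sq: assumes c: "corr U u G" shows "X1sq D T u G = (norm U)\<^sup>2"
proof -
  have ae: "AE q in lborel. q \<in> Q \<longrightarrow> (u (fst q) (snd q))\<^sup>2 + (norm (G (fst q) (snd q)))\<^sup>2 = (norm (fnQ U q))\<^sup>2"
    using corr_AE[OF c] by eventually_elim (auto simp: norm_Pair)
  have "X1sq D T u G = (LINT q|lborel. indicator Q q *\<^sub>R (norm (fnQ U q))\<^sup>2)"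
    unfolding X1sq_def by (rule lebesgue_on_integral[OF Q_borel _ ae]) simp
  also have "\<dots> = (LINT q|lborel. (norm (fnQ U q))\<^sup>2)"
    by (rule integral_cong_AE, simp, simp, use corr_AE[OF c] in eventually_elim) (auto simp: indicator_def zero_prod_def)
  finally show ?thesis by (simp add: norm_fnQ)
qed

section \<open>Riesz vectors of functionals in X^{-1}\<close>

lemma Xm1_value_cong:
  assumes F: "Xm1 D T F" and "corr U w G" "corr U w' G'" shows "F w = F w'"
proof -
  obtain C where C: "\<And>w G. X1 D T w G \<Longrightarrow> \<bar>F w\<bar> \<le> C * sqrt (X1sq D T w G)" using F unfolding Xm1_def by blast
  \<comment> \<open>w - w' corresponds to U - U = 0 and has X^1 norm 0, whichever gradients
    accompany the two functions; boundedness then forces equal values of F.\<close>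
  have c: "corr (1 *\<^sub>R U + (-1) *\<^sub>R U) (\<lambda>x t. 1 * w x t + (-1) * w' x t) (\<lambda>x t. 1 *\<^sub>R G x t + (-1) *\<^sub>R G' x t)"
    by (rule corr_lin[OF assms(2,3)])
  have "F (\<lambda>x t. 1 * w x t + (-1) * w' x t) = 1 * F w + (-1) * F w'"
    using F corr_X1[OF assms(2)] corr_X1[OF assms(3)] unfolding Xm1_def by blast
  moreover have "\<bar>F (\<lambda>x t. 1 * w x t + (-1) * w' x t)\<bar> \<le> 0"
    using C[OF corr_X1[OF c]] corr_X1sq[OF c] by simp
  ultimately show ?thesis by simp
qed

text \<open>Riesz representation in V, with F evaluated on the representatives \<open>fnQ\<close>.
  Invariance of F under change of representatives makes this linear and extends the formula to all
  raw functions.\<close>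

lemma Xm1_rep:
  assumes F: "Xm1 D T F" shows "\<exists>g\<in>V. \<forall>U w G. corr U w G \<longrightarrow> F w = g \<bullet> U"
proof -
  obtain C where C: "\<And>w G. X1 D T w G \<Longrightarrow> \<bar>F w\<bar> \<le> C * sqrt (X1sq D T w G)" using F unfolding Xm1_def by blast
  have lin: "F (\<lambda>x t. a * w1 x t + c * w2 x t) = a * F w1 + c * F w2" if "X1 D T w1 G1" "X1 D T w2 G2" for a c w1 w2 G1 G2
    using F that unfolding Xm1_def by blast
  let ?f = "\<lambda>U x t. fst (fnQ U (x, t)) :: real"
  have "\<exists>g\<in>closure V. \<forall>U\<in>V. g \<bullet> U = F (?f U)"
  proof (rule riesz_on_subspace[OF V_subspace, where C = C])
    fix x y assume xy: "x \<in> V" "y \<in> V"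
    note c = corr_lin[OF corr_fnQ[OF xy(1)] corr_fnQ[OF xy(2)], of 1 1]
    have "F (?f (x + y)) = F (\<lambda>s t. 1 * ?f x s t + 1 * ?f y s t)"
      using Xm1_value_cong[OF F corr_fnQ[OF V_add[OF xy]], of _ _] c by simp
    also have "\<dots> = 1 * F (?f x) + 1 * F (?f y)" by (rule lin[OF corr_X1[OF corr_fnQ[OF xy(1)]] corr_X1[OF corr_fnQ[OF xy(2)]]])
    finally show "F (?f (x + y)) = F (?f x) + F (?f y)" by simp
  next
    fix c x assume x: "x \<in> V"
    note cl = corr_lin[OF corr_fnQ[OF x] corr_fnQ[OF x], of c 0]
    have "F (?f (c *\<^sub>R x)) = F (\<lambda>s t. c * ?f x s t + 0 * ?f x s t)"
      using Xm1_value_cong[OF F corr_fnQ[OF V_scale[OF x, of c]], of _ _] cl by simp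
    also have "\<dots> = c * F (?f x) + 0 * F (?f x)" by (rule lin[OF corr_X1[OF corr_fnQ[OF x]] corr_X1[OF corr_fnQ[OF x]]])
    finally show "F (?f (c *\<^sub>R x)) = c * F (?f x)" by simp
  next
    fix x assume x: "x \<in> V"
    show "\<bar>F (?f x)\<bar> \<le> C * norm x"
      using C[OF corr_X1[OF corr_fnQ[OF x]]] corr_X1sq[OF corr_fnQ[OF x]] by simp
  qed
  then obtain g where g: "g \<in> V" "\<forall>U\<in>V. g \<bullet> U = F (?f U)" using V_closed by auto
  have "F w = g \<bullet> U" if "corr U w G" for U w G
    using g(2) corr_V[OF that] Xm1_value_cong[OF F that corr_fnQ[OF corr_V[OF that]]] by simp
  then show ?thesis using g(1) by blast
qed

text \<open>Meant for exp(K t) and exp(-K t). As the factor depends on time alone, the spatial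
  gradient is multiplied by it as well.\<close>

lemma mult_time:
  assumes c[measurable]: "c \<in> borel_measurable borel" and B: "\<And>t. t \<in> {0<..<T} \<Longrightarrow> \<bar>c t\<bar> \<le> B" and U: "corr U u G"
  shows "\<exists>W. corr W (\<lambda>x t. c t * u x t) (\<lambda>x t. c t *\<^sub>R G x t) \<and> norm W \<le> B * norm U"
proof -
  \<comment> \<open>c is controlled on (0, T) only; cut to this interval it is bounded everywhere
    and has the same effect on V.\<close>
  define c' where "c' t = indicator {0<..<T} t * c t" for t
  have B0: "B \<ge> 0" using B[of "T/2"] Tpos by (auto intro: order_trans[OF abs_ge_zero])
  have c'm[measurable]: "c' \<in> borel_measurable borel" unfolding c'_def by measurable
  have cb: "\<bar>c' t\<bar> \<le> B" for t using B[of t] B0 by (auto simp: c'_def indicator_def)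
  let ?w = "\<lambda>q. c' (snd q) *\<^sub>R fnQ U q"
  have sndm: "(\<lambda>q::(real^'n) \<times> real. c' (snd q)) \<in> borel_measurable borel"
    by (rule measurable_compose[OF borel_measurable_fst_snd(2)[of "\<lambda>q. q"] c'm]) simp
  have w: "sq_int ?w" by (rule sq_int_mult_bounded[OF sq_int_fnQ sndm cb])
  let ?W = "toL (slices ?w)"
  have rW: "AE t in lborel. rep ?W t = c' t *\<^sub>R rep U t"
    using rep_toL[OF sq_int_slices[OF w]] AE_slices_sq_int[OF sq_int_fnQ[of U]] AE_fnQ[of U]
  proof eventually_elim
    case (elim t)
    have "toL (\<lambda>x. fnQ U (x, t)) = rep U t" by (rule toL_eqI[OF elim(2) elim(3)])
    then show ?case using elim(1) toL_scaleR[OF elim(2), of "c' t"] by (simp add: slices_def)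
  qed
  have WV: "?W \<in> V"
    unfolding V_def mem_Collect_eq using rW corr_V[OF U, unfolded V_def mem_Collect_eq]
    by eventually_elim (simp add: subspace_scale[OF subspace_Hsp[OF Dopen]])
  have "corr ?W (\<lambda>x t. c t * u x t) (\<lambda>x t. c t *\<^sub>R G x t)"
    by (rule corrI[OF WV], use fnQ_slices[OF w] corr_AE[OF U] in eventually_elim) (auto simp: cyl_def c'_def)
  moreover have "norm ?W \<le> B * norm U"
  proof -
    have "(norm ?W)\<^sup>2 = (LINT q|lborel. (norm (?w q))\<^sup>2)" unfolding norm_slices[OF w] by (rule norm_toL[OF w])
    also have "\<dots> \<le> (LINT q|lborel. B\<^sup>2 * (norm (fnQ U q))\<^sup>2)"
    proof (rule integral_mono[OF sq_int_square[OF w]])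
      show "integrable lborel (\<lambda>q. B\<^sup>2 * (norm (fnQ U q))\<^sup>2)" using sq_int_square[OF sq_int_fnQ[of U]] by simp
      fix q :: "(real^'n) \<times> real"
      show "(norm (?w q))\<^sup>2 \<le> B\<^sup>2 * (norm (fnQ U q))\<^sup>2"
        using power_mono[OF cb[of "snd q"], of 2] by (simp add: power_mult_distrib mult_right_mono)
    qed
    also have "\<dots> = (B * norm U)\<^sup>2" by (simp add: norm_fnQ power_mult_distrib)
    finally show ?thesis by (rule power2_le_imp_le) (use B0 in simp)
  qed
  ultimately show ?thesis by blast
qed

lemma X0_fnQ: "X0 D T (\<lambda>x t. fnQ y (x, t))"
proof -
  have i: "integrable lborel (\<lambda>q. indicator Q q *\<^sub>R (fnQ y q)\<^sup>2)"
    using integrable_mult_indicator[OF _ sq_int_square[OF sq_int_fnQ[of y]], of Q] by simp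
  have m: "(\<lambda>p. fnQ y (fst p, snd p)) = fnQ y" by simp
  have "AE q in lborel. q \<in> Q \<longrightarrow> fnQ y q = fnQ y q" "AE q in lborel. q \<in> Q \<longrightarrow> (fnQ y q)\<^sup>2 = (fnQ y q)\<^sup>2" by auto
  then show ?thesis unfolding X0_def m
    using lebesgue_on_measurable[OF Q_borel fnQ_measurable[of y], of "fnQ y"] lebesgue_on_integrable[OF Q_borel, of "\<lambda>q. (fnQ y q)\<^sup>2"] i by simp
qed

text \<open>Only an inequality: the left side sees Q alone, while y and z may have mass
  outside.\<close>

lemma X0norm_fnQ: "X0norm D T (\<lambda>x t. fnQ y (x, t) - fnQ z (x, t)) \<le> norm (y - z)"
proof -
  let ?d = "\<lambda>q. fnQ y q - fnQ z q"
  have sd: "sq_int ?d" by (rule sq_int_diff[OF sq_int_fnQ sq_int_fnQ])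
  have "toL (slices ?d) = y - z"
    using slices_add[OF sq_int_fnQ[of y] sq_int_scaleR[OF sq_int_fnQ[of z], of "-1"]] slices_scaleR[OF sq_int_fnQ[of z], of "-1"]
    by (simp add: slices_fnQ)
  then have n: "(norm (y - z))\<^sup>2 = (LINT q|lborel. (norm (?d q))\<^sup>2)" using norm_slices[OF sd] norm_toL[OF sd] by simp
  have "AE q in lborel. q \<in> Q \<longrightarrow> (fnQ y (fst q, snd q) - fnQ z (fst q, snd q))\<^sup>2 = (?d q)\<^sup>2" by simp
  then have "integral\<^sup>L (lebesgue_on Q) (\<lambda>q. (fnQ y (fst q, snd q) - fnQ z (fst q, snd q))\<^sup>2) = (LINT q|lborel. indicator Q q *\<^sub>R (?d q)\<^sup>2)"
    by (intro lebesgue_on_integral[OF Q_borel]) simp_all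
  also have "\<dots> \<le> (LINT q|lborel. (norm (?d q))\<^sup>2)"
  proof (rule integral_mono[OF _ sq_int_square[OF sd]])
    show "integrable lborel (\<lambda>q. indicator Q q *\<^sub>R (?d q)\<^sup>2)"
      using integrable_mult_indicator[OF _ sq_int_square[OF sd], of Q] by simp
  qed (auto simp: indicator_def)
  finally show ?thesis unfolding X0norm_def n[symmetric] by (simp add: real_le_lsqrt)
qed

subsection \<open>Test functions\<close>

lemma testQ_iff: "testQ D T \<theta> \<longleftrightarrow> ccinf Q (uncur \<theta>)"
  by (simp add: testQ_def ccinf_def)

lemma axis0_Basis: "(axis i (1::real), 0::real) \<in> Basis" "(0::real^'n, 1::real) \<in> Basis"
  by (simp_all add: Basis_prod_def)

lemma testQ_section:
  assumes "testQ D T \<theta>" shows "ccinf D (\<lambda>x. \<theta> x t)" "grad (\<lambda>x. \<theta> x t) x = sgrad \<theta> x t"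
proof -
  have c: "ccinf Q (uncur \<theta>)" using assms by (simp add: testQ_iff)
  obtain K where K: "compact K" "K \<subseteq> Q" "\<And>q. q \<notin> K \<Longrightarrow> uncur \<theta> q = 0" using ccinf_support[OF c] by blast
  have e: "(\<lambda>x. \<theta> x t) = (\<lambda>x. uncur \<theta> (x, t))" by (simp add: uncur_def)
  show "ccinf D (\<lambda>x. \<theta> x t)" unfolding e
  proof (rule ccinfI[OF smooth_fun_section(2)[OF ccinf_smooth[OF c]]])
    show "compact (fst ` K)" by (intro compact_continuous_image continuous_intros K)
    show "fst ` K \<subseteq> D" using K(2) by (auto simp: cyl_def)
    show "uncur \<theta> (x, t) = 0" if "x \<notin> fst ` K" for x using K(3)[of "(x, t)"] that by force
  qed
  show "grad (\<lambda>x. \<theta> x t) x = sgrad \<theta> x t"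
    unfolding e grad_def sgrad_def by (simp add: smooth_fun_section(1)[OF ccinf_smooth[OF c]])
qed

text \<open>Each time section of a test function is a test function in D, hence a generator of H^1,
  and it is 0 at times outside (0, T).\<close>

lemma testQ_corr:
  assumes \<theta>: "testQ D T \<theta>" shows "\<exists>X. corr X \<theta> (sgrad \<theta>)"
proof -
  have c: "ccinf Q (uncur \<theta>)" using \<theta> by (simp add: testQ_iff)
  let ?F = "\<lambda>q. (\<theta> (fst q) (snd q), sgrad \<theta> (fst q) (snd q))"
  let ?w = "\<lambda>q. indicator Q q *\<^sub>R ?F q"
  have e: "(\<lambda>q. \<theta> (fst q) (snd q)) = uncur \<theta>" by (rule ext) (simp add: uncur_def)
  have cd: "ccinf Q (pd (uncur \<theta>) (axis i 1, 0))" for i by (rule ccinf_pd[OF c axis0_Basis(1)])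
  have m1[measurable]: "(\<lambda>q. \<theta> (fst q) (snd q)) \<in> borel_measurable borel" unfolding e by (rule smooth_fun_measurable[OF ccinf_smooth[OF c]])
  have m2[measurable]: "(\<lambda>q. sgrad \<theta> (fst q) (snd q)) \<in> borel_measurable borel"
    unfolding sgrad_def
    by (intro borel_measurable_continuous_onI continuous_on_vec_lambda) (simp add: smooth_fun_continuous[OF ccinf_smooth[OF cd]])
  have "integrable lborel (\<lambda>q. (uncur \<theta> q)\<^sup>2 + (\<Sum>i\<in>UNIV. (pd (uncur \<theta>) (axis i 1, 0) q)\<^sup>2))"
    using sq_int_square[OF sq_int_ccinf[OF c]] sq_int_square[OF sq_int_ccinf[OF cd]]
    by (intro Bochner_Integration.integrable_add Bochner_Integration.integrable_sum) simp_all
  then have w: "sq_int ?w"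
  proof (rule sq_int_bound[rotated])
    have "(norm (?w q))\<^sup>2 \<le> (uncur \<theta> q)\<^sup>2 + (\<Sum>i\<in>UNIV. (pd (uncur \<theta>) (axis i 1, 0) q)\<^sup>2)" for q
    proof -
      have "norm (?w q) \<le> norm (?F q)" by (cases "q \<in> Q") (simp_all add: indicator_def)
      then have "(norm (?w q))\<^sup>2 \<le> (norm (?F q))\<^sup>2" by (rule power_mono) simp
      also have "\<dots> = (uncur \<theta> q)\<^sup>2 + (\<Sum>i\<in>UNIV. (pd (uncur \<theta>) (axis i 1, 0) q)\<^sup>2)"
        by (simp add: norm_Pair norm_vec_square sgrad_def uncur_def sum_nonneg)
      finally show ?thesis .
    qed
    then show "AE q in lborel. (norm (?w q))\<^sup>2 \<le> (uncur \<theta> q)\<^sup>2 + (\<Sum>i\<in>UNIV. (pd (uncur \<theta>) (axis i 1, 0) q)\<^sup>2)" by (rule AE_I2)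
    show "?w \<in> borel_measurable lborel" by simp
  qed
  have "toL (slices ?w) \<in> V"
    unfolding V_def mem_Collect_eq using rep_toL[OF sq_int_slices[OF w]]
  proof eventually_elim
    case (elim t)
    show ?case
    proof (cases "t \<in> {0<..<T}")
      case True
      have "(\<lambda>x. ?w (x, t)) = pairf D (\<lambda>x. \<theta> x t) (grad (\<lambda>x. \<theta> x t))"
        by (rule ext) (use True in \<open>simp add: pairf_def cyl_def indicator_def testQ_section(2)[OF \<theta>]\<close>)
      then have "slices ?w t = toL (pairf D (\<lambda>x. \<theta> x t) (grad (\<lambda>x. \<theta> x t)))" by (simp only: slices_def)
      then have "slices ?w t \<in> Sgen D" using ccinf_smooth_vanishing[OF Dopen testQ_section(1)[OF \<theta>, of t]] by (auto simp: Sgen_def)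
      then have "slices ?w t \<in> Hsp D" unfolding Hsp_def by (rule subsetD[OF closure_subset])
      then show ?thesis using elim True by simp
    next
      case False
      have "(\<lambda>x. ?w (x, t)) = (\<lambda>x. 0)" by (rule ext) (use False in \<open>simp add: cyl_def zero_prod_def\<close>)
      then have "slices ?w t = 0" by (simp only: slices_def toL_0)
      then show ?thesis using elim False subspace_0[OF subspace_Hsp[OF Dopen]] by simp
    qed
  qed
  moreover have "AE q in lborel. q \<in> Q \<longrightarrow> fnQ (toL (slices ?w)) q = ?F q"
    using fnQ_slices[OF w] by eventually_elim simp
  ultimately show ?thesis using corrI by blast
qed

end

section \<open>Weak form in time and space-time test functions\<close>

lemma inner_slices_fnQ: "sq_int w \<Longrightarrow> U \<bullet> toL (slices w) = (LINT q|lborel. fnQ U q \<bullet> w q)"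
  using inner_slices[OF sq_int_fnQ[of U], of w] by (simp add: slices_fnQ)

text \<open>Along a basis vector of the product the derivative is again a smooth function of the
  first component, possibly 0, so this form is the coinduction invariant.\<close>

lemma smooth_fun_fst:
  fixes \<psi> :: "'a::euclidean_space \<Rightarrow> real"
  assumes \<psi>: "smooth_fun \<psi>"
  shows "pd (\<lambda>q::'a \<times> real. \<psi> (fst q)) v q = pd \<psi> (fst v) (fst q)" "smooth_fun (\<lambda>q::'a \<times> real. \<psi> (fst q))"
proof -
  have d: "((\<lambda>q::'a \<times> real. \<psi> (fst q)) has_derivative (\<lambda>v. pd \<psi> (fst v) (fst q))) (at q)" if "smooth_fun \<psi>" for \<psi> :: "'a \<Rightarrow> real" and q
    by (rule has_derivative_compose[OF _ smooth_fun_has_derivative[OF that]]) (auto intro!: derivative_eq_intros)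
  show "pd (\<lambda>q::'a \<times> real. \<psi> (fst q)) v q = pd \<psi> (fst v) (fst q)" by (rule pd_eqI[OF d[OF \<psi>]])
  show "smooth_fun (\<lambda>q::'a \<times> real. \<psi> (fst q))"
  proof (rule smooth_fun_coinduct[of "\<lambda>h. \<exists>\<psi>. smooth_fun \<psi> \<and> h = (\<lambda>q::'a \<times> real. \<psi> (fst q))"])
    show "\<exists>\<phi>. smooth_fun \<phi> \<and> (\<lambda>q::'a \<times> real. \<psi> (fst q)) = (\<lambda>q. \<phi> (fst q))" using \<psi> by blast
    fix h :: "'a \<times> real \<Rightarrow> real" assume "\<exists>\<psi>. smooth_fun \<psi> \<and> h = (\<lambda>q. \<psi> (fst q))"
    then obtain \<phi> :: "'a \<Rightarrow> real" where \<phi>: "smooth_fun \<phi>" "h = (\<lambda>q. \<phi> (fst q))" by blast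
    show "h differentiable (at q)" for q unfolding \<phi>(2) differentiable_def by (rule exI, rule d[OF \<phi>(1)])
    fix i :: "'a \<times> real" assume i: "i \<in> Basis"
    have e: "pd h i = (\<lambda>q. pd \<phi> (fst i) (fst q))" unfolding \<phi>(2) by (rule ext) (rule pd_eqI[OF d[OF \<phi>(1)]])
    show "\<exists>\<psi>. smooth_fun \<psi> \<and> pd h i = (\<lambda>q. \<psi> (fst q))"
    proof (cases "fst i \<in> Basis")
      case True
      then show ?thesis using e smooth_fun_pd[OF \<phi>(1)] by blast
    next
      case False
      then have "fst i = 0" using i by (auto simp: Basis_prod_def)
      then have "pd h i = (\<lambda>q. 0)"
        unfolding e using linear_0[OF pd_linear[OF smooth_fun_differentiable[OF \<phi>(1)]]] by simp
      then show ?thesis using smooth_fun_const[of 0] by (intro exI[of _ "\<lambda>x. 0"]) simp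
    qed
  qed
qed

lemma filterlim_inverse_Suc: "filterlim (\<lambda>n. 1 / real (Suc n)) (at 0) sequentially"
  using LIMSEQ_inverse_real_of_nat by (simp add: filterlim_at inverse_eq_divide)

context cylinder begin

text \<open>The shift test with the difference quotient of \<theta>: on the left it tends to minus
  the time derivative of \<theta> by dominated convergence, on the right the averages of X tend to
  X.\<close>

lemma weak_eq_tested:
  assumes u: "weak_eq U g" and \<theta>: "testQ D T \<theta>" and X: "corr X \<theta> (sgrad \<theta>)"
  shows "- (LINT q|lborel. fnQ (P U) q * pd (uncur \<theta>) (0, 1) q) = g \<bullet> X"
proof -
  let ?\<theta> = "uncur \<theta>" and ?dt = "pd (uncur \<theta>) (0, 1)"
  have c: "ccinf Q ?\<theta>" using \<theta> by (simp add: testQ_iff)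
  have cd: "ccinf Q ?dt" by (rule ccinf_pd[OF c axis0_Basis(2)])
  note sm = ccinf_smooth[OF c]
  have m[measurable]: "?\<theta> \<in> borel_measurable borel" "?dt \<in> borel_measurable borel"
    by (rule smooth_fun_measurable[OF sm], rule smooth_fun_measurable[OF ccinf_smooth[OF cd]])
  obtain K where K: "compact K" "K \<subseteq> Q" "\<And>q. q \<notin> K \<Longrightarrow> ?\<theta> q = 0" using ccinf_support[OF c] by blast
  have dt0: "?dt q = 0" if "q \<notin> Q" for q using ccinf_support[OF cd] that by blast
  have "\<exists>C. \<forall>q. \<bar>?dt q\<bar> \<le> C"
  proof (rule ccinf_bounded[OF cd])
    fix C assume "\<And>q. \<bar>?dt q\<bar> \<le> C" then show ?thesis by (intro exI[of _ C] allI)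
  qed
  then obtain C where C: "\<And>q. \<bar>?dt q\<bar> \<le> C" by auto
  have C0: "C \<ge> 0" using C[of undefined] by linarith
  have der: "((\<lambda>s. ?\<theta> (x, s)) has_real_derivative ?dt (x, s)) (at s)" for x s
  proof -
    have "((\<lambda>s. ?\<theta> (x, s)) has_derivative (\<lambda>v. pd ?\<theta> (0, v) (x, s))) (at s)"
      by (rule has_derivative_compose[OF _ smooth_fun_has_derivative[OF sm]]) (auto intro!: derivative_eq_intros)
    moreover have "(\<lambda>v. pd ?\<theta> (0, v) (x, s)) = (*) (?dt (x, s))"
    proof
      fix v show "pd ?\<theta> (0, v) (x, s) = ?dt (x, s) * v"
        using linear_scale[OF pd_linear[OF smooth_fun_differentiable[OF sm, of "(x, s)"]], of v "(0, 1)"] by simp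
    qed
    ultimately show ?thesis unfolding has_field_derivative_def by (rule back_subst)
  qed
  have lip: "\<bar>?\<theta> (x, t + h) - ?\<theta> (x, t)\<bar> \<le> C * h" if hp: "h > 0" for x t h
  proof -
    obtain z where "?\<theta> (x, t + h) - ?\<theta> (x, t) = (t + h - t) * ?dt (x, z)"
      using MVT2[of t "t + h" "\<lambda>s. ?\<theta> (x, s)" "\<lambda>s. ?dt (x, s)"] hp der by auto
    then have "\<bar>?\<theta> (x, t + h) - ?\<theta> (x, t)\<bar> = h * \<bar>?dt (x, z)\<bar>" using that by (simp add: abs_mult)
    also have "\<dots> \<le> h * C" using C that by (intro mult_left_mono) auto
    finally show ?thesis by (simp add: mult.commute)
  qed
  let ?h = "\<lambda>n. 1 / real (Suc n)"
  define d where "d n q = real (Suc n) * (?\<theta> q - indicator {0<..<T} (snd q) * ?\<theta> (fst q, snd q + ?h n))" for n q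
  \<comment> \<open>Shifting by h > 0 moves the support of \<theta> to earlier times, beyond the
    times of K, hence the full interval as time factor.\<close>
  let ?K = "fst ` K \<times> {0..T}"
  have Kc: "compact ?K" by (intro compact_Times compact_continuous_image continuous_intros K) simp
  have Kb[measurable]: "?K \<in> sets borel" using Kc by (intro borel_closed compact_imp_closed)
  have \<theta>0: "?\<theta> (x, s) = 0" if "x \<notin> fst ` K \<or> s \<notin> {0<..<T}" for x s
  proof (rule K(3))
    show "(x, s) \<notin> K" using that K(2) by (force simp: cyl_def)
  qed
  have bd: "(norm (d n q))\<^sup>2 \<le> C\<^sup>2 * indicator ?K q" for n q
  proof (cases "fst q \<in> fst ` K \<and> snd q \<in> {0<..<T}")
    case True
    have "\<bar>d n q\<bar> = real (Suc n) * \<bar>?\<theta> (fst q, snd q + ?h n) - ?\<theta> (fst q, snd q)\<bar>"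
      using True unfolding d_def abs_mult by simp
    also have "\<dots> \<le> real (Suc n) * (C * ?h n)" by (intro mult_left_mono lip) auto
    also have "\<dots> = C" by simp
    finally have "\<bar>d n q\<bar> \<le> C" .
    then have "(norm (d n q))\<^sup>2 \<le> C\<^sup>2" by (intro power_mono) auto
    moreover have "q \<in> ?K" using True by (cases q) auto
    ultimately show ?thesis by simp
  next
    case False
    then have "d n q = 0" unfolding d_def using \<theta>0[of "fst q" "snd q"] \<theta>0[of "fst q" "snd q + ?h n"] by (auto simp: indicator_def)
    then show ?thesis by simp
  qed
  have Ki: "integrable lborel (\<lambda>q. C\<^sup>2 * indicator ?K q :: real)"
    by (intro integrable_mult_right integrable_real_indicator) (use emeasure_compact_finite[OF Kc] in auto)
  have lim: "(\<lambda>n. d n q) \<longlonglongrightarrow> - ?dt q" for q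
  proof (cases "snd q \<in> {0<..<T}")
    case True
    have "((\<lambda>h. (?\<theta> (fst q, snd q + h) - ?\<theta> (fst q, snd q)) / h) \<longlongrightarrow> ?dt (fst q, snd q)) (at 0)"
      using der[of "fst q" "snd q"] by (simp add: DERIV_def)
    from filterlim_compose[OF this filterlim_inverse_Suc]
    have "(\<lambda>n. - ((?\<theta> (fst q, snd q + ?h n) - ?\<theta> (fst q, snd q)) / ?h n)) \<longlonglongrightarrow> - ?dt q" by (auto intro: tendsto_minus)
    moreover have "- ((?\<theta> (fst q, snd q + ?h n) - ?\<theta> (fst q, snd q)) / ?h n) = d n q" for n
      using True by (simp add: d_def algebra_simps)
    ultimately show ?thesis by simp
  next
    case False
    then have "q \<notin> Q" by (auto simp: cyl_def)
    moreover have "d n q = 0" for n using False \<theta>0[of "fst q" "snd q"] by (simp add: d_def)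
    ultimately show ?thesis using dt0 by simp
  qed
  have [measurable]: "(\<lambda>q. ?\<theta> (fst q, snd q + h)) \<in> borel_measurable borel" for h
    by (intro borel_measurable_continuous_onI continuous_on_compose2[OF smooth_fun_continuous[OF sm, of UNIV]] continuous_intros) auto
  have [measurable]: "(\<lambda>q::(real^'n) \<times> real. indicator {0<..<T} (snd q) :: real) \<in> borel_measurable borel"
    by (rule measurable_compose[OF borel_measurable_fst_snd(2)[of "\<lambda>q. q"]]) simp_all
  have dm: "d n \<in> borel_measurable borel" for n unfolding d_def by measurable
  have dtm: "(\<lambda>q. - ?dt q) \<in> borel_measurable borel" by measurable
  note dc = toL_dominated_convergence[OF dm dtm Ki bd lim]
  have PX: "P X = toL (slices ?\<theta>)"
  proof -
    have "AE q in lborel. fnQ (P X) q = ?\<theta> q"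
      using P_fnQ[of X] corr_AE[OF X]
    proof eventually_elim
      case (elim q)
      have "?\<theta> q = 0" if "q \<notin> Q" using that K(2,3) by blast
      then show ?case using elim by (cases "q \<in> Q") (auto simp: uncur_def)
    qed
    from slices_cong[OF sq_int_fnQ sq_int_ccinf[OF c] this] show ?thesis by (simp add: slices_fnQ)
  qed
  have rPX: "AE t in lborel. rep (P X) t = slices ?\<theta> t" unfolding PX by (rule rep_toL[OF sq_int_slices[OF sq_int_ccinf[OF c]]])
  have sec: "sq_int (\<lambda>x. ?\<theta> (x, t))" for t
    using sq_int_ccinf[OF testQ_section(1)[OF \<theta>, of t]] by (simp add: uncur_def)
  have quot: "real (Suc n) *\<^sub>R (P X - shift T (?h n) (P X)) = toL (slices (d n))" for n
  proof (rule toL_eqI[symmetric, OF sq_int_slices[OF dc(2)]])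
    show "AE t in lborel. rep (real (Suc n) *\<^sub>R (P X - shift T (?h n) (P X))) t = slices (d n) t"
      using rep_scaleR[of "real (Suc n)" "P X - shift T (?h n) (P X)"] rep_diff[of "P X" "shift T (?h n) (P X)"]
        rep_shift[of T "?h n" "P X"] rPX AE_translate[OF rPX, of "?h n"]
    proof eventually_elim
      case (elim t)
      have "slices (d n) t = toL (\<lambda>x. real (Suc n) *\<^sub>R (?\<theta> (x, t) - indicator {0<..<T} t *\<^sub>R ?\<theta> (x, t + ?h n)))"
        by (simp add: slices_def d_def)
      also have "\<dots> = real (Suc n) *\<^sub>R (slices ?\<theta> t - indicator {0<..<T} t *\<^sub>R slices ?\<theta> (t + ?h n))"
        unfolding slices_def
        by (subst toL_scaleR[OF sq_int_diff[OF sec sq_int_scaleR[OF sec]]], subst toL_diff[OF sec sq_int_scaleR[OF sec]], subst toL_scaleR[OF sec]) simp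
      finally show ?case using elim by simp
    qed
  qed
  let ?A = "toL (fnQ (P U))"
  have eq: "?A \<bullet> toL (d n) = restr {0<..<T} g \<bullet> (real (Suc n) *\<^sub>R avg (?h n) X)" for n
  proof -
    have "?A \<bullet> toL (d n) = P U \<bullet> toL (slices (d n))"
      by (simp add: inner_toL[OF sq_int_fnQ dc(2)] inner_slices_fnQ[OF dc(2)])
    also have "\<dots> = real (Suc n) * (P U \<bullet> (P X - shift T (?h n) (P X)))" by (simp add: quot[symmetric])
    also have "\<dots> = real (Suc n) * (g \<bullet> restr {0<..<T} (avg (?h n) X))"
      by (subst weak_eq_shift_test[OF u corr_V[OF X]]) simp_all
    finally show ?thesis by (simp add: restr_adj)
  qed
  have "(\<lambda>n. ?A \<bullet> toL (d n)) \<longlonglongrightarrow> ?A \<bullet> toL (\<lambda>q. - ?dt q)" by (intro tendsto_inner tendsto_const dc(3))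
  moreover have "(\<lambda>n. ?A \<bullet> toL (d n)) \<longlonglongrightarrow> restr {0<..<T} g \<bullet> X"
    unfolding eq by (intro tendsto_inner tendsto_const avg_tendsto)
  ultimately have "?A \<bullet> toL (\<lambda>q. - ?dt q) = restr {0<..<T} g \<bullet> X" by (rule LIMSEQ_unique)
  moreover have "restr {0<..<T} g \<bullet> X = g \<bullet> X"
    using V_supported[OF corr_V[OF X]] by (simp add: restr_adj supported_def)
  moreover have "?A \<bullet> toL (\<lambda>q. - ?dt q) = - (LINT q|lborel. fnQ (P U) q * ?dt q)"
    by (simp add: inner_toL[OF sq_int_fnQ dc(1)])
  ultimately show ?thesis by simp
qed

lemma tensor_test:
  assumes \<psi>: "ccinf D \<psi>" and \<xi>: "ccinf {0<..<T} \<xi>"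
  shows "testQ D T (\<lambda>x t. \<psi> x * \<xi> t)"
    and "pd (uncur (\<lambda>x t. \<psi> x * \<xi> t)) (0, 1) q = \<psi> (fst q) * pd \<xi> 1 (snd q)"
    and "sgrad (\<lambda>x t. \<psi> x * \<xi> t) x t = \<xi> t *\<^sub>R grad \<psi> x"
proof -
  have e: "uncur (\<lambda>x t. \<psi> x * \<xi> t) = (\<lambda>q. \<psi> (fst q) * \<xi> (snd q))" by (rule ext) (simp add: uncur_def)
  have s2: "smooth_fun (\<lambda>q::(real^'n) \<times> real. snd q)" by (rule smooth_fun_bounded_linear[OF bounded_linear_snd])
  have s: "smooth_fun (\<lambda>q::(real^'n) \<times> real. \<psi> (fst q))" "smooth_fun (\<lambda>q::(real^'n) \<times> real. \<xi> (snd q))"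
    by (rule smooth_fun_fst(2)[OF ccinf_smooth[OF \<psi>]], rule smooth_fun_compose[OF ccinf_smooth[OF \<xi>] s2])
  obtain K where K: "compact K" "K \<subseteq> D" "\<And>x. x \<notin> K \<Longrightarrow> \<psi> x = 0" using ccinf_support[OF \<psi>] by blast
  obtain L where L: "compact L" "L \<subseteq> {0<..<T}" "\<And>x. x \<notin> L \<Longrightarrow> \<xi> x = 0" using ccinf_support[OF \<xi>] by blast
  show t: "testQ D T (\<lambda>x t. \<psi> x * \<xi> t)"
    unfolding testQ_iff e
  proof (rule ccinfI[OF smooth_fun_mult[OF s] compact_Times[OF K(1) L(1)]])
    show "K \<times> L \<subseteq> Q" using K(2) L(2) by (auto simp: cyl_def)
    show "\<psi> (fst q) * \<xi> (snd q) = 0" if "q \<notin> K \<times> L" for q using that K(3)[of "fst q"] L(3)[of "snd q"] by (cases q) auto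
  qed
  have "pd (\<lambda>q::(real^'n) \<times> real. \<xi> (snd q)) (0, 1) q = pd \<xi> 1 (snd q) * pd snd (0, 1) q"
    using pd_compose[OF ccinf_smooth[OF \<xi>] smooth_fun_differentiable[OF s2]] by simp
  moreover have "pd snd (0::real^'n, 1::real) q = 1"
    using pd_eqI[OF bounded_linear_imp_has_derivative[OF bounded_linear_snd], of "(0, 1)" q] by simp
  moreover have "pd (\<lambda>q::(real^'n) \<times> real. \<psi> (fst q)) (0, 1) q = 0"
    using smooth_fun_fst(1)[OF ccinf_smooth[OF \<psi>], of "(0, 1)" q] linear_0[OF pd_linear[OF smooth_fun_differentiable[OF ccinf_smooth[OF \<psi>]]]] by simp
  ultimately show "pd (uncur (\<lambda>x t. \<psi> x * \<xi> t)) (0, 1) q = \<psi> (fst q) * pd \<xi> 1 (snd q)"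
    unfolding e by (subst pd_mult[OF smooth_fun_differentiable[OF s(1)] smooth_fun_differentiable[OF s(2)]]) simp
  have "grad (\<lambda>x. \<xi> t * \<psi> x) x = \<xi> t *\<^sub>R grad \<psi> x" by (rule grad_cmult[OF ccinf_smooth[OF \<psi>]])
  then show "sgrad (\<lambda>x t. \<psi> x * \<xi> t) x t = \<xi> t *\<^sub>R grad \<psi> x"
    using testQ_section(2)[OF t, of t x] by (simp add: mult.commute)
qed

text \<open>Separated test functions \<psi>(x) \<xi>(t) turn the space-time formulation into the
  scalar equation a' = c on (0, T), with a the product of P U with the function part of k, and c the
  product of g with k.\<close>

lemma tensor_test_identity:
  assumes U: "U \<in> V"
    and test: "\<And>\<theta> X. testQ D T \<theta> \<Longrightarrow> corr X \<theta> (sgrad \<theta>) \<Longrightarrow> - (LINT q|lborel. fnQ (P U) q * pd (uncur \<theta>) (0, 1) q) = g \<bullet> X"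
    and \<psi>: "ccinf D \<psi>" and k: "k = toL (pairf D \<psi> (grad \<psi>))" and \<xi>: "ccinf {0<..<T} \<xi>"
  shows "- (LINT t|lborel. pd \<xi> 1 t * (rep (P U) t \<bullet> lmap fst k)) = (LINT t|lborel. \<xi> t * (rep g t \<bullet> k))"
proof -
  let ?\<theta> = "\<lambda>x t. \<psi> x * \<xi> t"
  note tt = tensor_test[OF \<psi> \<xi>]
  have c: "ccinf Q (uncur ?\<theta>)" using tt(1) by (simp add: testQ_iff)
  have cd: "ccinf Q (pd (uncur ?\<theta>) (0, 1))" by (rule ccinf_pd[OF c axis0_Basis(2)])
  have \<xi>0: "\<xi> t = 0" if "t \<notin> {0<..<T}" for t using ccinf_support[OF \<xi>] that by blast
  have \<psi>0: "\<psi> x = 0" if "x \<notin> D" for x using ccinf_support[OF \<psi>] that by blast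
  have mx[measurable]: "\<xi> \<in> borel_measurable borel" "pd \<xi> 1 \<in> borel_measurable borel"
    using smooth_fun_measurable[OF ccinf_smooth[OF \<xi>]] smooth_fun_measurable[OF smooth_fun_pd[OF ccinf_smooth[OF \<xi>], of 1]] by simp_all
  have sk: "sq_int (pairf D \<psi> (grad \<psi>))" by (rule smooth_vanishing_sq_int[OF Dopen ccinf_smooth_vanishing[OF Dopen \<psi>]])
  have rk: "AE x in lborel. rep k x = pairf D \<psi> (grad \<psi>) x" unfolding k by (rule rep_toL[OF sk])
  have pk: "lmap fst k = toL \<psi>"
  proof (rule toL_eqI[symmetric, OF sq_int_ccinf[OF \<psi>]])
    show "AE x in lborel. rep (lmap fst k) x = \<psi> x"
      using rep_lmap[OF bounded_linear_fst, of k] rk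
    proof eventually_elim
      case (elim x) then show ?case using \<psi>0[of x] by (cases "x \<in> D") (auto simp: pairf_def)
    qed
  qed
  obtain X where X: "corr X ?\<theta> (sgrad ?\<theta>)" using testQ_corr[OF tt(1)] by blast
  have rX: "AE t in lborel. rep X t = \<xi> t *\<^sub>R k"
    using AE_fnQ[of X] AE_swap[OF corr_AE[OF X]]
  proof eventually_elim
    case (elim t)
    show ?case
    proof (rule l2_eqI)
      show "AE x in lborel. rep (rep X t) x = rep (\<xi> t *\<^sub>R k) x"
        using elim rk rep_scaleR[of "\<xi> t" k]
      proof eventually_elim
        case (elim x)
        then show ?case using \<xi>0[of t]
          by (cases "x \<in> D"; cases "t \<in> {0<..<T}") (simp_all add: pairf_def cyl_def tt(3) mult.commute zero_prod_def)
      qed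
    qed
  qed
  have "AE t in lborel. rep (toL (slices (pd (uncur ?\<theta>) (0, 1)))) t = pd \<xi> 1 t *\<^sub>R toL \<psi>"
    using AE_rep_slices[OF sq_int_ccinf[OF cd]]
  proof eventually_elim
    case (elim t)
    show ?case
    proof (rule l2_eqI)
      show "AE x in lborel. rep (rep (toL (slices (pd (uncur ?\<theta>) (0, 1)))) t) x = rep (pd \<xi> 1 t *\<^sub>R toL \<psi>) x"
        using elim rep_toL[OF sq_int_ccinf[OF \<psi>]] rep_scaleR[of "pd \<xi> 1 t" "toL \<psi>"]
        by eventually_elim (simp add: tt(2) mult.commute)
    qed
  qed
  then have "AE t in lborel. rep (P U) t \<bullet> rep (toL (slices (pd (uncur ?\<theta>) (0, 1)))) t = pd \<xi> 1 t * (rep (P U) t \<bullet> lmap fst k)"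
    by eventually_elim (simp add: pk)
  then have "P U \<bullet> toL (slices (pd (uncur ?\<theta>) (0, 1))) = (LINT t|lborel. pd \<xi> 1 t * (rep (P U) t \<bullet> lmap fst k))"
    by (rule inner_rep_cong) simp
  then have L: "(LINT q|lborel. fnQ (P U) q * pd (uncur ?\<theta>) (0, 1) q) = (LINT t|lborel. pd \<xi> 1 t * (rep (P U) t \<bullet> lmap fst k))"
    using inner_slices_fnQ[OF sq_int_ccinf[OF cd], of "P U"] by simp
  have "AE t in lborel. rep g t \<bullet> rep X t = \<xi> t * (rep g t \<bullet> k)" using rX by eventually_elim simp
  then have "g \<bullet> X = (LINT t|lborel. \<xi> t * (rep g t \<bullet> k))" by (rule inner_rep_cong) simp
  then show ?thesis using test[OF tt(1) X] L by simp
qed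

end

section \<open>Scalar equations in time and the initial value\<close>

lemma compact_subset_Ioo_upper:
  assumes K: "compact K" "K \<subseteq> {a<..<b::real}" and ab: "a < b"
  shows "\<exists>c. a < c \<and> c < b \<and> (\<forall>t\<in>K. t < c)"
proof (cases "K = {}")
  case True then show ?thesis using dense[OF ab] by auto
next
  case False
  obtain s where s: "s \<in> K" "\<And>t. t \<in> K \<Longrightarrow> t \<le> s" using compact_attains_sup[OF K(1) False] by blast
  then have "a < s" "s < b" using K(2) by auto
  then obtain c where "s < c" "c < b" using dense by blast
  then show ?thesis using s(2) \<open>a < s\<close> by (intro exI[of _ c]) fastforce
qed

text \<open>Z is the integral of \<zeta> from t to T. It vanishes near T, but near 0 it equals the
  full integral of \<zeta>, so in general it is not a test function on (0, T) and has to be cut off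
  at time 0.\<close>

lemma ccinf_antiderivative:
  assumes \<zeta>: "ccinf {0<..<T} \<zeta>" and T: "T > 0"
  shows "\<exists>Z C c. smooth_fun Z \<and> (\<forall>t. pd Z 1 t = - \<zeta> t) \<and> 0 < c \<and> c < T \<and> (\<forall>t\<ge>c. Z t = 0) \<and>
    (\<forall>t. 0 < t \<longrightarrow> t < T \<longrightarrow> iint \<zeta> t T = Z t) \<and> (\<forall>t\<ge>0. \<bar>Z t\<bar> \<le> C)"
proof -
  have cont: "continuous_on A \<zeta>" for A by (rule smooth_fun_continuous[OF ccinf_smooth[OF \<zeta>]])
  obtain F where F: "\<And>t. (F has_vector_derivative \<zeta> t) (at t)"
    using einterval_antiderivative[of "-\<infinity>" "\<infinity>" \<zeta>] cont[of UNIV] by (auto simp: continuous_on_eq_continuous_at)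
  then have Fd: "(F has_real_derivative \<zeta> t) (at t)" for t by (simp add: has_real_derivative_iff_has_vector_derivative)
  define Z where "Z t = F T - F t" for t
  have Zd: "(Z has_real_derivative - \<zeta> t) (at t)" for t unfolding Z_def by (auto intro!: derivative_eq_intros Fd)
  have pZ: "pd Z 1 t = - \<zeta> t" for t by (rule pd_real_derivative[OF Zd])
  have smm: "smooth_fun (\<lambda>t. - \<zeta> t)" using smooth_fun_cmult[OF ccinf_smooth[OF \<zeta>], of "-1"] by simp
  have Zs: "smooth_fun Z"
  proof (rule smooth_fun.intros)
    show "\<forall>x. Z differentiable at x" using Zd by (auto simp: real_differentiable_def)
    have "pd Z 1 = (\<lambda>t. - \<zeta> t)" using pZ by auto
    then show "\<forall>i\<in>Basis. smooth_fun (pd Z i)" using smm by simp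
  qed
  obtain K where K: "compact K" "K \<subseteq> {0<..<T}" "\<And>x. x \<notin> K \<Longrightarrow> \<zeta> x = 0" using ccinf_support[OF \<zeta>] by blast
  obtain c where c: "0 < c" "c < T" "\<forall>t\<in>K. t < c" using compact_subset_Ioo_upper[OF K(1,2) T] by blast
  have "\<exists>r. \<forall>x\<in>{c..}. Z x = r"
  proof (rule has_field_derivative_zero_constant)
    fix x assume "x \<in> {c..}"
    then have "\<zeta> x = 0" using c(3) by (intro K(3)) auto
    then show "(Z has_real_derivative 0) (at x within {c..})" using Zd[of x] by (simp add: has_field_derivative_at_within)
  qed simp
  then obtain r where r: "\<And>x. x \<ge> c \<Longrightarrow> Z x = r" by auto
  have "Z T = 0" by (simp add: Z_def)
  then have Z0: "Z t = 0" if "t \<ge> c" for t using r[OF that] r[of T] c(2) by simp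
  have "compact (Z ` {0..T})" by (intro compact_continuous_image smooth_fun_continuous[OF Zs]) simp
  then have "\<exists>C. \<forall>t\<in>{0..T}. \<bar>Z t\<bar> \<le> C" using compact_imp_bounded[of "Z ` {0..T}"] by (simp add: bounded_iff)
  then obtain C where C: "\<And>t. t \<in> {0..T} \<Longrightarrow> \<bar>Z t\<bar> \<le> C" by blast
  have C': "\<bar>Z t\<bar> \<le> C" if "0 \<le> t" for t
    using C[of t] C[of 0] Z0[of t] that T c by (cases "t \<le> T") auto
  have "iint \<zeta> t T = Z t" if "0 < t" "t < T" for t
  proof -
    have "(LBINT x=ereal t..ereal T. \<zeta> x) = F T - F t"
      by (rule interval_integral_FTC_finite[OF cont]) (rule has_vector_derivative_at_within[OF F])
    then show ?thesis using that interval_integral_Ioo[of "ereal t" "ereal T" \<zeta>] by (simp add: iint_eq Z_def)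
  qed
  with Zs pZ c(1,2) Z0 C' show ?thesis by (intro exI[of _ Z] exI[of _ C] exI[of _ c]) simp
qed

text \<open>For m > 0 a ramp from 0 to 1 between 1/m and 2/m; vanishing up to 1/m is what yields
  compact support inside (0, T).\<close>

lemma sstep_ramp:
  "pd (\<lambda>t. sstep (m * t - 1)) 1 t = m * pd sstep 1 (m * t - 1)" "smooth_fun (\<lambda>t. sstep (m * t - 1))"
proof -
  have s: "smooth_fun (\<lambda>t. m * t - 1 :: real)" by (intro smooth_fun_diff smooth_fun_cmult smooth_fun_ident smooth_fun_const)
  show "smooth_fun (\<lambda>t. sstep (m * t - 1))" by (rule smooth_fun_compose[OF smooth_fun_sstep s])
  have "pd (\<lambda>t. m * t - 1) 1 t = m" by (rule pd_real_derivative) (auto intro!: derivative_eq_intros)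
  then show "pd (\<lambda>t. sstep (m * t - 1)) 1 t = m * pd sstep 1 (m * t - 1)"
    by (simp add: pd_compose[OF smooth_fun_sstep smooth_fun_differentiable[OF s]])
qed

lemma sstep_ramp_tendsto: assumes "t > 0" shows "(\<lambda>n. sstep (real (Suc n) * t - 1)) \<longlonglongrightarrow> 1"
proof -
  obtain N where N: "2 / t < real N" using reals_Archimedean2 by blast
  have "sstep (real (Suc n) * t - 1) = 1" if "n \<ge> N" for n
  proof (rule sstep_eq_1)
    have "2 / t \<le> real (Suc n)" using N that by linarith
    then show "real (Suc n) * t - 1 \<ge> 1" using assms by (simp add: field_simps)
  qed
  then show ?thesis by (intro tendsto_eventually eventually_sequentiallyI[of N]) simp
qed

text \<open>Test with a cut-off primitive of \<open>\<zeta>\<close>; the cut-off layer at time zero is harmless because \<open>a\<close> tends to zero there.\<close>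
lemma primitive_identity:
  fixes a c :: "real \<Rightarrow> real"
  assumes a: "sq_int a" and c: "sq_int c" and T: "T > 0"
    and id: "\<And>\<xi>. ccinf {0<..<T} \<xi> \<Longrightarrow> - (LINT t|lborel. pd \<xi> 1 t * a t) = (LINT t|lborel. \<xi> t * c t)"
    and N: "(N \<longlongrightarrow> 0) (at_right 0)" "AE t in lborel. t \<in> {0<..<T} \<longrightarrow> \<bar>a t\<bar> \<le> N t"
    and \<zeta>: "ccinf {0<..<T} \<zeta>"
  shows "(LINT t|lborel. \<zeta> t * a t) = (LINT t|lborel. (if 0 < t \<and> t < T then iint \<zeta> t T else 0) * c t)"
proof -
  obtain Z CZ \<beta> where Zs: "smooth_fun Z" and pZ: "\<forall>t. pd Z 1 t = - \<zeta> t" and \<beta>: "0 < \<beta>" "\<beta> < T"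
    and Z0: "\<forall>t\<ge>\<beta>. Z t = 0" and iZ: "\<forall>t. 0 < t \<longrightarrow> t < T \<longrightarrow> iint \<zeta> t T = Z t" and CZ: "\<forall>t\<ge>0. \<bar>Z t\<bar> \<le> CZ"
    using ccinf_antiderivative[OF \<zeta> T] by blast
  note pZ = pZ[rule_format] and Z0 = Z0[rule_format] and iZ = iZ[rule_format] and CZ = CZ[rule_format]
  have [measurable]: "a \<in> borel_measurable borel" "c \<in> borel_measurable borel" using a c by (simp_all add: sq_int_def)
  have [measurable]: "\<zeta> \<in> borel_measurable borel" "Z \<in> borel_measurable borel" "sstep \<in> borel_measurable borel" "pd sstep 1 \<in> borel_measurable borel"
    using smooth_fun_measurable[OF ccinf_smooth[OF \<zeta>]] smooth_fun_measurable[OF Zs] smooth_fun_measurable[OF smooth_fun_sstep]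
      smooth_fun_measurable[OF smooth_fun_pd[OF smooth_fun_sstep, of 1]] by simp_all
  have \<zeta>0: "\<zeta> t = 0" if "t \<le> 0" for t using ccinf_support[OF \<zeta>] that by force
  have CZ0: "CZ \<ge> 0" using CZ[of 0] by simp
  obtain Cs where Cs: "Cs \<ge> 0" "\<And>s. \<bar>pd sstep 1 s\<bar> \<le> Cs" using sstep_deriv_bounded by blast
  define s where "s n t = sstep (real (Suc n) * t - 1)" for n t
  have sm[measurable]: "s n \<in> borel_measurable borel" for n unfolding s_def by measurable
  have s01: "0 \<le> s n t" "s n t \<le> 1" for n t using sstep_range by (simp_all add: s_def)
  have s0: "s n t = 0" if "t \<le> 1 / real (Suc n)" for n t
    unfolding s_def by (rule sstep_eq_0) (use that in \<open>simp add: field_simps\<close>)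
  \<comment> \<open>The term from differentiating the cut-off: of size n + 1, but concentrated on a
    layer of length 1/(n + 1).\<close>
  define dl where "dl n t = real (Suc n) * pd sstep 1 (real (Suc n) * t - 1) * Z t" for n t
  have dlm[measurable]: "dl n \<in> borel_measurable borel" for n unfolding dl_def by measurable
  have dlb: "\<bar>dl n t\<bar> \<le> real (Suc n) * (Cs * CZ) * indicator {1 / real (Suc n)..2 / real (Suc n)} t" for n t
  proof (cases "t \<in> {1 / real (Suc n)..2 / real (Suc n)}")
    case True
    then have "0 \<le> 1 / real (Suc n)" "1 / real (Suc n) \<le> t" by auto
    then have "0 \<le> t" by (rule order_trans)
    then have "\<bar>pd sstep 1 (real (Suc n) * t - 1)\<bar> * \<bar>Z t\<bar> \<le> Cs * CZ" using Cs CZ by (intro mult_mono) auto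
    then have "real (Suc n) * (\<bar>pd sstep 1 (real (Suc n) * t - 1)\<bar> * \<bar>Z t\<bar>) \<le> real (Suc n) * (Cs * CZ)" by (intro mult_left_mono) auto
    then show ?thesis using True by (simp add: dl_def abs_mult mult.assoc)
  next
    case False
    then have "real (Suc n) * t - 1 < 0 \<or> real (Suc n) * t - 1 > 1" by (auto simp: field_simps)
    then have "pd sstep 1 (real (Suc n) * t - 1) = 0" by (rule sstep_deriv_outside)
    then show ?thesis using False by (simp add: dl_def)
  qed
  \<comment> \<open>The scalar identity for the test function s_n Z, whose derivative is dl_n - s_n
    \<zeta>.\<close>
  have step: "(LINT t|lborel. s n t * \<zeta> t * a t) - (LINT t|lborel. dl n t * a t) = (LINT t|lborel. s n t * Z t * c t)" for n
  proof -
    let ?\<xi> = "\<lambda>t. s n t * Z t"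
    have ss: "smooth_fun (s n)" unfolding s_def using sstep_ramp(2)[of "real (Suc n)"] by simp
    have cc: "ccinf {0<..<T} ?\<xi>"
    proof (rule ccinfI[OF smooth_fun_mult[OF ss Zs], of "{1 / real (Suc n)..\<beta>}"])
      show "{1 / real (Suc n)..\<beta>} \<subseteq> {0<..<T}" using \<beta>
      proof -
        have "0 < 1 / real (Suc n)" by simp
        then show ?thesis using \<beta> unfolding subset_iff atLeastAtMost_iff greaterThanLessThan_iff by (meson less_le_trans le_less_trans)
      qed
      show "s n t * Z t = 0" if "t \<notin> {1 / real (Suc n)..\<beta>}" for t using that s0[of t n] Z0[of t] by fastforce
    qed simp
    have pds: "pd (s n) 1 t = real (Suc n) * pd sstep 1 (real (Suc n) * t - 1)" for t
      unfolding s_def by (rule sstep_ramp(1))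
    have pdx: "pd ?\<xi> 1 t = dl n t - s n t * \<zeta> t" for t
      by (subst pd_mult[OF smooth_fun_differentiable[OF ss] smooth_fun_differentiable[OF Zs]]) (simp add: pZ pds dl_def)
    have i1: "integrable lborel (\<lambda>t. s n t * \<zeta> t * a t)"
      using sq_int_inner[OF sq_int_mult_bounded[OF sq_int_ccinf[OF \<zeta>] sm[of n], of 1] a] s01 by (simp add: abs_le_iff mult.assoc)
    have i2': "integrable lborel (\<lambda>t. pd ?\<xi> 1 t * a t)"
      using sq_int_inner[OF sq_int_ccinf[OF ccinf_pd[OF cc, of 1]] a] by simp
    have "integrable lborel (\<lambda>t. pd ?\<xi> 1 t * a t + s n t * \<zeta> t * a t)" by (rule Bochner_Integration.integrable_add[OF i2' i1])
    then have i2: "integrable lborel (\<lambda>t. dl n t * a t)" unfolding pdx by (simp add: left_diff_distrib)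
    have "- (LINT t|lborel. pd ?\<xi> 1 t * a t) = (LINT t|lborel. s n t * \<zeta> t * a t) - (LINT t|lborel. dl n t * a t)"
      unfolding pdx left_diff_distrib by (subst Bochner_Integration.integral_diff[OF i2 i1]) simp
    then show ?thesis using id[OF cc] by simp
  qed
  have L1: "(\<lambda>n. LINT t|lborel. s n t * \<zeta> t * a t) \<longlonglongrightarrow> (LINT t|lborel. \<zeta> t * a t)"
  proof (rule integral_dominated_convergence[where w = "\<lambda>t. \<bar>\<zeta> t * a t\<bar>"])
    show "integrable lborel (\<lambda>t. \<bar>\<zeta> t * a t\<bar>)" using sq_int_inner[OF sq_int_ccinf[OF \<zeta>] a] by simp
    show "AE t in lborel. (\<lambda>n. s n t * \<zeta> t * a t) \<longlonglongrightarrow> \<zeta> t * a t"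
    proof (rule AE_I2)
      fix t show "(\<lambda>n. s n t * \<zeta> t * a t) \<longlonglongrightarrow> \<zeta> t * a t"
      proof (cases "t > 0")
        case True
        have "(\<lambda>n. s n t * (\<zeta> t * a t)) \<longlonglongrightarrow> 1 * (\<zeta> t * a t)"
          unfolding s_def by (intro tendsto_mult sstep_ramp_tendsto[OF True] tendsto_const)
        then show ?thesis by (simp add: mult.assoc)
      qed (simp add: \<zeta>0)
    qed
    show "AE t in lborel. norm (s n t * \<zeta> t * a t) \<le> \<bar>\<zeta> t * a t\<bar>" for n
    proof (rule AE_I2)
      fix t show "norm (s n t * \<zeta> t * a t) \<le> \<bar>\<zeta> t * a t\<bar>"
        using mult_right_mono[OF s01(2)[of n t] abs_ge_zero[of "\<zeta> t * a t"]] s01(1)[of n t] by (simp add: abs_mult mult.assoc)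
    qed
  qed measurable
  let ?W = "\<lambda>t. (if 0 < t \<and> t < T then Z t else 0)"
  have L3: "(\<lambda>n. LINT t|lborel. s n t * Z t * c t) \<longlonglongrightarrow> (LINT t|lborel. ?W t * c t)"
  proof (rule integral_dominated_convergence[where w = "\<lambda>t. \<bar>(indicator {0<..<T} t *\<^sub>R CZ) * c t\<bar>"])
    show "integrable lborel (\<lambda>t. \<bar>(indicator {0<..<T} t *\<^sub>R CZ) * c t\<bar>)"
      using sq_int_inner[OF sq_int_const_on[OF _ emeasure_Ioo_finite, of 0 T CZ] c] by simp
    have out: "s n t * Z t = 0" if "\<not> (0 < t \<and> t < T)" for n t
    proof (cases "t \<ge> T")
      case True then show ?thesis using Z0[of t] \<beta> by simp
    next
      case False
      then have "t \<le> 0" using that by simp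
      moreover have "0 \<le> 1 / real (Suc n)" by simp
      ultimately show ?thesis using s0[of t n] by (simp only: order_trans mult_zero_left)
    qed
    show "AE t in lborel. (\<lambda>n. s n t * Z t * c t) \<longlonglongrightarrow> ?W t * c t"
    proof (rule AE_I2)
      fix t show "(\<lambda>n. s n t * Z t * c t) \<longlonglongrightarrow> ?W t * c t"
      proof (cases "0 < t \<and> t < T")
        case True
        have "(\<lambda>n. s n t * (Z t * c t)) \<longlonglongrightarrow> 1 * (Z t * c t)"
          unfolding s_def by (intro tendsto_mult sstep_ramp_tendsto tendsto_const) (use True in simp)
        then show ?thesis using True by (simp add: mult.assoc)
      next
        case False
        show ?thesis unfolding if_not_P[OF False] out[OF False] by simp
      qed
    qed
    show "AE t in lborel. norm (s n t * Z t * c t) \<le> \<bar>(indicator {0<..<T} t *\<^sub>R CZ) * c t\<bar>" for n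
    proof (rule AE_I2)
      fix t show "norm (s n t * Z t * c t) \<le> \<bar>(indicator {0<..<T} t *\<^sub>R CZ) * c t\<bar>"
      proof (cases "0 < t \<and> t < T")
        case True
        have "s n t * \<bar>Z t\<bar> \<le> 1 * CZ" using s01 CZ[of t] True CZ0 by (intro mult_mono) auto
        then have "s n t * \<bar>Z t\<bar> * \<bar>c t\<bar> \<le> CZ * \<bar>c t\<bar>" by (simp add: mult_right_mono)
        then show ?thesis using True s01(1)[of n t] CZ0 by (simp add: abs_mult)
      next
        case False
        show ?thesis by (simp add: out[OF False])
      qed
    qed
  qed measurable
  have L2: "(\<lambda>n. LINT t|lborel. dl n t * a t) \<longlonglongrightarrow> 0"
  proof (rule LIMSEQ_I)
    fix r :: real assume r: "r > 0"
    \<comment> \<open>In the layer |a| is at most e, while |dl_n| has integral at most Cs * CZ; the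
      summand 1 keeps the divisor positive.\<close>
    define e where "e = r / (2 * (Cs * CZ + 1))"
    have q: "Cs * CZ \<ge> 0" using Cs CZ0 by simp
    have e: "e > 0" using r q by (simp add: e_def)
    have "\<forall>\<^sub>F t in at_right 0. \<bar>N t\<bar> < e" using tendstoD[OF N(1) e] by simp
    then obtain \<delta> where \<delta>: "\<delta> > 0" "\<And>t. 0 < t \<Longrightarrow> t < \<delta> \<Longrightarrow> \<bar>N t\<bar> < e" unfolding eventually_at_right_field by auto
    obtain n0 where n0: "2 / min \<delta> T < real n0" using reals_Archimedean2 by blast
    have "norm ((LINT t|lborel. dl n t * a t) - 0) < r" if n: "n \<ge> n0" for n
    proof -
      let ?J = "{1 / real (Suc n)..2 / real (Suc n)}"
      let ?w = "\<lambda>t. (real (Suc n) * (Cs * CZ) * e) * indicator ?J t"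
      have "2 / min \<delta> T < real (Suc n)" using n0 n by linarith
      moreover have "0 < min \<delta> T" using \<delta>(1) T by simp
      ultimately have "2 < real (Suc n) * min \<delta> T" using pos_divide_less_eq by blast
      then have sm: "2 / real (Suc n) < min \<delta> T" using pos_divide_less_eq[of "real (Suc n)" 2 "min \<delta> T"] by (simp only: of_nat_0_less_iff zero_less_Suc mult.commute)
      have ae: "AE t in lborel. norm (dl n t * a t) \<le> ?w t"
        using N(2)
      proof eventually_elim
        case (elim t)
        show ?case
        proof (cases "t \<in> ?J")
          case True
          have "0 < 1 / real (Suc n)" by simp
          moreover have "1 / real (Suc n) \<le> t" using True by simp
          ultimately have t0: "0 < t" by (rule less_le_trans)
          have "t \<le> 2 / real (Suc n)" using True by simp
          then have t1: "t < min \<delta> T" using sm by (rule le_less_trans)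
          have "\<bar>a t\<bar> \<le> e" using elim t0 t1 \<delta>(2)[of t] by auto
          then have "\<bar>dl n t\<bar> * \<bar>a t\<bar> \<le> (real (Suc n) * (Cs * CZ)) * e"
            using dlb[of n t] True q by (intro mult_mono) (auto intro: mult_nonneg_nonneg)
          then show ?thesis using True by (simp add: abs_mult)
        next
          case False
          then have "dl n t = 0" using dlb[of n t] by simp
          then show ?thesis using False by simp
        qed
      qed
      have wi: "integrable lborel ?w" by (intro integrable_mult_right integrable_real_indicator) (simp_all add: emeasure_lborel_Icc_eq)
      have "AE t in lborel. norm (dl n t * a t) \<le> norm (?w t)" using ae
      proof eventually_elim
        case (elim t) show ?case by (rule order_trans[OF elim]) (simp only: real_norm_def abs_ge_self)
      qed
      then have ai: "integrable lborel (\<lambda>t. dl n t * a t)" by (intro Bochner_Integration.integrable_bound[OF wi]) simp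
      have "norm (LINT t|lborel. dl n t * a t) \<le> (LINT t|lborel. norm (dl n t * a t))" by (rule integral_norm_bound)
      also have "\<dots> \<le> (LINT t|lborel. ?w t)" by (rule integral_mono_AE[OF integrable_norm[OF ai] wi ae])
      also have "(LINT t|lborel. ?w t) = (real (Suc n) * (Cs * CZ) * e) * measure lborel ?J" by simp
      also have "measure lborel ?J = 1 / real (Suc n)"
        by (subst measure_lborel_Icc) (simp_all add: divide_right_mono diff_divide_distrib[symmetric])
      also have "(real (Suc n) * (Cs * CZ) * e) * (1 / real (Suc n)) = Cs * CZ * e" by (simp add: field_simps del: of_nat_Suc)
      also have "\<dots> \<le> (Cs * CZ + 1) * e" using e by simp
      also have "\<dots> = r / 2" using q by (simp add: e_def field_simps)
      also have "\<dots> < r" using r by simp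
      finally show ?thesis by simp
    qed
    then show "\<exists>no. \<forall>n\<ge>no. norm ((LINT t|lborel. dl n t * a t) - 0) < r" by blast
  qed
  have "(\<lambda>n. LINT t|lborel. s n t * Z t * c t) \<longlonglongrightarrow> (LINT t|lborel. \<zeta> t * a t) - 0"
    using tendsto_diff[OF L1 L2] unfolding step .
  then have "(LINT t|lborel. \<zeta> t * a t) = (LINT t|lborel. ?W t * c t)" using LIMSEQ_unique[OF _ L3] by simp
  moreover have "(if 0 < t \<and> t < T then iint \<zeta> t T else 0) = ?W t" for t using iZ[of t] by simp
  ultimately show ?thesis by (simp only:)
qed

context cylinder begin

text \<open>The defect of the weak equation is a bounded functional of \<omega> with Riesz vector l
  in V. It vanishes on \<zeta>(t) k for k in \<open>Cgen D\<close>, where J acts on \<zeta> alone,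
  and density of \<open>Cgen D\<close> in \<open>Hsp D\<close> gives l = 0. The bound N carries the
  initial value 0.\<close>

lemma weak_eqI_tested:
  assumes U: "U \<in> V"
    and test: "\<And>\<theta> X. testQ D T \<theta> \<Longrightarrow> corr X \<theta> (sgrad \<theta>) \<Longrightarrow> - (LINT q|lborel. fnQ (P U) q * pd (uncur \<theta>) (0, 1) q) = g \<bullet> X"
    and N: "(N \<longlongrightarrow> 0) (at_right 0)" "AE t in lborel. t \<in> {0<..<T} \<longrightarrow> norm (rep (P U) t) \<le> N t"
  shows "weak_eq U g"
proof -
  let ?l = "\<lambda>\<omega>. P U \<bullet> P \<omega> - g \<bullet> Jop T \<omega>"
  obtain Kp where Kp: "\<And>x. norm (P x) \<le> norm x * Kp" using bounded_linear.bounded[OF bounded_linear_lmap[OF p]] by blast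
  have "\<exists>l\<in>closure V. \<forall>\<omega>\<in>V. l \<bullet> \<omega> = ?l \<omega>"
  proof (rule riesz_on_subspace[OF V_subspace, where C = "norm (P U) * Kp + norm g * T"])
    fix x y show "?l (x + y) = ?l x + ?l y" by (simp add: lmap_add[OF p] Jop_add inner_add_right)
  next
    fix c x show "?l (c *\<^sub>R x) = c * ?l x" by (simp add: lmap_scaleR[OF p] Jop_scaleR algebra_simps)
  next
    fix x
    have "\<bar>P U \<bullet> P x\<bar> \<le> norm (P U) * (norm x * Kp)"
      using Cauchy_Schwarz_ineq2[of "P U" "P x"] mult_left_mono[OF Kp[of x] norm_ge_zero[of "P U"]] by linarith
    moreover have "\<bar>g \<bullet> Jop T x\<bar> \<le> norm g * (T * norm x)"
      using Cauchy_Schwarz_ineq2[of g "Jop T x"] mult_left_mono[OF norm_Jop[of T x] norm_ge_zero[of g]] Tpos by linarith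
    ultimately show "\<bar>?l x\<bar> \<le> (norm (P U) * Kp + norm g * T) * norm x" by (simp add: algebra_simps abs_le_iff)
  qed
  then obtain l where l: "l \<in> V" "\<And>\<omega>. \<omega> \<in> V \<Longrightarrow> l \<bullet> \<omega> = ?l \<omega>" using V_closed by auto
  have zero: "AE t in lborel. rep l t \<bullet> k = 0" if kC: "k \<in> Cgen D" for k
  proof -
    obtain \<psi> where \<psi>: "ccinf D \<psi>" and k: "k = toL (pairf D \<psi> (grad \<psi>))" using kC by (auto simp: Cgen_def)
    have "k \<in> closure (Cgen D)" by (rule subsetD[OF closure_subset kC])
    then have kH: "k \<in> Hsp D" by (simp add: Hsp_eq_closure_Cgen[OF Dopen])
    let ?p = "lmap fst :: (real^'n, real \<times> (real^'n)) l2 \<Rightarrow> (real^'n, real) l2"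
    let ?a = "\<lambda>t. rep (P U) t \<bullet> ?p k" and ?c = "\<lambda>t. rep g t \<bullet> k"
    have sa: "sq_int ?a" by (rule sq_int_bounded_linear[OF sq_int_rep bounded_linear_inner_left'])
    have sc: "sq_int ?c" by (rule sq_int_bounded_linear[OF sq_int_rep bounded_linear_inner_left'])
    have N1: "((\<lambda>t. N t * norm (?p k)) \<longlongrightarrow> 0) (at_right 0)" using tendsto_mult_left_zero[OF N(1)] .
    have N2: "AE t in lborel. t \<in> {0<..<T} \<longrightarrow> \<bar>?a t\<bar> \<le> N t * norm (?p k)"
      using N(2)
    proof eventually_elim
      case (elim t)
      show ?case
      proof
        assume "t \<in> {0<..<T}"
        then have "norm (rep (P U) t) * norm (?p k) \<le> N t * norm (?p k)" using elim by (intro mult_right_mono) auto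
        then show "\<bar>?a t\<bar> \<le> N t * norm (?p k)" using Cauchy_Schwarz_ineq2[of "rep (P U) t" "?p k"] by linarith
      qed
    qed
    have "sq_int (\<lambda>t. rep l t \<bullet> k)" by (rule sq_int_bounded_linear[OF sq_int_rep bounded_linear_inner_left'])
    then have "AE t in lborel. t \<in> {0<..<T} \<longrightarrow> rep l t \<bullet> k = 0"
    proof (rule AE_zero_if_orth_ccinf)
      fix \<zeta> assume \<zeta>: "ccinf {0<..<T} \<zeta>"
      have \<zeta>m[measurable]: "\<zeta> \<in> borel_measurable borel" by (rule smooth_fun_measurable[OF ccinf_smooth[OF \<zeta>]])
      have \<zeta>0: "\<zeta> t = 0" if "t \<notin> {0<..<T}" for t using ccinf_support[OF \<zeta>] that by blast
      have sk: "sq_int (\<lambda>t. \<zeta> t *\<^sub>R k)" by (rule sq_int_bounded_linear[OF sq_int_ccinf[OF \<zeta>] bounded_linear_scaleR_left])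
      define \<omega> where "\<omega> = toL (\<lambda>t. \<zeta> t *\<^sub>R k)"
      have r\<omega>: "AE t in lborel. rep \<omega> t = \<zeta> t *\<^sub>R k" unfolding \<omega>_def by (rule rep_toL[OF sk])
      have \<omega>V: "\<omega> \<in> V" unfolding V_def mem_Collect_eq using r\<omega>
        by eventually_elim (use kH \<zeta>0 subspace_scale[OF subspace_Hsp[OF Dopen]] in auto)
      have "AE t in lborel. rep (P U) t \<bullet> rep (P \<omega>) t = \<zeta> t * ?a t"
        using r\<omega> rep_lmap[OF p, of \<omega>]
        by eventually_elim (simp add: linear_scale[OF bounded_linear.linear[OF p]])
      then have e1: "P U \<bullet> P \<omega> = (LINT t|lborel. \<zeta> t * ?a t)" by (rule inner_rep_cong) simp
      have ii: "iint (rep \<omega>) t T = iint \<zeta> t T *\<^sub>R k" for t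
      proof -
        have "iint (rep \<omega>) t T = iint (\<lambda>t. \<zeta> t *\<^sub>R k) t T"
          by (rule iint_cong_AE) (use r\<omega> in \<open>eventually_elim, simp\<close>, simp_all)
        also have "\<dots> = iint \<zeta> t T *\<^sub>R k"
          by (rule iint_bounded_linear[OF bounded_linear_scaleR_left sq_int_ccinf[OF \<zeta>], symmetric])
        finally show ?thesis .
      qed
      have "AE t in lborel. rep g t \<bullet> rep (Jop T \<omega>) t = (if 0 < t \<and> t < T then iint \<zeta> t T else 0) * ?c t"
        using rep_Jop[of T \<omega>] by eventually_elim (simp add: ii)
      then have e2: "g \<bullet> Jop T \<omega> = (LINT t|lborel. (if 0 < t \<and> t < T then iint \<zeta> t T else 0) * ?c t)" by (rule inner_rep_cong) simp
      have "P U \<bullet> P \<omega> = g \<bullet> Jop T \<omega>" unfolding e1 e2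
        by (rule primitive_identity[OF sa sc Tpos _ N1 N2 \<zeta>]) (rule tensor_test_identity[OF U test \<psi> k])
      then have "l \<bullet> \<omega> = 0" using l(2)[OF \<omega>V] by simp
      moreover have "AE t in lborel. rep l t \<bullet> rep \<omega> t = (rep l t \<bullet> k) * \<zeta> t" using r\<omega> by eventually_elim simp
      then have "l \<bullet> \<omega> = (LINT t|lborel. (rep l t \<bullet> k) * \<zeta> t)" by (rule inner_rep_cong) simp
      ultimately show "(LINT t|lborel. (rep l t \<bullet> k) * \<zeta> t) = 0" by simp
    qed simp
    then show ?thesis using l(1)[unfolded V_def mem_Collect_eq] by eventually_elim auto
  qed
  have orth: "l \<bullet> tens {a<..<b} k = 0" if "k \<in> Cgen D" for a b k
  proof -
    have "AE t in lborel. rep l t \<bullet> rep (tens {a<..<b} k) t = 0"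
      using zero[OF that] rep_tens[OF borel_open[OF open_greaterThanLessThan] emeasure_Ioo_finite, of a b k] by eventually_elim simp
    then have "l \<bullet> tens {a<..<b} k = (LINT t|(lborel::real measure). 0)" by (rule inner_rep_cong) simp
    then show ?thesis by simp
  qed
  have "AE t in lborel. \<forall>n\<in>closure (Cgen D). rep l t \<bullet> n = 0" by (rule AE_inner_zero_on_set) (rule orth)
  then have "AE t in lborel. rep l t = rep 0 t"
    using V_S[OF l(1)] rep_0[where ?'a = real and ?'b = "(real^'n, real \<times> (real^'n)) l2"]
  proof eventually_elim
    case (elim t)
    then have "rep l t \<bullet> rep l t = 0" by (simp add: Hsp_eq_closure_Cgen[OF Dopen])
    then show ?case using elim(3) by simp
  qed
  then have "l = 0" by (rule l2_eqI)
  then show ?thesis unfolding weak_eq_def using U l(2) by auto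
qed

end

section \<open>The transformed problem\<close>

text \<open>Cauchy-Schwarz in each row; the norm of a matrix is its Frobenius norm.\<close>

lemma norm_matrix_vector_mult_le: "norm ((A :: real^'n^'n) *v x) \<le> norm A * norm x"
proof -
  have nA: "(norm A)\<^sup>2 = (\<Sum>i\<in>UNIV. (norm (A $ i))\<^sup>2)"
    by (simp add: norm_vec_def L2_set_def sum_nonneg)
  have "(norm (A *v x))\<^sup>2 = (\<Sum>i\<in>UNIV. (A $ i \<bullet> x)\<^sup>2)"
    by (simp add: norm_vec_square matrix_vector_mul_component)
  also have "\<dots> \<le> (\<Sum>i\<in>UNIV. (norm (A $ i))\<^sup>2 * (norm x)\<^sup>2)"
  proof (rule sum_mono)
    fix i :: 'n
    have "\<bar>A $ i \<bullet> x\<bar>\<^sup>2 \<le> (norm (A $ i) * norm x)\<^sup>2" by (rule power_mono[OF Cauchy_Schwarz_ineq2]) simp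
    then show "(A $ i \<bullet> x)\<^sup>2 \<le> (norm (A $ i))\<^sup>2 * (norm x)\<^sup>2" by (simp add: power_mult_distrib)
  qed
  also have "\<dots> = (norm A * norm x)\<^sup>2" by (simp add: nA power_mult_distrib sum_distrib_right)
  finally show ?thesis by (rule power2_le_imp_le) simp
qed

lemma borel_measurable_matrix_vector_mult:
  fixes A :: "'a \<Rightarrow> real^'n^'n" and x :: "'a \<Rightarrow> real^'n"
  assumes "A \<in> borel_measurable M" "x \<in> borel_measurable M"
  shows "(\<lambda>q. A q *v x q) \<in> borel_measurable M"
proof (rule borel_measurable_continuous_Pair[OF assms])
  have c: "continuous_on UNIV (\<lambda>p. fst p $ i \<bullet> (snd p :: real^'n))" for i :: 'n
    by (intro continuous_on_inner bounded_linear.continuous_on[OF bounded_linear_vec_nth] continuous_intros)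
  have eq: "(\<lambda>p. fst p *v (snd p :: real^'n)) = (\<lambda>p :: (real^'n^'n) \<times> (real^'n). \<chi> i. fst p $ i \<bullet> snd p)"
    by (rule ext) (simp add: vec_eq_iff matrix_vector_mul_component)
  show "continuous_on UNIV (\<lambda>p :: (real^'n^'n) \<times> (real^'n). fst p *v snd p)"
    unfolding eq by (rule continuous_on_vec_lambda) (rule c)
qed

lemma smooth_fun_exp: "smooth_fun (\<lambda>t. exp (a * t :: real))"
proof -
  have "smooth_fun (exp :: real \<Rightarrow> real)"
  proof (rule smooth_fun_coinduct[of "\<lambda>f. f = exp"])
    fix f :: "real \<Rightarrow> real" and x assume f: "f = exp"
    show "f differentiable at x" unfolding f by (auto simp: real_differentiable_def intro: DERIV_exp)
    fix i :: real assume "i \<in> Basis"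
    then show "pd f i = exp" unfolding f using pd_real_derivative[OF DERIV_exp] by auto
  qed simp
  then show ?thesis by (rule smooth_fun_compose) (rule smooth_fun_cmult[OF smooth_fun_ident])
qed

context cylinder begin

text \<open>The extra summand a \<theta> in the time derivative is what, for a = -K, turns A into A
  - K.\<close>

lemma testQ_exp:
  assumes \<theta>: "testQ D T \<theta>"
  shows "testQ D T (\<lambda>x t. exp (a * t) * \<theta> x t)"
    and "sgrad (\<lambda>x t. exp (a * t) * \<theta> x t) x t = exp (a * t) *\<^sub>R sgrad \<theta> x t"
    and "tderiv (\<lambda>x t. exp (a * t) * \<theta> x t) x t = exp (a * t) * (tderiv \<theta> x t + a * \<theta> x t)"
proof -
  have c: "ccinf Q (uncur \<theta>)" using \<theta> by (simp add: testQ_iff)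
  let ?e = "\<lambda>q::(real^'n) \<times> real. exp (a * snd q)"
  have e: "uncur (\<lambda>x t. exp (a * t) * \<theta> x t) = (\<lambda>q. ?e q * uncur \<theta> q)" by (rule ext) (simp add: uncur_def)
  have s2: "smooth_fun (\<lambda>q::(real^'n) \<times> real. snd q)" by (rule smooth_fun_bounded_linear[OF bounded_linear_snd])
  have se: "smooth_fun ?e" by (rule smooth_fun_compose[OF smooth_fun_exp s2])
  have d: "(?e has_derivative (\<lambda>v. exp (a * snd q) * (a * snd v))) (at q)" for q
    by (auto intro!: derivative_eq_intros simp: algebra_simps)
  have pe: "pd ?e v q = exp (a * snd q) * (a * snd v)" for v q by (rule pd_eqI[OF d])
  obtain K where K: "compact K" "K \<subseteq> Q" "\<And>x. x \<notin> K \<Longrightarrow> uncur \<theta> x = 0" using ccinf_support[OF c] by blast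
  show "testQ D T (\<lambda>x t. exp (a * t) * \<theta> x t)"
    unfolding testQ_iff e by (rule ccinfI[OF smooth_fun_mult[OF se ccinf_smooth[OF c]] K(1,2)]) (simp add: K(3))
  note pm = pd_mult[OF smooth_fun_differentiable[OF se] smooth_fun_differentiable[OF ccinf_smooth[OF c]]]
  show "sgrad (\<lambda>x t. exp (a * t) * \<theta> x t) x t = exp (a * t) *\<^sub>R sgrad \<theta> x t"
    unfolding sgrad_def e pm by (simp add: vec_eq_iff pe)
  show "tderiv (\<lambda>x t. exp (a * t) * \<theta> x t) x t = exp (a * t) * (tderiv \<theta> x t + a * \<theta> x t)"
    unfolding tderiv_def e pm by (simp add: pe uncur_def algebra_simps)
qed

lemma X1_exp:
  assumes "X1 D T w G" "K \<ge> 0"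
  shows "\<exists>G'. X1 D T (\<lambda>x t. exp (- K * t) * w x t) G' \<and>
    sqrt (X1sq D T (\<lambda>x t. exp (- K * t) * w x t) G') \<le> sqrt (X1sq D T w G)"
proof -
  obtain U where U: "corr U w G" using corr_ex_if_X1[OF assms(1)] by blast
  have m: "(\<lambda>t. exp (- K * t)) \<in> borel_measurable borel" by simp
  have b: "\<bar>exp (- K * t)\<bar> \<le> 1" if "t \<in> {0<..<T}" for t using that assms(2) by simp
  obtain W where W: "corr W (\<lambda>x t. exp (- K * t) * w x t) (\<lambda>x t. exp (- K * t) *\<^sub>R G x t)" "norm W \<le> 1 * norm U"
    using mult_time[OF m b U] by blast
  have "sqrt (X1sq D T (\<lambda>x t. exp (- K * t) * w x t) (\<lambda>x t. exp (- K * t) *\<^sub>R G x t)) \<le> sqrt (X1sq D T w G)"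
    unfolding corr_X1sq[OF W(1)] corr_X1sq[OF U] using W(2) by simp
  then show ?thesis using corr_X1[OF W(1)] by (intro exI conjI)
qed

text \<open>As K \<ge> 0, multiplication by exp(-K t) does not increase the X^1 norm, so the
  composite functional stays bounded.\<close>

lemma Xm1_exp:
  assumes F: "Xm1 D T F" and K: "K \<ge> 0" shows "Xm1 D T (\<lambda>w. F (\<lambda>x t. exp (- K * t) * w x t))"
proof -
  let ?e = "\<lambda>w x t. exp (- K * t) * w x t :: real"
  have lin: "F (\<lambda>x t. a * w1 x t + c * w2 x t) = a * F w1 + c * F w2" if "X1 D T w1 G1" "X1 D T w2 G2" for a c w1 w2 G1 G2
    using F that unfolding Xm1_def by blast
  obtain C where C: "\<And>w G. X1 D T w G \<Longrightarrow> \<bar>F w\<bar> \<le> C * sqrt (X1sq D T w G)" using F unfolding Xm1_def by blast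
  have "F (?e (\<lambda>x t. a * w1 x t + c * w2 x t)) = a * F (?e w1) + c * F (?e w2)" if w: "X1 D T w1 G1" "X1 D T w2 G2" for w1 G1 w2 G2 a c
  proof -
    obtain H1 where 1: "X1 D T (?e w1) H1" using X1_exp[OF w(1) K] by blast
    obtain H2 where 2: "X1 D T (?e w2) H2" using X1_exp[OF w(2) K] by blast
    have "?e (\<lambda>x t. a * w1 x t + c * w2 x t) = (\<lambda>x t. a * ?e w1 x t + c * ?e w2 x t)" by (simp add: algebra_simps)
    then show ?thesis using lin[OF 1 2] by simp
  qed
  moreover have "\<bar>F (?e w)\<bar> \<le> \<bar>C\<bar> * sqrt (X1sq D T w G)" if w: "X1 D T w G" for w G
  proof -
    obtain H where H: "X1 D T (?e w) H" "sqrt (X1sq D T (?e w) H) \<le> sqrt (X1sq D T w G)" using X1_exp[OF w K] by blast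
    have nn: "0 \<le> sqrt (X1sq D T (?e w) H)" by (simp add: X1sq_def)
    have "\<bar>F (?e w)\<bar> \<le> C * sqrt (X1sq D T (?e w) H)" by (rule C[OF H(1)])
    also have "\<dots> \<le> \<bar>C\<bar> * sqrt (X1sq D T (?e w) H)" using nn by (intro mult_right_mono) auto
    also have "\<dots> \<le> \<bar>C\<bar> * sqrt (X1sq D T w G)" using H(2) by (intro mult_left_mono) auto
    finally show ?thesis .
  qed
  ultimately show ?thesis unfolding Xm1_def by blast
qed

lemma Xm1_lincomb:
  assumes "Xm1 D T F" "Xm1 D T H" shows "Xm1 D T (\<lambda>w. F w + r * H w)"
proof -
  obtain C where C: "\<And>w G. X1 D T w G \<Longrightarrow> \<bar>F w\<bar> \<le> C * sqrt (X1sq D T w G)" using assms(1) unfolding Xm1_def by blast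
  obtain E where E: "\<And>w G. X1 D T w G \<Longrightarrow> \<bar>H w\<bar> \<le> E * sqrt (X1sq D T w G)" using assms(2) unfolding Xm1_def by blast
  have "F (\<lambda>x t. a * w1 x t + c * w2 x t) + r * H (\<lambda>x t. a * w1 x t + c * w2 x t) = a * (F w1 + r * H w1) + c * (F w2 + r * H w2)"
    if w: "X1 D T w1 G1" "X1 D T w2 G2" for w1 G1 w2 G2 a c
  proof -
    have "F (\<lambda>x t. a * w1 x t + c * w2 x t) = a * F w1 + c * F w2" using assms(1) w unfolding Xm1_def by blast
    moreover have "H (\<lambda>x t. a * w1 x t + c * w2 x t) = a * H w1 + c * H w2" using assms(2) w unfolding Xm1_def by blast
    ultimately show ?thesis by (simp add: algebra_simps)
  qed
  moreover have "\<bar>F w + r * H w\<bar> \<le> (C + \<bar>r\<bar> * E) * sqrt (X1sq D T w G)" if w: "X1 D T w G" for w G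
  proof -
    have "\<bar>F w + r * H w\<bar> \<le> \<bar>F w\<bar> + \<bar>r\<bar> * \<bar>H w\<bar>" using abs_triangle_ineq[of "F w" "r * H w"] by (simp add: abs_mult)
    also have "\<dots> \<le> C * sqrt (X1sq D T w G) + \<bar>r\<bar> * (E * sqrt (X1sq D T w G))"
      by (intro add_mono C[OF w] mult_left_mono[OF E[OF w]]) simp
    finally show ?thesis by (simp add: algebra_simps)
  qed
  ultimately show ?thesis unfolding Xm1_def by blast
qed

text \<open>The value |g| is reached at g/|g|; for g = 0 the quotient is 0 by convention and serves
  equally. The set is shown to be bounded above so that its \<open>Sup\<close> dominates that
  value.\<close>

lemma Xm1_rep_norm:
  assumes g: "g \<in> V" "\<And>U w G. corr U w G \<Longrightarrow> F w = g \<bullet> U" shows "norm g \<le> Xm1norm D T F"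
proof -
  let ?S = "{F w | w G. X1 D T w G \<and> X1sq D T w G \<le> 1}"
  let ?X = "(1 / norm g) *\<^sub>R g"
  have XV: "?X \<in> V" by (rule V_scale[OF g(1)])
  note c = corr_fnQ[OF XV]
  have gn: "g \<bullet> ?X = norm g" by (simp add: dot_square_norm power2_eq_square)
  have "norm ?X \<le> 1" by simp
  then have "(norm ?X)\<^sup>2 \<le> 1" by (rule power_le_one[OF norm_ge_zero])
  then have "X1sq D T (\<lambda>x t. fst (fnQ ?X (x, t))) (\<lambda>x t. snd (fnQ ?X (x, t))) \<le> 1" unfolding corr_X1sq[OF c] .
  then have mem: "g \<bullet> ?X \<in> ?S"
    unfolding mem_Collect_eq using corr_X1[OF c] g(2)[OF c, symmetric]
    by (intro exI[of _ "\<lambda>x t. fst (fnQ ?X (x, t))"] exI[of _ "\<lambda>x t. snd (fnQ ?X (x, t))"] conjI)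
  have bdd: "bdd_above ?S"
  proof (rule bdd_aboveI[of _ "norm g"])
    fix r assume "r \<in> ?S"
    then obtain w G where w: "r = F w" "X1 D T w G" "X1sq D T w G \<le> 1" by blast
    obtain U where U: "corr U w G" using corr_ex_if_X1[OF w(2)] by blast
    have "(norm U)\<^sup>2 \<le> 1\<^sup>2" using w(3) corr_X1sq[OF U] by simp
    then have "norm U \<le> 1" by (rule power2_le_imp_le) simp
    then have "norm g * norm U \<le> norm g" by (simp add: mult_left_le)
    then show "r \<le> norm g" using g(2)[OF U] w(1) norm_cauchy_schwarz[of g U] by linarith
  qed
  show ?thesis using cSup_upper[OF mem bdd] unfolding Xm1norm_def gn .
qed

lemma X0_exp: assumes u: "X0 D T u" shows "X0 D T (\<lambda>x t. exp (K * t) * u x t)"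
proof -
  let ?F = "\<lambda>p. u (fst p) (snd p)"
  have e: "(\<lambda>q::(real^'n) \<times> real. exp (K * snd q)) \<in> borel_measurable (lebesgue_on Q)"
    by (rule lebesgue_on_measurable[OF Q_borel, of "\<lambda>q. exp (K * snd q)"])
      (auto intro!: borel_measurable_continuous_onI continuous_intros)
  have m: "(\<lambda>p. exp (K * snd p) * ?F p) \<in> borel_measurable (lebesgue_on Q)"
    using u e by (intro borel_measurable_times) (auto simp: X0_def)
  have "integrable (lebesgue_on Q) (\<lambda>p. (exp (K * snd p) * ?F p)\<^sup>2)"
  proof (rule Bochner_Integration.integrable_bound)
    show "integrable (lebesgue_on Q) (\<lambda>p. (exp (\<bar>K\<bar> * T))\<^sup>2 * (?F p)\<^sup>2)" using u by (simp add: X0_def)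
    show "(\<lambda>p. (exp (K * snd p) * ?F p)\<^sup>2) \<in> borel_measurable (lebesgue_on Q)" using m by simp
    show "AE p in lebesgue_on Q. norm ((exp (K * snd p) * ?F p)\<^sup>2) \<le> norm ((exp (\<bar>K\<bar> * T))\<^sup>2 * (?F p)\<^sup>2)"
    proof (subst AE_lebesgue_on_iff[OF Q_borel], rule AE_I2, rule impI)
      fix p assume "p \<in> Q"
      then have s: "0 \<le> snd p" "snd p \<le> T" by (auto simp: cyl_def)
      have "K * snd p \<le> \<bar>K\<bar> * snd p" using s by (intro mult_right_mono) auto
      also have "\<dots> \<le> \<bar>K\<bar> * T" using s by (intro mult_left_mono) auto
      finally have "(exp (K * snd p))\<^sup>2 \<le> (exp (\<bar>K\<bar> * T))\<^sup>2" by (intro power_mono) auto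
      then show "norm ((exp (K * snd p) * ?F p)\<^sup>2) \<le> norm ((exp (\<bar>K\<bar> * T))\<^sup>2 * (?F p)\<^sup>2)"
        by (simp add: power_mult_distrib mult_right_mono)
    qed
  qed
  then show ?thesis using m by (simp add: X0_def)
qed

end

section \<open>The operator K - A and its coercivity\<close>

locale parabolic = cylinder T D for T and D :: "(real^'n) set" +
  fixes b :: "real^'n \<Rightarrow> real \<Rightarrow> real^'n^'n" and f :: "real^'n \<Rightarrow> real \<Rightarrow> real^'n" and lam :: "real^'n \<Rightarrow> real \<Rightarrow> real"
    and bB :: "(real^'n) \<times> real \<Rightarrow> real^'n^'n" and fB :: "(real^'n) \<times> real \<Rightarrow> real^'n" and lB :: "(real^'n) \<times> real \<Rightarrow> real"
    and M0 \<delta> K :: real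
  assumes meas[measurable]: "bB \<in> borel_measurable borel" "fB \<in> borel_measurable borel" "lB \<in> borel_measurable borel"
    and coeff: "AE q in lborel. q \<in> Q \<longrightarrow> b (fst q) (snd q) = bB q \<and> f (fst q) (snd q) = fB q \<and> lam (fst q) (snd q) = lB q"
    and bound: "AE q in lborel. q \<in> Q \<longrightarrow> norm (bB q) \<le> M0 \<and> norm (fB q) \<le> M0 \<and> \<bar>lB q\<bar> \<le> M0"
    and elliptic: "AE q in lborel. q \<in> Q \<longrightarrow> (\<forall>\<xi>. \<xi> \<bullet> (bB q *v \<xi>) \<ge> \<delta> * (norm \<xi>)\<^sup>2)"
    and \<delta>: "\<delta> > 0" and M0: "M0 \<ge> 0"
begin

text \<open>The density of the form of K - A: its product with (w, grad w) is grad w . b grad u - (f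
  . grad u) w + (K - lam) u w, written with Borel versions of the coefficients.\<close>

definition aop where "aop U q = indicator Q q *\<^sub>R
  ((K - lB q) * fst (fnQ U q) - fB q \<bullet> snd (fnQ U q), bB q *v snd (fnQ U q))"

definition M where "M U = toL (slices (aop U))"

text \<open>A generous constant: the three terms add up to |K| + 3 M0.\<close>

abbreviation "CM \<equiv> 2 * (\<bar>K\<bar> + 2 * M0)"

lemma aop_measurable: "aop U \<in> borel_measurable borel"
proof -
  note [measurable] = borel_measurable_fst_snd[OF fnQ_measurable[of U]]
  have [measurable]: "(\<lambda>q. bB q *v snd (fnQ U q)) \<in> borel_measurable borel"
    by (rule borel_measurable_matrix_vector_mult) measurable
  show ?thesis unfolding aop_def by (intro borel_measurable_scaleR borel_measurable_Pair) measurable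
qed

lemma aop_bound: "AE q in lborel. (norm (aop U q))\<^sup>2 \<le> CM\<^sup>2 * (norm (fnQ U q))\<^sup>2"
  using bound
proof eventually_elim
  case (elim q)
  show ?case
  proof (cases "q \<in> Q")
    case True
    let ?W = "norm (fnQ U q)"
    have n: "\<bar>fst (fnQ U q)\<bar> \<le> ?W" "norm (snd (fnQ U q)) \<le> ?W"
      using norm_fst_le[of "fst (fnQ U q)" "snd (fnQ U q)"] norm_snd_le[of "snd (fnQ U q)" "fst (fnQ U q)"] by simp_all
    have 1: "\<bar>(K - lB q) * fst (fnQ U q)\<bar> \<le> (\<bar>K\<bar> + M0) * ?W"
      unfolding abs_mult using elim True n by (intro mult_mono) auto
    have 2: "\<bar>fB q \<bullet> snd (fnQ U q)\<bar> \<le> M0 * ?W"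
      using Cauchy_Schwarz_ineq2[of "fB q" "snd (fnQ U q)"] mult_mono[of "norm (fB q)" M0 "norm (snd (fnQ U q))" ?W] elim True n M0 by auto
    have 3: "norm (bB q *v snd (fnQ U q)) \<le> M0 * ?W"
      using norm_matrix_vector_mult_le[of "bB q" "snd (fnQ U q)"] mult_mono[of "norm (bB q)" M0 "norm (snd (fnQ U q))" ?W] elim True n M0 by auto
    have "norm (aop U q) \<le> norm ((K - lB q) * fst (fnQ U q) - fB q \<bullet> snd (fnQ U q)) + norm (bB q *v snd (fnQ U q))"
    proof -
      have np: "norm (r, y) \<le> norm r + norm y" for r :: real and y :: "real^'n"
        unfolding norm_Pair by (rule sqrt_sum_squares_le_sum) simp_all
      have "aop U q = ((K - lB q) * fst (fnQ U q) - fB q \<bullet> snd (fnQ U q), bB q *v snd (fnQ U q))" using True by (simp add: aop_def)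
      then show ?thesis by (simp only: np)
    qed
    also have "\<dots> \<le> (\<bar>K\<bar> + M0) * ?W + M0 * ?W + M0 * ?W" using 1 2 3 abs_triangle_ineq4[of "(K - lB q) * fst (fnQ U q)" "fB q \<bullet> snd (fnQ U q)"] unfolding real_norm_def by linarith
    also have "\<dots> \<le> CM * ?W"
    proof -
      have "(\<bar>K\<bar> + M0) * ?W + M0 * ?W + M0 * ?W = (\<bar>K\<bar> + 3 * M0) * ?W" by (simp add: algebra_simps)
      also have "\<dots> \<le> CM * ?W" using M0 by (intro mult_right_mono) auto
      finally show ?thesis .
    qed
    finally have "(norm (aop U q))\<^sup>2 \<le> (CM * ?W)\<^sup>2" by (intro power_mono) auto
    then show ?thesis by (simp add: power_mult_distrib)
  qed (simp add: aop_def zero_prod_def[symmetric])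
qed

lemma sq_int_aop: "sq_int (aop U)"
proof (rule sq_int_bound[OF _ _ aop_bound])
  show "aop U \<in> borel_measurable lborel" using aop_measurable by simp
  show "integrable lborel (\<lambda>q. CM\<^sup>2 * (norm (fnQ U q))\<^sup>2)" using sq_int_square[OF sq_int_fnQ[of U]] by simp
qed

lemma bounded_linear_M: "bounded_linear M"
proof (rule bounded_linear_intro[of _ CM])
  fix U W
  have "AE q in lborel. aop (U + W) q = aop U q + aop W q"
    using fnQ_add[of U W] by eventually_elim (simp add: aop_def indicator_def algebra_simps matrix_vector_right_distrib)
  then have "M (U + W) = toL (slices (\<lambda>q. aop U q + aop W q))"
    unfolding M_def by (rule slices_cong[OF sq_int_aop sq_int_add[OF sq_int_aop sq_int_aop]])
  then show "M (U + W) = M U + M W" by (simp add: slices_add[OF sq_int_aop sq_int_aop] M_def)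
next
  fix c :: real and U
  have "AE q in lborel. aop (c *\<^sub>R U) q = c *\<^sub>R aop U q"
    using fnQ_scaleR[of c U] by eventually_elim (simp add: aop_def indicator_def algebra_simps matrix_vector_mult_scaleR)
  then have "M (c *\<^sub>R U) = toL (slices (\<lambda>q. c *\<^sub>R aop U q))"
    unfolding M_def by (rule slices_cong[OF sq_int_aop sq_int_scaleR[OF sq_int_aop]])
  then show "M (c *\<^sub>R U) = c *\<^sub>R M U" by (simp add: slices_scaleR[OF sq_int_aop] M_def)
next
  fix U
  have "(norm (M U))\<^sup>2 = (LINT q|lborel. (norm (aop U q))\<^sup>2)"
    by (simp add: M_def norm_slices[OF sq_int_aop] norm_toL[OF sq_int_aop])
  also have "\<dots> \<le> (LINT q|lborel. CM\<^sup>2 * (norm (fnQ U q))\<^sup>2)"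
    by (rule integral_mono_AE[OF sq_int_square[OF sq_int_aop] _ aop_bound]) (use sq_int_square[OF sq_int_fnQ[of U]] in simp)
  also have "\<dots> = (CM * norm U)\<^sup>2" by (simp add: norm_fnQ power_mult_distrib)
  finally have "norm (M U) \<le> CM * norm U" by (rule power2_le_imp_le) (use M0 in simp)
  then show "norm (M U) \<le> norm U * CM" by (simp add: mult.commute)
qed

lemma M_supported: "supported T (M U)"
proof (rule supportedI)
  show "AE t in lborel. t \<notin> {0<..<T} \<longrightarrow> rep (M U) t = 0"
    using rep_toL[OF sq_int_slices[OF sq_int_aop[of U]]]
  proof eventually_elim
    case (elim t)
    show ?case
    proof
      assume t: "t \<notin> {0<..<T}"
      have "(\<lambda>x. aop U (x, t)) = (\<lambda>x. 0)" by (rule ext) (use t in \<open>simp add: aop_def cyl_def zero_prod_def\<close>)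
      then show "rep (M U) t = 0" using elim by (simp add: M_def slices_def toL_0)
    qed
  qed
qed

lemma M_inner: "M U \<bullet> X = (LINT q|lborel. aop U q \<bullet> fnQ X q)"
  using inner_slices_fnQ[OF sq_int_aop, of X U] by (simp add: M_def inner_commute)

text \<open>Young's inequality M0 |g| |u| \<le> \<delta>/2 |g|^2 + M0^2/(2\<delta>) u^2 spends half
  of the ellipticity on the drift. The other half, with \<delta>/2 u^2 borrowed from K u^2, makes up
  the first term.\<close>

lemma M_coercive:
  assumes U: "U \<in> V"
  shows "M U \<bullet> U \<ge> \<delta> / 2 * (norm U)\<^sup>2 + (K - M0 - M0\<^sup>2 / (2 * \<delta>) - \<delta> / 2) * (norm (P U))\<^sup>2"
proof -
  let ?k = "K - M0 - M0\<^sup>2 / (2 * \<delta>) - \<delta> / 2"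
  have i: "integrable lborel (\<lambda>q. \<delta> / 2 * (norm (fnQ U q))\<^sup>2)" "integrable lborel (\<lambda>q. ?k * (norm (fnQ (P U) q))\<^sup>2)"
    by (intro integrable_mult_right sq_int_square sq_int_fnQ)+
  have "\<delta> / 2 * (norm U)\<^sup>2 + ?k * (norm (P U))\<^sup>2 = (LINT q|lborel. \<delta> / 2 * (norm (fnQ U q))\<^sup>2 + ?k * (norm (fnQ (P U) q))\<^sup>2)"
    unfolding Bochner_Integration.integral_add[OF i] by (simp add: norm_fnQ)
  also have "\<dots> \<le> (LINT q|lborel. aop U q \<bullet> fnQ U q)"
  proof (rule integral_mono_AE[OF Bochner_Integration.integrable_add[OF i] sq_int_inner[OF sq_int_aop sq_int_fnQ]])
    show "AE q in lborel. \<delta> / 2 * (norm (fnQ U q))\<^sup>2 + ?k * (norm (fnQ (P U) q))\<^sup>2 \<le> aop U q \<bullet> fnQ U q"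
      using P_fnQ[of U] fnQ_off[OF U] bound elliptic
    proof eventually_elim
      case (elim q)
      show ?case
      proof (cases "q \<in> Q")
        case False
        then have "fnQ U q = 0" using elim(2) by simp
        then show ?thesis using elim(1) False by (simp add: aop_def zero_prod_def[symmetric])
      next
        case True
        define u g where "u = fst (fnQ U q)" and "g = snd (fnQ U q)"
        have n: "(norm (fnQ U q))\<^sup>2 = u\<^sup>2 + (norm g)\<^sup>2" by (simp add: u_def g_def norm_prod_def)
        have 1: "g \<bullet> (bB q *v g) \<ge> \<delta> * (norm g)\<^sup>2" using elim(4) True by blast
        have 2: "lB q * u\<^sup>2 \<le> M0 * u\<^sup>2" using elim(3) True by (intro mult_right_mono) auto
        have "\<bar>fB q \<bullet> g\<bar> \<le> norm (fB q) * norm g" by (rule Cauchy_Schwarz_ineq2)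
        also have "\<dots> \<le> M0 * norm g" using elim(3) True by (intro mult_right_mono) auto
        finally have "\<bar>fB q \<bullet> g\<bar> * \<bar>u\<bar> \<le> M0 * norm g * \<bar>u\<bar>" by (rule mult_right_mono) simp
        then have 3: "(fB q \<bullet> g) * u \<le> M0 * norm g * \<bar>u\<bar>" using abs_le_D1[of "(fB q \<bullet> g) * u"] by (simp add: abs_mult)
        have "0 \<le> (\<delta> * norm g - M0 * \<bar>u\<bar>)\<^sup>2 / (2 * \<delta>)" using \<delta> by simp
        also have "\<dots> = \<delta> / 2 * (norm g)\<^sup>2 - M0 * norm g * \<bar>u\<bar> + M0\<^sup>2 / (2 * \<delta>) * u\<^sup>2"
          using \<delta> by (simp add: power2_diff power_mult_distrib field_simps) (simp add: power2_eq_square algebra_simps)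
        finally have 4: "M0 * norm g * \<bar>u\<bar> \<le> \<delta> / 2 * (norm g)\<^sup>2 + M0\<^sup>2 / (2 * \<delta>) * u\<^sup>2" by simp
        have "aop U q \<bullet> fnQ U q = K * u\<^sup>2 - lB q * u\<^sup>2 - (fB q \<bullet> g) * u + g \<bullet> (bB q *v g)"
          using True by (simp add: aop_def inner_prod_def u_def g_def power2_eq_square algebra_simps inner_commute)
        then have "aop U q \<bullet> fnQ U q \<ge> K * u\<^sup>2 - M0 * u\<^sup>2 - (\<delta> / 2 * (norm g)\<^sup>2 + M0\<^sup>2 / (2 * \<delta>) * u\<^sup>2) + \<delta> * (norm g)\<^sup>2"
          using 1 2 3 4 by linarith
        moreover have "\<delta> / 2 * (u\<^sup>2 + (norm g)\<^sup>2) + ?k * u\<^sup>2 = K * u\<^sup>2 - M0 * u\<^sup>2 - (\<delta> / 2 * (norm g)\<^sup>2 + M0\<^sup>2 / (2 * \<delta>) * u\<^sup>2) + \<delta> * (norm g)\<^sup>2"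
          by (simp add: algebra_simps)
        ultimately show ?thesis using elim(1) by (simp add: n u_def[symmetric])
      qed
    qed
  qed
  finally show ?thesis by (simp add: M_inner)
qed

lemma M_Aform:
  assumes U: "corr U u G" and X: "corr X w H"
  shows "Aform T D b f lam u G w H = K * (LINT q|lborel. fnQ (P U) q * fst (fnQ X q)) - M U \<bullet> X"
proof -
  let ?F = "\<lambda>q. - (snd (fnQ X q) \<bullet> (bB q *v snd (fnQ U q))) + (fB q \<bullet> snd (fnQ U q)) * fst (fnQ X q) + lB q * fst (fnQ U q) * fst (fnQ X q)"
  note [measurable] = borel_measurable_fst_snd[OF fnQ_measurable[of U]] borel_measurable_fst_snd[OF fnQ_measurable[of X]]
  have [measurable]: "(\<lambda>q. bB q *v snd (fnQ U q)) \<in> borel_measurable borel"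
    by (rule borel_measurable_matrix_vector_mult) measurable
  have Fm: "?F \<in> borel_measurable borel" by measurable
  have ae: "AE q in lborel. q \<in> Q \<longrightarrow>
      - (H (fst q) (snd q) \<bullet> (b (fst q) (snd q) *v G (fst q) (snd q)))
      + (f (fst q) (snd q) \<bullet> G (fst q) (snd q)) * w (fst q) (snd q)
      + lam (fst q) (snd q) * u (fst q) (snd q) * w (fst q) (snd q) = ?F q"
    using coeff corr_AE[OF U] corr_AE[OF X] by eventually_elim simp
  have sX: "sq_int (\<lambda>q. fst (fnQ X q))" by (rule sq_int_bounded_linear[OF sq_int_fnQ bounded_linear_fst])
  have i1: "integrable lborel (\<lambda>q. K * (fnQ (P U) q * fst (fnQ X q)))"
    using sq_int_inner[OF sq_int_fnQ[of "P U"] sX] by simp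
  have i2: "integrable lborel (\<lambda>q. aop U q \<bullet> fnQ X q)" by (rule sq_int_inner[OF sq_int_aop sq_int_fnQ])
  have "Aform T D b f lam u G w H = (LINT q|lborel. indicator Q q *\<^sub>R ?F q)"
    unfolding Aform_def by (rule lebesgue_on_integral[OF Q_borel Fm ae])
  also have "\<dots> = (LINT q|lborel. K * (fnQ (P U) q * fst (fnQ X q)) - aop U q \<bullet> fnQ X q)"
  proof (rule integral_cong_AE)
    show "(\<lambda>q. indicator Q q *\<^sub>R ?F q) \<in> borel_measurable lborel" using Fm by simp
    show "(\<lambda>q. K * (fnQ (P U) q * fst (fnQ X q)) - aop U q \<bullet> fnQ X q) \<in> borel_measurable lborel"
      using aop_measurable[of U] by simp
    show "AE q in lborel. indicator Q q *\<^sub>R ?F q = K * (fnQ (P U) q * fst (fnQ X q)) - aop U q \<bullet> fnQ X q"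
      using P_fnQ[of U] fnQ_off[OF corr_V[OF U]]
    proof eventually_elim
      case (elim q)
      show ?case
      proof (cases "q \<in> Q")
        case True
        then show ?thesis using elim(1) by (simp add: aop_def inner_prod_def algebra_simps inner_commute)
      next
        case False
        then have "fnQ U q = 0" using elim(2) by simp
        then show ?thesis using elim(1) False by (simp add: aop_def zero_prod_def[symmetric])
      qed
    qed
  qed
  also have "\<dots> = K * (LINT q|lborel. fnQ (P U) q * fst (fnQ X q)) - M U \<bullet> X"
    unfolding Bochner_Integration.integral_diff[OF i1 i2] by (simp add: M_inner)
  finally show ?thesis .
qed

text \<open>Each term contains one factor from the solution and one from the test function, so the
  exponentials cancel pointwise.\<close>

lemma Aform_exp:
  "Aform T D b f lam (\<lambda>x t. exp (k * t) * u x t) (\<lambda>x t. exp (k * t) *\<^sub>R G x t) (\<lambda>x t. exp (- k * t) * w x t) (\<lambda>x t. exp (- k * t) *\<^sub>R H x t)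
    = Aform T D b f lam u G w H"
proof -
  have e: "exp (k * t) * exp (- k * t) = 1" for t by (simp add: exp_minus)
  have 1: "(exp (- k * t) *\<^sub>R h) \<bullet> (A *v (exp (k * t) *\<^sub>R g)) = h \<bullet> (A *v g)" for t h A and g :: "real^'n"
  proof -
    have "(exp (- k * t) *\<^sub>R h) \<bullet> (A *v (exp (k * t) *\<^sub>R g)) = (exp (k * t) * exp (- k * t)) * (h \<bullet> (A *v g))"
      by (simp add: matrix_vector_mult_scaleR)
    then show ?thesis unfolding e by simp
  qed
  have 2: "(h \<bullet> (exp (k * t) *\<^sub>R g)) * (exp (- k * t) * r) = (h \<bullet> g) * r" for t r and h g :: "real^'n"
  proof -
    have "(h \<bullet> (exp (k * t) *\<^sub>R g)) * (exp (- k * t) * r) = (exp (k * t) * exp (- k * t)) * ((h \<bullet> g) * r)" by (simp add: algebra_simps)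
    then show ?thesis unfolding e by simp
  qed
  have 3: "l * (exp (k * t) * s) * (exp (- k * t) * r) = l * s * r" for t l s r :: real
  proof -
    have "l * (exp (k * t) * s) * (exp (- k * t) * r) = (exp (k * t) * exp (- k * t)) * (l * s * r)" by (simp add: algebra_simps)
    then show ?thesis unfolding e by simp
  qed
  show ?thesis unfolding Aform_def 1 2 3 ..
qed

end

lemma AE_snd:
  assumes "AE t in lborel. P (t::real)" shows "AE q in lborel. P (snd (q :: 'a::euclidean_space \<times> real))"
proof -
  obtain N where N: "{t. \<not> P t} \<subseteq> N" "emeasure lborel N = 0" "N \<in> sets lborel" using AE_E[OF assms] by auto
  have "emeasure (lborel \<Otimes>\<^sub>M lborel) ((UNIV :: 'a set) \<times> N) = emeasure lborel (UNIV :: 'a set) * emeasure lborel N"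
    by (rule lborel.emeasure_pair_measure_Times) (use N in auto)
  then have "emeasure lborel ((UNIV :: 'a set) \<times> N) = 0" using N(2) by (simp add: lborel_prod)
  moreover have "(UNIV :: 'a set) \<times> N \<in> sets (lborel \<Otimes>\<^sub>M lborel)" using N(3) by (intro pair_measureI) auto
  then have "(UNIV :: 'a set) \<times> N \<in> sets lborel" by (simp only: lborel_prod)
  ultimately have "(UNIV :: 'a set) \<times> N \<in> null_sets lborel" by auto
  then show ?thesis by (rule AE_I') (use N(1) in auto)
qed

section \<open>From the stated problem to the abstract equation and back\<close>

locale semilinear = parabolic T D b f lam bB fB lB M0 \<delta> K
  for T and D :: "(real^'n) set" and b f lam bB fB lB M0 \<delta> K +
  fixes B :: "(real^'n \<Rightarrow> real \<Rightarrow> real) \<Rightarrow> ((real^'n \<Rightarrow> real \<Rightarrow> real) \<Rightarrow> real)"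
    and \<phi> :: "(real^'n \<Rightarrow> real \<Rightarrow> real) \<Rightarrow> real" and C :: real
  assumes Bmaps: "\<And>u. X0 D T u \<Longrightarrow> Xm1 D T (B u)" and phi: "Xm1 D T \<phi>" and Kpos: "K > 0"
    and Lip: "\<And>u1 u2. X0 D T u1 \<Longrightarrow> X0 D T u2 \<Longrightarrow>
      Xm1norm D T (\<lambda>w. BK B K u1 w - BK B K u2 w) \<le> C * X0norm D T (\<lambda>x t. u1 x t - u2 x t)"
    and C: "C \<ge> 0" "C\<^sup>2 \<le> \<delta> / 2 * (K - M0 - M0\<^sup>2 / (2 * \<delta>) - \<delta> / 2)"
    and \<kappa>: "K - M0 - M0\<^sup>2 / (2 * \<delta>) - \<delta> / 2 > 0"
begin

lemma BK_Xm1: "X0 D T u \<Longrightarrow> Xm1 D T (BK B K u)"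
  unfolding BK_def using Xm1_exp[OF Bmaps[OF X0_exp[of u K]], of K] Kpos by simp

text \<open>The Riesz vector in V of B_K(y) + exp(-K t) \<phi>, as a function of the class
  y.\<close>

definition Gvec where "Gvec y = (SOME g. g \<in> V \<and> (\<forall>U w G. corr U w G \<longrightarrow>
  BK B K (\<lambda>x t. fnQ y (x, t)) w + \<phi> (\<lambda>x t. exp (- K * t) * w x t) = g \<bullet> U))"

lemma Gvec:
  shows Gvec_V: "Gvec y \<in> V"
    and Gvec_inner: "corr U w G \<Longrightarrow> BK B K (\<lambda>x t. fnQ y (x, t)) w + \<phi> (\<lambda>x t. exp (- K * t) * w x t) = Gvec y \<bullet> U"
proof -
  have "Xm1 D T (\<lambda>w. BK B K (\<lambda>x t. fnQ y (x, t)) w + 1 * \<phi> (\<lambda>x t. exp (- K * t) * w x t))"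
    by (rule Xm1_lincomb[OF BK_Xm1[OF X0_fnQ] Xm1_exp[OF phi]]) (use Kpos in simp)
  from Xm1_rep[OF this] have "\<exists>g. g \<in> V \<and> (\<forall>U w G. corr U w G \<longrightarrow>
    BK B K (\<lambda>x t. fnQ y (x, t)) w + \<phi> (\<lambda>x t. exp (- K * t) * w x t) = g \<bullet> U)" by auto
  from someI_ex[OF this] show "Gvec y \<in> V"
    "corr U w G \<Longrightarrow> BK B K (\<lambda>x t. fnQ y (x, t)) w + \<phi> (\<lambda>x t. exp (- K * t) * w x t) = Gvec y \<bullet> U"
    unfolding Gvec_def by blast+
qed

lemma Gvec_lip: "norm (Gvec y - Gvec z) \<le> C * norm (y - z)"
proof -
  let ?f = "\<lambda>y x t. fnQ y (x, t) :: real"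
  have "norm (Gvec y - Gvec z) \<le> Xm1norm D T (\<lambda>w. BK B K (?f y) w - BK B K (?f z) w)"
  proof (rule Xm1_rep_norm)
    show "Gvec y - Gvec z \<in> V" by (rule V_diff[OF Gvec_V Gvec_V])
    show "BK B K (?f y) w - BK B K (?f z) w = (Gvec y - Gvec z) \<bullet> U" if "corr U w G" for U w G
      using Gvec_inner[OF that, of y] Gvec_inner[OF that, of z] by (simp add: inner_diff_left)
  qed
  also have "\<dots> \<le> C * X0norm D T (\<lambda>x t. ?f y x t - ?f z x t)" by (rule Lip[OF X0_fnQ X0_fnQ])
  also have "\<dots> \<le> C * norm (y - z)" by (rule mult_left_mono[OF X0norm_fnQ C(1)])
  finally show ?thesis .
qed

text \<open>B acts on raw functions; that it respects equality almost everywhere is extracted from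
  the Lipschitz bound at distance 0.\<close>

lemma BK_cong:
  assumes u: "X0 D T u1" "X0 D T u2" and eq: "AE q in lborel. q \<in> Q \<longrightarrow> u1 (fst q) (snd q) = u2 (fst q) (snd q)"
    and X: "corr X w G"
  shows "BK B K u1 w = BK B K u2 w"
proof -
  have F: "Xm1 D T (\<lambda>w. BK B K u1 w + (-1) * BK B K u2 w)" by (rule Xm1_lincomb[OF BK_Xm1[OF u(1)] BK_Xm1[OF u(2)]])
  obtain g where g: "g \<in> V" "\<forall>U w G. corr U w G \<longrightarrow> BK B K u1 w + (-1) * BK B K u2 w = g \<bullet> U"
    using Xm1_rep[OF F] by blast
  have "norm g \<le> Xm1norm D T (\<lambda>w. BK B K u1 w - BK B K u2 w)"
    by (rule Xm1_rep_norm[OF g(1)]) (use g(2) in auto)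
  also have "\<dots> \<le> C * X0norm D T (\<lambda>x t. u1 x t - u2 x t)" by (rule Lip[OF u])
  also have "X0norm D T (\<lambda>x t. u1 x t - u2 x t) = 0"
  proof -
    have "AE q in lborel. q \<in> Q \<longrightarrow> (u1 (fst q) (snd q) - u2 (fst q) (snd q))\<^sup>2 = 0" using eq by eventually_elim simp
    from lebesgue_on_integral[OF Q_borel _ this] show ?thesis by (simp add: X0norm_def)
  qed
  finally have "g = 0" by simp
  moreover have "BK B K u1 w + (-1) * BK B K u2 w = g \<bullet> X" using g(2) X by blast
  ultimately show ?thesis by simp
qed

text \<open>With exp(K t) u as solution and exp(-K t) \<theta> as test function all exponentials
  cancel. The derivative of exp(-K t) leaves -K \<theta>, which matches the K by which the form of M
  differs from that of A.\<close>

lemma transformed: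
  assumes U: "corr U u G" and \<theta>: "testQ D T \<theta>" and X: "corr X \<theta> (sgrad \<theta>)"
  shows "(- integral\<^sup>L (lebesgue_on Q) (\<lambda>p. (exp (K * snd p) * u (fst p) (snd p)) * tderiv (\<lambda>x t. exp (- K * t) * \<theta> x t) (fst p) (snd p))
      = Aform T D b f lam (\<lambda>x t. exp (K * t) * u x t) (\<lambda>x t. exp (K * t) *\<^sub>R G x t) (\<lambda>x t. exp (- K * t) * \<theta> x t) (sgrad (\<lambda>x t. exp (- K * t) * \<theta> x t))
        + B (\<lambda>x t. exp (K * t) * u x t) (\<lambda>x t. exp (- K * t) * \<theta> x t) + \<phi> (\<lambda>x t. exp (- K * t) * \<theta> x t))
    \<longleftrightarrow> - (LINT q|lborel. fnQ (P U) q * pd (uncur \<theta>) (0, 1) q) = (Gvec (P U) - M U) \<bullet> X"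
proof -
  let ?a = "fnQ (P U)" and ?dt = "pd (uncur \<theta>) (0, 1)" and ?\<psi> = "\<lambda>x t. exp (- K * t) * \<theta> x t"
  have c: "ccinf Q (uncur \<theta>)" using \<theta> by (simp add: testQ_iff)
  have cd: "ccinf Q ?dt" by (rule ccinf_pd[OF c axis0_Basis(2)])
  have [measurable]: "uncur \<theta> \<in> borel_measurable borel" "?dt \<in> borel_measurable borel"
    by (rule smooth_fun_measurable[OF ccinf_smooth[OF c]], rule smooth_fun_measurable[OF ccinf_smooth[OF cd]])
  note [measurable] = borel_measurable_fst_snd(1)[OF fnQ_measurable[of X]]
  have aU: "AE q in lborel. q \<in> Q \<longrightarrow> u (fst q) (snd q) = ?a q"
    using corr_AE[OF U] P_fnQ[of U] by eventually_elim simp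
  have e: "exp (K * t) * exp (- K * t) = 1" for t by (simp add: exp_minus)
  have ti: "(exp (K * t) * r) * tderiv ?\<psi> x t = r * (tderiv \<theta> x t - K * \<theta> x t)" for x t r
  proof -
    have "(exp (K * t) * r) * tderiv ?\<psi> x t = (exp (K * t) * exp (- K * t)) * (r * (tderiv \<theta> x t - K * \<theta> x t))"
      unfolding testQ_exp(3)[OF \<theta>, of "- K"] by (simp add: algebra_simps)
    then show ?thesis unfolding e by simp
  qed
  have i1: "integrable lborel (\<lambda>q. ?a q * ?dt q)" using sq_int_inner[OF sq_int_fnQ[of "P U"] sq_int_ccinf[OF cd]] by simp
  have i2: "integrable lborel (\<lambda>q. K * (?a q * fst (fnQ X q)))"
    using sq_int_inner[OF sq_int_fnQ[of "P U"] sq_int_bounded_linear[OF sq_int_fnQ[of X] bounded_linear_fst]] by simp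
  have "AE q in lborel. q \<in> Q \<longrightarrow> (exp (K * snd q) * u (fst q) (snd q)) * tderiv ?\<psi> (fst q) (snd q) = ?a q * (?dt q - K * uncur \<theta> q)"
    using aU
  proof eventually_elim
    case (elim q)
    show ?case
    proof
      assume "q \<in> Q"
      then have "u (fst q) (snd q) = ?a q" using elim by simp
      then show "(exp (K * snd q) * u (fst q) (snd q)) * tderiv ?\<psi> (fst q) (snd q) = ?a q * (?dt q - K * uncur \<theta> q)"
        unfolding ti by (simp add: tderiv_def uncur_def)
    qed
  qed
  then have "integral\<^sup>L (lebesgue_on Q) (\<lambda>q. (exp (K * snd q) * u (fst q) (snd q)) * tderiv ?\<psi> (fst q) (snd q))
      = (LINT q|lborel. indicator Q q *\<^sub>R (?a q * (?dt q - K * uncur \<theta> q)))"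
    by (intro lebesgue_on_integral[OF Q_borel]) simp_all
  also have "\<dots> = (LINT q|lborel. ?a q * ?dt q - K * (?a q * fst (fnQ X q)))"
  proof (rule integral_cong_AE)
    show "AE q in lborel. indicator Q q *\<^sub>R (?a q * (?dt q - K * uncur \<theta> q)) = ?a q * ?dt q - K * (?a q * fst (fnQ X q))"
      using P_fnQ[of U] fnQ_off[OF corr_V[OF U]] corr_AE[OF X]
    proof eventually_elim
      case (elim q)
      show ?case
      proof (cases "q \<in> Q")
        case True
        then have "fst (fnQ X q) = uncur \<theta> q" using elim(3) by (simp add: uncur_def)
        then show ?thesis using True by (simp add: algebra_simps)
      next
        case False
        then have "fnQ U q = 0" using elim(2) by simp
        then show ?thesis using elim(1) False by simp
      qed
    qed
  qed simp_all
  also have "\<dots> = (LINT q|lborel. ?a q * ?dt q) - K * (LINT q|lborel. ?a q * fst (fnQ X q))"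
    unfolding Bochner_Integration.integral_diff[OF i1 i2] by simp
  finally have I1: "integral\<^sup>L (lebesgue_on Q) (\<lambda>q. (exp (K * snd q) * u (fst q) (snd q)) * tderiv ?\<psi> (fst q) (snd q)) =
    (LINT q|lborel. ?a q * ?dt q) - K * (LINT q|lborel. ?a q * fst (fnQ X q))" .
  have sg: "sgrad ?\<psi> = (\<lambda>x t. exp (- K * t) *\<^sub>R sgrad \<theta> x t)" by (intro ext) (rule testQ_exp(2)[OF \<theta>])
  have I2: "Aform T D b f lam (\<lambda>x t. exp (K * t) * u x t) (\<lambda>x t. exp (K * t) *\<^sub>R G x t) ?\<psi> (sgrad ?\<psi>)
      = K * (LINT q|lborel. ?a q * fst (fnQ X q)) - M U \<bullet> X"
    unfolding sg Aform_exp by (rule M_Aform[OF U X])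
  have X0u: "X0 D T u" using corr_X1[OF U] by (simp add: X1_def)
  have "B (\<lambda>x t. exp (K * t) * u x t) ?\<psi> = BK B K u \<theta>" by (simp add: BK_def)
  also have "\<dots> = BK B K (\<lambda>x t. ?a (x, t)) \<theta>"
    by (rule BK_cong[OF X0u X0_fnQ _ X]) (use aU in simp)
  finally have I3: "B (\<lambda>x t. exp (K * t) * u x t) ?\<psi> + \<phi> ?\<psi> = Gvec (P U) \<bullet> X" using Gvec_inner[OF X, of "P U"] by simp
  show ?thesis unfolding I1 I2 inner_diff_left using I3 by (intro iffI; linarith)
qed

text \<open>Continuity in L_2 at time 0 together with v(., 0) = 0 provides the function N that
  \<open>weak_eqI_tested\<close> asks for; it dominates the transformed solution because exp(-K t)
  \<le> 1.\<close>

lemma solution_weak_eq: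
  assumes "is_solution T D b f lam B \<phi> v"
  shows "\<exists>U G. corr U (\<lambda>x t. exp (- K * t) * v x t) G \<and> weak_eq U (Gvec (P U) - M U)"
proof -
  obtain G where Y: "Y1 D T v G" and v0: "AE x in lebesgue_on D. v x 0 = 0"
    and eq: "\<And>\<psi>. testQ D T \<psi> \<Longrightarrow> - integral\<^sup>L (lebesgue_on Q) (\<lambda>p. v (fst p) (snd p) * tderiv \<psi> (fst p) (snd p))
        = Aform T D b f lam v G \<psi> (sgrad \<psi>) + B v \<psi> + \<phi> \<psi>"
    using assms unfolding is_solution_def by blast
  let ?u = "\<lambda>x t. exp (- K * t) * v x t" and ?G = "\<lambda>x t. exp (- K * t) *\<^sub>R G x t"
  obtain W where W: "corr W v G" using corr_ex_if_X1[of v G] Y by (auto simp: Y1_def)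
  have m: "(\<lambda>t. exp (- K * t)) \<in> borel_measurable borel" by simp
  have b1: "\<bar>exp (- K * t)\<bar> \<le> 1" if "t \<in> {0<..<T}" for t using that Kpos by simp
  obtain U where U: "corr U ?u ?G" using mult_time[OF m b1 W] by blast
  have e: "exp (K * t) * exp (- K * t) = 1" for t by (simp add: exp_minus)
  have e1: "exp (K * t) * (exp (- K * t) * r) = r" for t r unfolding mult.assoc[symmetric] e by simp
  have e2: "exp (K * t) *\<^sub>R (exp (- K * t) *\<^sub>R r) = r" for t and r :: "real^'n" unfolding scaleR_scaleR e by simp
  define N where "N t = sqrt (integral\<^sup>L (lebesgue_on D) (\<lambda>x. (v x t - v x 0)\<^sup>2))" for t
  have "((\<lambda>t. integral\<^sup>L (lebesgue_on D) (\<lambda>x. (v x t - v x 0)\<^sup>2)) \<longlongrightarrow> 0) (at 0 within {0..T})"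
    using Y Tpos by (auto simp: Y1_def)
  then have "((\<lambda>t. integral\<^sup>L (lebesgue_on D) (\<lambda>x. (v x t - v x 0)\<^sup>2)) \<longlongrightarrow> 0) (at_right 0)"
    by (simp add: at_within_Icc_at_right[OF Tpos])
  from tendsto_real_sqrt[OF this] have N1: "(N \<longlongrightarrow> 0) (at_right 0)" by (simp add: N_def[abs_def])
  have v0': "AE x in lborel. x \<in> D \<longrightarrow> v x 0 = 0" using v0 by (simp add: AE_lebesgue_on_iff[OF D_borel])
  have "AE q in lborel. fnQ (P U) q = indicator Q q * ?u (fst q) (snd q)"
    using P_fnQ[of U] corr_AE[OF U] by eventually_elim simp
  from AE_swap[OF this] AE_fnQ[of "P U"]
  have N2: "AE t in lborel. t \<in> {0<..<T} \<longrightarrow> norm (rep (P U) t) \<le> N t"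
  proof eventually_elim
    case (elim t)
    show ?case
    proof
      assume t: "t \<in> {0<..<T}"
      let ?r = "rep (rep (P U) t)"
      have r: "AE x in lborel. ?r x = indicator D x * ?u x t"
        using elim(1,2) by eventually_elim (use t in \<open>auto simp: cyl_def indicator_def\<close>)
      have "AE x in lborel. x \<in> D \<longrightarrow> (v x t - v x 0)\<^sup>2 = (exp (K * t) * ?r x)\<^sup>2"
        using r v0'
      proof eventually_elim
        case (elim x)
        show ?case
        proof
          assume x: "x \<in> D"
          then have rx: "?r x = ?u x t" using elim(1) by simp
          show "(v x t - v x 0)\<^sup>2 = (exp (K * t) * ?r x)\<^sup>2" unfolding rx e1 using elim(2) x by simp
        qed
      qed
      then have "integral\<^sup>L (lebesgue_on D) (\<lambda>x. (v x t - v x 0)\<^sup>2) = (LINT x|lborel. indicator D x *\<^sub>R (exp (K * t) * ?r x)\<^sup>2)"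
        by (intro lebesgue_on_integral[OF D_borel]) simp_all
      also have "\<dots> = (LINT x|lborel. (exp (K * t))\<^sup>2 * (norm (?r x))\<^sup>2)"
      proof (rule integral_cong_AE)
        show "AE x in lborel. indicator D x *\<^sub>R (exp (K * t) * ?r x)\<^sup>2 = (exp (K * t))\<^sup>2 * (norm (?r x))\<^sup>2"
          using r
        proof eventually_elim
          case (elim x) then show ?case by (cases "x \<in> D") (simp_all add: power_mult_distrib)
        qed
      qed simp_all
      also have "\<dots> = (exp (K * t))\<^sup>2 * (norm (rep (P U) t))\<^sup>2" by (simp add: norm_l2)
      finally have "N t = exp (K * t) * norm (rep (P U) t)" by (simp add: N_def real_sqrt_mult)
      moreover have "1 \<le> exp (K * t)" using t Kpos by simp
      then have "1 * norm (rep (P U) t) \<le> exp (K * t) * norm (rep (P U) t)" by (rule mult_right_mono) simp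
      ultimately show "norm (rep (P U) t) \<le> N t" by simp
    qed
  qed
  have "weak_eq U (Gvec (P U) - M U)"
  proof (rule weak_eqI_tested[OF corr_V[OF U] _ N1 N2])
    fix \<theta> X assume \<theta>: "testQ D T \<theta>" and X: "corr X \<theta> (sgrad \<theta>)"
    show "- (LINT q|lborel. fnQ (P U) q * pd (uncur \<theta>) (0, 1) q) = (Gvec (P U) - M U) \<bullet> X"
      using transformed[OF U \<theta> X, unfolded e1 e2] eq[OF testQ_exp(1)[OF \<theta>, of "- K"]] by (rule iffD1)
  qed
  then show ?thesis using U by blast
qed

lemma solution_unique:
  assumes "is_solution T D b f lam B \<phi> u" "is_solution T D b f lam B \<phi> v"
  shows "AE p in lebesgue_on Q. v (fst p) (snd p) = u (fst p) (snd p)"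
proof -
  obtain U G where U: "corr U (\<lambda>x t. exp (- K * t) * u x t) G" "weak_eq U (Gvec (P U) - M U)" using solution_weak_eq[OF assms(1)] by blast
  obtain W H where W: "corr W (\<lambda>x t. exp (- K * t) * v x t) H" "weak_eq W (Gvec (P W) - M W)" using solution_weak_eq[OF assms(2)] by blast
  have "P U = P W"
    by (rule semilinear_unique[OF bounded_linear_M _ \<kappa> C M_coercive Gvec_lip U(2) W(2)]) (use \<delta> in simp)
  have "AE q in lborel. q \<in> Q \<longrightarrow> v (fst q) (snd q) = u (fst q) (snd q)"
    using corr_AE[OF U(1)] corr_AE[OF W(1)] P_fnQ[of U] P_fnQ[of W]
    by eventually_elim (use \<open>P U = P W\<close> in auto)
  then show ?thesis by (simp add: AE_lebesgue_on_iff[OF Q_borel])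
qed

lemma solution_exists: "\<exists>u. is_solution T D b f lam B \<phi> u"
proof -
  have "\<exists>U. weak_eq U (Gvec (P U) - M U)"
    by (rule semilinear_exists[OF bounded_linear_M _ \<kappa> C M_coercive Gvec_lip]) (use \<delta> in simp)
  then obtain U where U: "weak_eq U (Gvec (P U) - M U)" by blast
  have UV: "U \<in> V" using U by (simp add: weak_eq_def)
  have "supported T (Gvec (P U) - M U)" by (rule supported_diff[OF V_supported[OF Gvec_V] M_supported])
  from continuous_representative[OF U this] obtain Z where Z: "continuous_on {0..T} Z" "Z 0 = 0"
    "AE t in lborel. t \<in> {0<..<T} \<longrightarrow> lmap fst (rep U t) = Z t" by blast
  define good where "good t \<longleftrightarrow> (AE x in lborel. fst (fnQ U (x, t)) = rep (Z t) x)" for t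
  have good: "AE t in lborel. t \<in> {0<..<T} \<longrightarrow> good t"
    using Z(3) AE_fnQ[of U]
  proof eventually_elim
    case (elim t)
    show ?case
    proof
      assume "t \<in> {0<..<T}"
      then have zt: "Z t = lmap fst (rep U t)" using elim(1) by simp
      show "good t" unfolding good_def zt using elim(2) rep_lmap[OF bounded_linear_fst, of "rep U t"] by eventually_elim simp
    qed
  qed
  \<comment> \<open>The sections of \<open>fnQ U\<close> equal Z t for almost every t, while
    \<open>Y1\<close> speaks of every t in [0, T]. They are kept at good times and replaced by a
    representative of Z t at the others; within (0, T) this alters a null set of times, hence a null
    subset of Q.\<close>
  define w where "w x t = (if good t then fst (fnQ U (x, t)) else rep (Z t) x)" for x t
  have wZ: "AE x in lborel. w x t = rep (Z t) x" for t
    by (cases "good t") (auto simp: w_def good_def)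
  have cw: "corr U w (\<lambda>x t. snd (fnQ U (x, t)))"
    by (rule corrI[OF UV], use AE_snd[OF good] in eventually_elim) (auto simp: w_def cyl_def)
  let ?u = "\<lambda>x t. exp (K * t) * w x t" and ?G = "\<lambda>x t. exp (K * t) *\<^sub>R snd (fnQ U (x, t))"
  have m: "(\<lambda>t. exp (K * t)) \<in> borel_measurable borel" by simp
  have b1: "\<bar>exp (K * t)\<bar> \<le> exp (K * T)" if "t \<in> {0<..<T}" for t using that Kpos by simp
  obtain W where W: "corr W ?u ?G" using mult_time[OF m b1 cw] by blast
  define y where "y t = exp (K * t) *\<^sub>R Z t" for t
  have yc: "continuous_on {0..T} y" unfolding y_def by (intro continuous_intros Z(1))
  have uy: "AE x in lborel. ?u x t = rep (y t) x" for t
    using wZ[of t] rep_scaleR[of "exp (K * t)" "Z t"] unfolding y_def by eventually_elim simp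
  have L: "L2 D (\<lambda>x. ?u x t)" for t
  proof -
    have 1: "AE x in lborel. x \<in> D \<longrightarrow> ?u x t = rep (y t) x" using uy[of t] by eventually_elim simp
    have 2: "AE x in lborel. x \<in> D \<longrightarrow> (?u x t)\<^sup>2 = (rep (y t) x)\<^sup>2" using uy[of t] by eventually_elim simp
    have 3: "integrable lborel (\<lambda>x. indicator D x *\<^sub>R (rep (y t) x)\<^sup>2)"
      using integrable_mult_indicator[OF _ sq_int_square[OF sq_int_rep[of "y t"]], of D] by simp
    show ?thesis unfolding L2_def
      using lebesgue_on_measurable[OF D_borel rep_measurable 1] lebesgue_on_integrable[OF D_borel _ 2] 3 by simp
  qed
  have le: "integral\<^sup>L (lebesgue_on D) (\<lambda>x. (?u x t - ?u x s)\<^sup>2) \<le> (norm (y t - y s))\<^sup>2" for t s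
  proof -
    have i: "integrable lborel (\<lambda>x. (norm (rep (y t - y s) x))\<^sup>2)" by (rule sq_int_square[OF sq_int_rep])
    have "AE x in lborel. x \<in> D \<longrightarrow> (?u x t - ?u x s)\<^sup>2 = (norm (rep (y t - y s) x))\<^sup>2"
      using uy[of t] uy[of s] rep_diff[of "y t" "y s"] by eventually_elim simp
    then have "integral\<^sup>L (lebesgue_on D) (\<lambda>x. (?u x t - ?u x s)\<^sup>2) = (LINT x|lborel. indicator D x *\<^sub>R (norm (rep (y t - y s) x))\<^sup>2)"
      by (intro lebesgue_on_integral[OF D_borel]) simp_all
    also have "\<dots> \<le> (LINT x|lborel. (norm (rep (y t - y s) x))\<^sup>2)"
      by (rule integral_mono[OF _ i]) (use integrable_mult_indicator[OF _ i, of D] in \<open>auto simp: indicator_def\<close>)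
    finally show ?thesis by (simp add: norm_l2)
  qed
  have cont: "((\<lambda>t. integral\<^sup>L (lebesgue_on D) (\<lambda>x. (?u x t - ?u x t0)\<^sup>2)) \<longlongrightarrow> 0) (at t0 within {0..T})" if "t0 \<in> {0..T}" for t0
  proof (rule tendsto_sandwich[of "\<lambda>t. 0" _ _ "\<lambda>t. (norm (y t - y t0))\<^sup>2"])
    have "(y \<longlongrightarrow> y t0) (at t0 within {0..T})" using yc that by (simp add: continuous_on_def)
    then have "((\<lambda>t. (norm (y t - y t0))\<^sup>2) \<longlongrightarrow> (norm (y t0 - y t0))\<^sup>2) (at t0 within {0..T})" by (intro tendsto_intros)
    then show "((\<lambda>t. (norm (y t - y t0))\<^sup>2) \<longlongrightarrow> 0) (at t0 within {0..T})" by simp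
  qed (auto intro!: always_eventually Bochner_Integration.integral_nonneg le tendsto_const)
  have Y: "Y1 D T ?u ?G" unfolding Y1_def using corr_X1[OF W] L cont by blast
  have "y 0 = 0" using Z(2) by (simp add: y_def)
  then have "AE x in lborel. ?u x 0 = rep (0 :: (real^'n, real) l2) x" using uy[of 0] by simp
  then have "AE x in lborel. x \<in> D \<longrightarrow> ?u x 0 = 0"
    using rep_0[where ?'a = "real^'n" and ?'b = real] by eventually_elim simp
  then have init: "AE x in lebesgue_on D. ?u x 0 = 0" by (simp only: AE_lebesgue_on_iff[OF D_borel])
  have wf: "- integral\<^sup>L (lebesgue_on Q) (\<lambda>p. ?u (fst p) (snd p) * tderiv \<psi> (fst p) (snd p))
      = Aform T D b f lam ?u ?G \<psi> (sgrad \<psi>) + B ?u \<psi> + \<phi> \<psi>" if \<psi>: "testQ D T \<psi>" for \<psi>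
  proof -
    let ?\<theta> = "\<lambda>x t. exp (K * t) * \<psi> x t"
    have \<theta>: "testQ D T ?\<theta>" by (rule testQ_exp(1)[OF \<psi>])
    obtain X where X: "corr X ?\<theta> (sgrad ?\<theta>)" using testQ_corr[OF \<theta>] by blast
    have e: "exp (- K * t) * exp (K * t) = 1" for t by (simp add: exp_minus)
    have e1: "exp (- K * t) * (exp (K * t) * r) = r" for t r unfolding mult.assoc[symmetric] e by simp
    show ?thesis using transformed[OF cw \<theta> X, unfolded e1] weak_eq_tested[OF U \<theta> X] by (rule iffD2)
  qed
  show ?thesis unfolding is_solution_def by (intro exI[of _ ?u] exI[of _ ?G] conjI Y init allI impI) (rule wf)
qed

end

section \<open>Choice of K and conclusion\<close>

theorem theorem6p1:
  fixes T \<delta> :: real and D :: "(real^'n) set"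
    and b :: "real^'n \<Rightarrow> real \<Rightarrow> real^'n^'n" and f :: "real^'n \<Rightarrow> real \<Rightarrow> real^'n"
    and lam :: "real^'n \<Rightarrow> real \<Rightarrow> real"
    and B :: "(real^'n \<Rightarrow> real \<Rightarrow> real) \<Rightarrow> ((real^'n \<Rightarrow> real \<Rightarrow> real) \<Rightarrow> real)"
    and \<phi> :: "(real^'n \<Rightarrow> real \<Rightarrow> real) \<Rightarrow> real"
  assumes adm: "admissible T D \<delta> b f lam"
    and B_maps: "\<And>u. X0 D T u \<Longrightarrow> Xm1 D T (B u)"
    and Lip: "\<exists>K\<^sub>s C\<^sub>s. K\<^sub>s > 0 \<and> C\<^sub>s > 0 \<and>
       (\<forall>u1 u2 K. X0 D T u1 \<longrightarrow> X0 D T u2 \<longrightarrow> K > K\<^sub>s \<longrightarrow>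
          Xm1norm D T (\<lambda>w. BK B K u1 w - BK B K u2 w)
            \<le> C\<^sub>s * X0norm D T (\<lambda>x t. u1 x t - u2 x t))"
    and phi: "Xm1 D T \<phi>"
  shows "\<exists>u. is_solution T D b f lam B \<phi> u \<and>
           (\<forall>v. is_solution T D b f lam B \<phi> v \<longrightarrow>
              (AE p in lebesgue_on (cyl D T). v (fst p) (snd p) = u (fst p) (snd p)))"
proof -
  have T: "T > 0" and D: "open D" and \<delta>: "\<delta> > 0" using adm by (auto simp: admissible_def domain_ok_def)
  interpret c: cylinder T D by unfold_locales (rule T, rule D)
  obtain K\<^sub>s C\<^sub>s where KC: "K\<^sub>s > 0" "C\<^sub>s > 0" and lip: "\<And>u1 u2 K. X0 D T u1 \<Longrightarrow> X0 D T u2 \<Longrightarrow> K > K\<^sub>s \<Longrightarrow>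
      Xm1norm D T (\<lambda>w. BK B K u1 w - BK B K u2 w) \<le> C\<^sub>s * X0norm D T (\<lambda>x t. u1 x t - u2 x t)"
    using Lip by blast
  let ?E = "(UNIV :: (real^'n) set) \<times> {0..T}"
  have E: "?E \<in> sets borel" by (intro borel_closed closed_Times) auto
  have EQ: "q \<in> ?E" if "q \<in> cyl D T" for q using that by (auto simp: cyl_def)
  from adm have mb: "(\<lambda>p. b (fst p) (snd p)) \<in> borel_measurable (lebesgue_on ?E)"
    and mf: "(\<lambda>p. f (fst p) (snd p)) \<in> borel_measurable (lebesgue_on ?E)"
    and ml: "(\<lambda>p. lam (fst p) (snd p)) \<in> borel_measurable (lebesgue_on ?E)"
    by (simp_all add: admissible_def)
  obtain bB where bB: "bB \<in> borel_measurable borel" "AE q in lborel. indicator ?E q *\<^sub>R b (fst q) (snd q) = bB q"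
    using lebesgue_on_ex_borel[OF E mb] by blast
  obtain fB where fB: "fB \<in> borel_measurable borel" "AE q in lborel. indicator ?E q *\<^sub>R f (fst q) (snd q) = fB q"
    using lebesgue_on_ex_borel[OF E mf] by blast
  obtain lB where lB: "lB \<in> borel_measurable borel" "AE q in lborel. indicator ?E q *\<^sub>R lam (fst q) (snd q) = lB q"
    using lebesgue_on_ex_borel[OF E ml] by blast
  have coeff: "AE q in lborel. q \<in> cyl D T \<longrightarrow> b (fst q) (snd q) = bB q \<and> f (fst q) (snd q) = fB q \<and> lam (fst q) (snd q) = lB q"
    using bB(2) fB(2) lB(2)
  proof eventually_elim
    case (elim q)
    show ?case
    proof
      assume "q \<in> cyl D T"
      then have "indicator ?E q = (1::real)" using EQ by (intro indicator_simps(1))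
      then show "b (fst q) (snd q) = bB q \<and> f (fst q) (snd q) = fB q \<and> lam (fst q) (snd q) = lB q" using elim by (simp only: scaleR_one)
    qed
  qed
  obtain M1 where "AE p in lebesgue_on (cyl D T). norm (b (fst p) (snd p)) + norm (matrix_inv (b (fst p) (snd p)))
        + norm (f (fst p) (snd p)) + \<bar>lam (fst p) (snd p)\<bar> \<le> M1"
    using adm by (auto simp: admissible_def)
  then have "AE p in lborel. p \<in> cyl D T \<longrightarrow> norm (b (fst p) (snd p)) + norm (matrix_inv (b (fst p) (snd p)))
        + norm (f (fst p) (snd p)) + \<bar>lam (fst p) (snd p)\<bar> \<le> M1"
    by (simp only: AE_lebesgue_on_iff[OF c.Q_borel])
  then have bound: "AE q in lborel. q \<in> cyl D T \<longrightarrow> norm (bB q) \<le> \<bar>M1\<bar> \<and> norm (fB q) \<le> \<bar>M1\<bar> \<and> \<bar>lB q\<bar> \<le> \<bar>M1\<bar>"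
    using coeff
  proof eventually_elim
    case (elim q)
    show ?case
    proof
      assume q: "q \<in> cyl D T"
      have "norm (bB q) + norm (matrix_inv (bB q)) + norm (fB q) + \<bar>lB q\<bar> \<le> M1" using elim q by auto
      then show "norm (bB q) \<le> \<bar>M1\<bar> \<and> norm (fB q) \<le> \<bar>M1\<bar> \<and> \<bar>lB q\<bar> \<le> \<bar>M1\<bar>"
        using norm_ge_zero[of "bB q"] norm_ge_zero[of "matrix_inv (bB q)"] norm_ge_zero[of "fB q"] abs_ge_zero[of "lB q"] by linarith
    qed
  qed
  have ell: "AE q in lborel. q \<in> cyl D T \<longrightarrow> (\<forall>\<xi>. \<xi> \<bullet> (bB q *v \<xi>) \<ge> \<delta> * (norm \<xi>)\<^sup>2)"
    using coeff
  proof eventually_elim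
    case (elim q)
    show ?case
    proof
      assume q: "q \<in> cyl D T"
      then have "fst q \<in> D" "snd q \<in> {0<..<T}" by (auto simp: cyl_def)
      then have "\<forall>\<xi>. \<xi> \<bullet> (b (fst q) (snd q) *v \<xi>) \<ge> \<delta> * (norm \<xi>)\<^sup>2" using adm unfolding admissible_def by blast
      then show "\<forall>\<xi>. \<xi> \<bullet> (bB q *v \<xi>) \<ge> \<delta> * (norm \<xi>)\<^sup>2" using elim q by simp
    qed
  qed
  \<comment> \<open>This makes \<kappa> equal to K_* + 2 C_*^2/\<delta> + 1, so \<delta>/2 times
    \<kappa> exceeds C_*^2 as the contraction requires, and the first summand secures K >
    K_*.\<close>
  define K where "K = K\<^sub>s + \<bar>M1\<bar> + \<bar>M1\<bar>\<^sup>2 / (2 * \<delta>) + \<delta> / 2 + 2 * C\<^sub>s\<^sup>2 / \<delta> + 1"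
  have k: "K - \<bar>M1\<bar> - \<bar>M1\<bar>\<^sup>2 / (2 * \<delta>) - \<delta> / 2 = K\<^sub>s + 2 * C\<^sub>s\<^sup>2 / \<delta> + 1" by (simp add: K_def)
  have nn: "0 \<le> 2 * C\<^sub>s\<^sup>2 / \<delta>" "0 \<le> \<bar>M1\<bar>\<^sup>2 / (2 * \<delta>)" using \<delta> by simp_all
  have KK: "K > K\<^sub>s" unfolding K_def using nn \<delta> by linarith
  interpret s: semilinear T D b f lam bB fB lB "\<bar>M1\<bar>" \<delta> K B \<phi> C\<^sub>s
  proof unfold_locales
    show "C\<^sub>s\<^sup>2 \<le> \<delta> / 2 * (K - \<bar>M1\<bar> - \<bar>M1\<bar>\<^sup>2 / (2 * \<delta>) - \<delta> / 2)"
    proof -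
      have "\<delta> / 2 * (K\<^sub>s + 2 * C\<^sub>s\<^sup>2 / \<delta> + 1) = \<delta> / 2 * (K\<^sub>s + 1) + C\<^sub>s\<^sup>2" using \<delta> by (simp add: field_simps)
      moreover have "0 \<le> \<delta> / 2 * (K\<^sub>s + 1)" using \<delta> KC by simp
      ultimately show ?thesis unfolding k by linarith
    qed
    show "0 < K - \<bar>M1\<bar> - \<bar>M1\<bar>\<^sup>2 / (2 * \<delta>) - \<delta> / 2" unfolding k using nn KC by linarith
    show "Xm1norm D T (\<lambda>w. BK B K u1 w - BK B K u2 w) \<le> C\<^sub>s * X0norm D T (\<lambda>x t. u1 x t - u2 x t)"
      if "X0 D T u1" "X0 D T u2" for u1 u2 by (rule lip[OF that KK])
  qed (assumption | rule bB(1) fB(1) lB(1) coeff bound ell \<delta> B_maps phi abs_ge_zero T D | (use KK KC in linarith))+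
  obtain u where u: "is_solution T D b f lam B \<phi> u" using s.solution_exists by blast
  show ?thesis by (intro exI[of _ u] conjI u allI impI) (rule s.solution_unique[OF u])
qed

end
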